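(* Let $A$ be a quadratic algebra over a finite quiver $\mathcal{Q}$, with Koszul bimodule complex $K(A)$ and Koszul cochain dg algebra $\tilde A$. Then there exists an isomorphism $$\phi:\operatorname{Hom}_{A^e}(K(A),A^e)\longrightarrow\operatorname{RHom}_{A^e}(K(A),A^e)$$ in $\mathcal{D}(\tilde A,A\text{-}\mathsf{Bimod})$.
   Context: **Quadratic algebras over a quiver.** $\mathcal{Q}=(\mathcal{Q}_0,\mathcal{Q}_1)$ has finitely many vertices and arrows, $\mathcal{Q}_0\neq\emptyset$; $\mathbb{F}$ is a field, $\otimes=\otimes_{\mathbb{F}}$. The ring $k=\mathbb{F}\mathcal{Q}_0$ has the complete set of orthogonal idempotents $\{e_i\}_{i\in\mathcal{Q}_0}$. $V=\mathbb{F}\mathcal{Q}_1$ is the $k$-bimodule with $e_j\alpha e_i=\alpha$ if $i$ is the source and $j$ the target of the arrow $\alpha$, and $0$ otherwise. For a $k$-subbimodule $R\subseteq V\otimes_kV$, $A=T_k(V)/(R)$ is a quadratic algebra over $\mathcal{Q}$. Bimodules are $\mathbb{F}$-central; $A^e=A\otimes A^{op}$, $k^e=k\otimes k$. **Koszul complex.** $W_0=k$, $W_1=V$, $W_2=R$, $W_p=\bigcap_{i+2+j=p}V^{\otimes_ki}\otimes_kR\otimes_kV^{\otimes_kj}$ for $p\ge3$. Elements of $W_p$ are written $x_1\ldots x_p$ (a sum of such products is understood), using $W_p\subseteq V^{\otimes_kq}\otimes_kW_r\otimes_kV^{\otimes_ks}$ for $q+r+s=p$. $K(A)$ is the chain complex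 of $A$-bimodules $K(A)_p=A\otimes_kW_p\otimes_kA$ with $d(\alpha\otimes x_1\ldots x_p\otimes\beta)=\alpha x_1\otimes x_2\ldots x_p\otimes\beta+(-1)^p\alpha\otimes x_1\ldots x_{p-1}\otimes x_p\beta$. **Koszul cochain dg algebra.** $\tilde A^p=\operatorname{Hom}_{k^e}(W_p,A)$ with differential $b_K(f)(x_1\ldots x_{p+1})=f(x_1\ldots x_p)x_{p+1}-(-1)^px_1f(x_2\ldots x_{p+1})$ and product $(f\smile g)(x_1\ldots x_{p+q})=(-1)^{pq}f(x_1\ldots x_p)g(x_{p+1}\ldots x_{p+q})$ for $f\in\tilde A^p$, $g\in\tilde A^q$. **Categories.** $\mathcal{C}(\tilde A,A\text{-}\mathsf{Bimod})$ is the dg category of dg $\tilde A$-bimodules in $A$-bimodules: objects are graded $\tilde A$-bimodules $C=(C^q)_{q\in\mathbb{Z}}$ with each $C^q$ an $A$-bimodule, $\alpha(f.x.g)\beta=f.(\alpha x\beta).g$, and a square-zero $A$-bimodule differential of degree $+1$ with $d_C(f.x)=b_K(f).x+(-1)^pf.d_C(x)$ and $d_C(x.f)=d_C(x).f+(-1)^qx.b_K(f)$ for $f\in\tilde A^p$, $x\in C^q$; degree-$r$ morphisms are families of $A$-bimodule maps $u:C^q\to C'^{q+r}$ with $u(f.x)=(-1)^{rp}f.u(x)$, $u(x.f)=u(x).f$, and $d(u)=d_{C'}u-(-1)^rud_C$. $\mathcal{K}(\tilde A,A\text{-}\mathsf{Bimod})$ is its homotopy category ($H^0$ of the morphism complexes),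 and $\mathcal{D}(\tilde A,A\text{-}\mathsf{Bimod})$ its localization at quasi-isomorphisms. **Objects and functors.** Chain complexes are viewed as cochain complexes by $C^q=C_{-q}$. $K(A)$ is an object via, for $z=\alpha\otimes x_1\ldots x_q\otimes\beta$ and $f\in\tilde A^p$ with $p\le q$: $f.z=(-1)^{(q-p)p}\alpha\otimes x_1\ldots x_{q-p}\otimes f(x_{q-p+1}\ldots x_q)\beta$, $z.f=(-1)^{pq}\alpha f(x_1\ldots x_p)\otimes x_{p+1}\ldots x_q\otimes\beta$ (zero if $p>q$), and the outer $A$-actions. For an object $C$, $\operatorname{Hom}_{A^e}(C,A^e)$ is the object with degree $q$ part $\operatorname{Hom}_{A^e}(C_q,A^e)$ (maps $u$ with $u(axb)=(a\otimes b)\cdot u(x)$), differential $u\mapsto-(-1)^qu\circ d_C$, actions $(f.u)(x)=(-1)^pu(x.f)$, $(u.f)(x)=u(f.x)$ for $f\in\tilde A^p$, and $(\alpha u\beta)(x)=u(x)\cdot(\beta\otimes\alpha)$ (product of $A^e$). $\operatorname{RHom}_{A^e}(-,A^e):\mathcal{D}(\tilde A,A\text{-}\mathsf{Bimod})^{op}\to\mathcal{D}(\tilde A,A\text{-}\mathsf{Bimod})$ is the right derived functor of the triangulated functor $\operatorname{Hom}_{A^e}(-,A^e):\mathcal{K}(\tilde A,A\text{-}\mathsf{Bimod})^{op}\to\mathcal{D}(\tilde A,A\text{-}\mathsf{Bimod})$, computed on $C$ by $\operatorname{Hom}_{A^e}(P,A^e)$ for a quasi-isomorphism $P\to C$ in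 $\mathcal{C}(\tilde A,A\text{-}\mathsf{Bimod})$ with $P$ $K$-projective (i.e. $\operatorname{Hom}(P,N)$ is acyclic for all acyclic $N$); such resolutions always exist. *)

theory Defs
  imports "HOL-Algebra.Free_Abelian_Groups" "HOL-Algebra.QuotRing" "HOL-Algebra.Module" "Graph_Theory.Digraph"
begin

section \<open>Tensor algebra of a quiver\<close>

text \<open>
  A quiver is a finite digraph (loops and parallel arcs allowed); \<open>tail\<close> is the source and
  \<open>head\<close> the target of an arrow.  Because \<open>e\<^sub>j \<alpha> e\<^sub>i = \<alpha>\<close> for \<open>\<alpha>\<close> from \<open>i\<close> to \<open>j\<close>,
  \<open>\<alpha> \<otimes> \<beta>\<close> is nonzero in \<open>V \<otimes>\<^sub>k V\<close> iff the source of \<open>\<alpha>\<close> is the target of \<open>\<beta>\<close>.  So the tensors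
  \<open>\<alpha>\<^sub>1 \<otimes> \<dots> \<otimes> \<alpha>\<^sub>p\<close> with \<open>tail \<alpha>\<^sub>i = head \<alpha>\<^sub>i\<^sub>+\<^sub>1\<close> are a basis of the \<open>p\<close>-fold tensor power of \<open>V\<close>.
  Such a tensor is encoded as \<open>(head \<alpha>\<^sub>1, [\<alpha>\<^sub>1, \<dots>, \<alpha>\<^sub>p])\<close>, and \<open>e\<^sub>i\<close> as \<open>(i, [])\<close>.
\<close>

type_synonym ('v, 'e) qpath = "'v \<times> 'e list"
type_synonym ('v, 'e, 'f) tens = "('v, 'e) qpath \<Rightarrow>\<^sub>0 'f"

fun walk_ok :: "('v, 'e) pre_digraph \<Rightarrow> 'v \<Rightarrow> 'e list \<Rightarrow> bool" where
  "walk_ok Q v [] \<longleftrightarrow> v \<in> verts Q"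
| "walk_ok Q v (a # as) \<longleftrightarrow> a \<in> arcs Q \<and> head Q a = v \<and> walk_ok Q (tail Q a) as"

fun walk_source :: "('v, 'e) pre_digraph \<Rightarrow> 'v \<Rightarrow> 'e list \<Rightarrow> 'v" where
  "walk_source Q v [] = v"
| "walk_source Q v (a # as) = walk_source Q (tail Q a) as"

definition tmult ::
  "('v, 'e) pre_digraph \<Rightarrow> ('v, 'e, 'f::field) tens \<Rightarrow> ('v, 'e, 'f) tens \<Rightarrow> ('v, 'e, 'f) tens" where
  "tmult Q x y = (\<Sum>(v, as) \<in> Poly_Mapping.keys x. \<Sum>(w, bs) \<in> Poly_Mapping.keys y.
     if walk_source Q v as = w
     then Poly_Mapping.single (v, as @ bs)
            (Poly_Mapping.lookup x (v, as) * Poly_Mapping.lookup y (w, bs))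
     else 0)"

definition tensor_algebra :: "('v, 'e) pre_digraph \<Rightarrow> ('v, 'e, 'f::field) tens ring" where
  "tensor_algebra Q =
     \<lparr>carrier = {x. \<forall>(v, as) \<in> Poly_Mapping.keys x. walk_ok Q v as},
      monoid.mult = tmult Q,
      one = (\<Sum>v \<in> verts Q. Poly_Mapping.single (v, []) 1),
      ring.zero = 0,
      add = (+)\<rparr>"

definition tpower :: "('v, 'e) pre_digraph \<Rightarrow> nat \<Rightarrow> ('v, 'e, 'f::field) tens set" where
  "tpower Q p = {x \<in> carrier (tensor_algebra Q). \<forall>(v, as) \<in> Poly_Mapping.keys x. length as = p}"

text \<open>\<open>tpower Q 0\<close> is the ring \<open>k\<close> and contains \<open>\<lambda> \<cdot> 1\<close> for every scalar \<open>\<lambda>\<close>, so closure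
  under multiplication by \<open>k\<close> includes closure under scalars.\<close>

locale quadratic_algebra = fin_digraph Q
  for Q :: "('v, 'e) pre_digraph" +
  fixes R :: "('v, 'e, 'f::field) tens set"
  assumes verts_nonempty: "verts Q \<noteq> {}"
    and relations_subset: "R \<subseteq> tpower Q 2"
    and relations_zero: "0 \<in> R"
    and relations_add: "x \<in> R \<Longrightarrow> y \<in> R \<Longrightarrow> x + y \<in> R"
    and relations_left: "c \<in> tpower Q 0 \<Longrightarrow> x \<in> R \<Longrightarrow> tmult Q c x \<in> R"
    and relations_right: "c \<in> tpower Q 0 \<Longrightarrow> x \<in> R \<Longrightarrow> tmult Q x c \<in> R"


section \<open>Bimodules and graded objects\<close>

text \<open>
  As in the library's \<^typ>\<open>('a, 'b) module\<close>, only the additive part of the underlying ring record is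
  relevant.  \<open>smult\<close> is the left and \<open>rsmult\<close> the right action.
\<close>

record ('a, 'x) bimod = "('a, 'x) module" +
  rsmult :: "'x \<Rightarrow> 'a \<Rightarrow> 'x"

text \<open>The operations take the degree(s) of their arguments as indices, because the carriers of
  different degrees may overlap.\<close>

record ('a, 't, 'x) dgobj =
  grp :: "int \<Rightarrow> ('a, 'x) bimod"
  diff :: "int \<Rightarrow> 'x \<Rightarrow> 'x"
  lact :: "nat \<Rightarrow> int \<Rightarrow> 't \<Rightarrow> 'x \<Rightarrow> 'x"
  ract :: "nat \<Rightarrow> int \<Rightarrow> 'x \<Rightarrow> 't \<Rightarrow> 'x"

definition signed :: "('x, 'm) ring_scheme \<Rightarrow> int \<Rightarrow> 'x \<Rightarrow> 'x" where
  "signed G n x = (if even n then x else \<ominus>\<^bsub>G\<^esub> x)"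

definition isign :: "int \<Rightarrow> int" where
  "isign n = (if even n then 1 else - 1)"

text \<open>Structure transport along an injection \<open>\<iota>\<close>, used to place an object inside a given universe.\<close>

definition transport :: "('x \<Rightarrow> 'y) \<Rightarrow> ('a, 't, 'x) dgobj \<Rightarrow> ('a, 't, 'y) dgobj" where
  "transport \<iota> C =
     \<lparr>grp = (\<lambda>n.
        \<lparr>carrier = \<iota> ` carrier (grp C n),
         monoid.mult = (\<lambda>_ _. undefined), one = undefined,
         ring.zero = \<iota> \<zero>\<^bsub>grp C n\<^esub>,
         add = (\<lambda>x y. \<iota> (inv_into UNIV \<iota> x \<oplus>\<^bsub>grp C n\<^esub> inv_into UNIV \<iota> y)),
         smult = (\<lambda>a x. \<iota> (a \<odot>\<^bsub>grp C n\<^esub> inv_into UNIV \<iota> x)),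
         rsmult = (\<lambda>x a. \<iota> (rsmult (grp C n) (inv_into UNIV \<iota> x) a))\<rparr>),
      diff = (\<lambda>n x. \<iota> (diff C n (inv_into UNIV \<iota> x))),
      lact = (\<lambda>p n f x. \<iota> (lact C p n f (inv_into UNIV \<iota> x))),
      ract = (\<lambda>p n x f. \<iota> (ract C p n (inv_into UNIV \<iota> x) f))\<rparr>"

type_synonym ('v, 'e, 'f) qalg = "('v, 'e, 'f) tens set"
type_synonym ('v, 'e, 'f) koszul_cochain = "('v, 'e, 'f) tens \<Rightarrow> ('v, 'e, 'f) qalg"
type_synonym ('v, 'e, 'f) koszul_chain =
  "(('v, 'e, 'f) qalg \<times> ('v, 'e, 'f) tens \<times> ('v, 'e, 'f) qalg \<Rightarrow>\<^sub>0 int) set"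
type_synonym ('v, 'e, 'f) env_elem =
  "(('v, 'e, 'f) qalg \<times> ('v, 'e, 'f) qalg \<Rightarrow>\<^sub>0 int) set"
type_synonym ('v, 'e, 'f, 'x) qobj =
  "(('v, 'e, 'f) qalg, ('v, 'e, 'f) koszul_cochain, 'x) dgobj"

datatype ('o, 'm) letter = Fwd 'o 'm 'o | Bwd 'o 'm 'o


context quadratic_algebra
begin

section \<open>The algebra, the spaces \<open>W\<^sub>p\<close>, and the Koszul cochain algebra\<close>

definition tideal :: "('v, 'e, 'f) tens set" where
  "tideal = genideal (tensor_algebra Q) R"

definition alg :: "('v, 'e, 'f) qalg ring" where
  "alg = tensor_algebra Q Quot tideal"

definition proj :: "('v, 'e, 'f) tens \<Rightarrow> ('v, 'e, 'f) qalg" where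
  "proj x = tideal +>\<^bsub>tensor_algebra Q\<^esub> x"

definition scal :: "'f \<Rightarrow> ('v, 'e, 'f) qalg" where
  "scal c = proj (\<Sum>v \<in> verts Q. Poly_Mapping.single (v, []) c)"

definition VRV :: "nat \<Rightarrow> nat \<Rightarrow> ('v, 'e, 'f) tens set" where
  "VRV i j = {\<Sum>(u, r, v) \<leftarrow> ts. tmult Q (tmult Q u r) v | ts.
                set ts \<subseteq> tpower Q i \<times> R \<times> tpower Q j}"

definition W :: "nat \<Rightarrow> ('v, 'e, 'f) tens set" where
  "W p = (if p = 0 then tpower Q 0 else if p = 1 then tpower Q 1 else if p = 2 then R
          else (\<Inter>(i, j) \<in> {(i, j). i + 2 + j = p}. VRV i j))"

text \<open>
  For \<open>x \<in> W (p + q)\<close>, \<open>split p q x\<close> is a presentation \<open>x = \<Sum> y z\<close> with \<open>y \<in> W p\<close>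
  and \<open>z \<in> W q\<close>: the sum implicit in the notation \<open>x\<^sub>1\<dots>x\<^sub>p\<^sub>+\<^sub>q\<close>.  All expressions in which it is
  used are \<open>k\<close>-balanced in \<open>(y, z)\<close>, so they do not depend on the presentation.
\<close>

definition split ::
  "nat \<Rightarrow> nat \<Rightarrow> ('v, 'e, 'f) tens \<Rightarrow> (('v, 'e, 'f) tens \<times> ('v, 'e, 'f) tens) list" where
  "split p q x = (SOME ts. set ts \<subseteq> W p \<times> W q \<and> x = (\<Sum>(y, z) \<leftarrow> ts. tmult Q y z))"

definition split_sum ::
  "nat \<Rightarrow> nat \<Rightarrow> (('v, 'e, 'f) tens \<Rightarrow> ('v, 'e, 'f) tens \<Rightarrow> ('v, 'e, 'f) qalg)
     \<Rightarrow> ('v, 'e, 'f) tens \<Rightarrow> ('v, 'e, 'f) qalg" where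
  "split_sum p q h x =
     finsum alg (\<lambda>i. case split p q x ! i of (y, z) \<Rightarrow> h y z) {..<length (split p q x)}"

definition cochains :: "nat \<Rightarrow> ('v, 'e, 'f) koszul_cochain set" where
  "cochains p = {f. f \<in> extensional (W p) \<and> (\<forall>x \<in> W p. f x \<in> carrier alg) \<and>
     (\<forall>x \<in> W p. \<forall>y \<in> W p. f (x + y) = f x \<oplus>\<^bsub>alg\<^esub> f y) \<and>
     (\<forall>x \<in> W p. \<forall>c \<in> tpower Q 0. \<forall>c' \<in> tpower Q 0.
        f (tmult Q (tmult Q c x) c') = proj c \<otimes>\<^bsub>alg\<^esub> f x \<otimes>\<^bsub>alg\<^esub> proj c')}"

definition cochain_add ::
  "nat \<Rightarrow> ('v, 'e, 'f) koszul_cochain \<Rightarrow> ('v, 'e, 'f) koszul_cochain \<Rightarrow> ('v, 'e, 'f) koszul_cochain" where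
  "cochain_add p f g = (\<lambda>x \<in> W p. f x \<oplus>\<^bsub>alg\<^esub> g x)"

definition cochain_scale :: "nat \<Rightarrow> 'f \<Rightarrow> ('v, 'e, 'f) koszul_cochain \<Rightarrow> ('v, 'e, 'f) koszul_cochain" where
  "cochain_scale p c f = (\<lambda>x \<in> W p. scal c \<otimes>\<^bsub>alg\<^esub> f x)"

definition cochain_one :: "('v, 'e, 'f) koszul_cochain" where
  "cochain_one = (\<lambda>x \<in> W 0. proj x)"

definition bK :: "nat \<Rightarrow> ('v, 'e, 'f) koszul_cochain \<Rightarrow> ('v, 'e, 'f) koszul_cochain" where
  "bK p f = (\<lambda>x \<in> W (p + 1).
     split_sum p 1 (\<lambda>y z. f y \<otimes>\<^bsub>alg\<^esub> proj z) x
       \<ominus>\<^bsub>alg\<^esub> signed alg (int p) (split_sum 1 p (\<lambda>y z. proj y \<otimes>\<^bsub>alg\<^esub> f z) x))"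

definition cup ::
  "nat \<Rightarrow> nat \<Rightarrow> ('v, 'e, 'f) koszul_cochain \<Rightarrow> ('v, 'e, 'f) koszul_cochain \<Rightarrow> ('v, 'e, 'f) koszul_cochain" where
  "cup p q f g = (\<lambda>x \<in> W (p + q).
     signed alg (int (p * q)) (split_sum p q (\<lambda>y z. f y \<otimes>\<^bsub>alg\<^esub> g z) x))"


section \<open>The enveloping algebra\<close>

definition env_free :: "(('v, 'e, 'f) qalg \<times> ('v, 'e, 'f) qalg \<Rightarrow>\<^sub>0 int) monoid" where
  "env_free = free_Abelian_group (carrier alg \<times> carrier alg)"

definition env_rels :: "(('v, 'e, 'f) qalg \<times> ('v, 'e, 'f) qalg \<Rightarrow>\<^sub>0 int) set" where
  "env_rels = generate env_free
     ({frag_of (a \<oplus>\<^bsub>alg\<^esub> a', b) - frag_of (a, b) - frag_of (a', b) | a a' b.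
         a \<in> carrier alg \<and> a' \<in> carrier alg \<and> b \<in> carrier alg} \<union>
      {frag_of (a, b \<oplus>\<^bsub>alg\<^esub> b') - frag_of (a, b) - frag_of (a, b') | a b b'.
         a \<in> carrier alg \<and> b \<in> carrier alg \<and> b' \<in> carrier alg} \<union>
      {frag_of (scal c \<otimes>\<^bsub>alg\<^esub> a, b) - frag_of (a, scal c \<otimes>\<^bsub>alg\<^esub> b) | a b c.
         a \<in> carrier alg \<and> b \<in> carrier alg})"

definition etens :: "('v, 'e, 'f) qalg \<Rightarrow> ('v, 'e, 'f) qalg \<Rightarrow> ('v, 'e, 'f) env_elem" where
  "etens a b = env_rels #>\<^bsub>env_free\<^esub> frag_of (a, b)"

text \<open>The product is the bilinear extension of \<open>(a \<otimes> b) (a' \<otimes> b') = a a' \<otimes> b' b\<close>.\<close>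

definition env :: "('v, 'e, 'f) env_elem ring" where
  "env =
     \<lparr>carrier = carrier (env_free Mod env_rels),
      monoid.mult = (\<lambda>X Y. \<Union>x \<in> X. \<Union>y \<in> Y. env_rels #>\<^bsub>env_free\<^esub>
         frag_extend (\<lambda>(a, b). frag_extend (\<lambda>(a', b').
            frag_of (a \<otimes>\<^bsub>alg\<^esub> a', b' \<otimes>\<^bsub>alg\<^esub> b)) y) x),
      one = etens \<one>\<^bsub>alg\<^esub> \<one>\<^bsub>alg\<^esub>,
      ring.zero = \<one>\<^bsub>env_free Mod env_rels\<^esub>,
      add = monoid.mult (env_free Mod env_rels)\<rparr>"


section \<open>The Koszul bimodule complex as a dg bimodule over the Koszul cochain algebra\<close>

text \<open>Cohomological grading: degree \<open>n\<close> is \<open>A \<otimes>\<^sub>k W\<^sub>-\<^sub>n \<otimes>\<^sub>k A\<close>, which is zero for \<open>n > 0\<close>.\<close>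

definition Wc :: "int \<Rightarrow> ('v, 'e, 'f) tens set" where
  "Wc n = (if n \<le> 0 then W (nat (- n)) else {0})"

definition kos_free ::
  "int \<Rightarrow> (('v, 'e, 'f) qalg \<times> ('v, 'e, 'f) tens \<times> ('v, 'e, 'f) qalg \<Rightarrow>\<^sub>0 int) monoid" where
  "kos_free n = free_Abelian_group (carrier alg \<times> Wc n \<times> carrier alg)"

definition kos_rels ::
  "int \<Rightarrow> (('v, 'e, 'f) qalg \<times> ('v, 'e, 'f) tens \<times> ('v, 'e, 'f) qalg \<Rightarrow>\<^sub>0 int) set" where
  "kos_rels n = generate (kos_free n)
     ({frag_of (a \<oplus>\<^bsub>alg\<^esub> a', x, b) - frag_of (a, x, b) - frag_of (a', x, b) | a a' x b.
         a \<in> carrier alg \<and> a' \<in> carrier alg \<and> x \<in> Wc n \<and> b \<in> carrier alg} \<union>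
      {frag_of (a, x + x', b) - frag_of (a, x, b) - frag_of (a, x', b) | a x x' b.
         a \<in> carrier alg \<and> x \<in> Wc n \<and> x' \<in> Wc n \<and> b \<in> carrier alg} \<union>
      {frag_of (a, x, b \<oplus>\<^bsub>alg\<^esub> b') - frag_of (a, x, b) - frag_of (a, x, b') | a x b b'.
         a \<in> carrier alg \<and> x \<in> Wc n \<and> b \<in> carrier alg \<and> b' \<in> carrier alg} \<union>
      {frag_of (a \<otimes>\<^bsub>alg\<^esub> proj c, x, b) - frag_of (a, tmult Q c x, b) | a c x b.
         a \<in> carrier alg \<and> c \<in> tpower Q 0 \<and> x \<in> Wc n \<and> b \<in> carrier alg} \<union>
      {frag_of (a, tmult Q x c, b) - frag_of (a, x, proj c \<otimes>\<^bsub>alg\<^esub> b) | a c x b.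
         a \<in> carrier alg \<and> c \<in> tpower Q 0 \<and> x \<in> Wc n \<and> b \<in> carrier alg})"

text \<open>The map into degree \<open>m\<close> induced by a balanced map on pure tensors.\<close>

definition kos_map ::
  "int \<Rightarrow> (('v, 'e, 'f) qalg \<times> ('v, 'e, 'f) tens \<times> ('v, 'e, 'f) qalg
       \<Rightarrow> (('v, 'e, 'f) qalg \<times> ('v, 'e, 'f) tens \<times> ('v, 'e, 'f) qalg \<Rightarrow>\<^sub>0 int))
     \<Rightarrow> ('v, 'e, 'f) koszul_chain \<Rightarrow> ('v, 'e, 'f) koszul_chain" where
  "kos_map m g X = (\<Union>c \<in> X. kos_rels m #>\<^bsub>kos_free m\<^esub> frag_extend g c)"

definition kos_grp :: "int \<Rightarrow> (('v, 'e, 'f) qalg, ('v, 'e, 'f) koszul_chain) bimod" where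
  "kos_grp n =
     \<lparr>carrier = carrier (kos_free n Mod kos_rels n),
      monoid.mult = (\<lambda>_ _. undefined), one = undefined,
      ring.zero = \<one>\<^bsub>kos_free n Mod kos_rels n\<^esub>,
      add = monoid.mult (kos_free n Mod kos_rels n),
      smult = (\<lambda>a. kos_map n (\<lambda>(\<alpha>, x, \<beta>). frag_of (a \<otimes>\<^bsub>alg\<^esub> \<alpha>, x, \<beta>))),
      rsmult = (\<lambda>X b. kos_map n (\<lambda>(\<alpha>, x, \<beta>). frag_of (\<alpha>, x, \<beta> \<otimes>\<^bsub>alg\<^esub> b)) X)\<rparr>"

definition kos_diff :: "int \<Rightarrow> ('v, 'e, 'f) koszul_chain \<Rightarrow> ('v, 'e, 'f) koszul_chain" where
  "kos_diff n X =
     (if n < 0 then let p = nat (- n) in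
        kos_map (n + 1) (\<lambda>(\<alpha>, x, \<beta>).
          (\<Sum>(y, z) \<leftarrow> split 1 (p - 1) x. frag_of (\<alpha> \<otimes>\<^bsub>alg\<^esub> proj y, z, \<beta>)) +
          frag_cmul (isign (int p))
            (\<Sum>(y, z) \<leftarrow> split (p - 1) 1 x. frag_of (\<alpha>, y, proj z \<otimes>\<^bsub>alg\<^esub> \<beta>))) X
      else \<zero>\<^bsub>kos_grp (n + 1)\<^esub>)"

definition kos_lact ::
  "nat \<Rightarrow> int \<Rightarrow> ('v, 'e, 'f) koszul_cochain \<Rightarrow> ('v, 'e, 'f) koszul_chain \<Rightarrow> ('v, 'e, 'f) koszul_chain" where
  "kos_lact p n f X =
     (if int p \<le> - n then let q = nat (- n) in
        kos_map (n + int p) (\<lambda>(\<alpha>, x, \<beta>).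
          frag_cmul (isign (int ((q - p) * p)))
            (\<Sum>(y, z) \<leftarrow> split (q - p) p x. frag_of (\<alpha>, y, f z \<otimes>\<^bsub>alg\<^esub> \<beta>))) X
      else \<zero>\<^bsub>kos_grp (n + int p)\<^esub>)"

definition kos_ract ::
  "nat \<Rightarrow> int \<Rightarrow> ('v, 'e, 'f) koszul_chain \<Rightarrow> ('v, 'e, 'f) koszul_cochain \<Rightarrow> ('v, 'e, 'f) koszul_chain" where
  "kos_ract p n X f =
     (if int p \<le> - n then let q = nat (- n) in
        kos_map (n + int p) (\<lambda>(\<alpha>, x, \<beta>).
          frag_cmul (isign (int (p * q)))
            (\<Sum>(y, z) \<leftarrow> split p (q - p) x. frag_of (\<alpha> \<otimes>\<^bsub>alg\<^esub> f y, z, \<beta>))) X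
      else \<zero>\<^bsub>kos_grp (n + int p)\<^esub>)"

definition koszul_complex :: "('v, 'e, 'f, ('v, 'e, 'f) koszul_chain) qobj" where
  "koszul_complex = \<lparr>grp = kos_grp, diff = kos_diff, lact = kos_lact, ract = kos_ract\<rparr>"


section \<open>The dg category of dg bimodules in \<open>A\<close>-bimodules\<close>

definition bimodule :: "(('v, 'e, 'f) qalg, 'x) bimod \<Rightarrow> bool" where
  "bimodule M \<longleftrightarrow> abelian_group M \<and>
     (\<forall>a \<in> carrier alg. \<forall>x \<in> carrier M. a \<odot>\<^bsub>M\<^esub> x \<in> carrier M \<and> rsmult M x a \<in> carrier M) \<and>
     (\<forall>a \<in> carrier alg. \<forall>x \<in> carrier M. \<forall>y \<in> carrier M.
        a \<odot>\<^bsub>M\<^esub> (x \<oplus>\<^bsub>M\<^esub> y) = a \<odot>\<^bsub>M\<^esub> x \<oplus>\<^bsub>M\<^esub> a \<odot>\<^bsub>M\<^esub> y \<and>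
        rsmult M (x \<oplus>\<^bsub>M\<^esub> y) a = rsmult M x a \<oplus>\<^bsub>M\<^esub> rsmult M y a) \<and>
     (\<forall>a \<in> carrier alg. \<forall>b \<in> carrier alg. \<forall>x \<in> carrier M.
        (a \<oplus>\<^bsub>alg\<^esub> b) \<odot>\<^bsub>M\<^esub> x = a \<odot>\<^bsub>M\<^esub> x \<oplus>\<^bsub>M\<^esub> b \<odot>\<^bsub>M\<^esub> x \<and>
        rsmult M x (a \<oplus>\<^bsub>alg\<^esub> b) = rsmult M x a \<oplus>\<^bsub>M\<^esub> rsmult M x b \<and>
        (a \<otimes>\<^bsub>alg\<^esub> b) \<odot>\<^bsub>M\<^esub> x = a \<odot>\<^bsub>M\<^esub> (b \<odot>\<^bsub>M\<^esub> x) \<and>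
        rsmult M x (a \<otimes>\<^bsub>alg\<^esub> b) = rsmult M (rsmult M x a) b \<and>
        rsmult M (a \<odot>\<^bsub>M\<^esub> x) b = a \<odot>\<^bsub>M\<^esub> rsmult M x b) \<and>
     (\<forall>x \<in> carrier M. \<one>\<^bsub>alg\<^esub> \<odot>\<^bsub>M\<^esub> x = x \<and> rsmult M x \<one>\<^bsub>alg\<^esub> = x) \<and>
     (\<forall>c. \<forall>x \<in> carrier M. scal c \<odot>\<^bsub>M\<^esub> x = rsmult M x (scal c))"

definition bimod_hom ::
  "(('v, 'e, 'f) qalg, 'x) bimod \<Rightarrow> (('v, 'e, 'f) qalg, 'y) bimod \<Rightarrow> ('x \<Rightarrow> 'y) \<Rightarrow> bool" where
  "bimod_hom M N h \<longleftrightarrow>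
     (\<forall>x \<in> carrier M. h x \<in> carrier N) \<and>
     (\<forall>x \<in> carrier M. \<forall>y \<in> carrier M. h (x \<oplus>\<^bsub>M\<^esub> y) = h x \<oplus>\<^bsub>N\<^esub> h y) \<and>
     (\<forall>a \<in> carrier alg. \<forall>x \<in> carrier M.
        h (a \<odot>\<^bsub>M\<^esub> x) = a \<odot>\<^bsub>N\<^esub> h x \<and> h (rsmult M x a) = rsmult N (h x) a)"

definition graded_bimodule :: "('v, 'e, 'f, 'x) qobj \<Rightarrow> bool" where
  "graded_bimodule C \<longleftrightarrow>
     (\<forall>n. bimodule (grp C n)) \<and>
     (\<forall>p n. \<forall>f \<in> cochains p. \<forall>x \<in> carrier (grp C n).
        lact C p n f x \<in> carrier (grp C (n + int p)) \<and>
        ract C p n x f \<in> carrier (grp C (n + int p))) \<and>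
     (\<forall>p n. \<forall>f \<in> cochains p. \<forall>x \<in> carrier (grp C n). \<forall>y \<in> carrier (grp C n).
        lact C p n f (x \<oplus>\<^bsub>grp C n\<^esub> y) = lact C p n f x \<oplus>\<^bsub>grp C (n + int p)\<^esub> lact C p n f y \<and>
        ract C p n (x \<oplus>\<^bsub>grp C n\<^esub> y) f = ract C p n x f \<oplus>\<^bsub>grp C (n + int p)\<^esub> ract C p n y f) \<and>
     (\<forall>p n. \<forall>f \<in> cochains p. \<forall>g \<in> cochains p. \<forall>x \<in> carrier (grp C n).
        lact C p n (cochain_add p f g) x
          = lact C p n f x \<oplus>\<^bsub>grp C (n + int p)\<^esub> lact C p n g x \<and>
        ract C p n x (cochain_add p f g)
          = ract C p n x f \<oplus>\<^bsub>grp C (n + int p)\<^esub> ract C p n x g) \<and>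
     (\<forall>p n c. \<forall>f \<in> cochains p. \<forall>x \<in> carrier (grp C n).
        lact C p n (cochain_scale p c f) x = scal c \<odot>\<^bsub>grp C (n + int p)\<^esub> lact C p n f x \<and>
        ract C p n x (cochain_scale p c f) = scal c \<odot>\<^bsub>grp C (n + int p)\<^esub> ract C p n x f) \<and>
     (\<forall>n. \<forall>x \<in> carrier (grp C n). lact C 0 n cochain_one x = x \<and> ract C 0 n x cochain_one = x) \<and>
     (\<forall>p q n. \<forall>f \<in> cochains p. \<forall>g \<in> cochains q. \<forall>x \<in> carrier (grp C n).
        lact C (p + q) n (cup p q f g) x = lact C p (n + int q) f (lact C q n g x) \<and>
        ract C (p + q) n x (cup p q f g) = ract C q (n + int p) (ract C p n x f) g \<and>
        ract C q (n + int p) (lact C p n f x) g = lact C p (n + int q) f (ract C q n x g)) \<and>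
     (\<forall>p q n. \<forall>f \<in> cochains p. \<forall>g \<in> cochains q. \<forall>x \<in> carrier (grp C n).
        \<forall>a \<in> carrier alg. \<forall>b \<in> carrier alg.
        rsmult (grp C (n + int p + int q))
          (a \<odot>\<^bsub>grp C (n + int p + int q)\<^esub> ract C q (n + int p) (lact C p n f x) g) b
        = ract C q (n + int p) (lact C p n f (rsmult (grp C n) (a \<odot>\<^bsub>grp C n\<^esub> x) b)) g)"

definition dg_object :: "('v, 'e, 'f, 'x) qobj \<Rightarrow> bool" where
  "dg_object C \<longleftrightarrow> graded_bimodule C \<and>
     (\<forall>n. bimod_hom (grp C n) (grp C (n + 1)) (diff C n)) \<and>
     (\<forall>n. \<forall>x \<in> carrier (grp C n). diff C (n + 1) (diff C n x) = \<zero>\<^bsub>grp C (n + 2)\<^esub>) \<and>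
     (\<forall>p n. \<forall>f \<in> cochains p. \<forall>x \<in> carrier (grp C n).
        diff C (n + int p) (lact C p n f x)
          = lact C (p + 1) n (bK p f) x
            \<oplus>\<^bsub>grp C (n + int p + 1)\<^esub>
            signed (grp C (n + int p + 1)) (int p) (lact C p (n + 1) f (diff C n x)) \<and>
        diff C (n + int p) (ract C p n x f)
          = ract C p (n + 1) (diff C n x) f
            \<oplus>\<^bsub>grp C (n + int p + 1)\<^esub>
            signed (grp C (n + int p + 1)) n (ract C (p + 1) n x (bK p f)))"

definition Mor ::
  "('v, 'e, 'f, 'x) qobj \<Rightarrow> ('v, 'e, 'f, 'y) qobj \<Rightarrow> int \<Rightarrow> (int \<Rightarrow> 'x \<Rightarrow> 'y) set" where
  "Mor C D r = {u.
     (\<forall>n. u n \<in> extensional (carrier (grp C n))) \<and>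
     (\<forall>n. bimod_hom (grp C n) (grp D (n + r)) (u n)) \<and>
     (\<forall>p n. \<forall>f \<in> cochains p. \<forall>x \<in> carrier (grp C n).
        u (n + int p) (lact C p n f x)
          = signed (grp D (n + r + int p)) (r * int p) (lact D p (n + r) f (u n x)) \<and>
        u (n + int p) (ract C p n x f) = ract D p (n + r) (u n x) f)}"

definition zero_mor ::
  "('v, 'e, 'f, 'x) qobj \<Rightarrow> ('v, 'e, 'f, 'y) qobj \<Rightarrow> int \<Rightarrow> int \<Rightarrow> 'x \<Rightarrow> 'y" where
  "zero_mor C D r = (\<lambda>n. \<lambda>x \<in> carrier (grp C n). \<zero>\<^bsub>grp D (n + r)\<^esub>)"

definition dMor ::
  "('v, 'e, 'f, 'x) qobj \<Rightarrow> ('v, 'e, 'f, 'y) qobj \<Rightarrow> int \<Rightarrow> (int \<Rightarrow> 'x \<Rightarrow> 'y) \<Rightarrow> int \<Rightarrow> 'x \<Rightarrow> 'y" where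
  "dMor C D r u = (\<lambda>n. \<lambda>x \<in> carrier (grp C n).
     diff D (n + r) (u n x)
       \<ominus>\<^bsub>grp D (n + r + 1)\<^esub> signed (grp D (n + r + 1)) r (u (n + 1) (diff C n x)))"

definition closed_mor ::
  "('v, 'e, 'f, 'x) qobj \<Rightarrow> ('v, 'e, 'f, 'y) qobj \<Rightarrow> int \<Rightarrow> (int \<Rightarrow> 'x \<Rightarrow> 'y) set" where
  "closed_mor C D r = {u \<in> Mor C D r. dMor C D r u = zero_mor C D (r + 1)}"

definition acyclic_Mor :: "('v, 'e, 'f, 'x) qobj \<Rightarrow> ('v, 'e, 'f, 'y) qobj \<Rightarrow> bool" where
  "acyclic_Mor C D \<longleftrightarrow> (\<forall>r. closed_mor C D r = dMor C D (r - 1) ` Mor C D (r - 1))"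

definition cocycles :: "('v, 'e, 'f, 'x) qobj \<Rightarrow> int \<Rightarrow> 'x set" where
  "cocycles C n = {x \<in> carrier (grp C n). diff C n x = \<zero>\<^bsub>grp C (n + 1)\<^esub>}"

definition coboundaries :: "('v, 'e, 'f, 'x) qobj \<Rightarrow> int \<Rightarrow> 'x set" where
  "coboundaries C n = diff C (n - 1) ` carrier (grp C (n - 1))"

definition cohomology :: "('v, 'e, 'f, 'x) qobj \<Rightarrow> int \<Rightarrow> 'x set set" where
  "cohomology C n = (\<lambda>x. coboundaries C n +>\<^bsub>grp C n\<^esub> x) ` cocycles C n"

definition acyclic_obj :: "('v, 'e, 'f, 'x) qobj \<Rightarrow> bool" where
  "acyclic_obj C \<longleftrightarrow> (\<forall>n. cocycles C n = coboundaries C n)"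

definition quasi_iso ::
  "('v, 'e, 'f, 'x) qobj \<Rightarrow> ('v, 'e, 'f, 'y) qobj \<Rightarrow> (int \<Rightarrow> 'x \<Rightarrow> 'y) \<Rightarrow> bool" where
  "quasi_iso C D u \<longleftrightarrow> u \<in> closed_mor C D 0 \<and>
     (\<forall>n. bij_betw (\<lambda>X. \<Union>x \<in> X. coboundaries D n +>\<^bsub>grp D n\<^esub> u n x)
            (cohomology C n) (cohomology D n))"


section \<open>The homotopy category and its localization at quasi-isomorphisms\<close>

definition homotopy_class ::
  "('v, 'e, 'f, 'x) qobj \<Rightarrow> ('v, 'e, 'f, 'x) qobj \<Rightarrow> (int \<Rightarrow> 'x \<Rightarrow> 'x) \<Rightarrow> (int \<Rightarrow> 'x \<Rightarrow> 'x) set" where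
  "homotopy_class C D u = {v \<in> closed_mor C D 0. \<exists>h \<in> Mor C D (- 1).
     \<forall>n. \<forall>x \<in> carrier (grp C n). v n x = u n x \<oplus>\<^bsub>grp D n\<^esub> dMor C D (- 1) h n x}"

definition KHom ::
  "('v, 'e, 'f, 'x) qobj \<Rightarrow> ('v, 'e, 'f, 'x) qobj \<Rightarrow> (int \<Rightarrow> 'x \<Rightarrow> 'x) set set" where
  "KHom C D = homotopy_class C D ` closed_mor C D 0"

definition Kid :: "('v, 'e, 'f, 'x) qobj \<Rightarrow> (int \<Rightarrow> 'x \<Rightarrow> 'x) set" where
  "Kid C = homotopy_class C C (\<lambda>n. \<lambda>x \<in> carrier (grp C n). x)"

definition Kcomp ::
  "('v, 'e, 'f, 'x) qobj \<Rightarrow> ('v, 'e, 'f, 'x) qobj \<Rightarrow>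
     (int \<Rightarrow> 'x \<Rightarrow> 'x) set \<Rightarrow> (int \<Rightarrow> 'x \<Rightarrow> 'x) set \<Rightarrow> (int \<Rightarrow> 'x \<Rightarrow> 'x) set" where
  "Kcomp C E G F = (\<Union>g \<in> G. \<Union>f \<in> F.
     homotopy_class C E (\<lambda>n. \<lambda>x \<in> carrier (grp C n). g n (f n x)))"

definition Kquasi_iso ::
  "('v, 'e, 'f, 'x) qobj \<Rightarrow> ('v, 'e, 'f, 'x) qobj \<Rightarrow> (int \<Rightarrow> 'x \<Rightarrow> 'x) set \<Rightarrow> bool" where
  "Kquasi_iso C D S \<longleftrightarrow> S \<in> KHom C D \<and> (\<exists>s \<in> S. quasi_iso C D s)"

text \<open>
  Gabriel-Zisman localization: morphisms from \<open>X\<close> to \<open>Y\<close> are zigzags of morphisms of the homotopy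
  category in which the backward arrows are quasi-isomorphisms, modulo the congruence generated by
  the identities and compositions of the homotopy category and by \<open>s\<^sup>-\<^sup>1 s = 1\<close>, \<open>s s\<^sup>-\<^sup>1 = 1\<close>.
  \<open>Fwd X f Y\<close> stands for \<open>f : X \<rightarrow> Y\<close>, and \<open>Bwd Y s X\<close> for the inverse, from \<open>Y\<close> to \<open>X\<close>, of
  \<open>s : X \<rightarrow> Y\<close>.  Zigzags are read from left to right.
\<close>

inductive zigzag ::
  "('v, 'e, 'f, 'x) qobj \<Rightarrow> ('v, 'e, 'f, 'x) qobj \<Rightarrow>
     (('v, 'e, 'f, 'x) qobj, (int \<Rightarrow> 'x \<Rightarrow> 'x) set) letter list \<Rightarrow> bool" where
  zz_nil: "dg_object X \<Longrightarrow> zigzag X X []"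
| zz_fwd: "dg_object X \<Longrightarrow> F \<in> KHom X Y \<Longrightarrow> zigzag Y Z w \<Longrightarrow> zigzag X Z (Fwd X F Y # w)"
| zz_bwd: "dg_object Y \<Longrightarrow> Kquasi_iso X Y S \<Longrightarrow> zigzag X Z w \<Longrightarrow> zigzag Y Z (Bwd Y S X # w)"

inductive zigzag_eq ::
  "('v, 'e, 'f, 'x) qobj \<Rightarrow> ('v, 'e, 'f, 'x) qobj \<Rightarrow>
     (('v, 'e, 'f, 'x) qobj, (int \<Rightarrow> 'x \<Rightarrow> 'x) set) letter list \<Rightarrow>
     (('v, 'e, 'f, 'x) qobj, (int \<Rightarrow> 'x \<Rightarrow> 'x) set) letter list \<Rightarrow> bool" where
  ze_refl: "zigzag X Y w \<Longrightarrow> zigzag_eq X Y w w"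
| ze_sym: "zigzag_eq X Y w w' \<Longrightarrow> zigzag_eq X Y w' w"
| ze_trans: "zigzag_eq X Y w w' \<Longrightarrow> zigzag_eq X Y w' w'' \<Longrightarrow> zigzag_eq X Y w w''"
| ze_cong: "zigzag X' X l \<Longrightarrow> zigzag_eq X Y w w' \<Longrightarrow> zigzag Y Y' r \<Longrightarrow>
     zigzag_eq X' Y' (l @ w @ r) (l @ w' @ r)"
| ze_id: "dg_object X \<Longrightarrow> zigzag_eq X X [Fwd X (Kid X) X] []"
| ze_comp: "dg_object X \<Longrightarrow> dg_object Y \<Longrightarrow> dg_object Z \<Longrightarrow> F \<in> KHom X Y \<Longrightarrow> G \<in> KHom Y Z \<Longrightarrow>
     zigzag_eq X Z [Fwd X F Y, Fwd Y G Z] [Fwd X (Kcomp X Z G F) Z]"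
| ze_inv1: "dg_object X \<Longrightarrow> dg_object Y \<Longrightarrow> Kquasi_iso X Y S \<Longrightarrow>
     zigzag_eq X X [Fwd X S Y, Bwd Y S X] []"
| ze_inv2: "dg_object X \<Longrightarrow> dg_object Y \<Longrightarrow> Kquasi_iso X Y S \<Longrightarrow>
     zigzag_eq Y Y [Bwd Y S X, Fwd X S Y] []"

definition DHom ::
  "('v, 'e, 'f, 'x) qobj \<Rightarrow> ('v, 'e, 'f, 'x) qobj \<Rightarrow>
     (('v, 'e, 'f, 'x) qobj, (int \<Rightarrow> 'x \<Rightarrow> 'x) set) letter list set set" where
  "DHom X Y = {w. zigzag X Y w} // {(w, w'). zigzag_eq X Y w w'}"

definition Did ::
  "('v, 'e, 'f, 'x) qobj \<Rightarrow> (('v, 'e, 'f, 'x) qobj, (int \<Rightarrow> 'x \<Rightarrow> 'x) set) letter list set" where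
  "Did X = {w. zigzag_eq X X [] w}"

definition Dcomp ::
  "('v, 'e, 'f, 'x) qobj \<Rightarrow> ('v, 'e, 'f, 'x) qobj \<Rightarrow>
     (('v, 'e, 'f, 'x) qobj, (int \<Rightarrow> 'x \<Rightarrow> 'x) set) letter list set \<Rightarrow>
     (('v, 'e, 'f, 'x) qobj, (int \<Rightarrow> 'x \<Rightarrow> 'x) set) letter list set \<Rightarrow>
     (('v, 'e, 'f, 'x) qobj, (int \<Rightarrow> 'x \<Rightarrow> 'x) set) letter list set" where
  "Dcomp X Z \<psi> \<phi> = {w. \<exists>w1 \<in> \<phi>. \<exists>w2 \<in> \<psi>. zigzag_eq X Z (w1 @ w2) w}"

definition D_iso ::
  "('v, 'e, 'f, 'x) qobj \<Rightarrow> ('v, 'e, 'f, 'x) qobj \<Rightarrow>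
     (('v, 'e, 'f, 'x) qobj, (int \<Rightarrow> 'x \<Rightarrow> 'x) set) letter list set \<Rightarrow> bool" where
  "D_iso X Y \<phi> \<longleftrightarrow> dg_object X \<and> dg_object Y \<and> \<phi> \<in> DHom X Y \<and>
     (\<exists>\<psi> \<in> DHom Y X. Dcomp X X \<psi> \<phi> = Did X \<and> Dcomp Y Y \<phi> \<psi> = Did Y)"


section \<open>Duality into the enveloping algebra and its right derived functor\<close>

definition dual_grp ::
  "('v, 'e, 'f, 'x) qobj \<Rightarrow> int \<Rightarrow> (('v, 'e, 'f) qalg, 'x \<Rightarrow> ('v, 'e, 'f) env_elem) bimod" where
  "dual_grp C n = (let M = grp C (- n) in
     \<lparr>carrier = {u \<in> extensional (carrier M).
        (\<forall>x \<in> carrier M. u x \<in> carrier env) \<and>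
        (\<forall>x \<in> carrier M. \<forall>y \<in> carrier M. u (x \<oplus>\<^bsub>M\<^esub> y) = u x \<oplus>\<^bsub>env\<^esub> u y) \<and>
        (\<forall>a \<in> carrier alg. \<forall>b \<in> carrier alg. \<forall>x \<in> carrier M.
           u (rsmult M (a \<odot>\<^bsub>M\<^esub> x) b) = etens a b \<otimes>\<^bsub>env\<^esub> u x)},
      monoid.mult = (\<lambda>_ _. undefined), one = undefined,
      ring.zero = (\<lambda>x \<in> carrier M. \<zero>\<^bsub>env\<^esub>),
      add = (\<lambda>u v. \<lambda>x \<in> carrier M. u x \<oplus>\<^bsub>env\<^esub> v x),
      smult = (\<lambda>a u. \<lambda>x \<in> carrier M. u x \<otimes>\<^bsub>env\<^esub> etens \<one>\<^bsub>alg\<^esub> a),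
      rsmult = (\<lambda>u b. \<lambda>x \<in> carrier M. u x \<otimes>\<^bsub>env\<^esub> etens b \<one>\<^bsub>alg\<^esub>)\<rparr>)"

definition Hom_Ae ::
  "('v, 'e, 'f, 'x) qobj \<Rightarrow> ('v, 'e, 'f, 'x \<Rightarrow> ('v, 'e, 'f) env_elem) qobj" where
  "Hom_Ae C =
     \<lparr>grp = dual_grp C,
      diff = (\<lambda>n u. \<lambda>x \<in> carrier (grp C (- (n + 1))).
        \<ominus>\<^bsub>env\<^esub> signed env n (u (diff C (- (n + 1)) x))),
      lact = (\<lambda>p n f u. \<lambda>x \<in> carrier (grp C (- (n + int p))).
        signed env (int p) (u (ract C p (- (n + int p)) x f))),
      ract = (\<lambda>p n u f. \<lambda>x \<in> carrier (grp C (- (n + int p))).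
        u (lact C p (- (n + int p)) f x))\<rparr>"

text \<open>The type \<open>'x\<close> plays the role of the universe: the objects considered, and in particular the
  test objects \<open>N\<close>, are those with carriers in \<open>'x\<close>.  The condition is therefore meaningful only if \<open>'x\<close>
  is large enough.\<close>

definition K_projective :: "('v, 'e, 'f, 'x) qobj \<Rightarrow> bool" where
  "K_projective P \<longleftrightarrow>
     (\<forall>N :: ('v, 'e, 'f, 'x) qobj. dg_object N \<and> acyclic_obj N \<longrightarrow> acyclic_Mor P N)"

definition K_projective_resolution ::
  "('v, 'e, 'f, 'x) qobj \<Rightarrow> ('v, 'e, 'f, 'x) qobj \<Rightarrow> (int \<Rightarrow> 'x \<Rightarrow> 'x) \<Rightarrow> bool" where
  "K_projective_resolution C P \<pi> \<longleftrightarrow> dg_object P \<and> K_projective P \<and> quasi_iso P C \<pi>"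

text \<open>\<open>Y\<close> is a value at \<open>C\<close> of the right derived functor of \<^const>\<open>Hom_Ae\<close>.  The value depends on
  the choice of a \<open>K\<close>-projective resolution, hence a relation and not a function.\<close>

definition is_RHom_Ae ::
  "('v, 'e, 'f, 'x) qobj \<Rightarrow> ('v, 'e, 'f, 'x \<Rightarrow> ('v, 'e, 'f) env_elem) qobj \<Rightarrow> bool" where
  "is_RHom_Ae C Y \<longleftrightarrow> (\<exists>P \<pi>. K_projective_resolution C P \<pi> \<and> Y = Hom_Ae P)"

end

end

theory Submission
 imports Defs
begin

text \<open>
 Let \<open>\<pi> : P \<rightarrow> K\<close> be a \<open>K\<close>-projective resolution of the Koszul complex. It suffices that \<open>\<pi>\<close> is a homotopy equivalence
 of complexes of \<open>A\<close>-bimodules: then so is precomposition with \<open>\<pi>\<close>, which is a morphism from \<open>Hom(K, A\<^sup>e)\<close> to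
 \<open>Hom(P, A\<^sup>e)\<close>. The cone \<open>N\<close> of \<open>\<pi>\<close> is an acyclic complex of bimodules. The bimodules \<open>A \<otimes> W\<^sub>p \<otimes> A\<close> are projective, so
 the inclusion of \<open>K\<close> in \<open>N\<close> is null-homotopic, which gives a right homotopy inverse of \<open>\<pi>\<close>. For the other side,
 forgetting the action of the cochain algebra has a right adjoint, coinduction. It preserves acyclicity, because
 acyclic complexes of vector spaces are contractible, so \<open>P\<close> is also \<open>K\<close>-projective as a complex of bimodules. The
 injection \<open>fam\<close> serves to encode the coinduced object of \<open>N\<close> in the universe \<open>'u\<close>.
\<close>

section \<open>Abelian groups\<close>

text \<open>The test in \<open>K_projective\<close> sees only morphisms linear over the cochain
  algebra, whereas the maps obtained from projectivity of the terms of K(A) are linear over A alone.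
  So no homotopy equivalence of dg bimodules is produced: the one map compatible with all structure
  is precomposition with the resolution, and the homotopies only show that it is bijective on
  cohomology. Coinduction is Hom over the ground field of two copies of the cochain algebra into the
  given complex. An element ph is read as the map sending (f, g) to the value at (1, 1) of f.ph.g;
  this reading dictates the actions, the differential and every sign. Its acyclicity asks only for a
  contraction linear over the field, whence the complements of cocycles, and evaluation at (1, 1)
  leads back to bimodules. In the Koszul calculus both differentials are inner, given by a degree 1
  element \<open>eps\<close> of square zero, so Leibniz rules and d d = 0 follow from associativity.
  The spaces W_p are tested by coefficients along paths, and k-bilinear projections onto them make
  every expression independent of the chosen presentation.\<close>

abbreviation (input) add_at ("(_ +[_]/ _)" [65, 0, 66] 65) where "x +[G] y == x \<oplus>\<^bsub>G\<^esub> y"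
abbreviation (input) minus_at ("(_ -[_]/ _)" [65, 0, 66] 65) where "x -[G] y == x \<ominus>\<^bsub>G\<^esub> y"
abbreviation (input) neg_at ("-[_] _" [0, 81] 80) where "-[G] x == \<ominus>\<^bsub>G\<^esub> x"
abbreviation (input) mult_at ("(_ **[_]/ _)" [70, 0, 71] 70) where "x **[G] y == x \<otimes>\<^bsub>G\<^esub> y"
abbreviation (input) smult_at ("(_ *[_]/ _)" [70, 0, 71] 70) where "a *[M] x == a \<odot>\<^bsub>M\<^esub> x"
abbreviation (input) zero_at ("0[_]") where "0[G] == \<zero>\<^bsub>G\<^esub>"
abbreviation (input) one_at ("1[_]") where "1[G] == \<one>\<^bsub>G\<^esub>"
abbreviation (input) car where "car == carrier"
abbreviation (input) deg where "deg n p q == n + int p + int q"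
abbreviation (input) elts where "elts C n == carrier (grp C n)"
abbreviation (input) coef where "coef == Poly_Mapping.lookup"
abbreviation (input) supp where "supp == Poly_Mapping.keys"
abbreviation (input) mon where "mon == Poly_Mapping.single"

lemmas rext = restrict_ext

lemmas (in abelian_group) ab_ax = abelian_group_axioms

section \<open>Signed sums in an abelian group, by reflection\<close>

datatype agx = V nat | Zr | Pl agx agx | Mi agx agx | Ng agx | Sg int agx

primrec agv :: "('x,'m) ring_scheme => 'x list => agx => 'x" where
 "agv G xs (V i) = xs ! i"
| "agv G xs Zr = 0[G]"
| "agv G xs (Pl s t) = agv G xs s +[G] agv G xs t"
| "agv G xs (Mi s t) = agv G xs s -[G] agv G xs t"
| "agv G xs (Ng s) = -[G] agv G xs s"
| "agv G xs (Sg n s) = signed G n (agv G xs s)"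

text \<open>The coefficient of the \<open>j\<close>-th variable. A sign \<open>signed G n\<close>
  with symbolic \<open>n\<close> turns into the integer factor \<open>isign n\<close>, so an
  identity whose signs have unknown parity reduces to arithmetic of integers.\<close>

primrec agc :: "agx => nat => int" where
 "agc (V i) = (%j. if j = i then 1 else 0)"
| "agc Zr = (%j. 0)"
| "agc (Pl s t) = (%j. agc s j + agc t j)"
| "agc (Mi s t) = (%j. agc s j - agc t j)"
| "agc (Ng s) = (%j. - agc s j)"
| "agc (Sg n s) = (%j. isign n * agc s j)"

primrec agb :: "nat => agx => bool" where
 "agb l (V i) = (i < l)"
| "agb l Zr = True"
| "agb l (Pl s t) = (agb l s & agb l t)"
| "agb l (Mi s t) = (agb l s & agb l t)"
| "agb l (Ng s) = agb l s"
| "agb l (Sg n s) = agb l s"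

context abelian_group
begin

lemma signed_cl [simp, intro]: "x : car G ==> signed G n x : car G"
 by (simp add: signed_def)

lemma signed_add: "x : car G ==> y : car G ==> signed G n (x \<oplus> y) = signed G n x \<oplus> signed G n y"
 by (simp add: signed_def minus_add)

lemma signed_signed: "x : car G ==> signed G m (signed G n x) = signed G (m + n) x"
 by (auto simp: signed_def)

lemma signed_zero [simp]: "signed G n \<zero> = \<zero>"
 by (simp add: signed_def)

lemma signed_even: "even n ==> signed G n x = x"
 by (simp add: signed_def)

lemma signed_cong: "even (m - n) ==> signed G m x = signed G n x"
 by (auto simp: signed_def)

lemma agv_closed: "set xs <= car G ==> agb (length xs) e ==> agv G xs e : car G"
 by (induction e) (auto simp: subset_iff)

text \<open>The sum runs over positions and not over members of the list, so repeated entries are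
  harmless.\<close>

definition ag_sum :: "'a list => (nat => int) => 'a" where
 "ag_sum xs c = finsum G (%i. [c i] \<cdot> (xs ! i)) {..<length xs}"

lemma ag_sum_closed: "set xs <= car G ==> ag_sum xs c : car G"
 unfolding ag_sum_def by (rule finsum_closed) (auto simp: subset_iff)

lemma ag_sum_add:
 assumes "set xs <= car G" shows "ag_sum xs (%i. c i + d i) = ag_sum xs c \<oplus> ag_sum xs d"
proof -
 have "ag_sum xs (%i. c i + d i) = finsum G (%i. [c i] \<cdot> (xs ! i) \<oplus> [d i] \<cdot> (xs ! i)) {..<length xs}"
  unfolding ag_sum_def using assms
  by (intro finsum_cong') (auto simp: subset_iff add.int_pow_mult)
 then show ?thesis
  unfolding ag_sum_def using assms by (simp add: subset_iff Pi_iff finsum_addf)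
qed

lemma add_pow_int_0: "[(0::int)] \<cdot> x = \<zero>"
 by (simp add: add_pow_def)

lemma ag_sum_zero: "ag_sum xs (%i. 0) = \<zero>"
 unfolding ag_sum_def by (rule add.finprod_one_eqI) (simp add: add_pow_def)

lemma ag_sum_minus:
 assumes "set xs <= car G" shows "ag_sum xs (%i. - c i) = \<ominus> ag_sum xs c"
proof -
 have "ag_sum xs (%i. - c i) \<oplus> ag_sum xs c = \<zero>"
  by (subst ag_sum_add[OF assms, symmetric]) (simp add: ag_sum_zero)
 then show ?thesis using ag_sum_closed[OF assms] by (simp add: minus_equality)
qed

lemma ag_sum_single:
 assumes "set xs <= car G" "i < length xs" shows "ag_sum xs (%j. if j = i then 1 else 0) = xs ! i"
proof -
 have "ag_sum xs (%j. if j = i then 1 else 0) = finsum G (%j. if i = j then xs ! j else \<zero>) {..<length xs}"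
  unfolding ag_sum_def using assms
  by (intro finsum_cong') (auto simp: subset_iff add_pow_int_0)
 also have "... = xs ! i"
  using assms by (subst finsum_singleton) (auto simp: subset_iff)
 finally show ?thesis .
qed

lemma agv_eq_sum: "set xs <= car G ==> agb (length xs) e ==> agv G xs e = ag_sum xs (agc e)"
proof (induction e)
 case (Sg n e) then show ?case
  by (cases "even n") (simp_all add: signed_def isign_def ag_sum_minus)
next
 case (Mi s t) then show ?case
  using ag_sum_add[of xs "agc s" "%j. - agc t j"] by (simp add: ag_sum_minus a_minus_def)
qed (simp_all add: ag_sum_single ag_sum_zero ag_sum_add ag_sum_minus)

text \<open>Decision procedure by reflection: both sides denote the same integer combination of \<open>xs\<close>.\<close>

lemma ag_eq:
 assumes "set xs <= car G" "agb (length xs) s" "agb (length xs) t"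
  and "!!i. i < length xs ==> agc s i = agc t i"
 shows "agv G xs s = agv G xs t"
 using assms by (auto simp: agv_eq_sum ag_sum_def subset_iff intro!: finsum_cong')

end

lemma isign_add: "isign (m + n) = isign m * isign n"
 by (auto simp: isign_def)

lemma isign_simps [simp]: "isign 0 = 1" "isign 1 = - 1" "isign n * isign n = 1" "isign n * (isign n * z) = z"
 "isign (- n) = isign n"
 by (auto simp: isign_def)

lemma isign_diff: "isign (m - n) = isign m * isign n"
 by (auto simp: isign_def)

section \<open>Additive maps between records\<close>

definition addmap :: "('x,'m) ring_scheme => ('y,'k) ring_scheme => ('x => 'y) => bool" where
 "addmap G H h \<longleftrightarrow> (ALL x:car G. h x : car H) &
   (ALL x:car G. ALL y:car G. h (x +[G] y) = h x +[H] h y)"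

lemma addmapI:
 "(!!x. x : car G ==> h x : car H) ==>
  (!!x y. x : car G ==> y : car G ==> h (x +[G] y) = h x +[H] h y) ==> addmap G H h"
 by (simp add: addmap_def)

lemma addmap_closed: "addmap G H h ==> x : car G ==> h x : car H"
 by (simp add: addmap_def)

lemma am_add: "addmap G H h ==> x : car G ==> y : car G ==> h (x +[G] y) = h x +[H] h y"
 by (simp add: addmap_def)

lemma am_zero:
 assumes "abelian_group G" "abelian_group H" "addmap G H h" shows "h 0[G] = 0[H]"
proof -
 interpret G: abelian_group G by fact
 interpret H: abelian_group H by fact
 have "h 0[G] +[H] h 0[G] = h 0[G]"
  using am_add[OF assms(3), of "0[G]" "0[G]"] by simp
 then show ?thesis using addmap_closed[OF assms(3), of "0[G]"]
  by (simp add: H.add.l_cancel_one)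
qed

lemma addmap_neg:
 assumes "abelian_group G" "abelian_group H" "addmap G H h" "x : car G"
 shows "h (-[G] x) = -[H] h x"
proof -
 interpret G: abelian_group G by fact
 interpret H: abelian_group H by fact
 have "h (-[G] x) +[H] h x = 0[H]"
  using am_add[OF assms(3), of "-[G] x" x] assms by (simp add: G.l_neg am_zero)
 then show ?thesis using addmap_closed[OF assms(3)] assms(4) by (simp add: H.minus_equality)
qed

lemma am_diff:
 assumes "abelian_group G" "abelian_group H" "addmap G H h" "x : car G" "y : car G"
 shows "h (x -[G] y) = h x -[H] h y"
 using assms abelian_group.a_inv_closed[OF assms(1)]
 by (simp add: a_minus_def am_add addmap_neg)

lemma am_signed:
 assumes "abelian_group G" "abelian_group H" "addmap G H h" "x : car G"
 shows "h (signed G n x) = signed H n (h x)"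
 using assms by (simp add: signed_def addmap_neg)

lemma am_comp: "addmap G H h ==> addmap H K k ==> addmap G K (%x. k (h x))"
 by (simp add: addmap_def)

lemma am_finsum:
 assumes "abelian_group G" "abelian_group H" "addmap G H h" "finite I" "!!i. i : I ==> g i : car G"
 shows "h (finsum G g I) = finsum H (%i. h (g i)) I"
proof -
 interpret G: abelian_group G by fact
 interpret H: abelian_group H by fact
 show ?thesis using assms(4,5)
 proof (induction rule: finite_induct)
  case empty then show ?case using am_zero assms by simp
 next
  case (insert i I)
  then have "finsum G g I : car G" by (auto intro!: G.finsum_closed)
  with insert show ?case
   using am_add[OF assms(3)] addmap_closed[OF assms(3)]
   by (subst G.finsum_insert; (subst H.finsum_insert)?) auto
 qed
qed

lemma am_finsum_pointwise:
 assumes "abelian_group G" "abelian_group H" "finite I" "!!i. i : I ==> addmap G H (t i)"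
 shows "addmap G H (%x. finsum H (%i. t i x) I)"
proof -
 interpret H: abelian_group H by fact
 show ?thesis
 proof (intro addmapI H.finsum_closed)
  fix x y assume xy: "x : car G" "y : car G"
  have "finsum H (%i. t i (x +[G] y)) I = finsum H (%i. t i x +[H] t i y) I"
   using xy assms(4) by (intro H.finsum_cong') (auto simp: addmap_def)
  then show "finsum H (%i. t i (x +[G] y)) I = finsum H (%i. t i x) I +[H] finsum H (%i. t i y) I"
   using xy assms(4) by (simp add: addmap_def Pi_iff H.finsum_addf)
 qed (use assms(4) in "auto simp: addmap_def")
qed

lemma am_signed_pointwise:
 assumes "abelian_group H" "addmap G H t"
 shows "addmap G H (%x. signed H n (t x))"
 using assms by (simp add: addmap_def abelian_group.signed_add abelian_group.signed_cl)

lemma am_add_pointwise: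
 assumes "abelian_group H" "addmap G H t" "addmap G H u"
 shows "addmap G H (%x. t x +[H] u x)"
proof -
 interpret H: abelian_group H by fact
 show ?thesis using assms(2,3) by (simp add: addmap_def H.a_ac)
qed

lemma addmap_minus_pointwise:
 assumes "abelian_group H" "addmap G H t" "addmap G H u"
 shows "addmap G H (%x. t x -[H] u x)"
proof -
 interpret H: abelian_group H by fact
 show ?thesis using assms(2,3) by (simp add: addmap_def H.a_ac H.minus_eq H.minus_add)
qed

lemma (in abelian_group) finsum_swap:
 assumes "finite A" "finite B" "!!i j. i : A ==> j : B ==> g i j : car G"
 shows "finsum G (%i. finsum G (%j. g i j) B) A = finsum G (%j. finsum G (%i. g i j) A) B"
 using assms(1,3)
proof (induction rule: finite_induct)
 case empty then show ?case by (simp add: finsum_zero)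
next
 case (insert i A)
 have "finsum G (%i. finsum G (%j. g i j) B) (insert i A)
   = finsum G (%j. g i j) B \<oplus> finsum G (%j. finsum G (%i. g i j) A) B"
  using insert by (subst finsum_insert) (auto intro!: finsum_closed)
 also have "... = finsum G (%j. g i j \<oplus> finsum G (%i. g i j) A) B"
  using insert by (subst finsum_addf) (auto intro!: finsum_closed)
 also have "... = finsum G (%j. finsum G (%i. g i j) (insert i A)) B"
  using insert by (intro finsum_cong') (auto intro!: finsum_closed)
 finally show ?case .
qed

text \<open>Sums over the positions of a list are the form in which \<open>split_sum\<close> is
  written; this is the step for inductions over presentations.\<close>

lemma (in abelian_group) finsum_snoc:
 assumes "!!i. i : set ys ==> g i : car G" "g y : car G"
 shows "finsum G (%i. g ((ys @ [y]) ! i)) {..<length (ys @ [y])} = finsum G (%i. g (ys ! i)) {..<length ys} \<oplus> g y"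
proof -
 have "finsum G (%i. g ((ys @ [y]) ! i)) {..<length (ys @ [y])} =
    g ((ys @ [y]) ! length ys) \<oplus> finsum G (%i. g ((ys @ [y]) ! i)) {..<length ys}"
  using assms by (simp add: lessThan_Suc) (subst finsum_insert, auto simp: nth_append)
 also have "finsum G (%i. g ((ys @ [y]) ! i)) {..<length ys} = finsum G (%i. g (ys ! i)) {..<length ys}"
  using assms by (intro finsum_cong') (auto simp: nth_append)
 finally show ?thesis using assms by (simp add: a_comm Pi_iff)
qed

lemma (in abelian_group) signed_finsum:
 assumes "finite A" "!!i. i : A ==> g i : car G"
 shows "signed G n (finsum G g A) = finsum G (%i. signed G n (g i)) A"
 using am_finsum[of G G "signed G n" A g] assms ab_ax
 by (simp add: addmap_def signed_add)

section \<open>Quotients of free abelian groups\<close>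

text \<open>The quotient group placed in the additive part of a ring record, so that
  \<open>abelian_group\<close> and \<open>finsum\<close> apply. The records \<open>env\<close> and
  \<open>kos_grp n\<close> carry such a group and differ only in their remaining fields.\<close>

definition quotrec :: "'b set => ('b \<Rightarrow>\<^sub>0 int) set => ('b \<Rightarrow>\<^sub>0 int) set ring" where
 "quotrec B H = \<lparr>carrier = car (free_Abelian_group B Mod H), monoid.mult = (%_ _. undefined), one = undefined,
   ring.zero = 1[free_Abelian_group B Mod H], add = monoid.mult (free_Abelian_group B Mod H)\<rparr>"

locale free_quot =
 fixes B :: "'b set" and S :: "('b \<Rightarrow>\<^sub>0 int) set"
 assumes S: "!!s. s : S ==> supp s <= B"
begin

abbreviation "FG \<equiv> free_Abelian_group B"
definition "H = generate FG S"
definition "cl c = H #>\<^bsub>FG\<^esub> c"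

sublocale FG: comm_group FG by (rule abelian_free_Abelian_group)

lemma S_carrier: "S <= car FG"
 using S by auto

lemma subgroup_H: "subgroup H FG"
 unfolding H_def by (rule FG.generate_is_subgroup[OF S_carrier])

sublocale HN: normal H FG
 using subgroup_H FG.normal_iff_subgroup by blast

abbreviation "quot \<equiv> quotrec B H"

lemma quot_simps: "car quot = cl ` {c. supp c <= B}" "0[quot] = cl 0"
 using FG.coset_mult_one[OF HN.subset]
 by (auto simp: quotrec_def carrier_FactGroup cl_def)

lemma cl_closed [simp, intro]: "supp c <= B ==> cl c : car quot"
 by (auto simp: quot_simps)

lemma cl_add: "supp c <= B ==> supp d <= B ==> cl c +[quot] cl d = cl (c + d)"
 using HN.rcos_sum[of c d] by (simp add: quotrec_def cl_def)

lemma abelian_group_quot: "abelian_group quot"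
proof -
 have "comm_group (FG Mod H)" by (rule FG.abelian_FactGroup[OF subgroup_H])
 moreover have "add_monoid quot = FG Mod H"
  by (simp add: quotrec_def)
 ultimately show ?thesis
  by (simp add: abelian_group_def abelian_group_axioms_def abelian_monoid_def comm_group_def)
qed

sublocale AG: abelian_group quot by (rule abelian_group_quot)

lemma cl_neg: "supp c <= B ==> -[quot] cl c = cl (- c)"
 by (rule AG.minus_equality) (auto simp: cl_add quot_simps)

lemma cl_diff: "supp c <= B ==> supp d <= B ==> cl c -[quot] cl d = cl (c - d)"
 by (simp add: a_minus_def cl_neg cl_add)

lemma cl_eq_zero_iff: "supp c <= B ==> cl c = 0[quot] \<longleftrightarrow> c : H"
proof -
 assume c: "supp c <= B"
 have "0[quot] = H" by (simp add: quotrec_def)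
 then show ?thesis unfolding cl_def using c
  by (metis FG.coset_join1 FG.coset_join2 FG.rcos_self HN.is_subgroup HN.subset carrier_free_Abelian_group_iff)
qed

text \<open>Connects the list sums of free symbols, by which the operations on the Koszul complex
  are defined, with finite sums in the quotient.\<close>

lemma cl_sum_list:
 "(!!y. y : set ys ==> supp (g y) <= B) ==>
  cl (\<Sum>y\<leftarrow>ys. g y) = finsum quot (%i. cl (g (ys ! i))) {..<length ys}
  & supp (\<Sum>y\<leftarrow>ys. g y) <= B"
proof (induction ys rule: rev_induct)
 case Nil then show ?case by (simp add: quot_simps)
next
 case (snoc y ys)
 have "finsum quot (%i. cl (g ((ys @ [y]) ! i))) {..<length (ys @ [y])} =
    cl (g ((ys @ [y]) ! length ys)) +[quot] finsum quot (%i. cl (g ((ys @ [y]) ! i))) {..<length ys}"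
  using snoc.prems by (simp add: lessThan_Suc) (subst AG.finsum_insert, auto simp: nth_append)
 also have "finsum quot (%i. cl (g ((ys @ [y]) ! i))) {..<length ys} = finsum quot (%i. cl (g (ys ! i))) {..<length ys}"
  using snoc.prems by (intro AG.finsum_cong') (auto simp: nth_append)
 moreover have "supp (g y + (\<Sum>y\<leftarrow>ys. g y)) <= B"
  using snoc keys_add[of "g y" "\<Sum>y\<leftarrow>ys. g y"] by fastforce
 moreover have "cl (g y + (\<Sum>y\<leftarrow>ys. g y)) = cl (g y) +[quot] cl (\<Sum>y\<leftarrow>ys. g y)"
  using snoc by (intro cl_add[symmetric]) auto
 ultimately show ?case using snoc by (simp add: add.commute)
qed

text \<open>The free group is generated by the symbols \<open>frag_of b\<close>, and closure under
  differences covers sums and negatives at once.\<close>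

lemma quot_induct [consumes 1, case_names zero gen diff]:
 assumes "X : car quot"
  and "P 0[quot]"
  and "!!b. b : B ==> P (cl (frag_of b))"
  and "!!X Y. X : car quot ==> Y : car quot ==> P X ==> P Y ==> P (X -[quot] Y)"
 shows "P X"
proof -
 obtain c where c: "supp c <= B" "X = cl c" using assms(1) by (auto simp: quot_simps)
 have "P (cl c)"
 proof (rule free_Abelian_group_induct[OF c(1), of "%c. P (cl c)"])
  fix x y assume "supp x <= B" "supp y <= B" "P (cl x)" "P (cl y)"
  then show "P (cl (x - y))"
   using assms(4)[of "cl x" "cl y"] by (simp add: cl_diff)
 next
  show "P (cl 0)" using assms(2) by (simp add: quot_simps)
 qed (use assms in "auto simp: quot_simps")
 then show ?thesis using c by simp
qed

lemma addmap_eqI: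
 assumes "abelian_group M" "addmap quot M h" "addmap quot M k"
  and "!!b. b : B ==> h (cl (frag_of b)) = k (cl (frag_of b))" "X : car quot"
 shows "h X = k X"
 using assms(5)
proof (induction rule: quot_induct)
 case zero then show ?case using am_zero[OF abelian_group_quot assms(1,2)] am_zero[OF abelian_group_quot assms(1,3)] by simp
next
 case (diff X Y) then show ?case
  by (simp add: am_diff[OF abelian_group_quot assms(1,2)] am_diff[OF abelian_group_quot assms(1,3)])
qed (use assms in auto)

text \<open>By induction on how an element of the subgroup is generated, only the values on the
  defining relations have to be known.\<close>

lemma hom_kills_H:
 assumes G: "group G" and "h : hom FG G" "!!s. s : S ==> h s = 1[G]" "x : H"
 shows "h x = 1[G]"
proof -
 interpret G: group G by fact
 interpret h: group_hom FG G h using assms(2) by unfold_locales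
 show ?thesis using assms(4) unfolding H_def
 proof (induction rule: generate.induct)
  case (inv s) then show ?case using assms(3)[of s] S_carrier h.hom_inv[of s] by auto
 next
  case (eng x y) then show ?case
   using FG.generate_in_carrier[OF S_carrier] by (subst h.hom_mult) (auto simp del: carrier_free_Abelian_group_iff)
 qed (use assms h.hom_one in auto)
qed

lemma cl_eq_iff: "supp c <= B ==> supp d <= B ==> cl c = cl d \<longleftrightarrow> c - d : H"
proof -
 assume cd: "supp c <= B" "supp d <= B"
 have "cl c = cl d \<longleftrightarrow> cl c -[quot] cl d = 0[quot]"
  using cd AG.minus_eq AG.add.inv_solve_right'[of "0[quot]" "cl c" "cl d"] by (auto simp: AG.r_neg a_minus_def)
 also have "... \<longleftrightarrow> c - d : H" proof -
  have "supp (c - d) <= B" using cd keys_diff[of c d] by blast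
  then show ?thesis using cd by (simp add: cl_diff cl_eq_zero_iff)
 qed
 finally show ?thesis .
qed

lemma cl_mem: "supp c <= B ==> d : cl c ==> supp d <= B & cl d = cl c"
 unfolding cl_def using FG.repr_independence[OF _ _ subgroup_H, of d c]
 FG.r_coset_subset_G[OF HN.subset, of c]
 by (auto simp: subset_iff)

lemma cl_self: "supp c <= B ==> c : cl c"
 unfolding cl_def by (rule FG.rcos_self[OF _ subgroup_H]) simp

text \<open>Maps out of the quotient given on representatives, in the union form of \<^const>\<open>quadratic_algebra.kos_map\<close>.\<close>

lemma union_map:
 assumes M: "abelian_group M"
  and h0: "!!c. supp c <= B ==> h c : car M"
  and hadd: "!!c d. supp c <= B ==> supp d <= B ==> h (c + d) = h c +[M] h d"
  and hS: "!!s. s : S ==> h s = 0[M]"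
  and c: "supp c <= B" and d: "d : cl c"
 shows "h d = h c"
proof -
 interpret M: abelian_group M by fact
 have hom: "h : hom FG (add_monoid M)" using h0 hadd by (auto simp: hom_def)
 have k: "supp d <= B" "d - c : H" using cl_mem[OF c d] c cl_eq_iff by auto
 then have kd: "supp (d - c) <= B" using c keys_diff[of d c] by auto
 have "h (d - c) = 0[M]"
  using hom_kills_H[OF M.a_group hom _ k(2)] hS by simp
 then have "h d = 0[M] +[M] h c"
  using hadd[OF kd c] by simp
 then show ?thesis using h0 c by simp
qed

text \<open>The extension of \<open>t\<close> to the free group is obtained only inside the proof.
  The premise on the relations is therefore stated for every additive \<open>h\<close> that
  restricts to \<open>t\<close>; these two properties suffice to compute \<open>h\<close> on a
  relation.\<close>

lemma universal:
 assumes M: "abelian_group M"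
  and t: "!!b. b : B ==> t b : car M"
  and hS: "!!h s. s : S ==> (!!c d. supp c <= B ==> supp d <= B ==> h (c - d) = h c -[M] h d) ==>
    (!!b. b : B ==> h (frag_of b) = t b) ==> h s = 0[M]"
 obtains ph where "addmap quot M ph" "!!b. b : B ==> ph (cl (frag_of b)) = t b"
proof -
 interpret M: abelian_group M by fact
 obtain h where h: "h : hom FG (add_monoid M)" "!!b. b : B ==> h (frag_of b) = t b"
  using comm_group.free_Abelian_group_universal[OF M.a_comm_group, of t B] t by auto
 interpret gh: group_hom FG "add_monoid M" h using h(1) M.a_group by (unfold_locales) (auto simp: group_def)
 have hadd: "h (c + d) = h c +[M] h d" if "supp c <= B" "supp d <= B" for c d
  using gh.hom_mult[of c d] that by simp
 have hcl: "h c : car M" if "supp c <= B" for c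
  using gh.hom_closed[of c] that by simp
 have hneg: "h (- c) = -[M] h c" if "supp c <= B" for c
  using gh.hom_inv[of c] that by (simp add: a_inv_def)
 have hdiff: "h (c - d) = h c -[M] h d" if "supp c <= B" "supp d <= B" for c d
  using hadd[of c "- d"] hneg[of d] that by (simp add: a_minus_def)
 have hs0: "h s = 0[M]" if "s : S" for s using hS[OF that hdiff h(2)] .
 \<comment> \<open>An arbitrary representative is taken; by \<open>union_map\<close> all members of
   a class have the same value.\<close>
 define ph where "ph X = h (SOME c. c : X)" for X
 have ph: "ph (cl c) = h c" if "supp c <= B" for c
  unfolding ph_def
  by (rule union_map[OF M hcl hadd hs0 that]) (use cl_self[OF that] in "auto intro: someI")
 show thesis
 proof (rule that)
  show "addmap quot M ph"
  proof (rule addmapI)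
   fix X Y assume "X : car quot" "Y : car quot"
   then obtain c d where cd: "supp c <= B" "supp d <= B" "X = cl c" "Y = cl d"
    by (auto simp: quot_simps(1))
   have "supp (c + d) <= B" using cd keys_add[of c d] by blast
   then show "ph (X +[quot] Y) = ph X +[M] ph Y" using cd by (simp add: cl_add ph hadd)
  qed (auto simp: quot_simps(1) ph hcl)
  show "ph (cl (frag_of b)) = t b" if "b : B" for b using ph[of "frag_of b"] h(2) that by simp
 qed
qed

end

section \<open>Paths and coefficients\<close>

lemma tens_sum_single: "x = (SUM a:supp x. mon a (coef x a))"
 by (rule poly_mapping_eqI) (auto simp: lookup_sum lookup_single when_def in_keys_iff)

text \<open>Scalar multiplication on tensors, which makes them a vector space in the sense of the
  library, so that a linear retraction onto a subspace is available.\<close>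

definition tsc :: "'f::field => ('a \<Rightarrow>\<^sub>0 'f) => ('a \<Rightarrow>\<^sub>0 'f)" where
 "tsc c x = Poly_Mapping.map ((*) c) x"

lemma lookup_tsc [simp]: "coef (tsc c x) k = c * coef x k"
 by (simp add: tsc_def map.rep_eq when_def)

lemma vector_space_tsc: "vector_space (tsc :: 'f::field => ('a \<Rightarrow>\<^sub>0 'f) => _)"
 by unfold_locales (auto intro!: poly_mapping_eqI simp: lookup_add algebra_simps)

abbreviation psrc :: "('v, 'e) pre_digraph => ('v, 'e) qpath => 'v" where
 "psrc Q a \<equiv> walk_source Q (fst a) (snd a)"

abbreviation pcat :: "('v, 'e) qpath => ('v, 'e) qpath => ('v, 'e) qpath" where
 "pcat a b \<equiv> (fst a, snd a @ snd b)"

abbreviation vsingle :: "'v => 'f => ('v, 'e, 'f::field) tens" where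
 "vsingle v c \<equiv> mon (v, []) c"

text \<open>The product of two basis paths with scalar \<open>c\<close>. It vanishes unless the
  source of \<open>a\<close> is the target of \<open>b\<close>, since the tensor product is over
  k.\<close>

definition tpair :: "('v, 'e) pre_digraph => ('v, 'e) qpath => ('v, 'e) qpath => 'f => ('v, 'e, 'f::field) tens" where
 "tpair Q a b c = (if psrc Q a = fst b then mon (pcat a b) c else 0)"

lemma tpair_add: "tpair Q a b (c + d) = tpair Q a b c + tpair Q a b d"
 by (simp add: tpair_def single_add)

lemma tpair_zero [simp]: "tpair Q a b 0 = 0"
 by (simp add: tpair_def)

lemma walk_source_append [simp]: "walk_source Q v (as @ bs) = walk_source Q (walk_source Q v as) bs"
 by (induction as arbitrary: v) auto

lemma tmult_alt:
 assumes "finite A" "supp x <= A" "finite B" "supp y <= B"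
 shows "tmult Q x y = (SUM a:A. SUM b:B. tpair Q a b (coef x a * coef y b))"
proof -
 have "tmult Q x y = (SUM a:supp x. SUM b:supp y.
   tpair Q a b (coef x a * coef y b))"
  by (auto simp: tmult_def tpair_def split_beta intro!: sum.cong)
 also have "... = (SUM a:A. SUM b:B. tpair Q a b (coef x a * coef y b))"
  using assms by (intro sum.mono_neutral_cong_left) (auto simp: in_keys_iff intro!: sum.mono_neutral_left)
 finally show ?thesis .
qed

lemma tmult_single: "tmult Q (mon a c) (mon b d) = tpair Q a b (c * d)"
 by (subst tmult_alt[of "{a}" _ "{b}"]) auto

lemma tmult_add_left: "tmult Q (x + x') y = tmult Q x y + tmult Q x' y"
proof -
 let ?A = "supp x \<union> supp x'"
 have "supp (x + x') <= ?A" by (rule keys_add)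
 then show ?thesis
  by (simp add: tmult_alt[of ?A _ "supp y"] lookup_add algebra_simps tpair_add sum.distrib)
qed

lemma tmult_add_right: "tmult Q x (y + y') = tmult Q x y + tmult Q x y'"
proof -
 let ?A = "supp y \<union> supp y'"
 have "supp (y + y') <= ?A" by (rule keys_add)
 then show ?thesis
  by (simp add: tmult_alt[of "supp x" _ ?A] lookup_add algebra_simps tpair_add sum.distrib)
qed

lemma tmult_zero [simp]: "tmult Q 0 y = 0" "tmult Q x 0 = 0"
 by (simp_all add: tmult_def)

lemma tmult_sum_left: "tmult Q (SUM i:I. f i) y = (SUM i:I. tmult Q (f i) y)"
 by (induction I rule: infinite_finite_induct) (auto simp: tmult_add_left)

lemma tmult_sum_right: "tmult Q y (SUM i:I. f i) = (SUM i:I. tmult Q y (f i))"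
 by (induction I rule: infinite_finite_induct) (auto simp: tmult_add_right)

text \<open>Both sides are additive in each argument, which reduces the claim to scaled paths, where
  it is associativity of concatenation.\<close>

lemma tmult_assoc: "tmult Q (tmult Q x y) z = tmult Q x (tmult Q y z)"
proof -
 have single: "tmult Q (tmult Q (mon a k) (mon b l)) (mon c m)
   = tmult Q (mon a k) (tmult Q (mon b l) (mon c m))" for a b c k l m
  by (simp add: tmult_single tpair_def mult.assoc)
 have "tmult Q (tmult Q (SUM a:A. mon a (f a)) (SUM b:B. mon b (g b))) (SUM c:C. mon c (h c))
  = tmult Q (SUM a:A. mon a (f a)) (tmult Q (SUM b:B. mon b (g b)) (SUM c:C. mon c (h c)))"
  for A B C f g h
  by (simp add: tmult_sum_left tmult_sum_right single)
 from this[of "coef x" "supp x" "coef y" "supp y" "coef z" "supp z"]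
 show ?thesis by (simp only: tens_sum_single[symmetric])
qed

lemma lookup_tpair:
 "coef (tpair Q a b c) k = (if psrc Q a = fst b & k = pcat a b then c else 0)"
 by (auto simp: tpair_def lookup_single when_def)

text \<open>If the left factor is homogeneous of length \<open>p\<close>, a path can be cut in one
  place only, after its first \<open>p\<close> arrows; a single product of coefficients remains of
  the double sum.\<close>

lemma lookup_tmult:
 assumes "!!a. coef x a \<noteq> 0 ==> length (snd a) = p"
 shows "coef (tmult Q x y) (v, cs) = (if p \<le> length cs then
   coef x (v, take p cs) * coef y (walk_source Q v (take p cs), drop p cs) else 0)"
proof -
 define a0 where "a0 = (v, take p cs)"
 define b0 where "b0 = (walk_source Q v (take p cs), drop p cs)"
 have a: "length (snd a) = p" if "a : supp x" for a using assms[of a] that by (simp add: in_keys_iff)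
 have *: "(psrc Q a = fst b & (v, cs) = pcat a b) = (p \<le> length cs & a = a0 & b = b0)"
  if "a : supp x" for a b
  using a[OF that] by (cases a; cases b) (auto simp: a0_def b0_def, metis append_take_drop_id)
 let ?B = "insert b0 (supp y)"
 have "coef (tmult Q x y) (v, cs) = (SUM a:supp x. SUM b:?B.
   if psrc Q a = fst b & (v, cs) = pcat a b then coef x a * coef y b else 0)"
  by (subst tmult_alt[of "supp x" _ ?B]) (simp_all add: lookup_sum lookup_tpair subset_insertI)
 also have "... = (SUM a:supp x. SUM b:?B.
   if b = b0 then (if p \<le> length cs & a = a0 then coef x a * coef y b else 0) else 0)"
 proof (intro sum.cong refl)
  fix a b assume a: "a : supp x"
  show "(if psrc Q a = fst b & (v, cs) = pcat a b then coef x a * coef y b else 0) =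
   (if b = b0 then (if p \<le> length cs & a = a0 then coef x a * coef y b else 0) else 0)"
   unfolding *[OF a] by simp
 qed
 also have "... = (SUM a:supp x. if a = a0 then (if p \<le> length cs then coef x a * coef y b0 else 0) else 0)"
  by (intro sum.cong refl) (subst sum.delta; simp)
 also have "... = (if p \<le> length cs then coef x a0 * coef y b0 else 0)"
  by (simp add: sum.delta in_keys_iff)
 finally show ?thesis by (simp add: a0_def b0_def)
qed

context quadratic_algebra
begin

abbreviation (input) amult (infixl "**" 70) where "a ** b == a \<otimes>\<^bsub>alg\<^esub> b"

abbreviation T :: "('v, 'e, 'f) tens ring" where "T \<equiv> tensor_algebra Q"

declare add_2_eq_Suc [simp del] add_2_eq_Suc' [simp del]

definition paths :: "nat => ('v, 'e) qpath set" where
 "paths p = {a. walk_ok Q (fst a) (snd a) & length (snd a) = p}"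

lemma walk_ok_vert: "walk_ok Q v as ==> v : verts Q"
 by (cases as) auto

lemma walk_ok_append [simp]: "walk_ok Q v (as @ bs) \<longleftrightarrow> walk_ok Q v as & walk_ok Q (walk_source Q v as) bs"
 by (induction as arbitrary: v) (auto simp: walk_ok_vert)

lemma walk_ok_source: "walk_ok Q v as ==> walk_source Q v as : verts Q"
 by (induction as arbitrary: v) auto

lemma walk_ok_arcs: "walk_ok Q v as ==> set as <= arcs Q"
 by (induction as arbitrary: v) auto

lemma fin_paths [simp]: "finite (paths p)"
proof (rule finite_subset)
 show "paths p <= verts Q \<times> {as. set as <= arcs Q & length as = p}"
  using walk_ok_arcs by (fastforce simp: paths_def walk_ok_vert)
qed (simp add: finite_lists_length_eq)

lemma paths_0: "paths 0 = (%v. (v, [])) ` verts Q"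
 by (auto simp: paths_def)

lemma paths_pcat: "a : paths p ==> b : paths q ==> psrc Q a = fst b ==> pcat a b : paths (p + q)"
 by (auto simp: paths_def)

lemma paths_fst: "a : paths p ==> fst a : verts Q"
 by (auto simp: paths_def walk_ok_vert)

lemma paths_src: "a : paths p ==> psrc Q a : verts Q"
 by (auto simp: paths_def walk_ok_source)

lemma paths_split:
 "(v, cs) : paths (p + q) ==> (v, take p cs) : paths p & (walk_source Q v (take p cs), drop p cs) : paths q"
 using walk_ok_append[of v "take p cs" "drop p cs"] by (auto simp: paths_def simp del: walk_ok_append)

lemma paths_splitE:
 assumes "c : paths (p + q)"
 obtains a b where "a : paths p" "b : paths q" "psrc Q a = fst b" "c = pcat a b"
 using paths_split[of "fst c" "snd c" p q] assms
 by (intro that[of "(fst c, take p (snd c))" "(walk_source Q (fst c) (take p (snd c)), drop p (snd c))"]) auto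

lemma carrier_T: "x : car (tensor_algebra Q) \<longleftrightarrow> (\<forall>a. coef x a \<noteq> 0 --> walk_ok Q (fst a) (snd a))"
 by (auto simp: tensor_algebra_def in_keys_iff)

lemma tpower_iff: "x : tpower Q p \<longleftrightarrow> (\<forall>a. coef x a \<noteq> 0 --> a : paths p)"
 by (auto simp: tpower_def carrier_T paths_def in_keys_iff)

lemma tpower_carrier: "x : tpower Q p ==> x : car T"
 by (simp add: tpower_def)

lemma tpower_zero [simp]: "0 : tpower Q p"
 by (simp add: tpower_iff)

lemma tpower_add: "x : tpower Q p ==> y : tpower Q p ==> x + y : tpower Q p"
 unfolding tpower_iff lookup_add by (metis add.right_neutral)

lemma tpower_neg: "x : tpower Q p ==> - x : tpower Q p"
 by (simp add: tpower_iff)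

lemma tpower_sum: "(!!i. i : I ==> f i : tpower Q p) ==> (SUM i:I. f i) : tpower Q p"
 by (induction I rule: infinite_finite_induct) (auto intro: tpower_add)

lemma tpower_tsc: "x : tpower Q p ==> tsc c x : tpower Q p"
 by (simp add: tpower_iff)

lemma tpower_single: "a : paths p ==> mon a c : tpower Q p"
 by (auto simp: tpower_iff lookup_single when_def)

lemma tp_vsingle: "v : verts Q ==> vsingle v c : tpower Q 0"
 by (rule tpower_single) (simp add: paths_0)

lemma tpower_eqI:
 assumes "x : tpower Q p" "y : tpower Q p" "!!a. a : paths p ==> coef x a = coef y a"
 shows "x = y"
 using assms by (intro poly_mapping_eqI) (metis tpower_iff)

lemma lookup_tmult_tpower:
 assumes "x : tpower Q p"
 shows "coef (tmult Q x y) (v, cs) = (if p \<le> length cs then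
   coef x (v, take p cs) * coef y (walk_source Q v (take p cs), drop p cs) else 0)"
 by (rule lookup_tmult) (use assms in "auto simp: tpower_iff paths_def")

lemma lookup_tmult_pcat:
 assumes "x : tpower Q p" "a : paths p" "psrc Q a = fst b"
 shows "coef (tmult Q x y) (pcat a b) = coef x a * coef y b"
 using assms by (subst lookup_tmult_tpower[OF assms(1)]) (auto simp: paths_def)

lemma tmult_tpower:
 assumes "x : tpower Q p" "y : tpower Q q"
 shows "tmult Q x y : tpower Q (p + q)"
 unfolding tpower_iff
proof (intro allI impI)
 fix c assume "coef (tmult Q x y) c \<noteq> 0"
 then have c: "p \<le> length (snd c)" "coef x (fst c, take p (snd c)) \<noteq> 0"
   "coef y (walk_source Q (fst c) (take p (snd c)), drop p (snd c)) \<noteq> 0"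
  using lookup_tmult_tpower[OF assms(1), of y "fst c" "snd c"] by (auto split: if_splits)
 then have "(fst c, take p (snd c)) : paths p" "(walk_source Q (fst c) (take p (snd c)), drop p (snd c)) : paths q"
  using assms by (auto simp: tpower_iff)
 from paths_pcat[OF this] c(1) show "c : paths (p + q)" by simp
qed

lemma lookup_tmult_l0: "c : tpower Q 0 ==>
 coef (tmult Q c x) a = coef c (fst a, []) * coef x a"
 by (cases a) (simp add: lookup_tmult_tpower)

lemma lookup_tmult_r0:
 assumes "x : tpower Q p" "c : tpower Q 0"
 shows "coef (tmult Q x c) a = coef x a * coef c (psrc Q a, [])"
proof (cases "a : paths p")
 case True
 then show ?thesis using lookup_tmult_pcat[OF assms(1) True, of "(psrc Q a, [])"] by simp
next
 case False
 then have "coef x a = 0" "coef (tmult Q x c) a = 0"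
  using assms tmult_tpower[OF assms] by (metis add.right_neutral tpower_iff)+
 then show ?thesis by simp
qed

lemma tmult_tpower0: "c : tpower Q 0 ==> x : tpower Q p ==> tmult Q c x : tpower Q p"
  "c : tpower Q 0 ==> x : tpower Q p ==> tmult Q x c : tpower Q p"
 using tmult_tpower[of c 0 x p] tmult_tpower[of x p c 0] by auto

definition tconst :: "'f => ('v, 'e, 'f) tens" where
 "tconst c = (SUM v:verts Q. vsingle v c)"

lemma lookup_tconst: "coef (tconst c) (v, as) = (if v : verts Q & as = [] then c else 0)"
proof -
 have "coef (tconst c) (v, as) = (SUM w:verts Q. if w = v then (if as = [] then c else 0) else 0)"
  unfolding tconst_def lookup_sum by (rule sum.cong) (auto simp: lookup_single when_def)
 then show ?thesis by simp
qed

lemma tconst_tpower: "tconst c : tpower Q 0"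
 unfolding tconst_def by (intro tpower_sum tp_vsingle)

lemma tconst_mult_left: "x : car T ==> tmult Q (tconst c) x = tsc c x"
 by (rule poly_mapping_eqI) (simp only: lookup_tmult_l0[OF tconst_tpower] lookup_tconst carrier_T lookup_tsc, metis walk_ok_vert mult_zero_right)

lemma tsc_mult:
 fixes x y :: "('v, 'e, 'f) tens"
 shows "tmult Q (tsc c x) y = tsc c (tmult Q x y)" "tmult Q x (tsc c y) = tsc c (tmult Q x y)"
proof -
 have tp: "tsc c (tpair Q a b k) = tpair Q a b (c * k)" for a b and c k :: 'f
  by (rule poly_mapping_eqI) (simp add: lookup_tpair)
 have add2: "tsc c (SUM i:I. f i) = (SUM i:I. tsc c (f i))" for I c and f :: "('v,'e) qpath => ('v,'e,'f) tens"
  by (rule poly_mapping_eqI) (simp add: lookup_sum sum_distrib_left)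
 have k: "supp (tsc c x) <= supp x" for c and x :: "('v,'e,'f) tens" by (auto simp: in_keys_iff)
 show "tmult Q (tsc c x) y = tsc c (tmult Q x y)"
  using k by (simp add: tmult_alt[of "supp x" _ "supp y"] add2 tp mult.assoc)
 show "tmult Q x (tsc c y) = tsc c (tmult Q x y)"
  using k by (simp add: tmult_alt[of "supp x" _ "supp y"] add2 tp mult.left_commute)
qed

lemma tone_mult: "x : car T ==> tmult Q x (tconst 1) = x"
proof -
 assume x: "x : car T"
 have "tmult Q (mon a k) (tconst 1) = mon a k" if "walk_ok Q (fst a) (snd a)" for a and k :: 'f
 proof -
  have "a : paths (length (snd a))" using that by (simp add: paths_def)
  note a = tpower_single[OF this, of k]
  show ?thesis using walk_ok_source[OF that]
   by (intro poly_mapping_eqI) (auto simp: lookup_tmult_r0[OF a tconst_tpower] lookup_tconst lookup_single when_def)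
 qed
 then have "tmult Q (SUM a:supp x. mon a (coef x a)) (tconst 1)
   = (SUM a:supp x. mon a (coef x a))"
  using x by (simp add: tmult_sum_left carrier_T in_keys_iff)
 then show ?thesis by (simp flip: tens_sum_single)
qed

lemma tconst_tsc: "tconst c = tsc c (tconst 1)"
 by (rule poly_mapping_eqI, rename_tac a, case_tac a) (simp add: lookup_tconst)

lemma tconst_mult_right: "x : car T ==> tmult Q x (tconst c) = tsc c x"
 by (subst tconst_tsc) (simp add: tsc_mult tone_mult)

lemma tsc_one [simp]: "tsc 1 x = x"
 by (rule poly_mapping_eqI) simp

lemma tmult_carrier: "x : car T ==> y : car T ==> tmult Q x y : car T"
proof -
 assume x: "x : car T" and y: "y : car T"
 have "supp (tmult Q x y) <=
   (\<Union>a \<in> supp x. \<Union>b \<in> supp y. supp (tpair Q a b (coef x a * coef y b)))"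
  by (subst tmult_alt[OF _ order_refl _ order_refl]) (auto dest!: keys_sum[THEN subsetD])
 then show ?thesis
  using x y by (force simp: carrier_T in_keys_iff[symmetric] tpair_def subset_iff split: if_splits)
qed

lemma T_simps [simp]: "monoid.mult T = tmult Q" "1[T] = tconst 1" "0[T] = 0" "add T = (+)"
 by (simp_all add: tensor_algebra_def tconst_def)

lemma ring_T: "ring T"
proof (rule ringI)
 show "abelian_group T"
 proof (rule abelian_groupI)
  show "EX y:car T. y +[T] x = 0[T]" if "x : car T" for x
   using that by (intro bexI[of _ "- x"]) (simp_all add: carrier_T)
 next
  show "x +[T] y : car T" if "x : car T" "y : car T" for x y
   using that unfolding carrier_T T_simps lookup_add by (metis add.right_neutral)
 qed (simp_all add: carrier_T algebra_simps)
 have one: "1[T] = tconst 1" by (simp add: tensor_algebra_def tconst_def)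
 show "monoid T"
  by (rule monoidI)
    (simp_all add: one tmult_carrier tpower_carrier[OF tconst_tpower] tmult_assoc tone_mult tconst_mult_left)
qed (simp_all add: tmult_add_left tmult_add_right)

subsection \<open>Left and right coefficients\<close>

text \<open>Write \<open>x\<close> as the sum of x_b \<otimes> b over the paths \<open>b\<close>
  formed by its last arrows. Then \<open>Rt p b x\<close> is the coefficient x_b, a tensor of length
  \<open>p\<close>. In the same way \<open>Lt q a x\<close> is the coefficient to the right of an
  initial path \<open>a\<close>.\<close>

definition Rt :: "nat => ('v, 'e) qpath => ('v, 'e, 'f) tens => ('v, 'e, 'f) tens" where
 "Rt p b x = (SUM a:paths p. mon a (if psrc Q a = fst b then coef x (pcat a b) else 0))"

definition Lt :: "nat => ('v, 'e) qpath => ('v, 'e, 'f) tens => ('v, 'e, 'f) tens" where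
 "Lt q a x = (SUM b:paths q. mon b (if psrc Q a = fst b then coef x (pcat a b) else 0))"

lemma lookup_Rt: "coef (Rt p b x) a = (if a : paths p & psrc Q a = fst b then coef x (pcat a b) else 0)"
 by (auto simp: Rt_def lookup_sum lookup_single when_def)

lemma lookup_Lt: "coef (Lt q a x) b = (if b : paths q & psrc Q a = fst b then coef x (pcat a b) else 0)"
 by (auto simp: Lt_def lookup_sum lookup_single when_def)

lemma Rt_tpower: "Rt p b x : tpower Q p"
 by (auto simp: tpower_iff lookup_Rt)

lemma Lt_tpower: "Lt q a x : tpower Q q"
 by (auto simp: tpower_iff lookup_Lt)

lemma Rt_add: "Rt p b (x + y) = Rt p b x + Rt p b y"
 by (rule poly_mapping_eqI) (simp add: lookup_Rt lookup_add)

lemma Lt_add: "Lt p b (x + y) = Lt p b x + Lt p b y"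
 by (rule poly_mapping_eqI) (simp add: lookup_Lt lookup_add)

lemma Rt_zero [simp]: "Rt p b 0 = 0"
 by (rule poly_mapping_eqI) (simp add: lookup_Rt)

lemma Lt_zero [simp]: "Lt p b 0 = 0"
 by (rule poly_mapping_eqI) (simp add: lookup_Lt)

lemma Rt_tsc: "Rt p b (tsc c x) = tsc c (Rt p b x)"
 by (rule poly_mapping_eqI) (simp add: lookup_Rt)

lemma Lt_tsc: "Lt p b (tsc c x) = tsc c (Lt p b x)"
 by (rule poly_mapping_eqI) (simp add: lookup_Lt)

lemma Rt_tmult_left: "c : tpower Q 0 ==> Rt p b (tmult Q c x) = tmult Q c (Rt p b x)"
 by (rule poly_mapping_eqI) (simp add: lookup_Rt lookup_tmult_l0)

lemma Lt_tmult_right: "c : tpower Q 0 ==> x : tpower Q n ==> Lt p b (tmult Q x c) = tmult Q (Lt p b x) c"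
 by (rule poly_mapping_eqI) (simp add: lookup_Lt lookup_tmult_r0 lookup_tmult_r0[OF Lt_tpower])

text \<open>The coefficient of \<open>b\<close> sees a right factor from k only at the source of
  \<open>b\<close>, where that factor is a scalar.\<close>

lemma Rt_tmult_right: "c : tpower Q 0 ==> x : tpower Q n ==>
 Rt p b (tmult Q x c) = tsc (coef c (psrc Q b, [])) (Rt p b x)"
 by (rule poly_mapping_eqI) (simp add: lookup_Rt lookup_tmult_r0)

lemma Lt_tmult_left: "c : tpower Q 0 ==> Lt p a (tmult Q c x) = tsc (coef c (fst a, [])) (Lt p a x)"
 by (rule poly_mapping_eqI) (simp add: lookup_Lt lookup_tmult_l0)

lemma Rt_Rt: "b : paths m ==> Rt p b (Rt (p + m) c x) = (if psrc Q b = fst c then Rt p (pcat b c) x else 0)"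
 by (rule poly_mapping_eqI) (auto simp: lookup_Rt paths_def)

lemma Lt_Lt: "a' : paths m ==> Lt p a' (Lt (m + p) a x) = (if psrc Q a = fst a' then Lt p (pcat a a') x else 0)"
 by (rule poly_mapping_eqI) (auto simp: lookup_Lt paths_def)

text \<open>Cutting off the front and cutting off the back commute. This identifies the two double
  sums in every later associativity proof.\<close>

lemma Lt_Rt: "a : paths p ==> b : paths q ==> Lt m a (Rt (p + m) b x) = Rt m b (Lt (m + q) a x)"
 by (rule poly_mapping_eqI) (auto simp: lookup_Lt lookup_Rt paths_def)

lemma Rt_tmult:
 assumes "y : tpower Q p" "z : tpower Q q" "b : paths q"
 shows "Rt p b (tmult Q y z) = tmult Q y (vsingle (fst b) (coef z b))"
proof -
 note v = tp_vsingle[OF paths_fst[OF assms(3)], of "coef z b"]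
 show ?thesis
 proof (rule tpower_eqI[OF Rt_tpower tmult_tpower0(2)[OF v assms(1)]])
  fix a assume "a : paths p"
  then show "coef (Rt p b (tmult Q y z)) a = coef (tmult Q y (vsingle (fst b) (coef z b))) a"
   using lookup_tmult_pcat[OF assms(1), of a b z]
   by (auto simp: lookup_Rt lookup_tmult_r0[OF assms(1) v] lookup_single when_def)
 qed
qed

lemma Lt_tmult:
 assumes "y : tpower Q p" "z : tpower Q q" "a : paths p"
 shows "Lt q a (tmult Q y z) = tmult Q (vsingle (psrc Q a) (coef y a)) z"
proof -
 note v = tp_vsingle[OF paths_src[OF assms(3)], of "coef y a"]
 show ?thesis
 proof (rule tpower_eqI[OF Lt_tpower tmult_tpower0(1)[OF v assms(2)]])
  fix b assume "b : paths q"
  then show "coef (Lt q a (tmult Q y z)) b = coef (tmult Q (vsingle (psrc Q a) (coef y a)) z) b"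
   using lookup_tmult_pcat[OF assms(1,3), of b z]
   by (auto simp: lookup_Lt lookup_tmult_l0[OF v] lookup_single when_def)
 qed
qed

section \<open>The spaces W\<close>

text \<open>Multiplication by scaled idempotents on both sides keeps the paths with prescribed end
  points.\<close>

lemma vspan_sandwich:
 assumes "v : verts Q" "w : verts Q" "x : tpower Q n"
 shows "coef (tmult Q (tmult Q (vsingle v c) x) (vsingle w d)) a
   = (if fst a = v & psrc Q a = w then c * coef x a * d else 0)"
 using assms by (auto simp: lookup_tmult_r0[OF tmult_tpower0(1)[OF tp_vsingle assms(3)] tp_vsingle]
   lookup_tmult_l0[OF tp_vsingle] lookup_single when_def)

lemma R_tpower: "x : R ==> x : tpower Q 2"
 using relations_subset by auto

lemma R_sum_list: "(!!i. i : set ys ==> f i : R) ==> (\<Sum>i\<leftarrow>ys. f i) : R"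
 by (induction ys) (auto intro: relations_add relations_zero)

lemma R_tsc: "x : R ==> tsc c x : R"
 using relations_left[OF tconst_tpower, of x c] tconst_mult_left[OF tpower_carrier[OF R_tpower]] by simp

lemma LtRt_VRV:
 assumes "u : tpower Q i" "r : R" "v : tpower Q j" "a : paths i" "b : paths j"
 shows "Lt 2 a (Rt (i + 2) b (tmult Q (tmult Q u r) v))
  = tmult Q (tmult Q (vsingle (psrc Q a) (coef u a)) r) (vsingle (fst b) (coef v b))"
proof -
 have ur: "tmult Q u r : tpower Q (i + 2)" using tmult_tpower[OF assms(1) R_tpower[OF assms(2)]] .
 show ?thesis
  by (simp add: Rt_tmult[OF ur assms(3,5)] Lt_tmult_right[OF tp_vsingle[OF paths_fst[OF assms(5)]] ur]
   Lt_tmult[OF assms(1) R_tpower[OF assms(2)] assms(4)])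
qed

lemma Lt_sum_list: "Lt q a (\<Sum>y\<leftarrow>ys. f y) = (\<Sum>y\<leftarrow>ys. Lt q a (f y))"
 by (induction ys) (auto simp: Lt_add)

lemma Rt_sum_list: "Rt q a (\<Sum>y\<leftarrow>ys. f y) = (\<Sum>y\<leftarrow>ys. Rt q a (f y))"
 by (induction ys) (auto simp: Rt_add)

lemma tpower_sum_list: "(!!i. i : set ys ==> f i : tpower Q p) ==> (\<Sum>i\<leftarrow>ys. f i) : tpower Q p"
 by (induction ys) (auto intro: tpower_add)

text \<open>The first \<open>i\<close> and the last \<open>j\<close> arrows are expanded in the
  basis of paths, and the middle factor is the resulting coefficient.\<close>

lemma tpower_expand:
 assumes "x : tpower Q (i + 2 + j)"
 shows "x = (\<Sum>(a, b)\<in>paths i \<times> paths j.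
   tmult Q (tmult Q (mon a 1) (Lt 2 a (Rt (i + 2) b x))) (mon b 1))" (is "_ = ?y")
proof (rule tpower_eqI[OF assms])
 have t: "tmult Q (tmult Q (mon a 1) (Lt 2 a (Rt (i + 2) b x))) (mon b 1) : tpower Q (i + 2 + j)"
  if "a : paths i" "b : paths j" for a b
  by (intro tmult_tpower tpower_single that Lt_tpower)
 then show "?y : tpower Q (i + 2 + j)" by (auto intro!: tpower_sum)
 fix k assume "k : paths (i + 2 + j)"
 then obtain k1 b where b: "k1 : paths (i + 2)" "b : paths j" "psrc Q k1 = fst b" "k = pcat k1 b"
  by (rule paths_splitE)
 from b(1) obtain a c where a: "a : paths i" "c : paths 2" "psrc Q a = fst c" "k1 = pcat a c"
  by (rule paths_splitE)
 have "coef (tmult Q (tmult Q (mon a' 1) (Lt 2 a' (Rt (i + 2) b' x))) (mon b' 1)) k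
   = (if (a', b') = (a, b) then coef x k else 0)" if "a' : paths i" "b' : paths j" for a' b'
  unfolding b(4)
  apply (subst lookup_tmult_pcat[OF tmult_tpower[OF tpower_single[OF that(1)] Lt_tpower] b(1,3)])
  unfolding a(4)
  apply (subst lookup_tmult_pcat[OF tpower_single[OF that(1)] a(1,3)])
  using a b by (auto simp: lookup_single when_def lookup_Lt lookup_Rt)
 then have "coef ?y k = (SUM ab:paths i \<times> paths j. if ab = (a, b) then coef x k else 0)"
  unfolding lookup_sum by (intro sum.cong refl) (simp only: mem_Times_iff split_beta prod.collapse fst_conv snd_conv)
 also have "... = coef x k" using a b by (simp only: sum.delta finite_SigmaI fin_paths mem_Sigma_iff) simp
 finally show "coef x k = coef ?y k" by simp
qed

text \<open>The outer tensor factors have a basis of paths, so V^i \<otimes> R \<otimes> V^j is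
  recognised by middle coefficients. For a product u r v such a coefficient is r with scaled
  idempotents on both sides, hence in R because R is a k-subbimodule; conversely the expansion in
  paths is a presentation. Membership in an intersection of such spaces thereby becomes a condition
  on coefficients.\<close>

lemma VRV_iff: "x : VRV i j \<longleftrightarrow> x : tpower Q (i + 2 + j) & (ALL a:paths i. ALL b:paths j. Lt 2 a (Rt (i + 2) b x) : R)"
proof (intro iffI conjI ballI)
 assume "x : VRV i j"
 then obtain ts where ts: "x = (\<Sum>(u, r, v) \<leftarrow> ts. tmult Q (tmult Q u r) v)" "set ts <= tpower Q i \<times> R \<times> tpower Q j"
  by (auto simp: VRV_def)
 show "x : tpower Q (i + 2 + j)" unfolding ts(1)
 proof (rule tpower_sum_list)
  fix t assume "t : set ts"
  then obtain u r v where t: "t = (u, r, v)" "u : tpower Q i" "r : R" "v : tpower Q j" using ts(2) by (cases t) auto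
  then show "(case t of (u, r, v) => tmult Q (tmult Q u r) v) : tpower Q (i + 2 + j)"
   by (simp add: tmult_tpower R_tpower)
 qed
 fix a b assume ab: "a : paths i" "b : paths j"
 show "Lt 2 a (Rt (i + 2) b x) : R" unfolding ts(1) Lt_sum_list Rt_sum_list
 proof (rule R_sum_list)
  fix t assume "t : set ts"
  then obtain u r v where t: "t = (u, r, v)" "u : tpower Q i" "r : R" "v : tpower Q j" using ts(2) by (cases t) auto
  then show "Lt 2 a (Rt (i + 2) b (case t of (u, r, v) => tmult Q (tmult Q u r) v)) : R"
   by (simp add: LtRt_VRV[OF t(2-4) ab] relations_left relations_right tp_vsingle paths_fst[OF ab(2)] paths_src[OF ab(1)])
 qed
next
 assume x: "x : tpower Q (i + 2 + j) & (ALL a:paths i. ALL b:paths j. Lt 2 a (Rt (i + 2) b x) : R)"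
 obtain xs where xs: "set xs = paths i \<times> paths j" "distinct xs"
  using finite_distinct_list[of "paths i \<times> paths j"] by auto
 define ts where "ts = map (%(a, b). (mon a 1 :: ('v,'e,'f) tens, Lt 2 a (Rt (i + 2) b x), mon b 1 :: ('v,'e,'f) tens)) xs"
 have "x = (\<Sum>(a, b)\<leftarrow>xs. tmult Q (tmult Q (mon a 1) (Lt 2 a (Rt (i + 2) b x))) (mon b 1))"
  using tpower_expand[of x i j] x xs by (simp add: sum_list_distinct_conv_sum_set)
 then have "x = (\<Sum>(u, r, v) \<leftarrow> ts. tmult Q (tmult Q u r) v)"
  by (simp add: ts_def comp_def split_beta')
 moreover have "set ts <= tpower Q i \<times> R \<times> tpower Q j"
  using x xs by (auto simp: ts_def tpower_single)
 ultimately show "x : VRV i j" by (auto simp: VRV_def)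
qed

lemma VRV_00: "VRV 0 0 = R"
proof (intro equalityI subsetI)
 fix x assume "x : VRV 0 0"
 then obtain ts where ts: "x = (\<Sum>(u, r, v) \<leftarrow> ts. tmult Q (tmult Q u r) v)" "set ts <= tpower Q 0 \<times> R \<times> tpower Q 0"
  by (auto simp: VRV_def)
 show "x : R" unfolding ts(1)
 proof (rule R_sum_list)
  fix t assume "t : set ts"
  then obtain u r v where t: "t = (u, r, v)" "u : tpower Q 0" "r : R" "v : tpower Q 0" using ts(2) by (cases t) auto
  then show "(case t of (u, r, v) => tmult Q (tmult Q u r) v) : R" by (simp add: relations_left relations_right)
 qed
next
 fix x assume x: "x : R"
 then have "x = (\<Sum>(u, r, v) \<leftarrow> [(tconst 1, x, tconst 1)]. tmult Q (tmult Q u r) v)"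
  using tpower_carrier[OF R_tpower[OF x]] by (simp add: tconst_mult_left tone_mult)
 moreover have "set [(tconst 1, x, tconst 1)] <= tpower Q 0 \<times> R \<times> tpower Q 0" using x by (simp add: tconst_tpower)
 ultimately show "x : VRV 0 0" unfolding VRV_def by blast
qed

text \<open>One description for all degrees: for n < 2 the condition is empty, and for n = 2 only i
  = j = 0 occurs and gives R.\<close>

lemma W_iff: "x : W n \<longleftrightarrow> x : tpower Q n & (\<forall>i j. i + 2 + j = n --> (ALL a:paths i. ALL b:paths j. Lt 2 a (Rt (i + 2) b x) : R))"
proof -
 consider "n = 0" | "n = 1" | "n = 2" | "n \<ge> 3" by linarith
 then show ?thesis
 proof cases
  case 3
  have "(\<forall>i j. i + 2 + j = n --> P i j) = P 0 0" for P using 3 by auto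
  with 3 show ?thesis using VRV_iff[of x 0 0] by (simp add: W_def VRV_00)
 next
  case 4
  then have "0 + 2 + (n - 2) = n" by simp
  then obtain i j where "i + 2 + j = n" by blast
  with 4 show ?thesis unfolding W_def by (auto simp: VRV_iff)
 qed (auto simp: W_def)
qed

lemma W_tpower: "x : W n ==> x : tpower Q n"
 by (simp add: W_iff)

lemma W_carrier: "x : W n ==> x : car T"
 by (rule tpower_carrier[OF W_tpower])

lemma W_0: "W 0 = tpower Q 0" and W_1: "W 1 = tpower Q 1" "W (Suc 0) = tpower Q 1" and W_2: "W 2 = R"
 by (simp_all add: W_def)

lemma W_zero [simp]: "0 : W n"
 by (simp add: W_iff relations_zero)

lemma W_add: "x : W n ==> y : W n ==> x + y : W n"
 by (simp add: W_iff tpower_add Rt_add Lt_add relations_add)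

lemma W_sum: "(!!i. i : I ==> f i : W p) ==> (SUM i:I. f i) : W p"
 by (induction I rule: infinite_finite_induct) (auto intro: W_add)

lemma W_tsc: "x : W n ==> tsc c x : W n"
 by (simp add: W_iff tpower_tsc Rt_tsc Lt_tsc R_tsc)

lemma W_left: "c : tpower Q 0 ==> x : W n ==> tmult Q c x : W n"
 by (auto simp: W_iff tmult_tpower0 Rt_tmult_left Lt_tmult_left R_tsc)

lemma W_right: "c : tpower Q 0 ==> x : W n ==> tmult Q x c : W n"
 unfolding W_iff by (auto simp: tmult_tpower0 Rt_tmult_right Lt_tsc R_tsc)

text \<open>A coefficient of a coefficient is the coefficient at the concatenated path, or zero if
  the paths do not compose. So every condition on \<open>Rt p b x\<close> is among the conditions on
  \<open>x\<close>.\<close>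

lemma W_Rt:
 assumes "x : W (p + q)" "b : paths q" shows "Rt p b x : W p"
 unfolding W_iff
proof (intro conjI allI impI ballI)
 fix i j a b' assume ij: "i + 2 + j = p" and ab: "a : paths i" "b' : paths j"
 have "Lt 2 a (Rt (i + 2) b' (Rt p b x)) = (if psrc Q b' = fst b then Lt 2 a (Rt (i + 2) (pcat b' b) x) else 0)"
  using Rt_Rt[OF ab(2), of "i + 2" b x] ij by simp
 then show "Lt 2 a (Rt (i + 2) b' (Rt p b x)) : R"
  using assms paths_pcat[OF ab(2) assms(2)] ab ij relations_zero by (auto simp: W_iff)
qed (rule Rt_tpower)

lemma W_Lt:
 assumes "x : W (p + q)" "a : paths p" shows "Lt q a x : W q"
 unfolding W_iff
proof (intro conjI allI impI ballI)
 fix i j a' b assume ij: "i + 2 + j = q" and ab: "a' : paths i" "b : paths j"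
 have "Lt 2 a' (Rt (i + 2) b (Lt q a x)) = Lt 2 a' (Lt (i + 2) a (Rt (p + (i + 2)) b x))"
  using Lt_Rt[OF assms(2) ab(2), of "i + 2" x] ij by (simp add: add_ac)
 also have "... = (if psrc Q a = fst a' then Lt 2 (pcat a a') (Rt (p + i + 2) b x) else 0)"
  using Lt_Lt[OF ab(1), of 2 a] by (simp add: add_ac)
 finally show "Lt 2 a' (Rt (i + 2) b (Lt q a x)) : R"
  using assms paths_pcat[OF assms(2) ab(1)] ab ij relations_zero by (auto simp: W_iff)
qed (rule Lt_tpower)

end

context quadratic_algebra
begin

section \<open>The quadratic algebra\<close>

lemma ideal_tideal: "ideal tideal T"
 unfolding tideal_def
 by (rule ring.genideal_ideal[OF ring_T]) (use R_tpower tpower_carrier in blast)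

lemma ring_alg: "ring alg"
 unfolding alg_def by (rule ideal.quotient_is_ring[OF ideal_tideal])

sublocale A: ring alg by (rule ring_alg)

lemma proj_hom: "proj : ring_hom T alg"
 using ideal.rcos_ring_hom[OF ideal_tideal] by (simp add: proj_def[abs_def] alg_def)

lemma proj_closed [simp]: "x : car T ==> proj x : car alg"
 using ring_hom_closed[OF proj_hom] .

lemma proj_add: "x : car T ==> y : car T ==> proj (x + y) = proj x +[alg] proj y"
 using ring_hom_add[OF proj_hom, of x y] by simp

lemma proj_mult: "x : car T ==> y : car T ==> proj (tmult Q x y) = proj x ** proj y"
 using ring_hom_mult[OF proj_hom, of x y] by simp

lemma proj_one [simp]: "proj (tconst 1) = 1[alg]"
 using ring_hom_one[OF proj_hom] by simp

lemma proj_zero [simp]: "proj 0 = 0[alg]"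
proof -
 have "proj 0 +[alg] proj 0 = proj 0" using proj_add[of 0 0] by (simp add: carrier_T)
 then show ?thesis using proj_closed[of 0] by (simp add: carrier_T A.add.l_cancel_one)
qed

lemma alg_carrier: "a : car alg ==> EX x:car T. a = proj x"
 by (auto simp: alg_def FactRing_def A_RCOSETS_def' proj_def)

lemma proj_R: "r : R ==> proj r = 0[alg]"
proof -
 assume r: "r : R"
 interpret T: ring T by (rule ring_T)
 have "r : tideal" using T.genideal_self[of R] r R_tpower tpower_carrier by (auto simp: tideal_def)
 then have "tideal +>\<^bsub>T\<^esub> r = tideal"
  using T.a_rcos_zero[OF ideal_tideal] by simp
 then show ?thesis by (simp add: proj_def alg_def FactRing_def)
qed

lemma proj_tpower [simp]: "c : tpower Q p ==> proj c : car alg"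
 by (rule proj_closed[OF tpower_carrier])

lemma scal_tconst: "scal c = proj (tconst c)"
 by (simp add: scal_def tconst_def)

lemma scal_cl [simp]: "scal c : car alg"
 by (simp add: scal_tconst proj_tpower[OF tconst_tpower])

lemma tconst_carrier: "tconst c : car T"
 by (rule tpower_carrier[OF tconst_tpower])

lemma scal_proj: "x : car T ==> scal c ** proj x = proj (tsc c x)"
 by (simp add: scal_tconst proj_mult[symmetric] tconst_carrier tconst_mult_left)

lemma proj_scal: "x : car T ==> proj x ** scal c = proj (tsc c x)"
 by (simp add: scal_tconst proj_mult[symmetric] tconst_carrier tconst_mult_right)

lemma scal_comm: "a : car alg ==> a ** scal c = scal c ** a"
 using alg_carrier[of a] by (auto simp: scal_proj proj_scal)

lemma scal_one [simp]: "scal 1 = 1[alg]"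
 by (simp add: scal_tconst)

lemma scal_mult: "scal c ** scal d = scal (c * d)"
proof -
 have "scal c ** scal d = proj (tsc c (tconst d))"
  using scal_proj[OF tconst_carrier, of c d] by (simp add: scal_tconst)
 moreover have "tsc c (tconst d) = tconst (c * d)" by (rule poly_mapping_eqI, rename_tac a, case_tac a) (simp add: lookup_tconst)
 ultimately show ?thesis by (simp add: scal_tconst)
qed

lemma scal_add: "scal (c + d) = scal c +[alg] scal d"
proof -
 have "tconst (c + d) = tconst c + tconst d" by (rule poly_mapping_eqI, rename_tac a, case_tac a) (simp add: lookup_tconst lookup_add)
 then show ?thesis by (simp add: scal_tconst proj_add tconst_carrier)
qed

lemma scal_zero [simp]: "scal 0 = 0[alg]"
proof -
 have "tconst 0 = 0" by (rule poly_mapping_eqI, rename_tac a, case_tac a) (simp add: lookup_tconst)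
 then show ?thesis by (simp add: scal_tconst)
qed

section \<open>Presentations\<close>

text \<open>\<open>\<rho>\<close> is the restriction to paths of a projection of \<open>k\<close>-bimodules from the tensor power onto \<open>W p\<close>.\<close>

definition is_rho :: "nat => (('v, 'e) qpath => ('v, 'e, 'f) tens) => bool" where
 "is_rho p r \<longleftrightarrow> (ALL b:paths p. r b : W p & (\<forall>c. tmult Q (vsingle (fst b) c) (r b) = tsc c (r b)) &
    (\<forall>c. tmult Q (r b) (vsingle (psrc Q b) c) = tsc c (r b))) &
   (ALL z:W p. z = (SUM b:paths p. tsc (coef z b) (r b)))"

definition rho :: "nat => ('v, 'e) qpath => ('v, 'e, 'f) tens" where
 "rho p = (SOME r. is_rho p r)"

text \<open>Linear algebra gives a retraction onto \<open>W p\<close> that is linear over the field.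
  Cutting its value on a path \<open>b\<close> by the idempotents at the two ends of
  \<open>b\<close> makes it k-bilinear. It remains the identity on \<open>W p\<close> because
  \<open>W p\<close> is stable under these idempotents.\<close>

lemma is_rho: "is_rho p (rho p)"
proof -
 interpret vp: vector_space_pair "tsc :: 'f => ('v,'e,'f) tens => _" "tsc :: 'f => ('v,'e,'f) tens => _"
  by (intro vector_space_pair.intro vector_space_tsc)
 have lin: "Vector_Spaces.linear tsc tsc (\<lambda>x :: ('v,'e,'f) tens. x)"
  by (simp add: Vector_Spaces.linear_iff vector_space_tsc)
 have sub: "vp.vs1.subspace (W p)"
  by (simp add: vp.vs1.subspace_def W_add W_tsc)
 obtain g where g: "range g <= W p" "Vector_Spaces.linear tsc tsc g" "!!x. x : W p ==> g x = x"
  using vp.linear_exists_left_inverse_on[OF lin sub] by auto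
 have gadd: "g (x + y) = g x + g y" and gsc: "g (tsc c x) = tsc c (g x)" for x y c
  using g(2) by (auto simp: Vector_Spaces.linear_iff)
 have g0: "g 0 = 0" using gadd[of 0 0] by simp
 have gsum: "g (SUM i:I. f i) = (SUM i:I. g (f i))" for f :: "('v,'e) qpath => ('v,'e,'f) tens" and I
  by (induction I rule: infinite_finite_induct) (auto simp: gadd g0)
 have gW: "g x : W p" for x using g(1) by auto
 define r where "r b = tmult Q (tmult Q (vsingle (fst b) 1) (g (mon b 1))) (vsingle (psrc Q b) 1)" for b
 note gt = W_tpower[OF gW]
 have lr: "coef (r b) a = (if fst a = fst b & psrc Q a = psrc Q b then coef (g (mon b 1)) a else 0)"
  if "b : paths p" for a b
  unfolding r_def by (subst vspan_sandwich[OF paths_fst[OF that] paths_src[OF that] gt]) (simp only: mult_1_left mult_1_right)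
 have rW: "r b : W p" if "b : paths p" for b
  unfolding r_def by (intro W_right W_left gW tp_vsingle paths_fst[OF that] paths_src[OF that])
 have r1: "tmult Q (vsingle (fst b) c) (r b) = tsc c (r b)" if "b : paths p" for b c
  by (rule poly_mapping_eqI) (simp add: lookup_tmult_l0[OF tp_vsingle[OF paths_fst[OF that]]] lr[OF that] lookup_single)
 have r2: "tmult Q (r b) (vsingle (psrc Q b) c) = tsc c (r b)" if "b : paths p" for b c
  by (rule poly_mapping_eqI) (simp add: lookup_tmult_r0[OF W_tpower[OF rW[OF that]] tp_vsingle[OF paths_src[OF that]]] lr[OF that] lookup_single when_def)
 have "z = (SUM b:paths p. tsc (coef z b) (r b))" if z: "z : W p" for z
 proof (rule tpower_eqI[OF W_tpower[OF z]])
  show "(SUM b:paths p. tsc (coef z b) (r b)) : tpower Q p"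
   by (intro tpower_sum tpower_tsc W_tpower rW)
  fix c assume c: "c : paths p"
  \<comment> \<open>The part of \<open>z\<close> parallel to \<open>c\<close>. Only paths with the
    end points of \<open>c\<close> contribute to the coefficient at \<open>c\<close>, and the
    retraction \<open>g\<close> fixes this part because it lies in \<open>W p\<close>.\<close>
  define zz where "zz = tmult Q (tmult Q (vsingle (fst c) 1) z) (vsingle (psrc Q c) 1)"
  have lz: "coef zz a = (if fst a = fst c & psrc Q a = psrc Q c then coef z a else 0)" for a
   unfolding zz_def by (subst vspan_sandwich[OF paths_fst[OF c] paths_src[OF c] W_tpower[OF z]]) (simp only: mult_1_left mult_1_right)
  have zzW: "zz : W p"
   unfolding zz_def by (intro W_right W_left z tp_vsingle paths_fst[OF c] paths_src[OF c])
  have "zz = (SUM b:paths p. tsc (coef zz b) (mon b 1))"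
  proof (rule tpower_eqI[OF W_tpower[OF zzW]])
   fix a assume "a : paths p"
   moreover have "coef (SUM b:paths p. tsc (coef zz b) (mon b 1)) a =
    (SUM b:paths p. if b = a then coef zz b else 0)"
    unfolding lookup_sum by (rule sum.cong) (auto simp: lookup_single when_def)
   ultimately show "coef zz a = coef (SUM b:paths p. tsc (coef zz b) (mon b 1)) a"
    by simp
  qed (intro tpower_sum tpower_tsc tpower_single)
  then have gz: "g zz = (SUM b:paths p. tsc (coef zz b) (g (mon b 1)))"
   by (metis (no_types, lifting) gsum gsc sum.cong)
  have "coef (g zz) c = (SUM b:paths p. coef zz b * coef (g (mon b 1)) c)"
   by (subst gz) (simp add: lookup_sum)
  then have "coef zz c = (SUM b:paths p. coef zz b * coef (g (mon b 1)) c)"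
   by (simp only: g(3)[OF zzW])
  also have "... = (SUM b:paths p. coef z b * coef (r b) c)"
   by (rule sum.cong) (auto simp: lz lr)
  finally show "coef z c = coef (SUM b:paths p. tsc (coef z b) (r b)) c"
   by (simp add: lz lookup_sum)
 qed
 then have "is_rho p r" using rW r1 r2 by (auto simp: is_rho_def)
 then show ?thesis unfolding rho_def by (rule someI[of "is_rho p"])
qed

lemma rho_W: "b : paths p ==> rho p b : W p"
 and rho_left: "b : paths p ==> tmult Q (vsingle (fst b) c) (rho p b) = tsc c (rho p b)"
 and rho_right: "b : paths p ==> tmult Q (rho p b) (vsingle (psrc Q b) c) = tsc c (rho p b)"
 and rho_sum: "z : W p ==> z = (SUM b:paths p. tsc (coef z b) (rho p b))"
 using is_rho[of p] unfolding is_rho_def by blast+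

text \<open>The scalar coefficients are written as multiples of idempotents, that is, as elements of
  k, so that a balanced map allows them to pass to the other argument.\<close>

lemma rho_sum_left: "z : W p ==> z = (SUM b:paths p. tmult Q (vsingle (fst b) (coef z b)) (rho p b))"
 by (subst rho_sum, assumption) (intro sum.cong refl, simp add: rho_left)

lemma rho_sum_right: "z : W p ==> z = (SUM b:paths p. tmult Q (rho p b) (vsingle (psrc Q b) (coef z b)))"
 by (subst rho_sum, assumption) (intro sum.cong refl, simp add: rho_right)

text \<open>This is the inclusion of W_(p+q) in W_p \<otimes>_k W_q. The left coefficients lie in
  \<open>W p\<close>. Replacing each path \<open>b\<close> by its projection \<open>rho q b\<close>
  does not change \<open>x\<close>, because the right coefficients \<open>Lt q a x\<close> lie in
  \<open>W q\<close> and are fixed by the projection.\<close>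

lemma tsum_tens:
 assumes "x : W (p + q)" shows "x = (SUM b:paths q. tmult Q (Rt p b x) (rho q b))"
proof (rule tpower_eqI[OF W_tpower[OF assms]])
 show "(SUM b:paths q. tmult Q (Rt p b x) (rho q b)) : tpower Q (p + q)"
  by (intro tpower_sum tmult_tpower Rt_tpower W_tpower rho_W)
 fix c assume "c : paths (p + q)"
 then obtain a d where c: "a : paths p" "d : paths q" "psrc Q a = fst d" "c = pcat a d" by (rule paths_splitE)
 have "coef x c = coef (Lt q a x) d" using c by (simp add: lookup_Lt)
 also have "... = (SUM b:paths q. coef (Lt q a x) b * coef (rho q b) d)"
  by (subst rho_sum[OF W_Lt[OF assms c(1)]]) (simp add: lookup_sum)
 also have "... = (SUM b:paths q. coef (tmult Q (Rt p b x) (rho q b)) c)"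
  unfolding c(4) by (intro sum.cong refl, subst lookup_tmult_pcat[OF Rt_tpower c(1,3)]) (use c in "auto simp: lookup_Lt lookup_Rt")
 finally show "coef x c = coef (SUM b:paths q. tmult Q (Rt p b x) (rho q b)) c"
  by (simp add: lookup_sum)
qed

text \<open>The presentation by projections shows that the choice made in \<open>split\<close> is
  from a nonempty set.\<close>

lemma split_spec:
 assumes "x : W (p + q)"
 shows "set (split p q x) <= W p \<times> W q" "x = (\<Sum>(y, z) \<leftarrow> split p q x. tmult Q y z)"
proof -
 obtain bs where bs: "set bs = paths q" "distinct bs" using finite_distinct_list[of "paths q"] by auto
 have "x = (\<Sum>(y, z) \<leftarrow> map (%b. (Rt p b x, rho q b)) bs. tmult Q y z)"
  using tsum_tens[OF assms] bs by (simp add: comp_def sum_list_distinct_conv_sum_set)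
 moreover have "set (map (%b. (Rt p b x, rho q b)) bs) <= W p \<times> W q"
  using bs W_Rt[OF assms] rho_W by auto
 ultimately have "\<exists>ts. set ts <= W p \<times> W q & x = (\<Sum>(y, z) \<leftarrow> ts. tmult Q y z)" by blast
 then have "set (split p q x) <= W p \<times> W q & x = (\<Sum>(y, z) \<leftarrow> split p q x. tmult Q y z)"
  unfolding split_def by (rule someI_ex)
 then show "set (split p q x) <= W p \<times> W q" "x = (\<Sum>(y, z) \<leftarrow> split p q x. tmult Q y z)" by auto
qed

section \<open>Balanced maps and independence of the presentation\<close>

definition balanced :: "nat => nat => ('x, 'm) ring_scheme => (('v, 'e, 'f) tens => ('v, 'e, 'f) tens => 'x) => bool" where
 "balanced p q M h \<longleftrightarrow> (ALL y:W p. ALL z:W q. h y z : car M) &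
   (ALL y:W p. ALL y':W p. ALL z:W q. h (y + y') z = h y z +[M] h y' z) &
   (ALL y:W p. ALL z:W q. ALL z':W q. h y (z + z') = h y z +[M] h y z') &
   (ALL y:W p. ALL z:W q. ALL c:tpower Q 0. h (tmult Q y c) z = h y (tmult Q c z))"

lemma balancedI:
 assumes "!!y z. y : W p ==> z : W q ==> h y z : car M"
  "!!y y' z. y : W p ==> y' : W p ==> z : W q ==> h (y + y') z = h y z +[M] h y' z"
  "!!y z z'. y : W p ==> z : W q ==> z' : W q ==> h y (z + z') = h y z +[M] h y z'"
  "!!y z c. y : W p ==> z : W q ==> c : tpower Q 0 ==> h (tmult Q y c) z = h y (tmult Q c z)"
 shows "balanced p q M h"
 using assms by (simp add: balanced_def)

text \<open>A separate notion of additivity, as \<open>W p\<close> is a set of tensors and not the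
  carrier of a record.\<close>

definition Wadd :: "nat => ('x, 'm) ring_scheme => (('v, 'e, 'f) tens => 'x) => bool" where
 "Wadd p M t \<longleftrightarrow> (ALL x:W p. t x : car M) & (ALL x:W p. ALL y:W p. t (x + y) = t x +[M] t y)"

lemma Wadd_zero:
 assumes "abelian_group M" "Wadd p M t" shows "t 0 = 0[M]"
proof -
 interpret M: abelian_group M by fact
 have "t 0 : car M" "t (0 + 0) = t 0 +[M] t 0" using assms(2) W_zero unfolding Wadd_def by blast+
 then show ?thesis by (simp add: M.add.l_cancel_one)
qed

lemma Wadd_sum:
 assumes "abelian_group M" "Wadd p M t" "finite I" "!!i. i : I ==> f i : W p"
 shows "t (SUM i:I. f i) = finsum M (%i. t (f i)) I"
proof -
 interpret M: abelian_group M by fact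
 show ?thesis using assms(3,4)
 proof (induction rule: finite_induct)
  case (insert i I)
  then have "t (SUM i:insert i I. f i) = t (f i) +[M] t (SUM i:I. f i)"
   using assms(2) W_sum[of I f p] by (simp add: Wadd_def)
  also have "... = finsum M (%i. t (f i)) (insert i I)"
   using insert assms(2) by (subst M.finsum_insert) (auto simp: Wadd_def)
  finally show ?case .
 qed (use Wadd_zero[OF assms(1,2)] in simp)
qed

text \<open>The value depends only on the product \<open>tmult Q y z\<close>: expand
  \<open>z\<close> by the projections and move the idempotent coefficients to the left factor, where
  they produce the coefficients of the product.\<close>

lemma balanced_tmult_right:
 assumes "abelian_group M" "balanced p q M h" "y : W p" "z : W q"
 shows "h y z = finsum M (%b. h (Rt p b (tmult Q y z)) (rho q b)) (paths q)"
proof -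
 interpret M: abelian_group M by fact
 have "Wadd q M (h y)" using assms(2,3) by (auto simp: balanced_def Wadd_def)
 from Wadd_sum[OF assms(1) this fin_paths, of q "%b. tmult Q (vsingle (fst b) (coef z b)) (rho q b)"]
 have "h y (SUM b:paths q. tmult Q (vsingle (fst b) (coef z b)) (rho q b)) =
  finsum M (%b. h y (tmult Q (vsingle (fst b) (coef z b)) (rho q b))) (paths q)"
  by (simp add: W_left tp_vsingle paths_fst rho_W)
 also have "... = finsum M (%b. h (Rt p b (tmult Q y z)) (rho q b)) (paths q)"
 proof (rule M.finsum_cong')
  fix b assume b: "b : paths q"
  note v = tp_vsingle[OF paths_fst[OF b], of "coef z b"]
  show "h y (tmult Q (vsingle (fst b) (coef z b)) (rho q b)) = h (Rt p b (tmult Q y z)) (rho q b)"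
   using assms(2-4) rho_W[OF b] v Rt_tmult[OF W_tpower[OF assms(3)] W_tpower[OF assms(4)] b] unfolding balanced_def by metis
 next
  show "(%b. h (Rt p b (tmult Q y z)) (rho q b)) : paths q \<rightarrow> car M"
   using assms(2-4) rho_W unfolding balanced_def
   by (intro Pi_I) (simp add: Rt_tmult[OF W_tpower[OF assms(3)] W_tpower[OF assms(4)]] W_right W_left tp_vsingle paths_fst)
 qed simp
 finally show ?thesis using rho_sum_left[OF assms(4)] by simp
qed

lemma balanced_tmult_left:
 assumes "abelian_group M" "balanced p q M h" "y : W p" "z : W q"
 shows "h y z = finsum M (%a. h (rho p a) (Lt q a (tmult Q y z))) (paths p)"
proof -
 interpret M: abelian_group M by fact
 have "Wadd p M (%y. h y z)" using assms(2,4) by (auto simp: balanced_def Wadd_def)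
 from Wadd_sum[OF assms(1) this fin_paths, of p "%b. tmult Q (rho p b) (vsingle (psrc Q b) (coef y b))"]
 have "h (SUM b:paths p. tmult Q (rho p b) (vsingle (psrc Q b) (coef y b))) z =
  finsum M (%b. h (tmult Q (rho p b) (vsingle (psrc Q b) (coef y b))) z) (paths p)"
  by (simp add: W_right tp_vsingle paths_src rho_W)
 also have "... = finsum M (%b. h (rho p b) (Lt q b (tmult Q y z))) (paths p)"
 proof (rule M.finsum_cong')
  fix b assume b: "b : paths p"
  note v = tp_vsingle[OF paths_src[OF b], of "coef y b"]
  show "h (tmult Q (rho p b) (vsingle (psrc Q b) (coef y b))) z = h (rho p b) (Lt q b (tmult Q y z))"
   using assms(2-4) rho_W[OF b] v Lt_tmult[OF W_tpower[OF assms(3)] W_tpower[OF assms(4)] b] unfolding balanced_def by metis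
 next
  show "(%b. h (rho p b) (Lt q b (tmult Q y z))) : paths p \<rightarrow> car M"
   using assms(2-4) rho_W unfolding balanced_def
   by (intro Pi_I) (simp add: Lt_tmult[OF W_tpower[OF assms(3)] W_tpower[OF assms(4)]] W_left W_right tp_vsingle paths_src)
 qed simp
 finally show ?thesis using rho_sum_right[OF assms(3)] by simp
qed

text \<open>A summand \<open>tmult Q y z\<close> of a presentation need not lie in
  \<open>W (p + q)\<close>. This weaker condition holds for every summand and passes to sums, so
  values can be accumulated term by term.\<close>

definition coefs_ok :: "nat => nat => ('v, 'e, 'f) tens => bool" where
 "coefs_ok p q x \<longleftrightarrow> (ALL b:paths q. Rt p b x : W p) & (ALL a:paths p. Lt q a x : W q)"

lemma coefs_ok_W: "x : W (p + q) ==> coefs_ok p q x"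
 by (simp add: coefs_ok_def W_Rt W_Lt)

lemma coefs_ok_tmult: "y : W p ==> z : W q ==> coefs_ok p q (tmult Q y z)"
 by (simp add: coefs_ok_def Rt_tmult[OF W_tpower W_tpower] Lt_tmult[OF W_tpower W_tpower] W_left W_right tp_vsingle paths_src paths_fst)

lemma coefs_ok_add: "coefs_ok p q x ==> coefs_ok p q y ==> coefs_ok p q (x + y)"
 by (simp add: coefs_ok_def Rt_add Lt_add W_add)

text \<open>The value of a balanced map on a canonical presentation of \<open>x\<close>, with the
  projections as right factors; in \<open>tsumL\<close> they are the left factors. In the first form
  left multiplication by k can be followed, in the second right multiplication.\<close>

definition tsumR :: "nat => nat => ('x, 'm) ring_scheme => (('v, 'e, 'f) tens => ('v, 'e, 'f) tens => 'x) => ('v, 'e, 'f) tens => 'x" where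
 "tsumR p q M h x = finsum M (%b. h (Rt p b x) (rho q b)) (paths q)"

definition tsumL :: "nat => nat => ('x, 'm) ring_scheme => (('v, 'e, 'f) tens => ('v, 'e, 'f) tens => 'x) => ('v, 'e, 'f) tens => 'x" where
 "tsumL p q M h x = finsum M (%a. h (rho p a) (Lt q a x)) (paths p)"

lemma tsumR_add:
 assumes "abelian_group M" "balanced p q M h" "coefs_ok p q x" "coefs_ok p q y"
 shows "tsumR p q M h (x + y) = tsumR p q M h x +[M] tsumR p q M h y"
proof -
 interpret M: abelian_group M by fact
 have "tsumR p q M h (x + y) = finsum M (%b. h (Rt p b x) (rho q b) +[M] h (Rt p b y) (rho q b)) (paths q)"
  unfolding tsumR_def Rt_add
  using assms(2-4) rho_W by (intro M.finsum_cong') (auto simp: balanced_def coefs_ok_def)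
 also have "... = tsumR p q M h x +[M] tsumR p q M h y"
  unfolding tsumR_def using assms(2-4) rho_W by (intro M.finsum_addf) (auto simp: balanced_def coefs_ok_def)
 finally show ?thesis .
qed

lemma tsumL_add:
 assumes "abelian_group M" "balanced p q M h" "coefs_ok p q x" "coefs_ok p q y"
 shows "tsumL p q M h (x + y) = tsumL p q M h x +[M] tsumL p q M h y"
proof -
 interpret M: abelian_group M by fact
 have "tsumL p q M h (x + y) = finsum M (%b. h (rho p b) (Lt q b x) +[M] h (rho p b) (Lt q b y)) (paths p)"
  unfolding tsumL_def Lt_add
  using assms(2-4) rho_W by (intro M.finsum_cong') (auto simp: balanced_def coefs_ok_def)
 also have "... = tsumL p q M h x +[M] tsumL p q M h y"
  unfolding tsumL_def using assms(2-4) rho_W by (intro M.finsum_addf) (auto simp: balanced_def coefs_ok_def)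
 finally show ?thesis .
qed

lemma tsum_closed:
 assumes "abelian_group M" "balanced p q M h" "coefs_ok p q x"
 shows "tsumR p q M h x : car M" "tsumL p q M h x : car M"
proof -
 interpret M: abelian_group M by fact
 show "tsumR p q M h x : car M" "tsumL p q M h x : car M"
  unfolding tsumR_def tsumL_def using assms(2-3) rho_W by (auto simp: balanced_def coefs_ok_def intro!: M.finsum_closed)
qed

text \<open>Both canonical values are additive and agree with \<open>h\<close> on a single product,
  so induction on the list gives the same value for every presentation. This is why the arbitrary
  choice in \<open>split\<close> is harmless.\<close>

lemma presentation:
 assumes M: "abelian_group M" and h: "balanced p q M h"
  and "set ts <= W p \<times> W q"
 shows "finsum M (%i. case ts ! i of (y, z) => h y z) {..<length ts} = tsumR p q M h (\<Sum>(y, z) \<leftarrow> ts. tmult Q y z)"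
  (is "?S ts = ?R ts")
  and "finsum M (%i. case ts ! i of (y, z) => h y z) {..<length ts} = tsumL p q M h (\<Sum>(y, z) \<leftarrow> ts. tmult Q y z)"
  (is "_ = ?L ts")
proof -
 interpret M: abelian_group M by fact
 have "?S ts = ?R ts & ?S ts = ?L ts & coefs_ok p q (\<Sum>(y, z) \<leftarrow> ts. tmult Q y z)" using assms(3)
 proof (induction ts rule: rev_induct)
  case Nil
  have "tsumR p q M h 0 +[M] tsumR p q M h 0 = tsumR p q M h 0" "tsumL p q M h 0 +[M] tsumL p q M h 0 = tsumL p q M h 0"
   using tsumR_add[OF M h, of 0 0] tsumL_add[OF M h, of 0 0] by (simp_all add: coefs_ok_def)
  moreover have ok: "coefs_ok p q 0" by (simp add: coefs_ok_def)
  ultimately show ?case using tsum_closed[OF M h ok] by (simp add: M.add.l_cancel_one)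
 next
  case (snoc t ts)
  obtain y z where t: "t = (y, z)" "y : W p" "z : W q" using snoc.prems by (cases t) auto
  have "?S (ts @ [t]) = ?S ts +[M] h y z"
   using M.finsum_snoc[of ts "%(y, z). h y z" t] snoc.prems h t by (auto simp: balanced_def)
  moreover have "h y z = tsumR p q M h (tmult Q y z)" "h y z = tsumL p q M h (tmult Q y z)"
   unfolding tsumR_def tsumL_def using balanced_tmult_right[OF M h t(2,3)] balanced_tmult_left[OF M h t(2,3)] .
  moreover have "tsumL p q M h (\<Sum>(y, z) \<leftarrow> ts. tmult Q y z) = tsumR p q M h (\<Sum>(y, z) \<leftarrow> ts. tmult Q y z)"
   using snoc.IH snoc.prems by (metis (no_types, lifting) le_sup_iff set_append)
  ultimately show ?case
   using snoc t coefs_ok_tmult[OF t(2,3)] by (simp add: tsumR_add[OF M h] tsumL_add[OF M h] coefs_ok_add)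
 qed
 then show "?S ts = ?R ts" "?S ts = ?L ts" by auto
qed

lemma split_presentation:
 assumes "abelian_group M" "balanced p q M h" "x : W (p + q)"
 shows "finsum M (%i. case split p q x ! i of (y, z) => h y z) {..<length (split p q x)} = tsumR p q M h x"
  "finsum M (%i. case split p q x ! i of (y, z) => h y z) {..<length (split p q x)} = tsumL p q M h x"
 using presentation[OF assms(1,2) split_spec(1)[OF assms(3)]] split_spec(2)[OF assms(3)] by auto

lemma tsum_RL:
 assumes "abelian_group M" "balanced p q M h" "x : W (p + q)"
 shows "tsumR p q M h x = tsumL p q M h x"
 using split_presentation[OF assms] by simp

lemma tsum_tmult:
 assumes "abelian_group M" "balanced p q M h" "y : W p" "z : W q"
 shows "tsumR p q M h (tmult Q y z) = h y z" "tsumL p q M h (tmult Q y z) = h y z"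
 unfolding tsumR_def tsumL_def
 using balanced_tmult_right[OF assms] balanced_tmult_left[OF assms] by auto

end

section \<open>The Koszul cochain algebra\<close>

context quadratic_algebra
begin

declare One_nat_def [simp del]

lemma cochainsI:
 assumes "f : extensional (W p)" "Wadd p alg f"
  "!!x c. x : W p ==> c : tpower Q 0 ==> f (tmult Q c x) = proj c ** f x"
  "!!x c. x : W p ==> c : tpower Q 0 ==> f (tmult Q x c) = f x ** proj c"
 shows "f : cochains p"
 using assms unfolding cochains_def Wadd_def by (auto simp: W_left)

lemma cochain_ext: "f : cochains p ==> f : extensional (W p)"
 and cochain_cl: "f : cochains p ==> x : W p ==> f x : car alg"
 and cochain_add: "f : cochains p ==> x : W p ==> y : W p ==> f (x + y) = f x +[alg] f y"
 by (auto simp: cochains_def)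

lemma cochain_left:
 assumes "f : cochains p" "x : W p" "c : tpower Q 0"
 shows "f (tmult Q c x) = proj c ** f x"
proof -
 have "f (tmult Q (tmult Q c x) (tconst 1)) = proj c ** f x ** proj (tconst 1)"
  using assms tconst_tpower unfolding cochains_def by blast
 then show ?thesis using assms by (simp add: tone_mult W_carrier[OF W_left] cochain_cl)
qed

lemma cochain_right:
 assumes "f : cochains p" "x : W p" "c : tpower Q 0"
 shows "f (tmult Q x c) = f x ** proj c"
proof -
 have "f (tmult Q (tmult Q (tconst 1) x) c) = proj (tconst 1) ** f x ** proj c"
  using assms tconst_tpower unfolding cochains_def by blast
 then show ?thesis using assms by (simp add: tconst_mult_left W_carrier cochain_cl)
qed

lemma cochain_eqI: "f : cochains p ==> g : cochains p ==> (!!x. x : W p ==> f x = g x) ==> f = g"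
 by (rule extensionalityI) (auto intro: cochain_ext)

definition cgrp :: "nat => ('v, 'e, 'f) koszul_cochain ring" where
 "cgrp p = \<lparr>carrier = cochains p, monoid.mult = (%_ _. undefined), one = undefined,
   ring.zero = (\<lambda>x\<in>W p. 0[alg]), add = cochain_add p\<rparr>"

lemma cgrp_simps [simp]: "car (cgrp p) = cochains p" "0[cgrp p] = (\<lambda>x\<in>W p. 0[alg])" "add (cgrp p) = cochain_add p"
 by (simp_all add: cgrp_def)

lemma cochain_add_closed: "f : cochains p ==> g : cochains p ==> cochain_add p f g : cochains p"
 by (rule cochainsI) (auto simp: cochain_add_def Wadd_def W_add W_left W_right cochain_cl cochain_add
   cochain_left cochain_right A.r_distr A.l_distr A.a_ac)

lemma cochain_zero_closed: "(\<lambda>x\<in>W p. 0[alg]) : cochains p"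
 by (rule cochainsI) (auto simp: Wadd_def W_add W_left W_right)

lemma cochain_neg_closed: "f : cochains p ==> (\<lambda>x\<in>W p. -[alg] f x) : cochains p"
 by (rule cochainsI) (auto simp: Wadd_def W_add W_left W_right cochain_cl cochain_add
   cochain_left cochain_right A.minus_add A.l_minus A.r_minus)

lemma cochain_scale_closed: "f : cochains p ==> cochain_scale p c f : cochains p"
 by (rule cochainsI) (auto simp: cochain_scale_def Wadd_def W_add W_left W_right cochain_cl cochain_add
   cochain_left cochain_right A.r_distr A.m_assoc[symmetric] scal_comm)

lemma cochain_one_closed: "cochain_one : cochains 0"
 by (rule cochainsI) (auto simp: cochain_one_def Wadd_def W_add W_left W_right proj_add proj_mult W_carrier tpower_carrier)

lemma ab_cgrp: "abelian_group (cgrp p)"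
proof (rule abelian_groupI)
 fix f assume f: "f : car (cgrp p)"
 show "EX g:car (cgrp p). g +[cgrp p] f = 0[cgrp p]"
  by (rule bexI[of _ "\<lambda>x\<in>W p. -[alg] f x"])
    (use f in "simp_all add: cochain_add_def cochain_neg_closed cochain_cl A.l_neg cong: restrict_cong")
 show "0[cgrp p] +[cgrp p] f = f"
  using f cochain_ext[of f p] by (auto simp: cochain_add_def cochain_cl extensional_def fun_eq_iff)
next
 fix f g h assume fg: "f : car (cgrp p)" "g : car (cgrp p)"
 show "f +[cgrp p] g : car (cgrp p)" using fg by (simp add: cochain_add_closed)
 show "f +[cgrp p] g = g +[cgrp p] f" using fg by (auto simp: cochain_add_def cochain_cl A.a_comm intro!: rext)
 assume "h : car (cgrp p)"
 then show "f +[cgrp p] g +[cgrp p] h = f +[cgrp p] (g +[cgrp p] h)"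
  using fg by (auto simp: cochain_add_def cochain_cl A.a_assoc intro!: rext)
qed (simp add: cochain_zero_closed)

sublocale C: abelian_group "cgrp p" for p by (rule ab_cgrp)

lemma cgrp_eval: "x : W p ==> addmap (cgrp p) alg (%f. f x)"
 by (rule addmapI) (auto simp: cochain_cl cochain_add_def)

lemma cgrp_eval_simps:
 assumes "f : cochains p" "g : cochains p" "x : W p"
 shows "(f +[cgrp p] g) x = f x +[alg] g x" "(f -[cgrp p] g) x = f x -[alg] g x"
  "(-[cgrp p] f) x = -[alg] f x" "(signed (cgrp p) n f) x = signed alg n (f x)"
 using assms addmap_neg[OF ab_cgrp A.ab_ax cgrp_eval[OF assms(3)], of f]
  am_diff[OF ab_cgrp A.ab_ax cgrp_eval[OF assms(3)], of f g]
  am_signed[OF ab_cgrp A.ab_ax cgrp_eval[OF assms(3)], of f n]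
 by (simp_all add: cochain_add_def)

lemma balanced_cup:
 assumes "f : cochains p" "g : cochains q"
 shows "balanced p q alg (%y z. f y ** g z)"
 by (rule balancedI) (use assms in "simp_all add: cochain_cl cochain_add A.l_distr A.r_distr cochain_left cochain_right A.m_assoc")

lemma cup_split:
 assumes "f : cochains p" "g : cochains q" "x : W (p + q)"
 shows "split_sum p q (%y z. f y ** g z) x = tsumR p q alg (%y z. f y ** g z) x"
  "split_sum p q (%y z. f y ** g z) x = tsumL p q alg (%y z. f y ** g z) x"
 unfolding split_sum_def using split_presentation[OF A.ab_ax balanced_cup[OF assms(1,2)] assms(3)] by auto

lemma cup_R:
 assumes "f : cochains p" "g : cochains q" "x : W (p + q)"
 shows "cup p q f g x = signed alg (int (p * q)) (tsumR p q alg (%y z. f y ** g z) x)"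
 using assms by (simp add: cup_def cup_split(1))

lemma cup_L:
 assumes "f : cochains p" "g : cochains q" "x : W (p + q)"
 shows "cup p q f g x = signed alg (int (p * q)) (tsumL p q alg (%y z. f y ** g z) x)"
 using assms by (simp add: cup_def cup_split(2))

lemma tsumR_mult_left:
 assumes "f : cochains p" "g : cochains q" "x : W (p + q)" "c : tpower Q 0"
 shows "tsumR p q alg (%y z. f y ** g z) (tmult Q c x) = proj c ** tsumR p q alg (%y z. f y ** g z) x"
proof -
 have cl: "f (Rt p b x) ** g (rho q b) : car alg" if "b : paths q" for b
  using that assms W_Rt[OF assms(3)] rho_W by (simp add: cochain_cl)
 show ?thesis unfolding tsumR_def
  by (subst A.finsum_rdistr)
   (use assms cl W_Rt[OF assms(3)] rho_W in "simp_all add: Rt_tmult_left cochain_left cochain_cl A.m_assoc Pi_iff cong: A.finsum_cong")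
qed

lemma tsumL_mult_right:
 assumes "f : cochains p" "g : cochains q" "x : W (p + q)" "c : tpower Q 0"
 shows "tsumL p q alg (%y z. f y ** g z) (tmult Q x c) = tsumL p q alg (%y z. f y ** g z) x ** proj c"
proof -
 have cl: "f (rho p b) ** g (Lt q b x) : car alg" if "b : paths p" for b
  using that assms W_Lt[OF assms(3)] rho_W by (simp add: cochain_cl)
 show ?thesis unfolding tsumL_def
  by (subst A.finsum_ldistr)
   (use assms cl W_Lt[OF assms(3)] rho_W in "simp_all add: Lt_tmult_right[OF _ W_tpower[OF assms(3)]] cochain_right cochain_cl A.m_assoc Pi_iff cong: A.finsum_cong")
qed

lemma signed_mult:
 assumes "a : car alg" "b : car alg"
 shows "signed alg n a ** b = signed alg n (a ** b)" "a ** signed alg n b = signed alg n (a ** b)"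
 using assms by (simp_all add: signed_def A.l_minus A.r_minus)

text \<open>Left linearity over k is read off from the form \<open>tsumR\<close>, right linearity
  from the form \<open>tsumL\<close>.\<close>

lemma cup_cl:
 assumes "f : cochains p" "g : cochains q"
 shows "cup p q f g : cochains (p + q)"
proof (rule cochainsI)
 show "cup p q f g : extensional (W (p + q))" by (simp add: cup_def)
 note b = balanced_cup[OF assms]
 have cl: "tsumR p q alg (%y z. f y ** g z) x : car alg"
   "tsumL p q alg (%y z. f y ** g z) x : car alg" if "x : W (p + q)" for x
  using tsum_closed[OF A.ab_ax b coefs_ok_W[OF that]] by auto
 show "Wadd (p + q) alg (cup p q f g)"
  by (simp add: Wadd_def cup_R[OF assms] cl W_add tsumR_add[OF A.ab_ax b] coefs_ok_W A.signed_add)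
 fix x and c :: "('v, 'e, 'f) tens" assume x: "x : W (p + q)" and c: "c : tpower Q 0"
 show "cup p q f g (tmult Q c x) = proj c ** cup p q f g x"
  using assms x c by (simp add: cup_R W_left tsumR_mult_left signed_mult cl)
 show "cup p q f g (tmult Q x c) = cup p q f g x ** proj c"
  using assms x c by (simp add: cup_L W_right tsumL_mult_right signed_mult cl)
qed

lemma cup_tmult:
 assumes "f : cochains p" "g : cochains q" "y : W p" "z : W q" "tmult Q y z : W (p + q)"
 shows "cup p q f g (tmult Q y z) = signed alg (int (p * q)) (f y ** g z)"
 using cup_R[OF assms(1,2,5)] tsum_tmult[OF A.ab_ax balanced_cup[OF assms(1,2)] assms(3,4)] by simp

lemma cup_one_left: "f : cochains p ==> cup 0 p cochain_one f = f"
proof (rule extensionalityI[of _ "W p"])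
 assume f: "f : cochains p"
 fix x assume x: "x : W p"
 have t: "tmult Q (tconst 1) x = x" using x by (simp add: tconst_mult_left W_carrier)
 then show "cup 0 p cochain_one f x = f x"
  using cup_tmult[OF cochain_one_closed f, of "tconst 1" x] x f
  by (simp add: W_0 tconst_tpower cochain_one_def cochain_cl signed_def)
qed (use cochain_ext in "auto simp: cup_def")

lemma cup_one_right: "f : cochains p ==> cup p 0 f cochain_one = f"
proof (rule extensionalityI[of _ "W p"])
 assume f: "f : cochains p"
 fix x assume x: "x : W p"
 have t: "tmult Q x (tconst 1) = x" using x by (simp add: tone_mult W_carrier)
 then show "cup p 0 f cochain_one x = f x"
  using cup_tmult[OF f cochain_one_closed, of x "tconst 1"] x f
  by (simp add: W_0 tconst_tpower cochain_one_def cochain_cl signed_def)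
qed (use cochain_ext in "auto simp: cup_def")

text \<open>Evaluate the outer product at the coefficients: both sides become the same double sum.\<close>

lemma cup_assoc:
 assumes f: "f : cochains p" and g: "g : cochains q" and h: "h : cochains r"
 shows "cup (p + q) r (cup p q f g) h = cup p (q + r) f (cup q r g h)"
proof (rule extensionalityI[of _ "W (p + q + r)"])
 fix x assume x: "x : W (p + q + r)"
 then have x': "x : W (p + (q + r))" by (simp add: add.assoc)
 define s where "s = int (p * q + p * r + q * r)"
 let ?F = "%a b. f (rho p a) ** g (Rt q b (Lt (q + r) a x)) ** h (rho r b)"
 have LR: "Lt q a (Rt (p + q) b x) = Rt q b (Lt (q + r) a x)" if "a : paths p" "b : paths r" for a b
  using Lt_Rt[OF that] .
 have W1: "Lt (q + r) a x : W (q + r)" if "a : paths p" for a using W_Lt[OF x' that] .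
 have W2: "Rt (p + q) b x : W (p + q)" if "b : paths r" for b using W_Rt[OF x that] .
 have Fc: "?F a b : car alg" "g (Rt q b (Lt (q + r) a x)) : car alg" if "a : paths p" "b : paths r" for a b
  using that f g h rho_W W_Rt[OF W1] by (auto simp: cochain_cl)
 have "cup (p + q) r (cup p q f g) h x = signed alg (int ((p + q) * r))
   (finsum alg (%b. cup p q f g (Rt (p + q) b x) ** h (rho r b)) (paths r))"
  using cup_R[OF cup_cl[OF f g] h x] by (simp add: tsumR_def)
 also have "finsum alg (%b. cup p q f g (Rt (p + q) b x) ** h (rho r b)) (paths r)
   = finsum alg (%b. signed alg (int (p * q)) (finsum alg (%a. ?F a b) (paths p))) (paths r)"
 proof (rule A.finsum_cong')
  fix b assume b: "b : paths r"
  have "cup p q f g (Rt (p + q) b x) = signed alg (int (p * q)) (finsum alg (%a. f (rho p a) ** g (Lt q a (Rt (p + q) b x))) (paths p))"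
   using cup_L[OF f g W2[OF b]] by (simp add: tsumL_def)
  also have "finsum alg (%a. f (rho p a) ** g (Lt q a (Rt (p + q) b x))) (paths p)
   = finsum alg (%a. f (rho p a) ** g (Rt q b (Lt (q + r) a x))) (paths p)"
   using b f rho_W Fc(2) by (intro A.finsum_cong') (auto simp: LR cochain_cl)
  finally show "cup p q f g (Rt (p + q) b x) ** h (rho r b) = signed alg (int (p * q)) (finsum alg (%a. ?F a b) (paths p))"
   using b f h rho_W Fc(2)
   by (simp add: signed_mult A.finsum_ldistr cochain_cl Pi_iff)
 qed (use Fc in "auto intro!: A.finsum_closed")
 also have "... = signed alg (int (p * q)) (finsum alg (%b. finsum alg (%a. ?F a b) (paths p)) (paths r))"
  using Fc by (subst A.signed_finsum) (auto intro!: A.finsum_closed)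
 also have "signed alg (int ((p + q) * r)) ... = signed alg s (finsum alg (%b. finsum alg (%a. ?F a b) (paths p)) (paths r))"
  using Fc by (subst A.signed_signed) (auto simp: s_def algebra_simps intro!: A.finsum_closed)
 also have "finsum alg (%b. finsum alg (%a. ?F a b) (paths p)) (paths r) = finsum alg (%a. finsum alg (%b. ?F a b) (paths r)) (paths p)"
  using Fc by (intro A.finsum_swap) auto
 finally have 1: "cup (p + q) r (cup p q f g) h x = signed alg s (finsum alg (%a. finsum alg (%b. ?F a b) (paths r)) (paths p))" .
 have "cup p (q + r) f (cup q r g h) x = signed alg (int (p * (q + r)))
   (finsum alg (%a. f (rho p a) ** cup q r g h (Lt (q + r) a x)) (paths p))"
  using cup_L[OF f cup_cl[OF g h] x'] by (simp add: tsumL_def)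
 also have "finsum alg (%a. f (rho p a) ** cup q r g h (Lt (q + r) a x)) (paths p)
   = finsum alg (%a. signed alg (int (q * r)) (finsum alg (%b. ?F a b) (paths r))) (paths p)"
 proof (rule A.finsum_cong')
  fix a assume a: "a : paths p"
  have "cup q r g h (Lt (q + r) a x) = signed alg (int (q * r)) (finsum alg (%b. g (Rt q b (Lt (q + r) a x)) ** h (rho r b)) (paths r))"
   using cup_R[OF g h W1[OF a]] by (simp add: tsumR_def)
  then show "f (rho p a) ** cup q r g h (Lt (q + r) a x) = signed alg (int (q * r)) (finsum alg (%b. ?F a b) (paths r))"
   using a f h rho_W Fc(2)
   by (simp add: signed_mult A.finsum_rdistr cochain_cl Pi_iff A.m_assoc cong: A.finsum_cong)
 qed (use Fc in "auto intro!: A.finsum_closed")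
 also have "... = signed alg (int (q * r)) (finsum alg (%a. finsum alg (%b. ?F a b) (paths r)) (paths p))"
  using Fc by (subst A.signed_finsum) (auto intro!: A.finsum_closed)
 also have "signed alg (int (p * (q + r))) ... = signed alg s (finsum alg (%a. finsum alg (%b. ?F a b) (paths r)) (paths p))"
  using Fc by (subst A.signed_signed) (auto simp: s_def algebra_simps intro!: A.finsum_closed)
 finally have 2: "cup p (q + r) f (cup q r g h) x = signed alg s (finsum alg (%a. finsum alg (%b. ?F a b) (paths r)) (paths p))" .
 show "cup (p + q) r (cup p q f g) h x = cup p (q + r) f (cup q r g h) x" using 1 2 by simp
qed (auto simp: cup_def add.assoc)

lemma cup_addmap_left: "g : cochains q ==> addmap (cgrp p) (cgrp (p + q)) (%f. cup p q f g)"
proof (rule addmapI)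
 assume g: "g : cochains q"
 fix f f' assume f: "f : car (cgrp p)" "f' : car (cgrp p)"
 then have f': "f : cochains p" "f' : cochains p" by auto
 note ff = cochain_add_closed[OF f']
 have "cup p q (cochain_add p f f') g x = cochain_add (p + q) (cup p q f g) (cup p q f' g) x" if x: "x : W (p + q)" for x
 proof -
  have cl: "f (Rt p b x) ** g (rho q b) : car alg" "f' (Rt p b x) ** g (rho q b) : car alg"  if "b : paths q" for b
   using that f' g W_Rt[OF x] rho_W by (simp_all add: cochain_cl)
  have "tsumR p q alg (%y z. cochain_add p f f' y ** g z) x =
   finsum alg (%b. f (Rt p b x) ** g (rho q b) +[alg] f' (Rt p b x) ** g (rho q b)) (paths q)"
   unfolding tsumR_def using f' g W_Rt[OF x] rho_W by (intro A.finsum_cong') (auto simp: cochain_add_def A.l_distr cochain_cl)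
  also have "... = tsumR p q alg (%y z. f y ** g z) x +[alg] tsumR p q alg (%y z. f' y ** g z) x"
   unfolding tsumR_def using cl by (intro A.finsum_addf) auto
  finally have E: "tsumR p q alg (%y z. cochain_add p f f' y ** g z) x = ..." .
  have "cup p q (cochain_add p f f') g x = cup p q f g x +[alg] cup p q f' g x"
   unfolding cup_R[OF ff g x] cup_R[OF f'(1) g x] cup_R[OF f'(2) g x] E
   using tsum_closed(1)[OF A.ab_ax balanced_cup[OF f'(1) g] coefs_ok_W[OF x]]
    tsum_closed(1)[OF A.ab_ax balanced_cup[OF f'(2) g] coefs_ok_W[OF x]] by (rule A.signed_add)
  then show ?thesis unfolding cochain_add_def[of "p + q"] using x by simp
 qed
 then show "cup p q (f +[cgrp p] f') g = cup p q f g +[cgrp (p + q)] cup p q f' g"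
  using cup_cl[OF ff g] cochain_add_closed[OF cup_cl[OF f'(1) g] cup_cl[OF f'(2) g]] by (auto intro: cochain_eqI)
qed (simp add: cup_cl)

lemma cup_addmap_right: "f : cochains p ==> addmap (cgrp q) (cgrp (p + q)) (%g. cup p q f g)"
proof (rule addmapI)
 assume f: "f : cochains p"
 fix g g' assume "g : car (cgrp q)" "g' : car (cgrp q)"
 then have g: "g : cochains q" "g' : cochains q" by auto
 note gg = cochain_add_closed[OF g]
 have "cup p q f (cochain_add q g g') x = cochain_add (p + q) (cup p q f g) (cup p q f g') x" if x: "x : W (p + q)" for x
 proof -
  have cl: "f (Rt p b x) ** g (rho q b) : car alg" "f (Rt p b x) ** g' (rho q b) : car alg"  if "b : paths q" for b
   using that f g W_Rt[OF x] rho_W by (simp_all add: cochain_cl)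
  have "tsumR p q alg (%y z. f y ** cochain_add q g g' z) x =
   finsum alg (%b. f (Rt p b x) ** g (rho q b) +[alg] f (Rt p b x) ** g' (rho q b)) (paths q)"
   unfolding tsumR_def using f g W_Rt[OF x] rho_W by (intro A.finsum_cong') (auto simp: cochain_add_def A.r_distr cochain_cl)
  also have "... = tsumR p q alg (%y z. f y ** g z) x +[alg] tsumR p q alg (%y z. f y ** g' z) x"
   unfolding tsumR_def using cl by (intro A.finsum_addf) auto
  finally have E: "tsumR p q alg (%y z. f y ** cochain_add q g g' z) x = ..." .
  have "cup p q f (cochain_add q g g') x = cup p q f g x +[alg] cup p q f g' x"
   unfolding cup_R[OF f gg x] cup_R[OF f g(1) x] cup_R[OF f g(2) x] E
   using tsum_closed(1)[OF A.ab_ax balanced_cup[OF f g(1)] coefs_ok_W[OF x]]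
    tsum_closed(1)[OF A.ab_ax balanced_cup[OF f g(2)] coefs_ok_W[OF x]] by (rule A.signed_add)
  then show ?thesis unfolding cochain_add_def[of "p + q"] using x by simp
 qed
 then show "cup p q f (g +[cgrp q] g') = cup p q f g +[cgrp (p + q)] cup p q f g'"
  using cup_cl[OF f gg] cochain_add_closed[OF cup_cl[OF f g(1)] cup_cl[OF f g(2)]] by (auto intro: cochain_eqI)
qed (simp add: cup_cl)

lemma cup_scale:
 assumes f: "f : cochains p" and g: "g : cochains q"
 shows "cup p q (cochain_scale p c f) g = cochain_scale (p + q) c (cup p q f g)"
  "cup p q f (cochain_scale q c g) = cochain_scale (p + q) c (cup p q f g)"
proof -
 have cl: "f (Rt p b x) ** g (rho q b) : car alg" if "b : paths q" "x : W (p + q)" for b x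
  using that f g W_Rt[OF that(2)] rho_W by (simp_all add: cochain_cl)
 have ts: "tsumR p q alg (%y z. f y ** g z) x : car alg" if "x : W (p + q)" for x
  using tsum_closed(1)[OF A.ab_ax balanced_cup[OF f g] coefs_ok_W[OF that]] .
 have "tsumR p q alg (%y z. cochain_scale p c f y ** g z) x = scal c ** tsumR p q alg (%y z. f y ** g z) x"
  if x: "x : W (p + q)" for x
  unfolding tsumR_def using f g W_Rt[OF x] rho_W cl x
  by (subst A.finsum_rdistr) (simp_all add: cochain_scale_def A.m_assoc cochain_cl Pi_iff cong: A.finsum_cong)
 then show "cup p q (cochain_scale p c f) g = cochain_scale (p + q) c (cup p q f g)"
  by (intro cochain_eqI[OF cup_cl[OF cochain_scale_closed[OF f] g] cochain_scale_closed[OF cup_cl[OF f g]]])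
    (simp add: cup_R[OF cochain_scale_closed[OF f] g] cup_R[OF f g] cochain_scale_def[of "p + q"] signed_mult ts)
 have "f (Rt p b x) ** (scal c ** g (rho q b)) = scal c ** (f (Rt p b x) ** g (rho q b))"
  if "b : paths q" "x : W (p + q)" for x b
  using that f g W_Rt[OF that(2)] rho_W by (simp add: A.m_assoc[symmetric] scal_comm cochain_cl)
 then have "tsumR p q alg (%y z. f y ** cochain_scale q c g z) x = scal c ** tsumR p q alg (%y z. f y ** g z) x"
  if x: "x : W (p + q)" for x
  unfolding tsumR_def using f g W_Rt[OF x] rho_W cl x
  by (subst A.finsum_rdistr) (simp_all add: cochain_scale_def cochain_cl Pi_iff cong: A.finsum_cong)
 then show "cup p q f (cochain_scale q c g) = cochain_scale (p + q) c (cup p q f g)"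
  by (intro cochain_eqI[OF cup_cl[OF f cochain_scale_closed[OF g]] cochain_scale_closed[OF cup_cl[OF f g]]])
    (simp add: cup_R[OF f cochain_scale_closed[OF g]] cup_R[OF f g] cochain_scale_def[of "p + q"] signed_mult ts)
qed

text \<open>The differential is the inner derivation \<open>f \<mapsto> -[\<epsilon>, f]\<close>, where \<open>\<epsilon>\<close> is the inclusion of
 \<open>V\<close> in \<open>A\<close>, and \<open>\<epsilon> \<smile> \<epsilon> = 0\<close> because the relations vanish in \<open>A\<close>.\<close>

definition eps :: "('v, 'e, 'f) koszul_cochain" where
 "eps = (\<lambda>x\<in>W 1. proj x)"

lemma eps_cl: "eps : cochains 1"
 by (rule cochainsI) (auto simp: eps_def Wadd_def W_add W_left W_right proj_add proj_mult W_carrier tpower_carrier)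

lemma eps_eps: "cup 1 1 eps eps = 0[cgrp 2]"
proof (rule extensionalityI[of _ "W 2"])
 fix x assume x: "x : W 2"
 then have x2: "x : W (1 + 1)" by (simp only: one_add_one)
 have "tsumR 1 1 alg (%y z. eps y ** eps z) x = finsum alg (%b. proj (tmult Q (Rt 1 b x) (rho 1 b))) (paths 1)"
  unfolding tsumR_def using W_Rt[OF x2] rho_W[of _ 1]
  by (intro A.finsum_cong') (simp_all add: Pi_iff eps_def proj_mult W_carrier[of _ 1] tmult_carrier)
 also have "... = proj (SUM b:paths 1. tmult Q (Rt 1 b x) (rho 1 b))"
 proof -
  have "proj (SUM b:I. tmult Q (Rt 1 b x) (rho 1 b)) = finsum alg (%b. proj (tmult Q (Rt 1 b x) (rho 1 b))) I"
   if "I <= paths 1" "finite I" for I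
   using that(2,1)
  proof (induction rule: finite_induct)
   case (insert b I)
   have c: "tmult Q (Rt 1 b x) (rho 1 b) : car T" if "b : paths 1" for b
    using that W_Rt[OF x2] rho_W[of _ 1] by (simp add: tmult_carrier W_carrier[of _ 1])
   have "(SUM b:I. tmult Q (Rt 1 b x) (rho 1 b)) : tpower Q (1 + 1)"
    using insert W_Rt[OF x2] rho_W[of _ 1] by (intro tpower_sum tmult_tpower W_tpower) auto
   note tp = tpower_carrier[OF this]
   have b: "b : paths 1" and I: "(%b. proj (tmult Q (Rt 1 b x) (rho 1 b))) : I \<rightarrow> car alg"
    using insert.prems c by (auto intro!: proj_closed)
   show ?case using insert c[OF b] I by (simp add: proj_add[OF c[OF b] tp])
  qed simp
  then show ?thesis by simp
 qed
 also have "... = proj x" using tsum_tens[OF x2] by simp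
 also have "... = 0[alg]" using x by (simp add: W_2 proj_R)
 finally show "cup 1 1 eps eps x = 0[cgrp 2] x"
  using x x2 by (simp add: cup_R[OF eps_cl eps_cl x2])
qed (simp_all add: cup_def one_add_one)

text \<open>The product f \<smile> eps contains the sign (-1)^p, which \<open>signed\<close>
  cancels. The same sign in eps \<smile> f is the one that the second term of \<open>bK\<close>
  carries.\<close>

lemma bK_eps:
 assumes f: "f : cochains p"
 shows "bK p f = signed (cgrp (p + 1)) (int p) (cup p 1 f eps) -[cgrp (p + 1)] cup 1 p eps f"
proof (rule extensionalityI[of _ "W (p + 1)"])
 note c1 = cup_cl[OF f eps_cl]
 have c2: "cup 1 p eps f : cochains (p + 1)" using cup_cl[OF eps_cl f] by (simp add: add.commute)
 have cl: "signed (cgrp (p + 1)) (int p) (cup p 1 f eps) : cochains (p + 1)"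
  using C.signed_cl[of "cup p 1 f eps" "p + 1"] c1 by simp
 have "signed (cgrp (p + 1)) (int p) (cup p 1 f eps) -[cgrp (p + 1)] cup 1 p eps f : cochains (p + 1)"
  using C.minus_closed[of _ "p + 1"] cl c2 by simp
 then show "signed (cgrp (p + 1)) (int p) (cup p 1 f eps) -[cgrp (p + 1)] cup 1 p eps f : extensional (W (p + 1))"
  by (rule cochain_ext)
 show "bK p f : extensional (W (p + 1))" by (simp add: bK_def)
 fix x assume x: "x : W (p + 1)"
 then have x': "x : W (1 + p)" by (simp add: add.commute)
 have "split_sum p 1 (%y z. f y ** proj z) x = split_sum p 1 (%y z. f y ** eps z) x"
  unfolding split_sum_def using split_spec(1)[OF x] f
  by (intro A.finsum_cong') (auto simp: eps_def split: prod.splits dest!: nth_mem intro!: A.m_closed cochain_cl[OF f] proj_closed W_carrier)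
 moreover have "split_sum 1 p (%y z. proj y ** f z) x = split_sum 1 p (%y z. eps y ** f z) x"
  unfolding split_sum_def using split_spec(1)[OF x'] f
  by (intro A.finsum_cong') (auto simp: eps_def split: prod.splits dest!: nth_mem intro!: A.m_closed cochain_cl[OF f] proj_closed W_carrier)
 moreover have "cup p 1 f eps x = signed alg (int p) (split_sum p 1 (%y z. f y ** eps z) x)"
  "cup 1 p eps f x = signed alg (int p) (split_sum 1 p (%y z. eps y ** f z) x)"
  using x x' by (simp_all add: cup_def)
 moreover have "split_sum p 1 (%y z. f y ** eps z) x : car alg"
  using tsum_closed[OF A.ab_ax balanced_cup[OF f eps_cl] coefs_ok_W[OF x]] cup_split[OF f eps_cl x] by simp
 ultimately show "bK p f x = (signed (cgrp (p + 1)) (int p) (cup p 1 f eps) -[cgrp (p + 1)] cup 1 p eps f) x"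
  unfolding cgrp_eval_simps(2)[OF cl c2 x] cgrp_eval_simps(4)[OF c1 c1 x] using x
  by (simp add: bK_def A.signed_signed A.signed_even)
qed

lemma bK_closed: "f : cochains p ==> bK p f : cochains (p + 1)"
 using cup_cl[of f p eps 1] cup_cl[of eps 1 f p] eps_cl C.minus_closed[of _ "p + 1"] C.signed_cl[of _ "p + 1"]
 by (simp add: bK_eps add.commute[of 1 p])

lemma addmap_eq_fun: "addmap G H t ==> (!!x. x : car G ==> abelian_group G ==> t' x = t x) ==> abelian_group G ==> addmap G H t'"
 using abelian_monoid.a_closed[OF abelian_group.axioms(1), of G] by (simp add: addmap_def)

lemma bK_addmap: "addmap (cgrp p) (cgrp (p + 1)) (bK p)"
proof (rule addmap_eq_fun)
 have "addmap (cgrp p) (cgrp (p + 1)) (%f. cup 1 p eps f)" using cup_addmap_right[OF eps_cl, of p] by (simp add: add.commute)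
 then show "addmap (cgrp p) (cgrp (p + 1)) (%f. signed (cgrp (p + 1)) (int p) (cup p 1 f eps) -[cgrp (p + 1)] cup 1 p eps f)"
  by (intro addmap_minus_pointwise am_signed_pointwise ab_cgrp cup_addmap_left eps_cl)
qed (auto simp: bK_eps ab_cgrp)

lemma cochain_scale_addmap: "addmap (cgrp p) (cgrp p) (cochain_scale p c)"
proof (rule addmapI)
 fix f g assume "f : car (cgrp p)" "g : car (cgrp p)"
 then show "cochain_scale p c (f +[cgrp p] g) = cochain_scale p c f +[cgrp p] cochain_scale p c g"
  unfolding cochain_scale_def cochain_add_def cgrp_simps by (intro rext) (simp add: cochain_cl A.r_distr)
qed (simp add: cochain_scale_closed)

lemma bK_scale:
 assumes f: "f : cochains p" shows "bK p (cochain_scale p c f) = cochain_scale (p + 1) c (bK p f)"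
proof -
 have 1: "cup p 1 f eps : car (cgrp (p + 1))" "cup 1 p eps f : car (cgrp (p + 1))"
  using cup_cl[OF f eps_cl] cup_cl[OF eps_cl f] by (simp_all add: add.commute)
 have "cup 1 p eps (cochain_scale p c f) = cochain_scale (p + 1) c (cup 1 p eps f)"
  using cup_scale(2)[OF eps_cl f] by (simp add: add.commute)
 then show ?thesis
  using am_diff[OF ab_cgrp ab_cgrp cochain_scale_addmap C.signed_cl[OF 1(1), of "int p"] 1(2), of c]
   am_signed[OF ab_cgrp ab_cgrp cochain_scale_addmap 1(1), of c "int p"]
  by (simp only: bK_eps[OF f] bK_eps[OF cochain_scale_closed[OF f]] cup_scale(1)[OF f eps_cl])
qed

text \<open>Both products of \<open>eps\<close> with the unit equal \<open>eps\<close>, so the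
  commutator vanishes.\<close>

lemma bK_one: "bK 0 cochain_one = 0[cgrp 1]"
 using bK_eps[OF cochain_one_closed] cup_one_left[OF eps_cl] cup_one_right[OF eps_cl] C.r_neg[of eps 1] eps_cl
 by (simp add: signed_def a_minus_def)

text \<open>By associativity only three products occur: x = f g eps, y = eps f g and z = f eps g.
  The last one appears twice with opposite signs.\<close>

lemma bK_cup:
 assumes f: "f : cochains p" and g: "g : cochains q"
 shows "bK (p + q) (cup p q f g) = cup (p + 1) q (bK p f) g +[cgrp (p + q + 1)]
   signed (cgrp (p + q + 1)) (int p) (cup p (q + 1) f (bK q g))"
proof -
 let ?C = "cgrp (p + q + 1)"
 define x where "x = cup (p + q) 1 (cup p q f g) eps"
 define y where "y = cup 1 (p + q) eps (cup p q f g)"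
 define z where "z = cup (p + 1) q (cup p 1 f eps) g"
 have xyz: "x : car ?C" "y : car ?C" "z : car ?C"
  unfolding x_def y_def z_def
  using cup_cl[OF cup_cl[OF f g] eps_cl] cup_cl[OF eps_cl cup_cl[OF f g]]
   cup_cl[OF cup_cl[OF f eps_cl] g] by (simp_all add: add_ac)
 have y2: "y = cup (p + 1) q (cup 1 p eps f) g" unfolding y_def using cup_assoc[OF eps_cl f g] by (simp add: add_ac)
 have x2: "x = cup p (q + 1) f (cup q 1 g eps)" unfolding x_def using cup_assoc[OF f g eps_cl] by simp
 have z2: "z = cup p (q + 1) f (cup 1 q eps g)" unfolding z_def using cup_assoc[OF f eps_cl g] by (simp add: add_ac)
 have a: "addmap (cgrp (p + 1)) ?C (%f. cup (p + 1) q f g)" using cup_addmap_left[OF g, of "p + 1"] by (simp add: add_ac)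
 have b: "addmap (cgrp (q + 1)) ?C (%g. cup p (q + 1) f g)" using cup_addmap_right[OF f, of "q + 1"] by (simp add: add_ac)
 have fc: "cup p 1 f eps : car (cgrp (p + 1))" "cup 1 p eps f : car (cgrp (p + 1))"
  using cup_cl[OF f eps_cl] cup_cl[OF eps_cl f] by (simp_all add: add.commute)
 have gc: "cup q 1 g eps : car (cgrp (q + 1))" "cup 1 q eps g : car (cgrp (q + 1))"
  using cup_cl[OF g eps_cl] cup_cl[OF eps_cl g] by (simp_all add: add.commute)
 have 1: "cup (p + 1) q (bK p f) g = signed ?C (int p) z -[?C] y"
  unfolding bK_eps[OF f] y2 z_def
  using am_diff[OF ab_cgrp ab_cgrp a C.signed_cl[OF fc(1)] fc(2)] am_signed[OF ab_cgrp ab_cgrp a fc(1)] by simp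
 have 2: "cup p (q + 1) f (bK q g) = signed ?C (int q) x -[?C] z"
  unfolding bK_eps[OF g] x2 z2
  using am_diff[OF ab_cgrp ab_cgrp b C.signed_cl[OF gc(1)] gc(2)] am_signed[OF ab_cgrp ab_cgrp b gc(1)] by simp
 have 3: "bK (p + q) (cup p q f g) = signed ?C (int (p + q)) x -[?C] y"
  unfolding bK_eps[OF cup_cl[OF f g]] x_def y_def ..
 show ?thesis unfolding 1 2 3
  using C.ag_eq[of "[x, y, z]" "p + q + 1" "Mi (Sg (int (p + q)) (V 0)) (V 1)"
    "Pl (Mi (Sg (int p) (V 2)) (V 1)) (Sg (int p) (Mi (Sg (int q) (V 0)) (V 2)))"] xyz
  by (simp add: isign_add less_Suc_eq)
qed

text \<open>The terms containing eps \<smile> eps vanish, and eps f eps (here \<open>z\<close>)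
  appears twice with opposite signs.\<close>

lemma bK_bK:
 assumes f: "f : cochains p" shows "bK (p + 1) (bK p f) = 0[cgrp (p + 2)]"
proof -
 let ?C = "cgrp (p + 2)" and ?D = "cgrp (p + 1)"
 have p2: "p + 1 + 1 = p + 2" by simp
 note be = bK_closed[OF f]
 have fc: "cup p 1 f eps : car ?D" "cup 1 p eps f : car ?D"
  using cup_cl[OF f eps_cl] cup_cl[OF eps_cl f] by (simp_all add: add.commute)
 have a: "addmap ?D ?C (%f. cup (p + 1) 1 f eps)" using cup_addmap_left[OF eps_cl, of "p + 1"] by (simp only: p2)
 have b: "addmap ?D ?C (%g. cup 1 (p + 1) eps g)" using cup_addmap_right[OF eps_cl, of "p + 1"] by (simp only: p2[symmetric] add.commute)
 define z where "z = cup (p + 1) 1 (cup 1 p eps f) eps"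
 have zc: "z : car ?C" unfolding z_def using addmap_closed[OF a fc(2)] .
 have z2: "cup 1 (p + 1) eps (cup p 1 f eps) = z" unfolding z_def using cup_assoc[OF eps_cl f eps_cl] by (simp add: add.commute)
 have e2: "cup 1 1 eps eps = 0[cgrp (1 + 1)]" using eps_eps by (simp only: one_add_one)
 have "cup (p + 1) 1 (cup p 1 f eps) eps = cup p (1 + 1) f (cup 1 1 eps eps)" using cup_assoc[OF f eps_cl eps_cl] by simp
 also have "... = 0[?C]" unfolding e2
  using am_zero[OF ab_cgrp ab_cgrp cup_addmap_right[OF f, of "1 + 1"]] by (simp add: one_add_one)
 finally have 1: "cup (p + 1) 1 (cup p 1 f eps) eps = 0[?C]" .
 have "cup 1 (p + 1) eps (cup 1 p eps f) = cup (1 + 1) p (cup 1 1 eps eps) f" using cup_assoc[OF eps_cl eps_cl f] by (simp add: add.commute)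
 also have "... = 0[?C]" unfolding e2
  using am_zero[OF ab_cgrp ab_cgrp cup_addmap_left[OF f, of "1 + 1"]] by (simp add: one_add_one add.commute)
 finally have 2: "cup 1 (p + 1) eps (cup 1 p eps f) = 0[?C]" .
 have 3: "cup (p + 1) 1 (bK p f) eps = signed ?C (int p) 0[?C] -[?C] z"
  unfolding bK_eps[OF f] z_def
  using am_diff[OF ab_cgrp ab_cgrp a C.signed_cl[OF fc(1)] fc(2)] am_signed[OF ab_cgrp ab_cgrp a fc(1)] 1 by simp
 have 4: "cup 1 (p + 1) eps (bK p f) = signed ?C (int p) z -[?C] 0[?C]"
  unfolding bK_eps[OF f]
  using am_diff[OF ab_cgrp ab_cgrp b C.signed_cl[OF fc(1)] fc(2)] am_signed[OF ab_cgrp ab_cgrp b fc(1)] 2 z2 by simp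
 show ?thesis unfolding bK_eps[OF be] p2 3 4
  using C.ag_eq[of "[z]" "p + 2" "Mi (Sg (int (p + 1)) (Mi (Sg (int p) Zr) (V 0))) (Mi (Sg (int p) (V 0)) Zr)" "Zr"] zc
  by (simp add: isign_add)
qed

end

section \<open>The enveloping algebra\<close>

text \<open>Relates records of different types with a common additive structure; group laws, finite
  sums and signs are carried over from \<open>quotrec\<close>.\<close>

definition same_addgrp :: "('x, 'm) ring_scheme => ('x, 'k) ring_scheme => bool" where
 "same_addgrp G H \<longleftrightarrow> car G = car H & 0[G] = 0[H] & add G = add H"

lemma same_add:
 assumes "same_addgrp G H"
 shows "car G = car H" "0[G] = 0[H]" "x +[G] y = x +[H] y" "-[G] x = -[H] x" "x -[G] y = x -[H] y"
  "finsum G g I = finsum H g I" "signed G n x = signed H n x"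
 using assms by (auto simp: same_addgrp_def a_inv_def a_minus_def finsum_def signed_def m_inv_def finprod_def)

lemma abelian_group_cong:
 assumes "same_addgrp G H" "abelian_group G" shows "abelian_group H"
proof -
 interpret G: abelian_group G by fact
 note [simp] = same_add(1-3)[OF assms(1), symmetric]
 show ?thesis
  by (rule abelian_groupI) (auto simp: G.a_ac intro: G.l_neg)
qed

lemma addmap_cong:
 assumes "same_addgrp G H" shows "addmap G K h = addmap H K h"
 using assms by (simp add: addmap_def same_addgrp_def)

text \<open>Extensional families under pointwise addition, with a target group that may vary with
  the point: constant for the duals, varying with the degrees for the coinduced objects.\<close>

lemma fun_abelian_group:
 assumes H: "!!x. x : D ==> abelian_group (H x)"
  and ext: "!!u. u : car G ==> u : extensional D"
  and cl: "!!u x. u : car G ==> x : D ==> u x : car (H x)"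
  and add: "!!u v. u : car G ==> v : car G ==> u +[G] v = (\<lambda>x\<in>D. u x +[H x] v x)"
  and zero: "0[G] = (\<lambda>x\<in>D. 0[H x])" "0[G] : car G"
  and addc: "!!u v. u : car G ==> v : car G ==> u +[G] v : car G"
  and neg: "!!u. u : car G ==> (\<lambda>x\<in>D. -[H x] u x) : car G"
 shows "abelian_group G"
proof -
 have am: "abelian_monoid (H x)" if "x : D" for x using H[OF that] by (rule abelian_group.axioms)
 show ?thesis
 proof (rule abelian_groupI)
  fix u assume u: "u : car G"
  show "EX v:car G. v +[G] u = 0[G]"
   by (rule bexI[OF _ neg[OF u]], unfold add[OF neg[OF u] u] zero, rule rext)
    (use u cl H in "simp add: abelian_group.l_neg")
  show "0[G] +[G] u = u"
   unfolding add[OF zero(2) u] by (rule extensionalityI[OF restrict_extensional ext[OF u]])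
    (use u cl am in "simp add: zero(1) abelian_monoid.l_zero")
 next
  fix u v w assume uv: "u : car G" "v : car G"
  show "u +[G] v : car G" by (rule addc[OF uv])
  show "u +[G] v = v +[G] u" unfolding add[OF uv] add[OF uv(2,1)]
   by (rule rext) (use uv cl am in "simp add: abelian_monoid.a_comm")
  assume w: "w : car G"
  show "u +[G] v +[G] w = u +[G] (v +[G] w)" unfolding add[OF addc[OF uv] w] add[OF uv(1) addc[OF uv(2) w]]
   by (rule rext) (use uv w cl am in "simp add: add[OF uv] add[OF uv(2) w] abelian_monoid.a_assoc")
 qed (rule zero)
qed

lemma frag_extend_fun_add: "frag_extend (%i. f i + g i) x = frag_extend f x + frag_extend g x"
 by (simp add: frag_extend_def frag_cmul_distrib2 sum.distrib)

lemma frag_extend_fun_diff: "frag_extend (%i. f i - g i) x = frag_extend f x - frag_extend g x"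
proof -
 have "frag_extend (%i. (f i - g i) + g i) x = frag_extend (%i. f i - g i) x + frag_extend g x"
  by (rule frag_extend_fun_add)
 then show ?thesis by simp
qed

lemma (in free_quot) keys_extend:
 assumes "!!b. b : C ==> supp (f b) <= B" "supp y <= C"
 shows "supp (frag_extend f y) <= B"
 using keys_frag_extend[of f y] assms by fastforce

lemma (in free_quot) cl_extend_zero:
 assumes "!!b. b : C ==> supp (f b) <= B" "!!b. b : C ==> cl (f b) = 0[quot]"
  "supp y <= C"
 shows "cl (frag_extend f y) = 0[quot]"
proof (rule free_Abelian_group_induct[OF assms(3), of "%y. cl (frag_extend f y) = 0[quot]"])
 fix x y assume xy: "supp x <= C" "supp y <= C" "cl (frag_extend f x) = 0[quot]" "cl (frag_extend f y) = 0[quot]"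
 have k: "supp (frag_extend f x) <= B" "supp (frag_extend f y) <= B"
  using keys_extend[where f = f, OF assms(1) xy(1)] keys_extend[where f = f, OF assms(1) xy(2)] by blast+
 have "cl (frag_extend f (x - y)) = cl (frag_extend f x) -[quot] cl (frag_extend f y)"
  using cl_diff[OF k] by (simp add: frag_extend_diff)
 then show "cl (frag_extend f (x - y)) = 0[quot]" using xy by (simp add: a_minus_def)
qed (use assms in "simp_all add: quot_simps")

context quadratic_algebra
begin

text \<open>The relations generating \<open>env_rels\<close> under a name of their own, as the
  parameter of the general theory of such quotients.\<close>

definition env_gens :: "(('v, 'e, 'f) qalg \<times> ('v, 'e, 'f) qalg \<Rightarrow>\<^sub>0 int) set" where
 "env_gens = {frag_of (a +[alg] a', b) - frag_of (a, b) - frag_of (a', b) | a a' b.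
    a : car alg & a' : car alg & b : car alg} \<union>
   {frag_of (a, b +[alg] b') - frag_of (a, b) - frag_of (a, b') | a b b'.
    a : car alg & b : car alg & b' : car alg} \<union>
   {frag_of (scal c ** a, b) - frag_of (a, scal c ** b) | a b c.
    a : car alg & b : car alg}"

abbreviation "AA \<equiv> car alg \<times> car alg"

lemma keys_diff3: "supp a <= X ==> supp b <= X ==> supp (a - b :: _ \<Rightarrow>\<^sub>0 int) <= X"
 using keys_diff[of a b] by blast

sublocale E: free_quot "AA" env_gens
proof
 fix s assume "s : env_gens"
 then show "supp s <= AA"
  unfolding env_gens_def by (elim UnE CollectE exE conjE) (simp_all add: keys_diff3)
qed

lemma E_H: "E.H = env_rels"
 unfolding E.H_def unfolding env_rels_def env_gens_def env_free_def ..

lemma E_cl: "E.cl x = env_rels #>\<^bsub>env_free\<^esub> x"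
 by (simp add: E.cl_def E_H env_free_def)

lemma etens_cl: "etens a b = E.cl (frag_of (a, b))"
 by (simp add: etens_def E_cl)

lemma env_add_monoid: "same_addgrp E.quot env"
 by (simp add: same_addgrp_def quotrec_def env_def E_H env_free_def)

lemmas env_same = same_add[OF env_add_monoid]

lemma abelian_env: "abelian_group env"
 by (rule abelian_group_cong[OF env_add_monoid E.abelian_group_quot])

lemma etens_closed [simp, intro]: "a : car alg ==> b : car alg ==> etens a b : car env"
 unfolding etens_cl env_same(1)[symmetric] by (rule E.cl_closed) simp

lemma cl_gens3:
 assumes "frag_of x - frag_of y - frag_of z : env_gens" "x : AA" "y : AA" "z : AA"
 shows "E.cl (frag_of x) = E.cl (frag_of y) +[env] E.cl (frag_of z)"
proof -
 have k: "supp (frag_of x) <= AA" "supp (frag_of y + frag_of z) <= AA"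
  "supp (frag_of y) <= AA" "supp (frag_of z) <= AA"
  using assms keys_add[of "frag_of y" "frag_of z"] by auto
 have "frag_of x - (frag_of y + frag_of z) : E.H"
  using assms(1) unfolding E.H_def by (intro generate.incl) (simp add: algebra_simps)
 then have "E.cl (frag_of x) = E.cl (frag_of y + frag_of z)" using E.cl_eq_iff k by blast
 then show ?thesis using E.cl_add[OF k(3,4)] by (simp add: env_same(3))
qed

lemma etens_add_left: "a : car alg ==> a' : car alg ==> b : car alg ==>
 etens (a +[alg] a') b = etens a b +[env] etens a' b"
 unfolding etens_cl by (rule cl_gens3) (simp_all, unfold env_gens_def, blast)

lemma etens_add_right: "a : car alg ==> b : car alg ==> b' : car alg ==>
 etens a (b +[alg] b') = etens a b +[env] etens a b'"
 unfolding etens_cl by (rule cl_gens3) (simp_all, unfold env_gens_def, blast)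

lemma etens_scal: "a : car alg ==> b : car alg ==> etens (scal c ** a) b = etens a (scal c ** b)"
proof -
 assume ab: "a : car alg" "b : car alg"
 then have "frag_of (scal c ** a, b) - frag_of (a, scal c ** b) : E.H"
  unfolding E.H_def by (intro generate.incl) (unfold env_gens_def, blast)
 then show ?thesis unfolding etens_cl using ab E.cl_eq_iff[of "frag_of (scal c ** a, b)" "frag_of (a, scal c ** b)"]
  by simp
qed

lemma env_addmap_eqI:
 assumes "abelian_group M" "addmap env M h" "addmap env M k"
  and "!!a b. a : car alg ==> b : car alg ==> h (etens a b) = k (etens a b)" "X : car env"
 shows "h X = k X"
 by (rule E.addmap_eqI[OF assms(1)])
  (use assms(2-5) in "auto simp: addmap_cong[OF env_add_monoid] env_same(1) etens_cl")

definition emul1 where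
 "emul1 p y = frag_extend (%(a', b'). frag_of (fst p ** a', b' ** snd p)) y"

definition emul where
 "emul x y = frag_extend (%p. emul1 p y) x"

lemma env_mult: "X **[env] Y = (\<Union>x\<in>X. \<Union>y\<in>Y. E.cl (emul x y))"
 by (simp add: env_def emul_def emul1_def E_cl split_beta')

lemma keys_emul1: "p : AA ==> supp y <= AA ==> supp (emul1 p y) <= AA"
 unfolding emul1_def by (rule E.keys_extend[where C = AA]) auto

lemma keys_emul: "supp x <= AA ==> supp y <= AA ==> supp (emul x y) <= AA"
 unfolding emul_def by (rule E.keys_extend[where C = AA, OF keys_emul1])

lemma emul1_add: "emul1 p (x + y) = emul1 p x + emul1 p y"
 by (simp add: emul1_def frag_extend_add)

lemma emul_add: "emul (x + x') y = emul x y + emul x' y" "emul x (y + y') = emul x y + emul x y'"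
 by (simp_all add: emul_def frag_extend_add emul1_add frag_extend_fun_add)

lemma cl_rel3:
 assumes "x : AA" "y : AA" "z : AA" "E.cl (frag_of x) = E.cl (frag_of y) +[env] E.cl (frag_of z)"
 shows "E.cl (frag_of x - frag_of y - frag_of z) = 0[E.quot]"
proof -
 have k: "supp (frag_of x) <= AA" "supp (frag_of y + frag_of z) <= AA"
  "supp (frag_of y) <= AA" "supp (frag_of z) <= AA"
  using assms keys_add[of "frag_of y" "frag_of z"] by auto
 have "E.cl (frag_of x) = E.cl (frag_of y + frag_of z)" using assms(4) E.cl_add[OF k(3,4)] by (simp add: env_same(3))
 then have "frag_of x - (frag_of y + frag_of z) : E.H" using E.cl_eq_iff k by blast
 then show ?thesis using k E.cl_eq_zero_iff[OF keys_diff3[OF k(1,2)]] by (simp add: algebra_simps)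
qed

lemma cl_rel2:
 assumes "x : AA" "y : AA" "E.cl (frag_of x) = E.cl (frag_of y)"
 shows "E.cl (frag_of x - frag_of y) = 0[E.quot]"
 using E.cl_eq_iff[of "frag_of x" "frag_of y"] E.cl_eq_zero_iff[OF keys_diff3, of "frag_of x" "frag_of y"] assms by simp

lemma emul1_gens:
 assumes "p : AA" "s : env_gens" shows "E.cl (emul1 p s) = 0[E.quot]"
 using assms(2)[unfolded env_gens_def]
proof (elim UnE CollectE exE conjE)
 fix a a' b assume s: "s = frag_of (a +[alg] a', b) - frag_of (a, b) - frag_of (a', b)" and
  c: "a : car alg" "a' : car alg" "b : car alg"
 show ?thesis unfolding s emul1_def frag_extend_diff frag_extend_of split_conv
  by (rule cl_rel3) (use assms(1) c in "simp_all add: mem_Times_iff etens_cl[symmetric] A.r_distr etens_add_left")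
next
 fix a b b' assume s: "s = frag_of (a, b +[alg] b') - frag_of (a, b) - frag_of (a, b')" and
  c: "a : car alg" "b : car alg" "b' : car alg"
 show ?thesis unfolding s emul1_def frag_extend_diff frag_extend_of split_conv
  by (rule cl_rel3) (use assms(1) c in "simp_all add: mem_Times_iff etens_cl[symmetric] A.l_distr etens_add_right")
next
 fix a b c assume s: "s = frag_of (scal c ** a, b) - frag_of (a, scal c ** b)" and
  c: "a : car alg" "b : car alg"
 have p: "fst p : car alg" "snd p : car alg" using assms(1) by auto
 have "fst p ** (scal c ** a) = scal c ** (fst p ** a)"
  using p c by (simp add: A.m_assoc[symmetric] scal_comm)
 then have "etens (fst p ** (scal c ** a)) (b ** snd p) = etens (fst p ** a) (scal c ** b ** snd p)"
  using p c by (simp add: etens_scal A.m_assoc)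
 then show ?thesis unfolding s emul1_def frag_extend_diff frag_extend_of split_conv
  by (intro cl_rel2) (use p c in "simp_all add: mem_Times_iff etens_cl[symmetric]")
qed

lemma emul_gens_right:
 assumes "supp x <= AA" "s : env_gens" shows "E.cl (emul x s) = 0[E.quot]"
 unfolding emul_def using E.S[OF assms(2)] assms
 by (intro E.cl_extend_zero[where C = AA] keys_emul1 emul1_gens)

text \<open>The relation stands in the outer extension. It is distributed into the inner one, so
  that only its product with one symbol on the right has to be examined.\<close>

lemma emul_gens_left:
 assumes "supp y <= AA" "s : env_gens" shows "E.cl (emul s y) = 0[E.quot]"
 using assms(2)[unfolded env_gens_def]
proof (elim UnE CollectE exE conjE)
 fix a a' b assume s: "s = frag_of (a +[alg] a', b) - frag_of (a, b) - frag_of (a', b)" and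
  c: "a : car alg" "a' : car alg" "b : car alg"
 show ?thesis unfolding s emul_def emul1_def frag_extend_diff frag_extend_of split_conv frag_extend_fun_diff[symmetric]
 proof (rule E.cl_extend_zero[OF _ _ assms(1)])
  fix p assume p: "p : AA"
  then show "E.cl ((case p of (a'', b') => frag_of (fst (a +[alg] a', b) ** a'', b' ** snd (a +[alg] a', b))) -
   (case p of (a', b') => frag_of (fst (a, b) ** a', b' ** snd (a, b))) -
   (case p of (a'', b') => frag_of (fst (a', b) ** a'', b' ** snd (a', b)))) = 0[E.quot]"
   unfolding split_beta by (intro cl_rel3) (use p c in "simp_all add: mem_Times_iff etens_cl[symmetric] A.l_distr etens_add_left")
 qed (use c in "simp_all add: split_beta mem_Times_iff keys_diff3")
next
 fix a b b' assume s: "s = frag_of (a, b +[alg] b') - frag_of (a, b) - frag_of (a, b')" and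
  c: "a : car alg" "b : car alg" "b' : car alg"
 show ?thesis unfolding s emul_def emul1_def frag_extend_diff frag_extend_of split_conv frag_extend_fun_diff[symmetric]
 proof (rule E.cl_extend_zero[OF _ _ assms(1)])
  fix p assume p: "p : AA"
  then show "E.cl ((case p of (a', b'') => frag_of (fst (a, b +[alg] b') ** a', b'' ** snd (a, b +[alg] b'))) -
   (case p of (a', b') => frag_of (fst (a, b) ** a', b' ** snd (a, b))) -
   (case p of (a', b'') => frag_of (fst (a, b') ** a', b'' ** snd (a, b')))) = 0[E.quot]"
   unfolding split_beta by (intro cl_rel3) (use p c in "simp_all add: mem_Times_iff etens_cl[symmetric] A.r_distr etens_add_right")
 qed (use c in "simp_all add: split_beta mem_Times_iff keys_diff3")
next
 fix a b c assume s: "s = frag_of (scal c ** a, b) - frag_of (a, scal c ** b)" and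
  c: "a : car alg" "b : car alg"
 show ?thesis unfolding s emul_def emul1_def frag_extend_diff frag_extend_of split_conv frag_extend_fun_diff[symmetric]
 proof (rule E.cl_extend_zero[OF _ _ assms(1)])
  fix p assume p: "p : AA"
  then have p: "fst p : car alg" "snd p : car alg" by auto
  have "snd p ** (scal c ** b) = scal c ** (snd p ** b)"
   using p c by (simp add: A.m_assoc[symmetric] scal_comm)
  then have "etens (scal c ** a ** fst p) (snd p ** b) = etens (a ** fst p) (snd p ** (scal c ** b))"
   using p c by (simp add: etens_scal A.m_assoc)
  then show "E.cl ((case p of (a', b') => frag_of (fst (scal c ** a, b) ** a', b' ** snd (scal c ** a, b))) -
   (case p of (a', b') => frag_of (fst (a, scal c ** b) ** a', b' ** snd (a, scal c ** b)))) = 0[E.quot]"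
   unfolding split_beta by (intro cl_rel2) (use p c in "simp_all add: mem_Times_iff etens_cl[symmetric]")
 qed (use c in "simp_all add: split_beta mem_Times_iff keys_diff3")
qed

text \<open>The product is defined as a union over all representatives. It is a single coset because
  the bilinear extension takes a relation in either argument to the zero class; the two
  representatives are exchanged one after the other.\<close>

lemma env_mult_cl:
 assumes x: "supp x <= AA" and y: "supp y <= AA"
 shows "E.cl x **[env] E.cl y = E.cl (emul x y)"
proof -
 have "E.cl (emul x' y') = E.cl (emul x y)" if x': "x' : E.cl x" and y': "y' : E.cl y" for x' y'
 proof -
  have xk: "supp x' <= AA" using E.cl_mem[OF x x'] by simp
  have "E.cl (emul x' y') = E.cl (emul x' y)"
   by (rule E.union_map[OF E.abelian_group_quot, of "%y. E.cl (emul x' y)", OF _ _ _ y y'])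
    (simp_all add: keys_emul xk emul_gens_right emul_add E.cl_add)
  also have "... = E.cl (emul x y)"
   by (rule E.union_map[OF E.abelian_group_quot, of "%x. E.cl (emul x y)", OF _ _ _ x x'])
    (simp_all add: keys_emul y emul_gens_left emul_add E.cl_add)
  finally show ?thesis .
 qed
 then show ?thesis unfolding env_mult using E.cl_self[OF x] E.cl_self[OF y] by blast
qed

lemma etens_mult:
 assumes "a : car alg" "b : car alg" "a' : car alg" "b' : car alg"
 shows "etens a b **[env] etens a' b' = etens (a ** a') (b' ** b)"
 unfolding etens_cl using assms by (subst env_mult_cl) (simp_all add: emul_def emul1_def)

lemma env_cl: "X : car env ==> \<exists>x. supp x <= AA & X = E.cl x"
 by (auto simp: env_same(1)[symmetric] E.quot_simps(1))

lemma env_mult_closed: "X : car env ==> Y : car env ==> X **[env] Y : car env"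
 by (drule env_cl, drule env_cl, elim exE conjE)
  (simp add: env_mult_cl env_same(1)[symmetric] E.cl_closed[OF keys_emul])

lemma env_distr:
 assumes "X : car env" "Y : car env" "Z : car env"
 shows "(X +[env] Y) **[env] Z = X **[env] Z +[env] Y **[env] Z"
  "Z **[env] (X +[env] Y) = Z **[env] X +[env] Z **[env] Y"
proof -
 obtain x y z where k: "supp x <= AA" "supp y <= AA" "supp z <= AA"
  and e: "X = E.cl x" "Y = E.cl y" "Z = E.cl z" using assms env_cl by metis
 have k': "supp (x + y) <= AA" using k keys_add[of x y] by blast
 show "(X +[env] Y) **[env] Z = X **[env] Z +[env] Y **[env] Z"
  "Z **[env] (X +[env] Y) = Z **[env] X +[env] Z **[env] Y"
  unfolding e env_same(3)[symmetric] E.cl_add[OF k(1,2)] env_mult_cl[OF k'  k(3)] env_mult_cl[OF k(3) k']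
   env_mult_cl[OF k(1,3)] env_mult_cl[OF k(2,3)] env_mult_cl[OF k(3,1)] env_mult_cl[OF k(3,2)] emul_add
  by (simp_all add: E.cl_add keys_emul k)
qed

lemma env_addmap_left: "Z : car env ==> addmap env env (%X. X **[env] Z)"
 and env_addmap_right: "Z : car env ==> addmap env env (%X. Z **[env] X)"
 by (simp_all add: addmap_def env_mult_closed env_distr)

text \<open>Both sides are additive in each argument, so the arguments may be replaced by pure
  tensors one at a time.\<close>

lemma env_assoc:
 assumes "X : car env" "Y : car env" "Z : car env"
 shows "X **[env] Y **[env] Z = X **[env] (Y **[env] Z)"
proof -
 have 1: "etens a b **[env] etens a' b' **[env] Z = etens a b **[env] (etens a' b' **[env] Z)"
  if c: "a : car alg" "b : car alg" "a' : car alg" "b' : car alg" for a b a' b'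
  by (rule env_addmap_eqI[OF abelian_env _ am_comp[OF env_addmap_right env_addmap_right] _ assms(3)])
   (use c in "simp_all add: env_addmap_right env_mult_closed etens_mult A.m_assoc")
 have 2: "etens a b **[env] Y **[env] Z = etens a b **[env] (Y **[env] Z)"
  if c: "a : car alg" "b : car alg" for a b
  by (rule env_addmap_eqI[OF abelian_env am_comp[OF env_addmap_right env_addmap_left] am_comp[OF env_addmap_left env_addmap_right] _ assms(2)])
   (use c assms 1 in simp_all)
 show ?thesis
  by (rule env_addmap_eqI[OF abelian_env am_comp[OF env_addmap_left env_addmap_left] env_addmap_left _ assms(1)])
   (use assms 2 in "simp_all add: env_mult_closed")
qed

lemma ring_env: "ring env"
proof (rule ringI[OF abelian_env])
 have one: "1[env] = etens 1[alg] 1[alg]" by (simp add: env_def)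
 have id: "addmap env env (%X. X)" by (simp add: addmap_def)
 show "monoid env"
 proof (rule monoidI)
  fix X assume X: "X : car env"
  show "1[env] **[env] X = X"
   by (rule env_addmap_eqI[OF abelian_env env_addmap_right id _ X]) (simp_all add: one etens_mult)
  show "X **[env] 1[env] = X"
   by (rule env_addmap_eqI[OF abelian_env env_addmap_left id _ X]) (simp_all add: one etens_mult)
 qed (simp_all add: env_mult_closed env_assoc one)
qed (simp_all add: env_distr)

sublocale N: ring env by (rule ring_env)

lemma env_one: "1[env] = etens 1[alg] 1[alg]" by (simp add: env_def)

text \<open>Scalars are central and pass from one tensor factor to the other. This makes the left
  and right scalar actions on a dual agree.\<close>

lemma etens_scal_central:
 assumes "X : car env"
 shows "etens (scal c) 1[alg] **[env] X = X **[env] etens 1[alg] (scal c)"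
  and "X **[env] etens (scal c) 1[alg] = X **[env] etens 1[alg] (scal c)"
proof -
 show "etens (scal c) 1[alg] **[env] X = X **[env] etens 1[alg] (scal c)"
  by (rule env_addmap_eqI[OF abelian_env env_addmap_right env_addmap_left _ assms]) (simp_all add: etens_mult etens_scal)
 have "etens (scal c) 1[alg] = etens 1[alg] (scal c)" using etens_scal[of "1[alg]" "1[alg]" c] by simp
 then show "X **[env] etens (scal c) 1[alg] = X **[env] etens 1[alg] (scal c)" by simp
qed

end

section \<open>Dg bimodules\<close>

context quadratic_algebra
begin

lemma bim_ab: "bimodule M ==> abelian_group M"
 and bim_l: "bimodule M ==> a : car alg ==> x : car M ==> a *[M] x : car M"
 and bim_r: "bimodule M ==> a : car alg ==> x : car M ==> rsmult M x a : car M"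
 and bim_l_add: "bimodule M ==> a : car alg ==> x : car M ==> y : car M ==>
   a *[M] (x +[M] y) = a *[M] x +[M] a *[M] y"
 and bim_r_add: "bimodule M ==> a : car alg ==> x : car M ==> y : car M ==>
   rsmult M (x +[M] y) a = rsmult M x a +[M] rsmult M y a"
 and bim_add_l: "bimodule M ==> a : car alg ==> b : car alg ==> x : car M ==>
   (a +[alg] b) *[M] x = a *[M] x +[M] b *[M] x"
 and bim_add_r: "bimodule M ==> a : car alg ==> b : car alg ==> x : car M ==>
   rsmult M x (a +[alg] b) = rsmult M x a +[M] rsmult M x b"
 and bim_mult_l: "bimodule M ==> a : car alg ==> b : car alg ==> x : car M ==>
   (a ** b) *[M] x = a *[M] (b *[M] x)"
 and bim_mult_r: "bimodule M ==> a : car alg ==> b : car alg ==> x : car M ==>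
   rsmult M x (a ** b) = rsmult M (rsmult M x a) b"
 and bim_lr: "bimodule M ==> a : car alg ==> b : car alg ==> x : car M ==>
   rsmult M (a *[M] x) b = a *[M] rsmult M x b"
 and bim_one: "bimodule M ==> x : car M ==> 1[alg] *[M] x = x"
   "bimodule M ==> x : car M ==> rsmult M x 1[alg] = x"
 and bim_scal: "bimodule M ==> x : car M ==> scal c *[M] x = rsmult M x (scal c)"
 unfolding bimodule_def by blast+

lemma bim_addmap: "bimodule M ==> a : car alg ==> addmap M M (%x. a *[M] x)"
  "bimodule M ==> a : car alg ==> addmap M M (%x. rsmult M x a)"
 by (simp_all add: addmap_def bim_l bim_r bim_l_add bim_r_add)

lemma bimod_hom_iff: "bimod_hom M N h \<longleftrightarrow> addmap M N h &
 (ALL a:car alg. ALL x:car M. h (a *[M] x) = a *[N] h x & h (rsmult M x a) = rsmult N (h x) a)"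
 unfolding bimod_hom_def addmap_def by blast

lemma bhomD:
 assumes "bimod_hom M N h"
 shows "addmap M N h" "x : car M ==> h x : car N"
  "x : car M ==> y : car M ==> h (x +[M] y) = h x +[N] h y"
  "a : car alg ==> x : car M ==> h (a *[M] x) = a *[N] h x"
  "a : car alg ==> x : car M ==> h (rsmult M x a) = rsmult N (h x) a"
 using assms unfolding bimod_hom_iff addmap_def by blast+

lemma bimod_homI:
 assumes "addmap M N h" "!!a x. a : car alg ==> x : car M ==> h (a *[M] x) = a *[N] h x"
  "!!a x. a : car alg ==> x : car M ==> h (rsmult M x a) = rsmult N (h x) a"
 shows "bimod_hom M N h"
 using assms unfolding bimod_hom_iff by blast

lemma bimod_hom_comp: "bimod_hom L M h ==> bimod_hom M N k ==> bimod_hom L N (%x. k (h x))"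
 by (simp add: bimod_hom_def)

lemma bimod_hom_cong: "bimodule M ==> bimod_hom M N h ==> (!!x. x : car M ==> k x = h x) ==> bimod_hom M N k"
 unfolding bimod_hom_def by (simp add: bim_l bim_r abelian_monoid.a_closed[OF abelian_group.axioms(1)[OF bim_ab]])

lemma bim_signed:
 assumes "bimodule M" "a : car alg" "x : car M"
 shows "a *[M] signed M n x = signed M n (a *[M] x)" "rsmult M (signed M n x) a = signed M n (rsmult M x a)"
 by (rule am_signed[OF bim_ab bim_ab bim_addmap(1)] am_signed[OF bim_ab bim_ab bim_addmap(2)], (rule assms)+)+

lemma bim_neg:
 assumes "bimodule M" "a : car alg" "x : car M"
 shows "a *[M] (-[M] x) = -[M] (a *[M] x)" "rsmult M (-[M] x) a = -[M] (rsmult M x a)"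
 by (rule addmap_neg[OF bim_ab bim_ab bim_addmap(1)] addmap_neg[OF bim_ab bim_ab bim_addmap(2)], (rule assms)+)+

lemma bim_zero:
 assumes "bimodule M" "a : car alg"
 shows "a *[M] 0[M] = 0[M]" "rsmult M 0[M] a = 0[M]"
 by (rule am_zero[OF bim_ab bim_ab bim_addmap(1)] am_zero[OF bim_ab bim_ab bim_addmap(2)], (rule assms)+)+

text \<open>The last axiom of \<open>graded_bimodule\<close> couples both actions with both
  multiplications by A; it follows once each action separately is a bimodule map.\<close>

lemma graded_bimoduleI:
 assumes "!!n. bimodule (grp C n)"
  and "!!p n f. f : cochains p ==> bimod_hom (grp C n) (grp C (n + int p)) (lact C p n f)"
  and "!!p n f. f : cochains p ==> bimod_hom (grp C n) (grp C (n + int p)) (%x. ract C p n x f)"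
  and "!!p n f g x. f : cochains p ==> g : cochains p ==> x : elts C n ==>
    lact C p n (cochain_add p f g) x = lact C p n f x +[grp C (n + int p)] lact C p n g x"
  and "!!p n f g x. f : cochains p ==> g : cochains p ==> x : elts C n ==>
    ract C p n x (cochain_add p f g) = ract C p n x f +[grp C (n + int p)] ract C p n x g"
  and "!!p n c f x. f : cochains p ==> x : elts C n ==>
    lact C p n (cochain_scale p c f) x = scal c *[grp C (n + int p)] lact C p n f x"
  and "!!p n c f x. f : cochains p ==> x : elts C n ==>
    ract C p n x (cochain_scale p c f) = scal c *[grp C (n + int p)] ract C p n x f"
  and "!!n x. x : elts C n ==> lact C 0 n cochain_one x = x"
  and "!!n x. x : elts C n ==> ract C 0 n x cochain_one = x"
  and "!!p q n f g x. f : cochains p ==> g : cochains q ==> x : elts C n ==>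
    lact C (p + q) n (cup p q f g) x = lact C p (n + int q) f (lact C q n g x)"
  and "!!p q n f g x. f : cochains p ==> g : cochains q ==> x : elts C n ==>
    ract C (p + q) n x (cup p q f g) = ract C q (n + int p) (ract C p n x f) g"
  and "!!p q n f g x. f : cochains p ==> g : cochains q ==> x : elts C n ==>
    ract C q (n + int p) (lact C p n f x) g = lact C p (n + int q) f (ract C q n x g)"
 shows "graded_bimodule C"
 unfolding graded_bimodule_def
proof (intro conjI allI ballI)
 fix p q n f g x a b
 assume f: "f : cochains p" and g: "g : cochains q" and x: "x : elts C n" and a: "a : car alg" and b: "b : car alg"
 have ax: "a *[grp C n] x : elts C n" by (rule bim_l[OF assms(1) a x])
 have fx: "lact C p n f x : elts C (n + int p)" by (rule bhomD(2)[OF assms(2)[OF f] x])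
 have afx: "a *[grp C (n + int p)] lact C p n f x : elts C (n + int p)" by (rule bim_l[OF assms(1) a fx])
 show "rsmult (grp C (deg n p q)) (a *[grp C (deg n p q)] ract C q (n + int p) (lact C p n f x) g) b
    = ract C q (n + int p) (lact C p n f (rsmult (grp C n) (a *[grp C n] x) b)) g"
  by (simp add: bhomD(4,5)[OF assms(2)[OF f]] ax x a b bhomD(4,5)[OF assms(3)[OF g]] fx afx)
qed (simp_all add: assms bhomD(2,3)[OF assms(2)] bhomD(2,3)[OF assms(3)])

lemma dg_objectI:
 assumes "!!n. bimodule (grp C n)"
  and "!!p n f. f : cochains p ==> bimod_hom (grp C n) (grp C (n + int p)) (lact C p n f)"
  and "!!p n f. f : cochains p ==> bimod_hom (grp C n) (grp C (n + int p)) (%x. ract C p n x f)"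
  and "!!p n f g x. f : cochains p ==> g : cochains p ==> x : elts C n ==>
    lact C p n (cochain_add p f g) x = lact C p n f x +[grp C (n + int p)] lact C p n g x"
  and "!!p n f g x. f : cochains p ==> g : cochains p ==> x : elts C n ==>
    ract C p n x (cochain_add p f g) = ract C p n x f +[grp C (n + int p)] ract C p n x g"
  and "!!p n c f x. f : cochains p ==> x : elts C n ==>
    lact C p n (cochain_scale p c f) x = scal c *[grp C (n + int p)] lact C p n f x"
  and "!!p n c f x. f : cochains p ==> x : elts C n ==>
    ract C p n x (cochain_scale p c f) = scal c *[grp C (n + int p)] ract C p n x f"
  and "!!n x. x : elts C n ==> lact C 0 n cochain_one x = x"
  and "!!n x. x : elts C n ==> ract C 0 n x cochain_one = x"
  and "!!p q n f g x. f : cochains p ==> g : cochains q ==> x : elts C n ==>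
    lact C (p + q) n (cup p q f g) x = lact C p (n + int q) f (lact C q n g x)"
  and "!!p q n f g x. f : cochains p ==> g : cochains q ==> x : elts C n ==>
    ract C (p + q) n x (cup p q f g) = ract C q (n + int p) (ract C p n x f) g"
  and "!!p q n f g x. f : cochains p ==> g : cochains q ==> x : elts C n ==>
    ract C q (n + int p) (lact C p n f x) g = lact C p (n + int q) f (ract C q n x g)"
  and "!!n. bimod_hom (grp C n) (grp C (n + 1)) (diff C n)"
  and "!!n x. x : elts C n ==> diff C (n + 1) (diff C n x) = 0[grp C (n + 2)]"
  and "!!p n f x. f : cochains p ==> x : elts C n ==>
    diff C (n + int p) (lact C p n f x) = lact C (p + 1) n (bK p f) x +[grp C (n + int p + 1)]
    signed (grp C (n + int p + 1)) (int p) (lact C p (n + 1) f (diff C n x))"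
  and "!!p n f x. f : cochains p ==> x : elts C n ==>
    diff C (n + int p) (ract C p n x f) = ract C p (n + 1) (diff C n x) f +[grp C (n + int p + 1)]
    signed (grp C (n + int p + 1)) n (ract C (p + 1) n x (bK p f))"
 shows "dg_object C"
proof -
 have "graded_bimodule C" by (rule graded_bimoduleI; fact)
 then show ?thesis unfolding dg_object_def using assms(13-) by blast
qed

lemma bimod_hom_signed:
 assumes "bimodule N" "bimod_hom M N h" shows "bimod_hom M N (%x. signed N n (h x))"
 by (rule bimod_homI[OF am_signed_pointwise[OF bim_ab[OF assms(1)] bhomD(1)[OF assms(2)]]])
  (simp_all add: bhomD[OF assms(2)] bim_signed[OF assms(1)])

lemma bimod_hom_minus:
 assumes "bimodule N" "bimod_hom M N h" "bimod_hom M N k" shows "bimod_hom M N (%x. h x -[N] k x)"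
 by (rule bimod_homI[OF addmap_minus_pointwise[OF bim_ab[OF assms(1)] bhomD(1)[OF assms(2)] bhomD(1)[OF assms(3)]]])
  (simp_all add: bhomD[OF assms(2)] bhomD[OF assms(3)] a_minus_def bim_neg[OF assms(1)] bim_l_add[OF assms(1)]
   bim_r_add[OF assms(1)] abelian_group.a_inv_closed[OF bim_ab[OF assms(1)]])

end

locale gbo = quadratic_algebra Q R for Q :: "('v, 'e) pre_digraph" and R :: "('v, 'e, 'f::field) tens set" +
 fixes C :: "('v, 'e, 'f, 'x) qobj"
 assumes gb: "graded_bimodule C"
begin

lemmas gb1 = gb[unfolded graded_bimodule_def, THEN conjunct1]
lemmas gb2 = gb[unfolded graded_bimodule_def, THEN conjunct2, THEN conjunct1]
lemmas gb3 = gb[unfolded graded_bimodule_def, THEN conjunct2, THEN conjunct2, THEN conjunct1]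
lemmas gb4 = gb[unfolded graded_bimodule_def, THEN conjunct2, THEN conjunct2, THEN conjunct2, THEN conjunct1]
lemmas gb5 = gb[unfolded graded_bimodule_def, THEN conjunct2, THEN conjunct2, THEN conjunct2, THEN conjunct2, THEN conjunct1]
lemmas gb6 = gb[unfolded graded_bimodule_def, THEN conjunct2, THEN conjunct2, THEN conjunct2, THEN conjunct2, THEN conjunct2, THEN conjunct1]
lemmas gb7 = gb[unfolded graded_bimodule_def, THEN conjunct2, THEN conjunct2, THEN conjunct2, THEN conjunct2, THEN conjunct2, THEN conjunct2, THEN conjunct1]
lemmas gb8 = gb[unfolded graded_bimodule_def, THEN conjunct2, THEN conjunct2, THEN conjunct2, THEN conjunct2, THEN conjunct2, THEN conjunct2, THEN conjunct2]

lemma bim: "bimodule (grp C n)" using gb1 by blast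

sublocale G: abelian_group "grp C n" for n by (rule bim_ab[OF bim])

lemma lact_one: "x : elts C n ==> lact C 0 n cochain_one x = x"
 and ract_one: "x : elts C n ==> ract C 0 n x cochain_one = x"
 using gb6 by blast+

lemma lract_bim:
 assumes "f : cochains p" "g : cochains q" "x : elts C n" "a : car alg" "b : car alg"
 shows "rsmult (grp C (deg n p q)) (a *[grp C (deg n p q)] ract C q (n + int p) (lact C p n f x) g) b
    = ract C q (n + int p) (lact C p n f (rsmult (grp C n) (a *[grp C n] x) b)) g"
 using gb8 assms by blast

lemma lact_cl0: "f : cochains p ==> x : elts C n ==> lact C p n f x : elts C (n + int p)"
 and ract_cl0: "f : cochains p ==> x : elts C n ==> ract C p n x f : elts C (n + int p)"
 using gb2 by blast+

text \<open>The coupled axiom is separated by inserting the unit cochain for the other action and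
  the unit of A on one side.\<close>

lemma lact_bim:
 assumes f: "f : cochains p" and m: "m = n + int p"
 shows "bimod_hom (grp C n) (grp C m) (lact C p n f)"
 unfolding m
proof (rule bimod_homI)
 show "addmap (grp C n) (grp C (n + int p)) (lact C p n f)"
  using gb2 gb3 f by (simp add: addmap_def)
 fix a x assume a: "a : car alg" and x: "x : elts C n"
 note l = lract_bim[OF f cochain_one_closed x, simplified]
 note cl = lact_cl0[OF f x] lact_cl0[OF f bim_l[OF bim a x]] lact_cl0[OF f bim_r[OF bim a x]]
 show "lact C p n f (a *[grp C n] x) = a *[grp C (n + int p)] lact C p n f x"
  using l[OF a A.one_closed] a x cl by (simp add: ract_one bim_one bim bim_l)
 show "lact C p n f (rsmult (grp C n) x a) = rsmult (grp C (n + int p)) (lact C p n f x) a"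
  using l[OF A.one_closed a] a x cl by (simp add: ract_one bim_one bim bim_r)
qed

lemma ract_bim:
 assumes f: "f : cochains p" and m: "m = n + int p"
 shows "bimod_hom (grp C n) (grp C m) (%x. ract C p n x f)"
 unfolding m
proof (rule bimod_homI)
 show "addmap (grp C n) (grp C (n + int p)) (%x. ract C p n x f)"
  using gb2 gb3 f by (simp add: addmap_def)
 fix a x assume a: "a : car alg" and x: "x : elts C n"
 note l = lract_bim[OF cochain_one_closed f x, simplified]
 note cl = ract_cl0[OF f x] ract_cl0[OF f bim_l[OF bim a x]] ract_cl0[OF f bim_r[OF bim a x]]
 show "ract C p n (a *[grp C n] x) f = a *[grp C (n + int p)] ract C p n x f"
  using l[OF a A.one_closed] a x cl by (simp add: lact_one bim_one bim bim_l)
 show "ract C p n (rsmult (grp C n) x a) f = rsmult (grp C (n + int p)) (ract C p n x f) a"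
  using l[OF A.one_closed a] a x cl by (simp add: lact_one bim_one bim bim_r)
qed

lemma lact_cl: "f : cochains p ==> x : elts C n ==> m = n + int p ==> lact C p n f x : elts C m"
 and ract_cl: "f : cochains p ==> x : elts C n ==> m = n + int p ==> ract C p n x f : elts C m"
 by (simp_all add: lact_cl0 ract_cl0)

lemma lact_coadd: "x : elts C n ==> m = n + int p ==> addmap (cgrp p) (grp C m) (%f. lact C p n f x)"
 and ract_coadd: "x : elts C n ==> m = n + int p ==> addmap (cgrp p) (grp C m) (%f. ract C p n x f)"
 using gb2 gb4 by (simp_all add: addmap_def)

lemma lact_scale: "f : cochains p ==> x : elts C n ==> m = n + int p ==>
  lact C p n (cochain_scale p c f) x = scal c *[grp C m] lact C p n f x"
 and ract_scale: "f : cochains p ==> x : elts C n ==> m = n + int p ==>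
  ract C p n x (cochain_scale p c f) = scal c *[grp C m] ract C p n x f"
 using gb5 by simp_all

lemma lact_cup: "f : cochains p ==> g : cochains q ==> x : elts C n ==> k = p + q ==> m = n + int q ==>
  lact C k n (cup p q f g) x = lact C p m f (lact C q n g x)"
 and ract_cup: "f : cochains p ==> g : cochains q ==> x : elts C n ==> k = p + q ==> m = n + int p ==>
  ract C k n x (cup p q f g) = ract C q m (ract C p n x f) g"
 and ract_lact: "f : cochains p ==> g : cochains q ==> x : elts C n ==> m = n + int p ==> m' = n + int q ==>
  ract C q m (lact C p n f x) g = lact C p m' f (ract C q n x g)"
 using gb7 by simp_all

text \<open>For a differential of the form (-1)^n x.eps - eps.x, the equation d d = 0 and both
  Leibniz rules follow from associativity of the actions, the formula for \<open>bK\<close> as a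
  commutator and eps \<smile> eps = 0. The Koszul complex is of this kind.\<close>

lemma inner_dg_object:
 assumes d: "!!n x. x : elts C n ==>
  diff C n x = signed (grp C (n + 1)) n (ract C 1 n x eps) -[grp C (n + 1)] lact C 1 n eps x"
 shows "dg_object C"
 unfolding dg_object_def
proof (intro conjI allI ballI)
 show "graded_bimodule C" by (rule gb)
 have hom: "bimod_hom (grp C n) (grp C (n + 1)) (diff C n)" for n
  by (rule bimod_hom_cong[OF bim bimod_hom_minus[OF bim bimod_hom_signed[OF bim ract_bim[OF eps_cl]] lact_bim[OF eps_cl]]])
   (simp_all add: d)
 then show "bimod_hom (grp C n) (grp C (n + 1)) (diff C n)" for n .
 have d': "diff C n x = signed (grp C m) n (ract C 1 n x eps) -[grp C m] lact C 1 n eps x"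
  if "x : elts C n" "m = n + 1" for n m x
  using d that by simp
 note am = am_diff[OF G.ab_ax G.ab_ax] am_signed[OF G.ab_ax G.ab_ax]
 note amc = am_diff[OF ab_cgrp G.ab_ax] am_signed[OF ab_cgrp G.ab_ax]
 have ee: "cup 1 1 eps eps = 0[cgrp 2]" by (rule eps_eps)
 {
  fix n x assume x: "x : elts C n"
  let ?H = "grp C (n + 2)"
  define u where "u = ract C 1 n x eps"
  define v where "v = lact C 1 n eps x"
  have uv: "u : elts C (n + 1)" "v : elts C (n + 1)"
   unfolding u_def v_def using x eps_cl by (auto intro: lact_cl ract_cl)
  have dx: "diff C n x = signed (grp C (n + 1)) n u -[grp C (n + 1)] v" unfolding u_def v_def by (rule d[OF x])
  have "ract C 1 (n + 1) u eps = ract C 2 n x (cup 1 1 eps eps)" unfolding u_def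
   by (rule ract_cup[OF eps_cl eps_cl x, symmetric]) simp_all
  also have "... = 0[?H]" unfolding ee by (rule am_zero[OF ab_cgrp G.ab_ax ract_coadd[OF x]]) simp
  finally have 1: "ract C 1 (n + 1) u eps = 0[?H]" .
  have "lact C 1 (n + 1) eps v = lact C 2 n (cup 1 1 eps eps) x" unfolding v_def
   by (rule lact_cup[OF eps_cl eps_cl x, symmetric]) simp_all
  also have "... = 0[?H]" unfolding ee by (rule am_zero[OF ab_cgrp G.ab_ax lact_coadd[OF x]]) simp
  finally have 2: "lact C 1 (n + 1) eps v = 0[?H]" .
  \<comment> \<open>The mixed term eps.x.eps is all that survives; the two orders of the actions
    produce it with opposite signs.\<close>
  define z where "z = ract C 1 (n + 1) v eps"
  have z: "z : car ?H" unfolding z_def by (rule ract_cl[OF eps_cl uv(2)]) simp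
  have z2: "lact C 1 (n + 1) eps u = z" unfolding z_def u_def v_def by (rule ract_lact[OF eps_cl eps_cl x, symmetric]) simp_all
  have r: "ract C 1 (n + 1) (diff C n x) eps = signed ?H n 0[?H] -[?H] z"
   unfolding dx using am[OF bhomD(1)[OF ract_bim[OF eps_cl, of "n + 2" "n + 1"]]] uv 1 by (simp add: z_def)
  have l: "lact C 1 (n + 1) eps (diff C n x) = signed ?H n z -[?H] 0[?H]"
   unfolding dx using am[OF bhomD(1)[OF lact_bim[OF eps_cl, of "n + 2" "n + 1"]]] uv 2 z2 by simp
  have "diff C n x : elts C (n + 1)" using bhomD(2)[OF hom x] .
  note d'[OF this, of "n + 2"]
  then show "diff C (n + 1) (diff C n x) = 0[?H]" unfolding r l
   using G.ag_eq[of "[z]" "n + 2" "Mi (Sg (n + 1) (Mi (Sg n Zr) (V 0))) (Mi (Sg n (V 0)) Zr)" "Zr"] z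
   by (simp add: isign_add)
 }
 fix p n f x assume f: "f : cochains p" and x: "x : elts C n"
 let ?H = "grp C (n + int p + 1)"
 have dx: "diff C n x : elts C (n + 1)" using bhomD(2)[OF hom x] .
 have xe: "ract C 1 n x eps : elts C (n + 1)" "lact C 1 n eps x : elts C (n + 1)"
  using x eps_cl by (auto intro: lact_cl ract_cl)
 have xf: "ract C p n x f : elts C (n + int p)" "lact C p n f x : elts C (n + int p)"
  using x f by (auto intro: lact_cl ract_cl)
 have fc: "cup p 1 f eps : car (cgrp (p + 1))" "cup 1 p eps f : car (cgrp (p + 1))"
  using cup_cl[OF f eps_cl] cup_cl[OF eps_cl f] by (simp_all add: add.commute)
 note sc = C.signed_cl[OF fc(1), of "int p", unfolded cgrp_simps]
 {
  define a where "a = ract C 1 (n + int p) (lact C p n f x) eps"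
  define b where "b = lact C 1 (n + int p) eps (lact C p n f x)"
  define c where "c = lact C p (n + 1) f (lact C 1 n eps x)"
  have abc: "a : car ?H" "b : car ?H" "c : car ?H" unfolding a_def b_def c_def
   using xf xe f eps_cl by (auto intro: lact_cl ract_cl)
  have a2: "lact C p (n + 1) f (ract C 1 n x eps) = a" unfolding a_def
   by (rule ract_lact[OF f eps_cl x, symmetric]) simp_all
  have b2: "lact C (p + 1) n (cup 1 p eps f) x = b" unfolding b_def
   by (rule lact_cup[OF eps_cl f x]) simp_all
  have c2: "lact C (p + 1) n (cup p 1 f eps) x = c" unfolding c_def
   by (rule lact_cup[OF f eps_cl x]) simp_all
  have 1: "diff C (n + int p) (lact C p n f x) = signed ?H (n + int p) a -[?H] b"
   unfolding a_def b_def by (rule d'[OF xf(2) refl])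
  have 2: "lact C (p + 1) n (bK p f) x = signed ?H (int p) c -[?H] b"
   unfolding bK_eps[OF f] using amc[OF lact_coadd[OF x, of "n + int p + 1" "p + 1"]] fc sc by (simp add: b2 c2)
  have 3: "lact C p (n + 1) f (diff C n x) = signed ?H n a -[?H] c"
   unfolding d[OF x] using am[OF bhomD(1)[OF lact_bim[OF f, of "n + int p + 1" "n + 1"]]] xe by (simp add: a2 c_def)
  show "diff C (n + int p) (lact C p n f x) = lact C (p + 1) n (bK p f) x +[?H] signed ?H (int p) (lact C p (n + 1) f (diff C n x))"
   unfolding 1 2 3 using G.ag_eq[of "[a, b, c]" "n + int p + 1" "Mi (Sg (n + int p) (V 0)) (V 1)"
    "Pl (Mi (Sg (int p) (V 2)) (V 1)) (Sg (int p) (Mi (Sg n (V 0)) (V 2)))"] abc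
   by (simp add: isign_add less_Suc_eq)
 }
 define a where "a = ract C 1 (n + int p) (ract C p n x f) eps"
 define b where "b = lact C 1 (n + int p) eps (ract C p n x f)"
 define c where "c = ract C p (n + 1) (ract C 1 n x eps) f"
 have abc: "a : car ?H" "b : car ?H" "c : car ?H" unfolding a_def b_def c_def
  using xf xe f eps_cl by (auto intro: lact_cl ract_cl)
 have b2: "ract C p (n + 1) (lact C 1 n eps x) f = b" unfolding b_def
  by (rule ract_lact[OF eps_cl f x]) simp_all
 have a2: "ract C (p + 1) n x (cup p 1 f eps) = a" unfolding a_def
  by (rule ract_cup[OF f eps_cl x]) simp_all
 have c2: "ract C (p + 1) n x (cup 1 p eps f) = c" unfolding c_def
  by (rule ract_cup[OF eps_cl f x]) simp_all
 have 1: "diff C (n + int p) (ract C p n x f) = signed ?H (n + int p) a -[?H] b"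
  unfolding a_def b_def by (rule d'[OF xf(1) refl])
 have 2: "ract C (p + 1) n x (bK p f) = signed ?H (int p) a -[?H] c"
  unfolding bK_eps[OF f] using amc[OF ract_coadd[OF x, of "n + int p + 1" "p + 1"]] fc sc by (simp add: a2 c2)
 have 3: "ract C p (n + 1) (diff C n x) f = signed ?H n c -[?H] b"
  unfolding d[OF x] using am[OF bhomD(1)[OF ract_bim[OF f, of "n + int p + 1" "n + 1"]]] xe by (simp add: b2 c_def)
 show "diff C (n + int p) (ract C p n x f) = ract C p (n + 1) (diff C n x) f +[?H] signed ?H n (ract C (p + 1) n x (bK p f))"
  unfolding 1 2 3 using G.ag_eq[of "[a, b, c]" "n + int p + 1" "Mi (Sg (n + int p) (V 0)) (V 1)"
   "Pl (Mi (Sg n (V 2)) (V 1)) (Sg n (Mi (Sg (int p) (V 0)) (V 2)))"] abc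
  by (simp add: isign_add less_Suc_eq)
qed

end

locale dgo = quadratic_algebra Q R for Q :: "('v, 'e) pre_digraph" and R :: "('v, 'e, 'f::field) tens set" +
 fixes C :: "('v, 'e, 'f, 'x) qobj"
 assumes dg: "dg_object C"
begin

sublocale gbo Q R C
 using dg by unfold_locales (simp add: dg_object_def)

lemma diff_bim: "m = n + 1 ==> bimod_hom (grp C n) (grp C m) (diff C n)"
 using dg unfolding dg_object_def by blast

lemma diff_cl: "x : elts C n ==> m = n + 1 ==> diff C n x : elts C m"
 using bhomD(2)[OF diff_bim] .

lemma diff_diff: "x : elts C n ==> m = n + 1 ==> k = n + 2 ==> diff C m (diff C n x) = 0[grp C k]"
 using dg unfolding dg_object_def by blast

lemma diff_lact: "f : cochains p ==> x : elts C n ==> m = n + int p ==> k = n + int p + 1 ==> n' = n + 1 ==> p' = p + 1 ==>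
   diff C m (lact C p n f x) = lact C p' n (bK p f) x +[grp C k] signed (grp C k) (int p) (lact C p n' f (diff C n x))"
 and diff_ract: "f : cochains p ==> x : elts C n ==> m = n + int p ==> k = n + int p + 1 ==> n' = n + 1 ==> p' = p + 1 ==>
   diff C m (ract C p n x f) = ract C p n' (diff C n x) f +[grp C k] signed (grp C k) n (ract C p' n x (bK p f))"
 using dg unfolding dg_object_def by blast+

section \<open>The dual of a dg bimodule\<close>

lemma signed_env_mult:
 assumes "a : car env" "b : car env"
 shows "signed env n a **[env] b = signed env n (a **[env] b)" "a **[env] signed env n b = signed env n (a **[env] b)"
 using assms by (simp_all add: signed_def N.l_minus N.r_minus)

lemma dual_carrier: "u : car (dual_grp C n) \<longleftrightarrow> u : extensional (elts C (- n)) & addmap (grp C (- n)) env u &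
  (ALL a:car alg. ALL b:car alg. ALL x:elts C (- n).
    u (rsmult (grp C (- n)) (a *[grp C (- n)] x) b) = etens a b **[env] u x)"
 unfolding dual_grp_def Let_def addmap_def by auto

lemma dual_ops:
 "0[dual_grp C n] = (\<lambda>x \<in> elts C (- n). 0[env])"
 "u +[dual_grp C n] v = (\<lambda>x \<in> elts C (- n). u x +[env] v x)"
 "a *[dual_grp C n] u = (\<lambda>x \<in> elts C (- n). u x **[env] etens 1[alg] a)"
 "rsmult (dual_grp C n) u b = (\<lambda>x \<in> elts C (- n). u x **[env] etens b 1[alg])"
 by (simp_all add: dual_grp_def Let_def)

lemma dual_ext: "u : car (dual_grp C n) ==> u : extensional (elts C (- n))"
 and dual_addmap: "u : car (dual_grp C n) ==> addmap (grp C (- n)) env u"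
 by (simp_all add: dual_carrier)

lemma dual_cl: "u : car (dual_grp C n) ==> x : elts C (- n) ==> u x : car env"
 by (rule addmap_closed[OF dual_addmap])

lemma dual_equiv: "u : car (dual_grp C n) ==> x : elts C (- n) ==> a : car alg ==> b : car alg ==>
  u (rsmult (grp C (- n)) (a *[grp C (- n)] x) b) = etens a b **[env] u x"
 by (simp add: dual_carrier)

text \<open>A scalar acting on the argument comes out as right multiplication by 1 \<otimes> c,
  which is how that scalar acts on the functional itself.\<close>

lemma dual_scal:
 assumes u: "u : car (dual_grp C n)" and x: "x : elts C (- n)"
 shows "u (scal c *[grp C (- n)] x) = u x **[env] etens 1[alg] (scal c)"
 using dual_equiv[OF u x scal_cl A.one_closed] dual_cl[OF u x] x
 by (simp add: bim_one bim bim_l etens_scal_central)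

lemma dual_memI:
 assumes "!!x. x : elts C (- n) ==> u x : car env"
  "!!x y. x : elts C (- n) ==> y : elts C (- n) ==> u (x +[grp C (- n)] y) = u x +[env] u y"
  "!!a b x. a : car alg ==> b : car alg ==> x : elts C (- n) ==>
    u (rsmult (grp C (- n)) (a *[grp C (- n)] x) b) = etens a b **[env] u x"
  "D = elts C (- n)"
 shows "(\<lambda>x\<in>D. u x) : car (dual_grp C n)"
 using assms by (simp add: dual_carrier addmap_def bim_l[OF bim] bim_r[OF bim])

lemma dual_mult_right:
 assumes "u : car (dual_grp C n)" "Z : car env"
 shows "(\<lambda>x\<in>elts C (- n). u x **[env] Z) : car (dual_grp C n)"
 by (rule dual_memI) (use assms in "simp_all add: dual_cl am_add[OF dual_addmap[OF assms(1)]] N.l_distr dual_equiv N.m_assoc")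

text \<open>The differential and both actions on a dual are precompositions with bimodule maps up to
  a sign, so this statement covers them all.\<close>

lemma dual_pull:
 assumes "u : car (dual_grp C n)" "bimod_hom (grp C (- n')) (grp C (- n)) t" "D = elts C (- n')"
 shows "(\<lambda>x\<in>D. signed env k (u (t x))) : car (dual_grp C n')"
 by (rule dual_memI)
  (use assms in "simp_all add: dual_cl bhomD[OF assms(2)] am_add[OF dual_addmap[OF assms(1)]] N.signed_add dual_equiv
    signed_env_mult bim_l[OF bim]")

lemma dual_add_closed:
 assumes "u : car (dual_grp C n)" "v : car (dual_grp C n)"
 shows "u +[dual_grp C n] v : car (dual_grp C n)"
 unfolding dual_ops
 by (rule dual_memI) (use assms in "simp_all add: dual_cl am_add[OF dual_addmap[OF assms(1)]] am_add[OF dual_addmap[OF assms(2)]]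
  N.r_distr dual_equiv N.a_ac")

lemma dual_abelian: "abelian_group (dual_grp C n)"
proof (rule fun_abelian_group[where D = "elts C (- n)" and H = "%_. env"])
 show "0[dual_grp C n] : car (dual_grp C n)"
  unfolding dual_ops by (rule dual_memI) simp_all
 fix u assume u: "u : car (dual_grp C n)"
 show "(\<lambda>x\<in>elts C (- n). -[env] u x) : car (dual_grp C n)"
  by (rule dual_memI) (use u in "simp_all add: dual_cl am_add[OF dual_addmap[OF u]] dual_equiv N.minus_add N.r_minus")
qed (auto simp: dual_ops dual_ext dual_cl dual_add_closed[unfolded dual_ops] N.ab_ax)

lemma dual_eval: "x : elts C (- n) ==> addmap (dual_grp C n) env (%u. u x)"
 by (simp add: addmap_def dual_cl dual_ops)

lemma dual_bimodule: "bimodule (dual_grp C n)"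
 unfolding bimodule_def
proof (intro conjI ballI allI)
 fix a u v assume a: "a : car alg" and u: "u : car (dual_grp C n)"
 show "a *[dual_grp C n] u : car (dual_grp C n)" "rsmult (dual_grp C n) u a : car (dual_grp C n)"
  unfolding dual_ops using a u by (auto intro: dual_mult_right)
 assume v: "v : car (dual_grp C n)"
 show "a *[dual_grp C n] (u +[dual_grp C n] v) = a *[dual_grp C n] u +[dual_grp C n] a *[dual_grp C n] v"
  "rsmult (dual_grp C n) (u +[dual_grp C n] v) a = rsmult (dual_grp C n) u a +[dual_grp C n] rsmult (dual_grp C n) v a"
  unfolding dual_ops by (rule rext, use a u v in "simp add: N.l_distr dual_cl")+
next
 fix a b u assume ab: "a : car alg" "b : car alg" and u: "u : car (dual_grp C n)"
 show "(a +[alg] b) *[dual_grp C n] u = a *[dual_grp C n] u +[dual_grp C n] b *[dual_grp C n] u"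
  "rsmult (dual_grp C n) u (a +[alg] b) = rsmult (dual_grp C n) u a +[dual_grp C n] rsmult (dual_grp C n) u b"
  "(a ** b) *[dual_grp C n] u = a *[dual_grp C n] (b *[dual_grp C n] u)"
  "rsmult (dual_grp C n) u (a ** b) = rsmult (dual_grp C n) (rsmult (dual_grp C n) u a) b"
  "rsmult (dual_grp C n) (a *[dual_grp C n] u) b = a *[dual_grp C n] (rsmult (dual_grp C n) u b)"
  unfolding dual_ops
  by (rule rext, use ab u in "simp add: N.r_distr dual_cl etens_add_left etens_add_right N.m_assoc etens_mult")+
next
 fix u assume u: "u : car (dual_grp C n)"
 show "1[alg] *[dual_grp C n] u = u" "rsmult (dual_grp C n) u 1[alg] = u"
  unfolding dual_ops by (rule extensionalityI[OF restrict_extensional dual_ext[OF u]], use u in "simp add: env_one[symmetric] dual_cl")+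
 show "scal c *[dual_grp C n] u = rsmult (dual_grp C n) u (scal c)" for c
  unfolding dual_ops by (rule rext) (use u in "simp add: etens_scal_central dual_cl")
qed (rule dual_abelian)

lemma Hom_simps:
 "grp (Hom_Ae C) = dual_grp C"
 "diff (Hom_Ae C) n u = (\<lambda>x \<in> car (grp C (- (n + 1))). -[env] signed env n (u (diff C (- (n + 1)) x)))"
 "lact (Hom_Ae C) p n f u = (\<lambda>x \<in> car (grp C (- (n + int p))). signed env (int p) (u (ract C p (- (n + int p)) x f)))"
 "ract (Hom_Ae C) p n u f = (\<lambda>x \<in> car (grp C (- (n + int p))). u (lact C p (- (n + int p)) f x))"
 by (simp_all add: Hom_Ae_def)

lemma pull_bimod_hom:
 assumes t: "bimod_hom (grp C (- n')) (grp C (- n)) t"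
 shows "bimod_hom (dual_grp C n) (dual_grp C n') (%u. \<lambda>x \<in> elts C (- n'). signed env k (u (t x)))"
proof (rule bimod_homI[OF addmapI])
 note tc = bhomD(2)[OF t]
 fix u v assume u: "u : car (dual_grp C n)"
 show "(\<lambda>x \<in> elts C (- n'). signed env k (u (t x))) : car (dual_grp C n')"
  by (rule dual_pull[OF u t refl])
 show "v : car (dual_grp C n) ==> (\<lambda>x \<in> elts C (- n'). signed env k ((u +[dual_grp C n] v) (t x))) =
  (\<lambda>x \<in> elts C (- n'). signed env k (u (t x))) +[dual_grp C n'] (\<lambda>x \<in> elts C (- n'). signed env k (v (t x)))"
  unfolding dual_ops by (rule rext) (use u in "simp add: tc dual_cl N.signed_add")
 fix a assume a: "a : car alg"
 show "(\<lambda>x \<in> elts C (- n'). signed env k ((a *[dual_grp C n] u) (t x))) =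
   a *[dual_grp C n'] (\<lambda>x \<in> elts C (- n'). signed env k (u (t x)))"
  unfolding dual_ops by (rule rext) (use u a in "simp add: tc dual_cl signed_env_mult")
 show "(\<lambda>x \<in> elts C (- n'). signed env k ((rsmult (dual_grp C n) u a) (t x))) =
   rsmult (dual_grp C n') (\<lambda>x \<in> elts C (- n'). signed env k (u (t x))) a"
  unfolding dual_ops by (rule rext) (use u a in "simp add: tc dual_cl signed_env_mult")
qed

lemma neg_signed: "x : car env ==> -[env] signed env n x = signed env (n + 1) x"
 by (simp add: signed_def)

text \<open>The two signs of the definition are merged: -(-1)^n = (-1)^(n+1).\<close>

lemma Hom_diff:
 assumes "u : car (dual_grp C n)"
 shows "diff (Hom_Ae C) n u = (\<lambda>x \<in> car (grp C (- (n + 1))). signed env (n + 1) (u (diff C (- (n + 1)) x)))"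
 unfolding Hom_simps by (rule rext) (simp add: neg_signed dual_cl[OF assms] diff_cl)

lemma Hom_ract:
 "ract (Hom_Ae C) p n u f = (\<lambda>x \<in> car (grp C (- (n + int p))). signed env 0 (u (lact C p (- (n + int p)) f x)))"
 unfolding Hom_simps by (simp add: N.signed_even)

theorem dg_object_Hom_Ae: "dg_object (Hom_Ae C)"
proof (rule dg_objectI)
 show "bimodule (grp (Hom_Ae C) n)" for n by (simp add: Hom_simps dual_bimodule)
 show "bimod_hom (grp (Hom_Ae C) n) (grp (Hom_Ae C) (n + int p)) (lact (Hom_Ae C) p n f)" if "f : cochains p" for p n f
  unfolding Hom_simps(1,3)[abs_def] by (intro pull_bimod_hom ract_bim that) simp
 show "bimod_hom (grp (Hom_Ae C) n) (grp (Hom_Ae C) (n + int p)) (%u. ract (Hom_Ae C) p n u f)" if "f : cochains p" for p n f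
  unfolding Hom_simps(1) Hom_ract by (intro pull_bimod_hom lact_bim that) simp
 show "bimod_hom (grp (Hom_Ae C) n) (grp (Hom_Ae C) (n + 1)) (diff (Hom_Ae C) n)" for n
  unfolding Hom_simps(1)
  by (rule bimod_hom_cong[OF dual_bimodule pull_bimod_hom[of "n + 1" n "diff C (- (n + 1))" "n + 1"]])
   (simp_all add: Hom_diff diff_bim)
next
 fix p n f g u assume f: "f : cochains p" and g: "g : cochains p" and "u : elts (Hom_Ae C) n"
 then have u: "u : car (dual_grp C n)" by (simp add: Hom_simps)
 \<comment> \<open>A functional in degree n + p of the dual has its arguments in degree m, and the
   action of a p-cochain leads from there to degree -n, where \<open>u\<close> is defined.\<close>
 define m where "m = - (n + int p)"
 have m: "- n = m + int p" by (simp add: m_def)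
 note uc = dual_cl[OF u, unfolded m] and ua = am_add[OF dual_addmap[OF u], unfolded m]
 show "lact (Hom_Ae C) p n (cochain_add p f g) u = lact (Hom_Ae C) p n f u +[grp (Hom_Ae C) (n + int p)] lact (Hom_Ae C) p n g u"
  unfolding Hom_simps dual_ops m_def[symmetric]
  by (rule rext) (use f g am_add[OF ract_coadd[OF _ refl]] in "simp add: uc ua ract_cl N.signed_add")
 show "ract (Hom_Ae C) p n u (cochain_add p f g) = ract (Hom_Ae C) p n u f +[grp (Hom_Ae C) (n + int p)] ract (Hom_Ae C) p n u g"
  unfolding Hom_simps dual_ops m_def[symmetric]
  by (rule rext) (use f g am_add[OF lact_coadd[OF _ refl]] in "simp add: uc ua lact_cl")
next
 fix p n c f u assume f: "f : cochains p" and "u : elts (Hom_Ae C) n"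
 then have u: "u : car (dual_grp C n)" by (simp add: Hom_simps)
 define m where "m = - (n + int p)"
 have m: "- n = m + int p" by (simp add: m_def)
 note uc = dual_cl[OF u, unfolded m] and us = dual_scal[OF u, unfolded m]
 show "lact (Hom_Ae C) p n (cochain_scale p c f) u = scal c *[grp (Hom_Ae C) (n + int p)] lact (Hom_Ae C) p n f u"
  unfolding Hom_simps dual_ops m_def[symmetric]
  by (rule rext) (use f in "simp add: uc us ract_cl signed_env_mult ract_scale[OF _ _ refl]")
 show "ract (Hom_Ae C) p n u (cochain_scale p c f) = scal c *[grp (Hom_Ae C) (n + int p)] ract (Hom_Ae C) p n u f"
  unfolding Hom_simps dual_ops m_def[symmetric]
  by (rule rext) (use f in "simp add: uc us lact_cl lact_scale[OF _ _ refl]")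
next
 fix n u assume "u : elts (Hom_Ae C) n"
 then have u: "u : car (dual_grp C n)" by (simp add: Hom_simps)
 show "lact (Hom_Ae C) 0 n cochain_one u = u" "ract (Hom_Ae C) 0 n u cochain_one = u"
  unfolding Hom_simps by (rule extensionalityI[OF restrict_extensional], use u dual_ext[OF u] in "simp_all add: ract_one lact_one N.signed_even")+
 define m where "m = - (n + 2)"
 have m: "- (n + 1) = m + 1" "- (n + 1 + 1) = m" "- n = m + 2" by (simp_all add: m_def)
 have du: "diff (Hom_Ae C) n u : car (dual_grp C (n + 1))"
  unfolding Hom_diff[OF u] by (rule dual_pull[OF u diff_bim]) simp_all
 show "diff (Hom_Ae C) (n + 1) (diff (Hom_Ae C) n u) = 0[grp (Hom_Ae C) (n + 2)]"
  unfolding Hom_diff[OF du] unfolding Hom_diff[OF u] unfolding Hom_simps(1) dual_ops m m_def[symmetric]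
  by (rule rext) (use am_zero[OF G.ab_ax N.ab_ax dual_addmap[OF u]] in
   "simp add: diff_cl m diff_diff[OF _ refl refl]")
next
 fix p q n f g u assume f: "f : cochains p" and g: "g : cochains q" and "u : elts (Hom_Ae C) n"
 then have u: "u : car (dual_grp C n)" by (simp add: Hom_simps)
 define m where "m = - (n + int (p + q))"
 have m: "- (n + int q) = m + int p" "- (n + int p) = m + int q" "- (n + int q + int p) = m" "- (deg n p q) = m" "- n = m + int p + int q"
  by (simp_all add: m_def)
 have m': "m + int p + int q = m + int q + int p" by simp
 note uc = dual_cl[OF u, unfolded m]
 show "lact (Hom_Ae C) (p + q) n (cup p q f g) u = lact (Hom_Ae C) p (n + int q) f (lact (Hom_Ae C) q n g u)"
  unfolding Hom_simps m m_def[symmetric]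
  by (rule rext) (use f g in "simp add: ract_cl0 ract_cup[OF f g _ refl refl] uc N.signed_signed")
 show "ract (Hom_Ae C) (p + q) n u (cup p q f g) = ract (Hom_Ae C) q (n + int p) (ract (Hom_Ae C) p n u f) g"
  unfolding Hom_simps m m_def[symmetric]
  by (rule rext) (use f g in "simp add: lact_cl0 lact_cup[OF f g _ refl refl]")
 \<comment> \<open>Dualising exchanges the sides: the left action on the dual comes from the right
   action on C and conversely. Hence \<open>ract_lact\<close> is used with \<open>f\<close> and
   \<open>g\<close> interchanged.\<close>
 show "ract (Hom_Ae C) q (n + int p) (lact (Hom_Ae C) p n f u) g = lact (Hom_Ae C) p (n + int q) f (ract (Hom_Ae C) q n u g)"
  unfolding Hom_simps m m_def[symmetric]
  by (rule rext) (use f g in "simp add: lact_cl0 ract_cl0 ract_lact[OF g f _ refl refl]")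
next
 fix p n f u assume f: "f : cochains p" and "u : elts (Hom_Ae C) n"
 then have u: "u : car (dual_grp C n)" by (simp add: Hom_simps)
 have fu: "lact (Hom_Ae C) p n f u : car (dual_grp C (n + int p))"
  unfolding Hom_simps by (rule dual_pull[OF u ract_bim[OF f] refl]) simp
 have uf: "ract (Hom_Ae C) p n u f : car (dual_grp C (n + int p))"
  unfolding Hom_ract by (rule dual_pull[OF u lact_bim[OF f] refl]) simp
 have du: "diff (Hom_Ae C) n u : car (dual_grp C (n + 1))"
  unfolding Hom_diff[OF u] by (rule dual_pull[OF u diff_bim]) simp_all
 have e: "- (n + 1 + int p) = - (n + int p + 1)" "- (n + int (p + 1)) = - (n + int p + 1)" by simp_all
 have fdu: "lact (Hom_Ae C) p (n + 1) f (diff (Hom_Ae C) n u) : car (dual_grp C (n + int p + 1))"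
  unfolding Hom_simps(3) e by (rule dual_pull[OF du ract_bim[OF f]]) simp_all
 have ubf: "ract (Hom_Ae C) (p + 1) n u (bK p f) : car (dual_grp C (n + int p + 1))"
  unfolding Hom_ract e by (rule dual_pull[OF u lact_bim[OF bK_closed[OF f]]]) simp_all
 define m where "m = - (n + int p + 1)"
 have m: "- (n + int p) = m + 1" "- (n + 1) = m + int p" "- (n + 1 + int p) = m" "- (n + int (p + 1)) = m" "- n = m + int p + 1" "- n = m + 1 + int p"
  "- n = m + int (p + 1)"
  by (simp_all add: m_def)
 note uc1 = dual_cl[OF u, unfolded m(5)] and uc2 = dual_cl[OF u, unfolded m(6)] and uc3 = dual_cl[OF u, unfolded m(7)]
  and ua = am_add[OF dual_addmap[OF u], unfolded m(5)] and us = am_signed[OF G.ab_ax N.ab_ax dual_addmap[OF u], unfolded m(5)]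
 note ds = am_signed[OF dual_abelian N.ab_ax dual_eval, unfolded m_def[symmetric]]
 have sg: "(signed (dual_grp C (n + int p + 1)) k v) x = signed env k (v x)" if "v : car (dual_grp C (n + int p + 1))" "x : elts C m" for k v x
  using am_signed[OF dual_abelian N.ab_ax dual_eval that(1)] that(2) by (simp add: m_def)
 show "diff (Hom_Ae C) (n + int p) (lact (Hom_Ae C) p n f u) = lact (Hom_Ae C) (p + 1) n (bK p f) u +[grp (Hom_Ae C) (n + int p + 1)]
    signed (grp (Hom_Ae C) (n + int p + 1)) (int p) (lact (Hom_Ae C) p (n + 1) f (diff (Hom_Ae C) n u))"
  unfolding Hom_diff[OF fu] unfolding Hom_simps(1) dual_ops m_def[symmetric]
 proof (rule rext)
  fix x assume x: "x : elts C m"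
  have dx: "diff C m x : elts C (m + 1)" using x by (simp add: diff_cl)
  have xf: "ract C p m x f : elts C (m + int p)" using x f by (simp add: ract_cl)
  have bf: "ract C (p + 1) m x (bK p f) : elts C (m + int p + 1)" using ract_cl[OF bK_closed[OF f] x, of "m + int p + 1"] by simp
  have dxf: "ract C p (m + 1) (diff C m x) f : elts C (m + int p + 1)" using ract_cl[OF f dx, of "m + int p + 1"] by simp
  \<comment> \<open>For the same reason the left Leibniz rule of the dual comes from the right
    Leibniz rule of C.\<close>
  have d: "diff C (m + int p) (ract C p m x f) = ract C p (m + 1) (diff C m x) f +[grp C (m + int p + 1)]
    signed (grp C (m + int p + 1)) m (ract C (p + 1) m x (bK p f))"
   by (rule diff_ract[OF f x]) simp_all
  define y where "y = u (ract C p (m + 1) (diff C m x) f)"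
  define z where "z = u (ract C (p + 1) m x (bK p f))"
  have yz: "y : car env" "z : car env" unfolding y_def z_def using uc1 bf dxf by auto
  have 1: "lact (Hom_Ae C) p (n + 1) f (diff (Hom_Ae C) n u) x = signed env (int p) (signed env (n + 1) (y +[env] signed env m z))"
   unfolding Hom_diff[OF u] Hom_simps(3,4) m using x xf by (simp add: d y_def z_def ua us dxf bf G.signed_cl)
  have 2: "lact (Hom_Ae C) (p + 1) n (bK p f) u x = signed env (int (p + 1)) z"
   unfolding Hom_simps m using x by (simp add: z_def)
  have 3: "lact (Hom_Ae C) p n f u (diff C m x) = signed env (int p) y"
   unfolding Hom_simps m using dx by (simp add: y_def)
  show "signed env (n + int p + 1) (lact (Hom_Ae C) p n f u (diff C m x)) = lact (Hom_Ae C) (p + 1) n (bK p f) u x +[env]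
    (signed (dual_grp C (n + int p + 1)) (int p) (lact (Hom_Ae C) p (n + 1) f (diff (Hom_Ae C) n u))) x"
   unfolding sg[OF fdu x] 1 2 3
   using N.ag_eq[of "[y, z]" "Sg (n + int p + 1) (Sg (int p) (V 0))"
    "Pl (Sg (int (p + 1)) (V 1)) (Sg (int p) (Sg (int p) (Sg (n + 1) (Pl (V 0) (Sg m (V 1))))))"] yz
   by (simp add: isign_add less_Suc_eq m_def isign_diff)
 qed
 show "diff (Hom_Ae C) (n + int p) (ract (Hom_Ae C) p n u f) = ract (Hom_Ae C) p (n + 1) (diff (Hom_Ae C) n u) f +[grp (Hom_Ae C) (n + int p + 1)]
    signed (grp (Hom_Ae C) (n + int p + 1)) n (ract (Hom_Ae C) (p + 1) n u (bK p f))"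
  unfolding Hom_diff[OF uf] unfolding Hom_simps(1) dual_ops m_def[symmetric]
 proof (rule rext)
  fix x assume x: "x : elts C m"
  have dx: "diff C m x : elts C (m + 1)" using x by (simp add: diff_cl)
  have xf: "lact C p m f x : elts C (m + int p)" using x f by (simp add: lact_cl)
  have bf: "lact C (p + 1) m (bK p f) x : elts C (m + int p + 1)" using lact_cl[OF bK_closed[OF f] x, of "m + int p + 1"] by simp
  have dxf: "lact C p (m + 1) f (diff C m x) : elts C (m + int p + 1)" using lact_cl[OF f dx, of "m + int p + 1"] by simp
  have d: "diff C (m + int p) (lact C p m f x) = lact C (p + 1) m (bK p f) x +[grp C (m + int p + 1)]
    signed (grp C (m + int p + 1)) (int p) (lact C p (m + 1) f (diff C m x))"
   by (rule diff_lact[OF f x]) simp_all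
  define y where "y = u (lact C p (m + 1) f (diff C m x))"
  define z where "z = u (lact C (p + 1) m (bK p f) x)"
  have yz: "y : car env" "z : car env" unfolding y_def z_def using uc1 bf dxf by auto
  have 1: "ract (Hom_Ae C) p (n + 1) (diff (Hom_Ae C) n u) f x = signed env (n + 1) (z +[env] signed env (int p) y)"
   unfolding Hom_diff[OF u] Hom_simps(3,4) m using x xf by (simp add: d y_def z_def ua us dxf bf G.signed_cl)
  have 2: "ract (Hom_Ae C) (p + 1) n u (bK p f) x = z"
   unfolding Hom_simps m using x by (simp add: z_def)
  have 3: "ract (Hom_Ae C) p n u f (diff C m x) = y"
   unfolding Hom_simps m using dx by (simp add: y_def)
  show "signed env (n + int p + 1) (ract (Hom_Ae C) p n u f (diff C m x)) = ract (Hom_Ae C) p (n + 1) (diff (Hom_Ae C) n u) f x +[env]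
    (signed (dual_grp C (n + int p + 1)) n (ract (Hom_Ae C) (p + 1) n u (bK p f))) x"
   unfolding sg[OF ubf x] 1 2 3
   using N.ag_eq[of "[y, z]" "Sg (n + int p + 1) (V 0)"
    "Pl (Sg (n + 1) (Pl (V 1) (Sg (int p) (V 0)))) (Sg n (V 1))"] yz
   by (simp add: isign_add less_Suc_eq)
 qed
qed

end

section \<open>The Koszul bimodule complex\<close>

context quadratic_algebra
begin

definition kos_gens :: "int => (('v, 'e, 'f) qalg \<times> ('v, 'e, 'f) tens \<times> ('v, 'e, 'f) qalg \<Rightarrow>\<^sub>0 int) set" where
 "kos_gens n = {frag_of (a +[alg] a', x, b) - frag_of (a, x, b) - frag_of (a', x, b) | a a' x b.
    a : car alg & a' : car alg & x : Wc n & b : car alg} \<union>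
   {frag_of (a, x + x', b) - frag_of (a, x, b) - frag_of (a, x', b) | a x x' b.
    a : car alg & x : Wc n & x' : Wc n & b : car alg} \<union>
   {frag_of (a, x, b +[alg] b') - frag_of (a, x, b) - frag_of (a, x, b') | a x b b'.
    a : car alg & x : Wc n & b : car alg & b' : car alg} \<union>
   {frag_of (a ** proj c, x, b) - frag_of (a, tmult Q c x, b) | a c x b.
    a : car alg & c : tpower Q 0 & x : Wc n & b : car alg} \<union>
   {frag_of (a, tmult Q x c, b) - frag_of (a, x, proj c ** b) | a c x b.
    a : car alg & c : tpower Q 0 & x : Wc n & b : car alg}"

abbreviation "AWA n \<equiv> car alg \<times> Wc n \<times> car alg"

lemma Wc_W [simp]: "Wc (- int q) = W q"
 by (simp add: Wc_def)

lemma Wc_pos: "n > 0 ==> Wc n = {0}"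
 by (simp add: Wc_def)

lemma Wc_add: "x : Wc n ==> y : Wc n ==> x + y : Wc n"
 and Wc_left: "c : tpower Q 0 ==> x : Wc n ==> tmult Q c x : Wc n"
 and Wc_right: "c : tpower Q 0 ==> x : Wc n ==> tmult Q x c : Wc n"
 and Wc_zero [simp]: "0 : Wc n"
 by (auto simp: Wc_def W_add W_left W_right split: if_splits)

sublocale K: free_quot "AWA n" "kos_gens n" for n
proof
 fix s assume "s : kos_gens n"
 then show "supp s <= AWA n"
  unfolding kos_gens_def by (elim UnE CollectE exE conjE) (simp_all add: keys_diff3 Wc_add Wc_left Wc_right)
qed

lemma K_H: "K.H n = kos_rels n"
 unfolding K.H_def unfolding kos_rels_def kos_gens_def kos_free_def ..

lemma K_cl: "K.cl n x = kos_rels n #>\<^bsub>kos_free n\<^esub> x"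
 by (simp add: K.cl_def K_H kos_free_def)

lemma kos_add_monoid: "same_addgrp (K.quot n) (kos_grp n)"
 by (simp add: same_addgrp_def quotrec_def kos_grp_def K_H kos_free_def)

lemmas kos_same = same_add[OF kos_add_monoid]

lemma ab_kos: "abelian_group (kos_grp n)"
 by (rule abelian_group_cong[OF kos_add_monoid K.abelian_group_quot])

sublocale KG: abelian_group "kos_grp n" for n by (rule ab_kos)

definition ktens :: "int => ('v, 'e, 'f) qalg => ('v, 'e, 'f) tens => ('v, 'e, 'f) qalg => ('v, 'e, 'f) koszul_chain" where
 "ktens n a x b = K.cl n (frag_of (a, x, b))"

text \<open>The maps on triples that induce homomorphisms on A \<otimes>_k W \<otimes>_k A: additive
  in each argument and balanced over k on both sides of W.\<close>

definition kbal :: "int => ('x, 'm) ring_scheme => (('v, 'e, 'f) qalg => ('v, 'e, 'f) tens => ('v, 'e, 'f) qalg => 'x) => bool" where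
 "kbal n M t \<longleftrightarrow>
  (ALL x:Wc n. ALL b:car alg. addmap alg M (%a. t a x b)) &
  (ALL a:car alg. ALL x:Wc n. addmap alg M (%b. t a x b)) &
  (ALL a:car alg. ALL x:Wc n. ALL y:Wc n. ALL b:car alg. t a (x + y) b = t a x b +[M] t a y b) &
  (ALL a:car alg. ALL x:Wc n. ALL b:car alg. ALL c:tpower Q 0. t (a ** proj c) x b = t a (tmult Q c x) b) &
  (ALL a:car alg. ALL x:Wc n. ALL b:car alg. ALL c:tpower Q 0. t a (tmult Q x c) b = t a x (proj c ** b))"

lemma kbalI:
 assumes "!!x b. x : Wc n ==> b : car alg ==> addmap alg M (%a. t a x b)"
  "!!a x. a : car alg ==> x : Wc n ==> addmap alg M (%b. t a x b)"
  "!!a x y b. a : car alg ==> x : Wc n ==> y : Wc n ==> b : car alg ==> t a (x + y) b = t a x b +[M] t a y b"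
  "!!a x b c. a : car alg ==> x : Wc n ==> b : car alg ==> c : tpower Q 0 ==> t (a ** proj c) x b = t a (tmult Q c x) b"
  "!!a x b c. a : car alg ==> x : Wc n ==> b : car alg ==> c : tpower Q 0 ==> t a (tmult Q x c) b = t a x (proj c ** b)"
 shows "kbal n M t"
 using assms by (simp add: kbal_def)

lemma kbalD:
 assumes "kbal n M t"
 shows "x : Wc n ==> b : car alg ==> addmap alg M (%a. t a x b)"
  "a : car alg ==> x : Wc n ==> addmap alg M (%b. t a x b)"
  "a : car alg ==> x : Wc n ==> y : Wc n ==> b : car alg ==> t a (x + y) b = t a x b +[M] t a y b"
  "a : car alg ==> x : Wc n ==> b : car alg ==> c : tpower Q 0 ==> t (a ** proj c) x b = t a (tmult Q c x) b"
  "a : car alg ==> x : Wc n ==> b : car alg ==> c : tpower Q 0 ==> t a (tmult Q x c) b = t a x (proj c ** b)"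
 using assms by (simp_all add: kbal_def)

lemma kbal_closed: "kbal n M t ==> a : car alg ==> x : Wc n ==> b : car alg ==> t a x b : car M"
 using addmap_closed[OF kbalD(1)] .

lemma kbal_addmap_x: "kbal (- int q) M t ==> a : car alg ==> b : car alg ==> Wadd q M (%x. t a x b)"
 using kbal_closed[of "- int q" M t] kbalD(3)[of "- int q" M t] by (simp add: Wadd_def)

lemma kbal_signed: "abelian_group M ==> kbal n M t ==> kbal n M (%a x b. signed M k (t a x b))"
 by (rule kbalI) (simp_all add: kbalD am_signed_pointwise abelian_group.signed_add kbal_closed)

lemma kbal_add:
 assumes M: "abelian_group M" and t: "kbal n M t" and u: "kbal n M u"
 shows "kbal n M (%a x b. t a x b +[M] u a x b)"
proof -
 interpret M: abelian_group M by fact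
 show ?thesis
  by (rule kbalI) (simp_all add: kbalD[OF t] kbalD[OF u] am_add_pointwise M kbal_closed[OF t] kbal_closed[OF u] M.a_ac)
qed

lemma ktens_closed [simp, intro]: "a : car alg ==> x : Wc n ==> b : car alg ==> ktens n a x b : car (kos_grp n)"
 unfolding ktens_def kos_same(1)[symmetric] by (rule K.cl_closed) simp

lemma K_rel3:
 assumes "frag_of x - frag_of y - frag_of z : kos_gens n" "x : AWA n" "y : AWA n" "z : AWA n"
 shows "K.cl n (frag_of x) = K.cl n (frag_of y) +[kos_grp n] K.cl n (frag_of z)"
proof -
 have k: "supp (frag_of x) <= AWA n" "supp (frag_of y + frag_of z) <= AWA n"
  "supp (frag_of y) <= AWA n" "supp (frag_of z) <= AWA n"
  using assms keys_add[of "frag_of y" "frag_of z"] by auto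
 have "frag_of x - (frag_of y + frag_of z) : K.H n"
  using assms(1) unfolding K.H_def by (intro generate.incl) (simp add: algebra_simps)
 then have "K.cl n (frag_of x) = K.cl n (frag_of y + frag_of z)" using K.cl_eq_iff k by blast
 then show ?thesis using K.cl_add[OF k(3,4)] by (simp add: kos_same(3))
qed

lemma K_rel2:
 assumes "frag_of x - frag_of y : kos_gens n" "x : AWA n" "y : AWA n"
 shows "K.cl n (frag_of x) = K.cl n (frag_of y)"
 using K.cl_eq_iff[of "frag_of x" n "frag_of y"] assms generate.incl[OF assms(1), of "K.FG n"] by (simp add: K.H_def)

lemma kbal_ktens: "kbal n (kos_grp n) (ktens n)"
proof (rule kbalI; (intro addmapI)?)
 fix a a' x b assume "x : Wc n" "b : car alg" "a : car alg" "a' : car alg"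
 then show "ktens n (a +[alg] a') x b = ktens n a x b +[kos_grp n] ktens n a' x b"
  unfolding ktens_def by (intro K_rel3) (simp_all, unfold kos_gens_def, blast)
next
 fix a x b b' assume "a : car alg" "x : Wc n" "b : car alg" "b' : car alg"
 then show "ktens n a x (b +[alg] b') = ktens n a x b +[kos_grp n] ktens n a x b'"
  unfolding ktens_def by (intro K_rel3) (simp_all, unfold kos_gens_def, blast)
next
 fix a x y b assume "a : car alg" "x : Wc n" "y : Wc n" "b : car alg"
 then show "ktens n a (x + y) b = ktens n a x b +[kos_grp n] ktens n a y b"
  unfolding ktens_def by (intro K_rel3) (simp_all add: Wc_add, unfold kos_gens_def, blast)
next
 fix a x b and c :: "('v, 'e, 'f) tens" assume "a : car alg" "x : Wc n" "b : car alg" "c : tpower Q 0"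
 then show "ktens n (a ** proj c) x b = ktens n a (tmult Q c x) b"
  "ktens n a (tmult Q x c) b = ktens n a x (proj c ** b)"
  unfolding ktens_def by (intro K_rel2; simp add: Wc_left Wc_right; unfold kos_gens_def; blast)+
qed simp_all

lemma kos_am_eqI:
 assumes "abelian_group M" "addmap (kos_grp n) M h" "addmap (kos_grp n) M k"
  and "!!a x b. a : car alg ==> x : Wc n ==> b : car alg ==> h (ktens n a x b) = k (ktens n a x b)" "X : car (kos_grp n)"
 shows "h X = k X"
 by (rule K.addmap_eqI[OF assms(1)])
  (use assms(2-5) in "auto simp: addmap_cong[OF kos_add_monoid] kos_same(1) ktens_def")

text \<open>Stated for any \<open>h\<close> on the free group that respects differences and
  restricts to \<open>t\<close>. It thus serves the abstract extension in \<open>kos_lift\<close> as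
  well as the explicit one in \<open>kos_map_tens\<close>.\<close>

lemma kbal_gens:
 assumes M: "abelian_group M" and t: "kbal n M t" and s: "s : kos_gens n"
  and h: "!!c d. supp c <= AWA n ==> supp d <= AWA n ==> h (c - d) = h c -[M] h d"
   "!!a x b. a : car alg ==> x : Wc n ==> b : car alg ==> h (frag_of (a, x, b)) = t a x b"
 shows "h s = 0[M]"
proof -
 interpret M: abelian_group M by fact
 have 3: "h (frag_of p - frag_of q - frag_of r) = 0[M]"
  if "p : AWA n" "q : AWA n" "r : AWA n" "h (frag_of p) = h (frag_of q) +[M] h (frag_of r)"
   "h (frag_of q) : car M" "h (frag_of r) : car M" for p q r
  using that h(1)[OF keys_diff3, of "frag_of p" "frag_of q" "frag_of r"] h(1)[of "frag_of p" "frag_of q"]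
   M.ag_eq[of "[h (frag_of q), h (frag_of r)]" "Mi (Mi (Pl (V 0) (V 1)) (V 0)) (V 1)" Zr]
  by (simp add: less_Suc_eq)
 have 2: "h (frag_of p - frag_of q) = 0[M]"
  if "p : AWA n" "q : AWA n" "h (frag_of p) = h (frag_of q)" "h (frag_of q) : car M" for p q
  using that h(1)[of "frag_of p" "frag_of q"] by (simp add: a_minus_def M.r_neg)
 note tc = kbal_closed[OF t]
 show ?thesis using s[unfolded kos_gens_def]
  by (elim UnE CollectE exE conjE; simp only:)
   (rule 3 2; simp add: h(2) tc kbalD(3-5)[OF t] am_add[OF kbalD(1)[OF t]] am_add[OF kbalD(2)[OF t]] Wc_add Wc_left Wc_right)+
qed

text \<open>The universal property of A \<otimes>_k W \<otimes>_k A for balanced maps.\<close>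

lemma kos_lift:
 assumes M: "abelian_group M" and t: "kbal n M t"
 obtains ph where "addmap (kos_grp n) M ph" "!!a x b. a : car alg ==> x : Wc n ==> b : car alg ==> ph (ktens n a x b) = t a x b"
proof (rule K.universal[OF M, of n "%(a, x, b). t a x b"])
 show "b : AWA n ==> (case b of (a, x, b) => t a x b) : car M" for b using kbal_closed[OF t] by auto
 fix h :: "_ => 'a" and s assume "s : kos_gens n" "!!c d. supp c <= AWA n ==> supp d <= AWA n ==> h (c - d) = h c -[M] h d"
  "!!b. b : AWA n ==> h (frag_of b) = (case b of (a, x, b) => t a x b)"
 then show "h s = 0[M]" by (intro kbal_gens[OF M t]) auto
next
 fix ph assume "addmap (K.quot n) M ph" "!!b. b : AWA n ==> ph (K.cl n (frag_of b)) = (case b of (a, x, b) => t a x b)"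
 then show thesis by (intro that[of ph]) (auto simp: addmap_cong[OF kos_add_monoid] ktens_def)
qed

text \<open>Connects maps given by formulas on free symbols with balanced maps. The representative
  \<open>g\<close> may depend on choices such as \<open>split\<close>, but its class
  \<open>t\<close> does not. This reduces maps on the Koszul complex to their values on pure
  tensors.\<close>

lemma kos_map_tens:
 assumes t: "kbal n (kos_grp m) t"
  and g: "!!a x b. a : car alg ==> x : Wc n ==> b : car alg ==> supp (g (a, x, b)) <= AWA m & K.cl m (g (a, x, b)) = t a x b"
 shows "addmap (kos_grp n) (kos_grp m) (kos_map m g)"
  "!!a x b. a : car alg ==> x : Wc n ==> b : car alg ==> kos_map m g (ktens n a x b) = t a x b"
proof -
 have gk: "supp (frag_extend g c) <= AWA m" if "supp c <= AWA n" for c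
  by (rule K.keys_extend[OF _ that]) (use g in auto)
 have kd: "K.cl m (frag_extend g (c - d)) = K.cl m (frag_extend g c) -[kos_grp m] K.cl m (frag_extend g d)"
  if "supp c <= AWA n" "supp d <= AWA n" for c d
  unfolding frag_extend_diff kos_same(5)[symmetric] by (rule K.cl_diff[symmetric, OF gk[OF that(1)] gk[OF that(2)]])
 have ka: "K.cl m (frag_extend g (c + d)) = K.cl m (frag_extend g c) +[kos_grp m] K.cl m (frag_extend g d)"
  if "supp c <= AWA n" "supp d <= AWA n" for c d
  unfolding frag_extend_add kos_same(3)[symmetric] by (rule K.cl_add[symmetric, OF gk[OF that(1)] gk[OF that(2)]])
 have kc: "K.cl m (frag_extend g c) : car (kos_grp m)" if "supp c <= AWA n" for c
  unfolding kos_same(1)[symmetric] by (rule K.cl_closed[OF gk[OF that]])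
 have ks: "K.cl m (frag_extend g s) = 0[kos_grp m]" if "s : kos_gens n" for s
  by (rule kbal_gens[OF ab_kos t that kd]) (use g in simp_all)
 have eq: "kos_map m g (K.cl n c) = K.cl m (frag_extend g c)" if c: "supp c <= AWA n" for c
 proof -
  have "K.cl m (frag_extend g d) = K.cl m (frag_extend g c)" if "d : K.cl n c" for d
   by (rule K.union_map[OF ab_kos, of n "%c. K.cl m (frag_extend g c)", OF kc ka ks c that])
  then show ?thesis unfolding kos_map_def K_cl[of m, symmetric] using K.cl_self[OF c] by blast
 qed
 show "kos_map m g (ktens n a x b) = t a x b" if "a : car alg" "x : Wc n" "b : car alg" for a x b
  unfolding ktens_def using eq[of "frag_of (a, x, b)"] g[OF that] that by simp
 show "addmap (kos_grp n) (kos_grp m) (kos_map m g)"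
  unfolding addmap_cong[OF kos_add_monoid, symmetric]
 proof (rule addmapI)
  fix X assume "X : car (K.quot n)"
  then obtain c where c: "supp c <= AWA n" "X = K.cl n c" by (auto simp: K.quot_simps(1))
  then show "kos_map m g X : car (kos_grp m)" using eq kc by simp
  fix Y assume "Y : car (K.quot n)"
  then obtain d where d: "supp d <= AWA n" "Y = K.cl n d" by (auto simp: K.quot_simps(1))
  have "supp (c + d) <= AWA n" using c d keys_add[of c d] by blast
  then show "kos_map m g (X +[K.quot n] Y) = kos_map m g X +[kos_grp m] kos_map m g Y"
   unfolding c(2) d(2) K.cl_add[OF c(1) d(1)] using eq ka c d by simp
 qed
qed

lemmas ktens_add1 = kbalD(1)[OF kbal_ktens]
 and ktens_add3 = kbalD(2)[OF kbal_ktens]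
 and ktens_add2 = kbalD(3)[OF kbal_ktens]
 and ktens_bal1 = kbalD(4)[OF kbal_ktens]
 and ktens_bal2 = kbalD(5)[OF kbal_ktens]

text \<open>A scalar multiple of the unit lies in k, is central in A and acts alike on both sides of
  W, so it passes through the middle factor.\<close>

lemma ktens_scal:
 assumes c: "a : car alg" "x : Wc n" "b : car alg"
 shows "ktens n (scal c ** a) x b = ktens n a x (scal c ** b)"
proof -
 have xT: "x : car T"
  using c(2) W_carrier[of x "nat (- n)"] by (cases "n \<le> 0") (simp_all add: Wc_def carrier_T)
 have "ktens n (scal c ** a) x b = ktens n (a ** proj (tconst c)) x b"
  using scal_comm[OF c(1), of c] by (simp add: scal_tconst)
 also have "... = ktens n a (tmult Q x (tconst c)) b"
  using c ktens_bal1[OF c tconst_tpower] by (simp add: tconst_mult_left tconst_mult_right xT)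
 also have "... = ktens n a x (scal c ** b)" using ktens_bal2[OF c tconst_tpower] by (simp add: scal_tconst)
 finally show ?thesis .
qed

subsection \<open>The bimodule structure\<close>

lemma kos_smult:
 assumes "a' : car alg"
 shows "addmap (kos_grp n) (kos_grp n) (%X. a' *[kos_grp n] X)"
  "!!a x b. a : car alg ==> x : Wc n ==> b : car alg ==> a' *[kos_grp n] ktens n a x b = ktens n (a' ** a) x b"
proof -
 have e: "(%X. a' *[kos_grp n] X) = kos_map n (\<lambda>(\<alpha>, x, \<beta>). frag_of (a' ** \<alpha>, x, \<beta>))"
  by (simp add: kos_grp_def)
 have t: "kbal n (kos_grp n) (%a x b. ktens n (a' ** a) x b)"
  by (rule kbalI) (use assms in "simp_all add: ktens_add2 ktens_add3 ktens_bal2 ktens_bal1[symmetric] A.m_assoc addmap_def A.r_distr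
    am_add[OF ktens_add1] am_add[OF ktens_add3]")
 note k = kos_map_tens[OF t, of "\<lambda>(\<alpha>, x, \<beta>). frag_of (a' ** \<alpha>, x, \<beta>)"]
 show "addmap (kos_grp n) (kos_grp n) (%X. a' *[kos_grp n] X)"
  unfolding e by (rule k(1)) (use assms in "simp add: ktens_def")
 show "a' *[kos_grp n] ktens n a x b = ktens n (a' ** a) x b" if "a : car alg" "x : Wc n" "b : car alg" for a x b
  using k(2)[OF _ that] fun_cong[OF e, of "ktens n a x b"] assms by (simp add: ktens_def)
qed

lemma kos_rsmult:
 assumes "b' : car alg"
 shows "addmap (kos_grp n) (kos_grp n) (%X. rsmult (kos_grp n) X b')"
  "!!a x b. a : car alg ==> x : Wc n ==> b : car alg ==> rsmult (kos_grp n) (ktens n a x b) b' = ktens n a x (b ** b')"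
proof -
 have e: "(%X. rsmult (kos_grp n) X b') = kos_map n (\<lambda>(\<alpha>, x, \<beta>). frag_of (\<alpha>, x, \<beta> ** b'))"
  by (simp add: kos_grp_def)
 have t: "kbal n (kos_grp n) (%a x b. ktens n a x (b ** b'))"
  by (rule kbalI) (use assms in "simp_all add: ktens_add2 ktens_add1 ktens_bal2 ktens_bal1 A.m_assoc addmap_def A.l_distr
    am_add[OF ktens_add3] am_add[OF ktens_add1]")
 note k = kos_map_tens[OF t, of "\<lambda>(\<alpha>, x, \<beta>). frag_of (\<alpha>, x, \<beta> ** b')"]
 show "addmap (kos_grp n) (kos_grp n) (%X. rsmult (kos_grp n) X b')"
  unfolding e by (rule k(1)) (use assms in "simp add: ktens_def")
 show "rsmult (kos_grp n) (ktens n a x b) b' = ktens n a x (b ** b')" if "a : car alg" "x : Wc n" "b : car alg" for a x b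
  using k(2)[OF _ that] fun_cong[OF e, of "ktens n a x b"] assms by (simp add: ktens_def)
qed

lemma kos_bimodule: "bimodule (kos_grp n)"
 unfolding bimodule_def
proof (intro conjI ballI allI)
 fix a X Y assume a: "a : car alg" and X: "X : car (kos_grp n)"
 note l = kos_smult[OF a] and r = kos_rsmult[OF a]
 show "a *[kos_grp n] X : car (kos_grp n)" "rsmult (kos_grp n) X a : car (kos_grp n)"
  using addmap_closed[OF l(1) X] addmap_closed[OF r(1) X] by auto
 assume Y: "Y : car (kos_grp n)"
 show "a *[kos_grp n] (X +[kos_grp n] Y) = a *[kos_grp n] X +[kos_grp n] a *[kos_grp n] Y"
  "rsmult (kos_grp n) (X +[kos_grp n] Y) a = rsmult (kos_grp n) X a +[kos_grp n] rsmult (kos_grp n) Y a"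
  using am_add[OF l(1) X Y] am_add[OF r(1) X Y] by auto
next
 fix a b X assume ab: "a : car alg" "b : car alg" and X: "X : car (kos_grp n)"
 note l = kos_smult(1) and r = kos_rsmult(1) and lt = kos_smult(2) and rt = kos_rsmult(2)
 have ab': "a +[alg] b : car alg" "a ** b : car alg" using ab by auto
 show "(a +[alg] b) *[kos_grp n] X = a *[kos_grp n] X +[kos_grp n] b *[kos_grp n] X"
  by (rule kos_am_eqI[OF ab_kos l[OF ab'(1)] am_add_pointwise[OF ab_kos l[OF ab(1)] l[OF ab(2)]] _ X])
   (simp add: lt ab ab' A.l_distr am_add[OF ktens_add1])
 show "rsmult (kos_grp n) X (a +[alg] b) = rsmult (kos_grp n) X a +[kos_grp n] rsmult (kos_grp n) X b"
  by (rule kos_am_eqI[OF ab_kos r[OF ab'(1)] am_add_pointwise[OF ab_kos r[OF ab(1)] r[OF ab(2)]] _ X])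
   (simp add: rt ab ab' A.r_distr am_add[OF ktens_add3])
 show "(a ** b) *[kos_grp n] X = a *[kos_grp n] (b *[kos_grp n] X)"
  by (rule kos_am_eqI[OF ab_kos l[OF ab'(2)] am_comp[OF l[OF ab(2)] l[OF ab(1)]] _ X])
   (simp add: lt ab ab' A.m_assoc)
 show "rsmult (kos_grp n) X (a ** b) = rsmult (kos_grp n) (rsmult (kos_grp n) X a) b"
  by (rule kos_am_eqI[OF ab_kos r[OF ab'(2)] am_comp[OF r[OF ab(1)] r[OF ab(2)]] _ X])
   (simp add: rt ab ab' A.m_assoc)
 show "rsmult (kos_grp n) (a *[kos_grp n] X) b = a *[kos_grp n] (rsmult (kos_grp n) X b)"
  by (rule kos_am_eqI[OF ab_kos am_comp[OF l[OF ab(1)] r[OF ab(2)]] am_comp[OF r[OF ab(2)] l[OF ab(1)]] _ X])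
   (simp add: lt rt ab)
next
 fix X assume X: "X : car (kos_grp n)"
 have id: "addmap (kos_grp n) (kos_grp n) (%X. X)" by (simp add: addmap_def)
 show "1[alg] *[kos_grp n] X = X"
  by (rule kos_am_eqI[OF ab_kos kos_smult(1)[OF A.one_closed] id _ X]) (simp add: kos_smult(2))
 show "rsmult (kos_grp n) X 1[alg] = X"
  by (rule kos_am_eqI[OF ab_kos kos_rsmult(1)[OF A.one_closed] id _ X]) (simp add: kos_rsmult(2))
next
 fix X and c :: 'f assume X: "X : car (kos_grp n)"
 show "scal c *[kos_grp n] X = rsmult (kos_grp n) X (scal c)"
  by (rule kos_am_eqI[OF ab_kos kos_smult(1)[OF scal_cl] kos_rsmult(1)[OF scal_cl] _ X])
   (simp add: kos_smult(2) kos_rsmult(2) scal_comm ktens_scal)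
qed (rule ab_kos)

text \<open>Here \<open>Wc n\<close> is zero, and pure tensors with middle factor 0 vanish by
  additivity.\<close>

lemma kos_pos: "n > 0 ==> X : car (kos_grp n) ==> X = 0[kos_grp n]"
proof (rule kos_am_eqI[OF ab_kos[of n], where n = n and h = "%X. X" and k = "%X. 0[kos_grp n]"])
 fix a x b assume n: "n > 0" and c: "a : car alg" "x : Wc n" "b : car alg"
 then have "ktens n a 0 b = ktens n a 0 b +[kos_grp n] ktens n a 0 b" using ktens_add2[of a 0 n 0 b] by simp
 moreover have "x = 0" using n c(2) by (simp add: Wc_pos)
 ultimately show "ktens n a x b = 0[kos_grp n]" using c KG.add.l_cancel_one[of "ktens n a 0 b" n "ktens n a 0 b"] by simp
qed (simp_all add: addmap_def)

end

lemma addmap_sfinsum: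
 assumes "abelian_group G" "abelian_group H" "addmap G H h" "finite I" "!!i. i : I ==> g i : car G"
 shows "h (signed G k (finsum G g I)) = signed H k (finsum H (%i. h (g i)) I)"
proof -
 interpret G: abelian_group G by fact
 have "finsum G g I : car G" using assms(5) by (auto intro: G.finsum_closed)
 then show ?thesis using am_signed[OF assms(1-3)] am_finsum[OF assms] by simp
qed

lemma (in abelian_group) signed_dsum:
 assumes "finite A" "finite B" "!!i j. i : A ==> j : B ==> g i j : car G"
 shows "signed G k (finsum G (%i. signed G l (finsum G (g i) B)) A) = signed G (k + l) (finsum G (%i. finsum G (g i) B) A)"
proof -
 have c: "finsum G (g i) B : car G" if "i : A" for i using assms that by (auto intro: finsum_closed)
 have "finsum G (%i. signed G l (finsum G (g i) B)) A = signed G l (finsum G (%i. finsum G (g i) B) A)"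
  using signed_finsum[OF assms(1) c] by simp
 then show ?thesis using c by (simp add: signed_signed finsum_closed)
qed

context quadratic_algebra
begin

subsection \<open>The actions of the Koszul cochain algebra\<close>

lemma alg_addmap_left: "a : car alg ==> addmap alg alg (%b. a ** b)"
 and alg_addmap_right: "a : car alg ==> addmap alg alg (%b. b ** a)"
 by (simp_all add: addmap_def A.l_distr A.r_distr)

lemmas ab_alg = A.ab_ax

lemma balanced_lact:
 assumes "f : cochains p" "a : car alg" "b : car alg"
 shows "balanced r p (kos_grp (- int r)) (%y z. ktens (- int r) a y (f z ** b))"
 by (rule balancedI) (use assms in "simp_all add: cochain_cl cochain_add ktens_add2 A.l_distr am_add[OF ktens_add3]
   ktens_bal2 cochain_left A.m_assoc")

lemma balanced_ract:
 assumes "f : cochains p" "a : car alg" "b : car alg"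
 shows "balanced p r (kos_grp (- int r)) (%y z. ktens (- int r) (a ** f y) z b)"
 by (rule balancedI) (use assms in "simp_all add: cochain_cl cochain_add ktens_add2 A.r_distr am_add[OF ktens_add1]
   ktens_bal1[symmetric] cochain_right A.m_assoc")

text \<open>The left action on pure tensors without its sign. The number \<open>r\<close> is the
  homological degree of the result, so the argument has degree r + p. The right action is
  \<open>TR\<close>.\<close>

definition TL :: "nat => nat => ('v, 'e, 'f) koszul_cochain => ('v, 'e, 'f) qalg => ('v, 'e, 'f) tens => ('v, 'e, 'f) qalg => ('v, 'e, 'f) koszul_chain" where
 "TL p r f a x b = tsumR r p (kos_grp (- int r)) (%y z. ktens (- int r) a y (f z ** b)) x"

definition TR :: "nat => nat => ('v, 'e, 'f) koszul_cochain => ('v, 'e, 'f) qalg => ('v, 'e, 'f) tens => ('v, 'e, 'f) qalg => ('v, 'e, 'f) koszul_chain" where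
 "TR p r f a x b = tsumR p r (kos_grp (- int r)) (%y z. ktens (- int r) (a ** f y) z b) x"

lemma TLR: "TL p r f a x b = finsum (kos_grp (- int r)) (%d. ktens (- int r) a (Rt r d x) (f (rho p d) ** b)) (paths p)"
 by (simp add: TL_def tsumR_def)

lemma TLL:
 assumes "f : cochains p" "a : car alg" "x : W (r + p)" "b : car alg"
 shows "TL p r f a x b = finsum (kos_grp (- int r)) (%c. ktens (- int r) a (rho r c) (f (Lt p c x) ** b)) (paths r)"
 unfolding TL_def using tsum_RL[OF ab_kos balanced_lact[OF assms(1,2,4)] assms(3)] by (simp add: tsumL_def)

lemma TRR: "TR p r f a x b = finsum (kos_grp (- int r)) (%d. ktens (- int r) (a ** f (Rt p d x)) (rho r d) b) (paths r)"
 by (simp add: TR_def tsumR_def)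

lemma TRL:
 assumes "f : cochains p" "a : car alg" "x : W (p + r)" "b : car alg"
 shows "TR p r f a x b = finsum (kos_grp (- int r)) (%c. ktens (- int r) (a ** f (rho p c)) (Lt r c x) b) (paths p)"
 unfolding TR_def using tsum_RL[OF ab_kos balanced_ract[OF assms(1,2,4)] assms(3)] by (simp add: tsumL_def)

text \<open>Balance over k on the left uses the form \<open>TLR\<close>, balance on the right the
  form \<open>TLL\<close>; the two agree because the presentation is irrelevant.\<close>

lemma kbal_TL:
 assumes f: "f : cochains p" shows "kbal (- int (r + p)) (kos_grp (- int r)) (TL p r f)"
proof (rule kbalI, unfold Wc_W)
 fix x b assume x: "x : W (r + p)" and b: "b : car alg"
 show "addmap alg (kos_grp (- int r)) (%a. TL p r f a x b)" unfolding TLR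
  by (intro am_finsum_pointwise ab_alg ab_kos fin_paths ktens_add1)
   (use f x b in "simp_all add: W_Rt rho_W cochain_cl")
next
 fix a x assume x: "x : W (r + p)" and a: "a : car alg"
 show "addmap alg (kos_grp (- int r)) (%b. TL p r f a x b)" unfolding TLR
  by (intro am_finsum_pointwise ab_alg ab_kos fin_paths am_comp[OF alg_addmap_left ktens_add3])
   (use f x a in "simp_all add: W_Rt rho_W cochain_cl")
next
 fix a x y b assume "a : car alg" "x : W (r + p)" "y : W (r + p)" "b : car alg"
 then show "TL p r f a (x + y) b = TL p r f a x b +[kos_grp (- int r)] TL p r f a y b"
  unfolding TL_def by (intro tsumR_add[OF ab_kos balanced_lact] f coefs_ok_W)
next
 fix a x b and c :: "('v, 'e, 'f) tens" assume h: "a : car alg" "x : W (r + p)" "b : car alg" "c : tpower Q 0"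
 show "TL p r f (a ** proj c) x b = TL p r f a (tmult Q c x) b" unfolding TLR
  using f h by (intro KG.finsum_cong' Pi_I) (simp_all add: W_Rt rho_W cochain_cl ktens_bal1 Rt_tmult_left W_left)
 show "TL p r f a (tmult Q x c) b = TL p r f a x (proj c ** b)"
  using f h by (subst TLL; (subst TLL)?; simp?; (intro KG.finsum_cong' Pi_I)?)
   (simp_all add: W_Lt rho_W cochain_cl cochain_right Lt_tmult_right[OF _ W_tpower] A.m_assoc W_right)
qed

lemma kbal_TR:
 assumes f: "f : cochains p" shows "kbal (- int (p + r)) (kos_grp (- int r)) (TR p r f)"
proof (rule kbalI, unfold Wc_W)
 fix x b assume x: "x : W (p + r)" and b: "b : car alg"
 show "addmap alg (kos_grp (- int r)) (%a. TR p r f a x b)" unfolding TRR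
  by (intro am_finsum_pointwise ab_alg ab_kos fin_paths am_comp[OF alg_addmap_right ktens_add1])
   (use f x b in "simp_all add: W_Rt rho_W cochain_cl")
next
 fix a x assume x: "x : W (p + r)" and a: "a : car alg"
 show "addmap alg (kos_grp (- int r)) (%b. TR p r f a x b)" unfolding TRR
  by (intro am_finsum_pointwise ab_alg ab_kos fin_paths ktens_add3)
   (use f x a in "simp_all add: W_Rt rho_W cochain_cl")
next
 fix a x y b assume "a : car alg" "x : W (p + r)" "y : W (p + r)" "b : car alg"
 then show "TR p r f a (x + y) b = TR p r f a x b +[kos_grp (- int r)] TR p r f a y b"
  unfolding TR_def by (intro tsumR_add[OF ab_kos balanced_ract] f coefs_ok_W)
next
 fix a x b and c :: "('v, 'e, 'f) tens" assume h: "a : car alg" "x : W (p + r)" "b : car alg" "c : tpower Q 0"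
 show "TR p r f (a ** proj c) x b = TR p r f a (tmult Q c x) b" unfolding TRR
  using f h by (intro KG.finsum_cong' Pi_I) (simp_all add: W_Rt rho_W cochain_cl cochain_left A.m_assoc Rt_tmult_left W_left)
 show "TR p r f a (tmult Q x c) b = TR p r f a x (proj c ** b)"
  using f h by (subst TRL; (subst TRL)?; simp?; (intro KG.finsum_cong' Pi_I)?)
   (simp_all add: W_Lt rho_W cochain_cl ktens_bal2 Lt_tmult_right[OF _ W_tpower] W_right)
qed

lemma K_cl_isign: "supp c <= AWA m ==> K.cl m (frag_cmul (isign k) c) = signed (kos_grp m) k (K.cl m c)"
 using K.cl_neg[of c m] by (simp add: isign_def signed_def kos_same(4))

text \<open>The list \<open>split p q x\<close> is some presentation of \<open>x\<close>, so the
  class of the free sum over it is the canonical value \<open>tsumR\<close>.\<close>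

lemma K_cl_split:
 assumes h: "balanced p q (kos_grp m) (%y z. ktens m (a y) (t y z) (b z))" and x: "x : W (p + q)"
  and c: "!!y z. y : W p ==> z : W q ==> a y : car alg & t y z : Wc m & b z : car alg"
 shows "supp (\<Sum>(y, z) \<leftarrow> split p q x. frag_of (a y, t y z, b z)) <= AWA m"
  "K.cl m (\<Sum>(y, z) \<leftarrow> split p q x. frag_of (a y, t y z, b z)) = tsumR p q (kos_grp m) (%y z. ktens m (a y) (t y z) (b z)) x"
proof -
 have "supp ((%(y, z). frag_of (a y, t y z, b z)) yz) <= AWA m" if "yz : set (split p q x)" for yz
  using split_spec(1)[OF x] that c by (cases yz) auto
 note k = K.cl_sum_list[where ys = "split p q x" and g = "%(y, z). frag_of (a y, t y z, b z)" and n = m, OF this]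
 show "supp (\<Sum>(y, z) \<leftarrow> split p q x. frag_of (a y, t y z, b z)) <= AWA m" using k by simp
 have "K.cl m (\<Sum>(y, z) \<leftarrow> split p q x. frag_of (a y, t y z, b z)) =
   finsum (kos_grp m) (%i. K.cl m ((%(y, z). frag_of (a y, t y z, b z)) (split p q x ! i))) {..<length (split p q x)}"
  using k by (simp add: kos_same(6))
 also have "... = finsum (kos_grp m) (%i. case split p q x ! i of (y, z) => ktens m (a y) (t y z) (b z)) {..<length (split p q x)}"
  by (simp add: ktens_def split_beta)
 also have "... = tsumR p q (kos_grp m) (%y z. ktens m (a y) (t y z) (b z)) x"
  by (rule split_presentation(1)[OF ab_kos h x])
 finally show "K.cl m (\<Sum>(y, z) \<leftarrow> split p q x. frag_of (a y, t y z, b z)) = tsumR p q (kos_grp m) (%y z. ktens m (a y) (t y z) (b z)) x" .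
qed

text \<open>Writing the degree as -(r + p) turns the truncated difference q - p of the definition
  into r and places the result in degree -r.\<close>

lemma kos_lact_tens:
 assumes f: "f : cochains p" and n: "n = - int (r + p)"
 shows "addmap (kos_grp n) (kos_grp (- int r)) (kos_lact p n f)"
  "!!a x b. a : car alg ==> x : W (r + p) ==> b : car alg ==>
    kos_lact p n f (ktens n a x b) = signed (kos_grp (- int r)) (int (r * p)) (TL p r f a x b)"
proof -
 define g where "g = (\<lambda>(\<alpha> :: ('v, 'e, 'f) qalg, x :: ('v, 'e, 'f) tens, \<beta> :: ('v, 'e, 'f) qalg). frag_cmul (isign (int (r * p))) (\<Sum>(y, z) \<leftarrow> split r p x. frag_of (\<alpha>, y, f z ** \<beta>)))"
 have nn: "nat (- n) = r + p" "n + int p = - int r" "int p \<le> - n" using n by simp_all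
 have e: "kos_lact p n f = kos_map (- int r) g"
  by (rule ext) (simp only: kos_lact_def nn Let_def if_True g_def add_diff_cancel_right')
 note t = kbal_signed[OF ab_kos kbal_TL[OF f, of r], of "int (r * p)", folded n]
 have g: "supp (g (a, x, b)) <= AWA (- int r) & K.cl (- int r) (g (a, x, b)) = signed (kos_grp (- int r)) (int (r * p)) (TL p r f a x b)"
  if "a : car alg" "x : Wc n" "b : car alg" for a x b
 proof -
  have x: "x : W (r + p)" using that(2) unfolding n Wc_W .
  note k = K_cl_split[where a = "%_. a" and t = "%y _. y" and b = "%z. f z ** b", OF balanced_lact[OF f that(1,3)] x]
  have k1: "supp (\<Sum>(y, z) \<leftarrow> split r p x. frag_of (a, y, f z ** b)) <= AWA (- int r)"
   and k2: "K.cl (- int r) (\<Sum>(y, z) \<leftarrow> split r p x. frag_of (a, y, f z ** b)) = TL p r f a x b"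
   unfolding TL_def by (rule k; use f that in "simp add: cochain_cl")+
  show ?thesis unfolding g_def split_conv K_cl_isign[OF k1] k2
   by (rule conjI[OF order_trans[OF keys_cmul k1] refl])
 qed
 show "addmap (kos_grp n) (kos_grp (- int r)) (kos_lact p n f)"
  unfolding e by (rule kos_map_tens(1)[OF t g])
 show "kos_lact p n f (ktens n a x b) = signed (kos_grp (- int r)) (int (r * p)) (TL p r f a x b)"
  if "a : car alg" "x : W (r + p)" "b : car alg" for a x b
  unfolding e by (rule kos_map_tens(2)[OF t g]) (use that in "simp_all only: n Wc_W")
qed

lemma kos_ract_tens:
 assumes f: "f : cochains p" and n: "n = - int (p + r)"
 shows "addmap (kos_grp n) (kos_grp (- int r)) (%X. kos_ract p n X f)"
  "!!a x b. a : car alg ==> x : W (p + r) ==> b : car alg ==>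
    kos_ract p n (ktens n a x b) f = signed (kos_grp (- int r)) (int (p * (p + r))) (TR p r f a x b)"
proof -
 define g where "g = (\<lambda>(\<alpha> :: ('v, 'e, 'f) qalg, x :: ('v, 'e, 'f) tens, \<beta> :: ('v, 'e, 'f) qalg). frag_cmul (isign (int (p * (p + r)))) (\<Sum>(y, z) \<leftarrow> split p r x. frag_of (\<alpha> ** f y, z, \<beta>)))"
 have nn: "nat (- n) = p + r" "n + int p = - int r" "int p \<le> - n" using n by simp_all
 have e: "(%X. kos_ract p n X f) = kos_map (- int r) g"
  by (rule ext) (simp only: kos_ract_def nn Let_def if_True g_def add_diff_cancel_left')
 note t = kbal_signed[OF ab_kos kbal_TR[OF f, of r], of "int (p * (p + r))", folded n]
 have g: "supp (g (a, x, b)) <= AWA (- int r) & K.cl (- int r) (g (a, x, b)) = signed (kos_grp (- int r)) (int (p * (p + r))) (TR p r f a x b)"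
  if "a : car alg" "x : Wc n" "b : car alg" for a x b
 proof -
  have x: "x : W (p + r)" using that(2) unfolding n Wc_W .
  note k = K_cl_split[where a = "%y. a ** f y" and t = "%_ z. z" and b = "%_. b", OF balanced_ract[OF f that(1,3)] x]
  have k1: "supp (\<Sum>(y, z) \<leftarrow> split p r x. frag_of (a ** f y, z, b)) <= AWA (- int r)"
   and k2: "K.cl (- int r) (\<Sum>(y, z) \<leftarrow> split p r x. frag_of (a ** f y, z, b)) = TR p r f a x b"
   unfolding TR_def by (rule k; use f that in "simp add: cochain_cl")+
  show ?thesis unfolding g_def split_conv K_cl_isign[OF k1] k2
   by (rule conjI[OF order_trans[OF keys_cmul k1] refl])
 qed
 show "addmap (kos_grp n) (kos_grp (- int r)) (%X. kos_ract p n X f)"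
  unfolding e by (rule kos_map_tens(1)[OF t g])
 show "kos_ract p n (ktens n a x b) f = signed (kos_grp (- int r)) (int (p * (p + r))) (TR p r f a x b)"
  if "a : car alg" "x : W (p + r)" "b : car alg" for a x b
  unfolding fun_cong[OF e] by (rule kos_map_tens(2)[OF t g]) (use that in "simp_all only: n Wc_W")
qed

text \<open>Since \<open>eps\<close> is the inclusion of V in A, splitting off the first or the last
  arrow is the right or the left action of \<open>eps\<close>.\<close>

lemma kos_diff_tens:
 assumes n: "n = - int (r + 1)"
 shows "addmap (kos_grp n) (kos_grp (- int r)) (kos_diff n)"
  "!!a x b. a : car alg ==> x : W (r + 1) ==> b : car alg ==>
    kos_diff n (ktens n a x b) = TR 1 r eps a x b +[kos_grp (- int r)] signed (kos_grp (- int r)) (int (r + 1)) (TL 1 r eps a x b)"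
proof -
 define g where "g = (\<lambda>(\<alpha> :: ('v, 'e, 'f) qalg, x :: ('v, 'e, 'f) tens, \<beta> :: ('v, 'e, 'f) qalg). (\<Sum>(y, z) \<leftarrow> split 1 r x. frag_of (\<alpha> ** proj y, z, \<beta>)) +
  frag_cmul (isign (int (r + 1))) (\<Sum>(y, z) \<leftarrow> split r 1 x. frag_of (\<alpha>, y, proj z ** \<beta>)))"
 have nr: "n + 1 = - int r" "nat (- n) = r + 1" "n < 0" using n by auto
 have e: "kos_diff n = kos_map (- int r) g"
  by (rule ext) (simp add: kos_diff_def nr Let_def g_def)
 have n': "n = - int (1 + r)" using n by simp
 note t = kbal_add[OF ab_kos kbal_TR[OF eps_cl, of r, folded n'] kbal_signed[OF ab_kos kbal_TL[OF eps_cl, of r, folded n], of "int (r + 1)"]]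
 have g: "supp (g (a, x, b)) <= AWA (- int r) & K.cl (- int r) (g (a, x, b)) =
   TR 1 r eps a x b +[kos_grp (- int r)] signed (kos_grp (- int r)) (int (r + 1)) (TL 1 r eps a x b)"
  if "a : car alg" "x : Wc n" "b : car alg" for a x b
 proof -
  have x: "x : W (r + 1)" using that(2) unfolding n Wc_W .
  then have x': "x : W (1 + r)" by (simp add: add.commute)
  have m1: "(\<Sum>(y, z) \<leftarrow> split r 1 x. frag_of (a, y, proj z ** b)) = (\<Sum>(y, z) \<leftarrow> split r 1 x. frag_of (a, y, eps z ** b))"
   using split_spec(1)[OF x] by (intro arg_cong[of _ _ sum_list] map_cong refl) (auto simp: eps_def)
  have m2: "(\<Sum>(y, z) \<leftarrow> split 1 r x. frag_of (a ** proj y, z, b)) = (\<Sum>(y, z) \<leftarrow> split 1 r x. frag_of (a ** eps y, z, b))"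
   using split_spec(1)[OF x'] by (intro arg_cong[of _ _ sum_list] map_cong refl) (auto simp: eps_def)
  note k = K_cl_split[where a = "%_. a" and t = "%y _. y" and b = "%z. eps z ** b", OF balanced_lact[OF eps_cl that(1,3)] x]
  have k1: "supp (\<Sum>(y, z) \<leftarrow> split r 1 x. frag_of (a, y, eps z ** b)) <= AWA (- int r)"
   and k2: "K.cl (- int r) (\<Sum>(y, z) \<leftarrow> split r 1 x. frag_of (a, y, eps z ** b)) = TL 1 r eps a x b"
   unfolding TL_def by (rule k; use eps_cl that in "simp add: cochain_cl")+
  note l = K_cl_split[where a = "%y. a ** eps y" and t = "%_ z. z" and b = "%_. b", OF balanced_ract[OF eps_cl that(1,3)] x']
  have l1: "supp (\<Sum>(y, z) \<leftarrow> split 1 r x. frag_of (a ** eps y, z, b)) <= AWA (- int r)"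
   and l2: "K.cl (- int r) (\<Sum>(y, z) \<leftarrow> split 1 r x. frag_of (a ** eps y, z, b)) = TR 1 r eps a x b"
   unfolding TR_def by (rule l; use eps_cl that in "simp add: cochain_cl")+
  let ?S = "(\<Sum>(y, z) \<leftarrow> split r 1 x. frag_of (a, y, eps z ** b))"
  let ?U = "(\<Sum>(y, z) \<leftarrow> split 1 r x. frag_of (a ** eps y, z, b))"
  have k3: "supp (frag_cmul (isign (int (r + 1))) ?S) <= AWA (- int r)"
   by (rule order_trans[OF keys_cmul k1])
  have "K.cl (- int r) (?U + frag_cmul (isign (int (r + 1))) ?S) = K.cl (- int r) ?U +[kos_grp (- int r)] K.cl (- int r) (frag_cmul (isign (int (r + 1))) ?S)"
   unfolding kos_same(3)[symmetric] by (rule K.cl_add[OF l1 k3, symmetric])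
  then show ?thesis unfolding g_def split_conv m1 m2 K_cl_isign[OF k1] k2 l2
   by (rule conjI[OF order_trans[OF keys_add Un_least[OF l1 k3]]])
 qed
 show "addmap (kos_grp n) (kos_grp (- int r)) (kos_diff n)"
  unfolding e by (rule kos_map_tens(1)[OF t g])
 show "kos_diff n (ktens n a x b) = TR 1 r eps a x b +[kos_grp (- int r)] signed (kos_grp (- int r)) (int (r + 1)) (TL 1 r eps a x b)"
  if "a : car alg" "x : W (r + 1)" "b : car alg" for a x b
  unfolding e by (rule kos_map_tens(2)[OF t g]) (use that in "simp_all only: n Wc_W")
qed

lemma kos_lact_zero: "\<not> int p \<le> - n ==> m = n + int p ==> kos_lact p n f X = 0[kos_grp m]"
 and kos_ract_zero: "\<not> int p \<le> - n ==> m = n + int p ==> kos_ract p n X f = 0[kos_grp m]"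
 by (simp_all add: kos_lact_def kos_ract_def)

lemma degree_split:
 assumes "int p \<le> - n" obtains r where "n = - int (r + p)" "n = - int (p + r)" "n + int p = - int r"
 using assms by (intro that[of "nat (- n) - p"]) auto

lemma kos_lact_addmap: "f : cochains p ==> m = n + int p ==> addmap (kos_grp n) (kos_grp m) (kos_lact p n f)"
proof (cases "int p \<le> - n")
 case True
 assume f: "f : cochains p" and m: "m = n + int p"
 from True obtain r where r: "n = - int (r + p)" "n + int p = - int r" by (rule degree_split)
 show ?thesis using kos_lact_tens(1)[OF f r(1)] unfolding m r(2) .
qed (simp add: addmap_def kos_lact_zero)

lemma kos_ract_addmap: "f : cochains p ==> m = n + int p ==> addmap (kos_grp n) (kos_grp m) (%X. kos_ract p n X f)"
proof (cases "int p \<le> - n")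
 case True
 assume f: "f : cochains p" and m: "m = n + int p"
 from True obtain r where r: "n = - int (p + r)" "n + int p = - int r" by (rule degree_split)
 show ?thesis using kos_ract_tens(1)[OF f r(1)] unfolding m r(2) .
qed (simp add: addmap_def kos_ract_zero)

lemma kos_eq0I:
 assumes "addmap (kos_grp n) (kos_grp m) h" "addmap (kos_grp n) (kos_grp m) k" "X : car (kos_grp n)" "n = - int N"
  "!!a x b. a : car alg ==> x : W N ==> b : car alg ==> h (ktens n a x b) = k (ktens n a x b)"
 shows "h X = k X"
 by (rule kos_am_eqI[OF ab_kos assms(1,2) _ assms(3)]) (use assms(5) in "simp add: assms(4)")

lemma TL_closed: "f : cochains p ==> a : car alg ==> x : W (r + p) ==> b : car alg ==> TL p r f a x b : car (kos_grp (- int r))"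
 using kbal_closed[OF kbal_TL, of f p a x r b] by (simp only: Wc_W)

lemma TR_closed: "f : cochains p ==> a : car alg ==> x : W (p + r) ==> b : car alg ==> TR p r f a x b : car (kos_grp (- int r))"
 using kbal_closed[OF kbal_TR, of f p a x r b] by (simp only: Wc_W)

lemma TL_map:
 assumes f: "f : cochains p" and M: "abelian_group M" and h: "addmap (kos_grp (- int r)) M h" and c: "a : car alg" "x : W (r + p)" "b : car alg"
 shows "h (TL p r f a x b) = finsum M (%d. h (ktens (- int r) a (Rt r d x) (f (rho p d) ** b))) (paths p)"
 unfolding TLR by (rule am_finsum[OF ab_kos M h]) (use f c in "simp_all add: W_Rt rho_W cochain_cl")

lemma TR_map:
 assumes f: "f : cochains p" and M: "abelian_group M" and h: "addmap (kos_grp (- int r)) M h" and c: "a : car alg" "x : W (p + r)" "b : car alg"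
 shows "h (TR p r f a x b) = finsum M (%d. h (ktens (- int r) (a ** f (Rt p d x)) (rho r d) b)) (paths r)"
 unfolding TRR by (rule am_finsum[OF ab_kos M h]) (use f c in "simp_all add: W_Rt rho_W cochain_cl")

lemma TL_bim:
 assumes f: "f : cochains p" and c: "a : car alg" "x : W (r + p)" "b : car alg" "a' : car alg"
 shows "a' *[kos_grp (- int r)] TL p r f a x b = TL p r f (a' ** a) x b"
  "rsmult (kos_grp (- int r)) (TL p r f a x b) a' = TL p r f a x (b ** a')"
 unfolding TL_map[OF f ab_kos kos_smult(1)[OF c(4)] c(1-3)] TL_map[OF f ab_kos kos_rsmult(1)[OF c(4)] c(1-3)]
 unfolding TLR by (intro KG.finsum_cong' Pi_I; use f c in "simp add: W_Rt rho_W cochain_cl kos_smult(2) kos_rsmult(2) A.m_assoc")+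

lemma TR_bim:
 assumes f: "f : cochains p" and c: "a : car alg" "x : W (p + r)" "b : car alg" "a' : car alg"
 shows "a' *[kos_grp (- int r)] TR p r f a x b = TR p r f (a' ** a) x b"
  "rsmult (kos_grp (- int r)) (TR p r f a x b) a' = TR p r f a x (b ** a')"
 unfolding TR_map[OF f ab_kos kos_smult(1)[OF c(4)] c(1-3)] TR_map[OF f ab_kos kos_rsmult(1)[OF c(4)] c(1-3)]
 unfolding TRR by (intro KG.finsum_cong' Pi_I; use f c in "simp add: W_Rt rho_W cochain_cl kos_smult(2) kos_rsmult(2) A.m_assoc")+

lemma bimod_hom_zero: "m = n + int p ==> bimod_hom (kos_grp n) (kos_grp m) (%X. 0[kos_grp m])"
 by (simp add: bimod_hom_def bim_zero[OF kos_bimodule])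

lemma kos_lact_hom:
 assumes f: "f : cochains p" shows "bimod_hom (kos_grp n) (kos_grp (n + int p)) (kos_lact p n f)"
proof (cases "int p \<le> - n")
 case True
 then obtain r where r: "n = - int (r + p)" "n + int p = - int r" by (rule degree_split)
 note L = kos_lact_tens[OF f r(1)]
 show ?thesis unfolding r(2)
 proof (rule bimod_homI[OF L(1)])
  fix a' X assume a': "a' : car alg" and X: "X : car (kos_grp n)"
  note sm = bim_signed[OF kos_bimodule a' TL_closed[OF f]]
  show "kos_lact p n f (a' *[kos_grp n] X) = a' *[kos_grp (- int r)] kos_lact p n f X"
   by (rule kos_eq0I[OF am_comp[OF kos_smult(1)[OF a'] L(1)] am_comp[OF L(1) kos_smult(1)[OF a']] X r(1)])
    (use a' in "simp add: L(2)[unfolded r(1)] kos_smult(2) r(1) sm TL_bim[OF f] del: of_nat_add of_nat_mult")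
  show "kos_lact p n f (rsmult (kos_grp n) X a') = rsmult (kos_grp (- int r)) (kos_lact p n f X) a'"
   by (rule kos_eq0I[OF am_comp[OF kos_rsmult(1)[OF a'] L(1)] am_comp[OF L(1) kos_rsmult(1)[OF a']] X r(1)])
    (use a' in "simp add: L(2)[unfolded r(1)] kos_rsmult(2) r(1) sm TL_bim[OF f] del: of_nat_add of_nat_mult")
 qed
next
 case False
 show ?thesis by (rule bimod_hom_cong[OF kos_bimodule bimod_hom_zero[OF refl]]) (rule kos_lact_zero[OF False refl])
qed

lemma kos_ract_hom:
 assumes f: "f : cochains p" shows "bimod_hom (kos_grp n) (kos_grp (n + int p)) (%X. kos_ract p n X f)"
proof (cases "int p \<le> - n")
 case True
 then obtain r where r: "n = - int (p + r)" "n + int p = - int r" by (rule degree_split)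
 note L = kos_ract_tens[OF f r(1)]
 show ?thesis unfolding r(2)
 proof (rule bimod_homI[OF L(1)])
  fix a' X assume a': "a' : car alg" and X: "X : car (kos_grp n)"
  note sm = bim_signed[OF kos_bimodule a' TR_closed[OF f]]
  show "kos_ract p n (a' *[kos_grp n] X) f = a' *[kos_grp (- int r)] kos_ract p n X f"
   by (rule kos_eq0I[OF am_comp[OF kos_smult(1)[OF a'] L(1)] am_comp[OF L(1) kos_smult(1)[OF a']] X r(1)])
    (use a' in "simp add: L(2)[unfolded r(1)] kos_smult(2) r(1) sm TR_bim[OF f] del: of_nat_add of_nat_mult")
  show "kos_ract p n (rsmult (kos_grp n) X a') f = rsmult (kos_grp (- int r)) (kos_ract p n X f) a'"
   by (rule kos_eq0I[OF am_comp[OF kos_rsmult(1)[OF a'] L(1)] am_comp[OF L(1) kos_rsmult(1)[OF a']] X r(1)])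
    (use a' in "simp add: L(2)[unfolded r(1)] kos_rsmult(2) r(1) sm TR_bim[OF f] del: of_nat_add of_nat_mult")
 qed
next
 case False
 show ?thesis by (rule bimod_hom_cong[OF kos_bimodule bimod_hom_zero[OF refl]]) (rule kos_ract_zero[OF False refl])
qed

end

context quadratic_algebra
begin

lemma TL_coadd:
 assumes f: "f : cochains p" and g: "g : cochains p" and c: "a : car alg" "x : W (r + p)" "b : car alg"
 shows "TL p r (cochain_add p f g) a x b = TL p r f a x b +[kos_grp (- int r)] TL p r g a x b"
proof -
 let ?t = "%f d. ktens (- int r) a (Rt r d x) (f (rho p d) ** b)"
 have cl: "?t f d : car (kos_grp (- int r))" "?t g d : car (kos_grp (- int r))" if "d : paths p" for d
  using that f g c by (simp_all add: W_Rt rho_W cochain_cl)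
 have "TL p r (cochain_add p f g) a x b = finsum (kos_grp (- int r)) (%d. ?t f d +[kos_grp (- int r)] ?t g d) (paths p)"
  unfolding TLR using f g c by (intro KG.finsum_cong' Pi_I)
   (simp_all add: W_Rt rho_W cochain_cl cochain_add_def A.l_distr am_add[OF ktens_add3])
 also have "... = TL p r f a x b +[kos_grp (- int r)] TL p r g a x b"
  unfolding TLR using cl by (intro KG.finsum_addf) auto
 finally show ?thesis .
qed

lemma TR_coadd:
 assumes f: "f : cochains p" and g: "g : cochains p" and c: "a : car alg" "x : W (p + r)" "b : car alg"
 shows "TR p r (cochain_add p f g) a x b = TR p r f a x b +[kos_grp (- int r)] TR p r g a x b"
proof -
 let ?t = "%f d. ktens (- int r) (a ** f (Rt p d x)) (rho r d) b"
 have cl: "?t f d : car (kos_grp (- int r))" "?t g d : car (kos_grp (- int r))" if "d : paths r" for d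
  using that f g c by (simp_all add: W_Rt rho_W cochain_cl)
 have "TR p r (cochain_add p f g) a x b = finsum (kos_grp (- int r)) (%d. ?t f d +[kos_grp (- int r)] ?t g d) (paths r)"
  unfolding TRR using f g c by (intro KG.finsum_cong' Pi_I)
   (simp_all add: W_Rt rho_W cochain_cl cochain_add_def A.r_distr am_add[OF ktens_add1])
 also have "... = TR p r f a x b +[kos_grp (- int r)] TR p r g a x b"
  unfolding TRR using cl by (intro KG.finsum_addf) auto
 finally show ?thesis .
qed

lemma TL_scale:
 assumes f: "f : cochains p" and c: "a : car alg" "x : W (r + p)" "b : car alg"
 shows "TL p r (cochain_scale p k f) a x b = scal k *[kos_grp (- int r)] TL p r f a x b"
 unfolding TL_map[OF f ab_kos kos_smult(1)[OF scal_cl] c] unfolding TLR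
 using f c by (intro KG.finsum_cong' Pi_I)
   (simp_all add: W_Rt rho_W cochain_cl cochain_scale_def kos_smult(2) ktens_scal A.m_assoc)

lemma TR_scale:
 assumes f: "f : cochains p" and c: "a : car alg" "x : W (p + r)" "b : car alg"
 shows "TR p r (cochain_scale p k f) a x b = scal k *[kos_grp (- int r)] TR p r f a x b"
 unfolding TR_map[OF f ab_kos kos_smult(1)[OF scal_cl] c] unfolding TRR
 using f c by (intro KG.finsum_cong' Pi_I)
   (simp_all add: W_Rt rho_W cochain_cl cochain_scale_def kos_smult(2) A.m_assoc[symmetric] scal_comm)

lemma kos_lact_coadd:
 assumes f: "f : cochains p" and g: "g : cochains p" and X: "X : car (kos_grp n)"
 shows "kos_lact p n (cochain_add p f g) X = kos_lact p n f X +[kos_grp (n + int p)] kos_lact p n g X"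
proof (cases "int p \<le> - n")
 case True
 then obtain r where r: "n = - int (r + p)" "n + int p = - int r" by (rule degree_split)
 note fg = cochain_add_closed[OF f g]
 show ?thesis unfolding r(2)
  by (rule kos_eq0I[OF kos_lact_tens(1)[OF fg r(1)] am_add_pointwise[OF ab_kos kos_lact_tens(1)[OF f r(1)] kos_lact_tens(1)[OF g r(1)]] X r(1)])
   (simp only: kos_lact_tens(2)[OF fg r(1)] kos_lact_tens(2)[OF f r(1)] kos_lact_tens(2)[OF g r(1)] TL_coadd[OF f g] KG.signed_add TL_closed[OF f] TL_closed[OF g])
qed (simp add: kos_lact_zero)

lemma kos_ract_coadd:
 assumes f: "f : cochains p" and g: "g : cochains p" and X: "X : car (kos_grp n)"
 shows "kos_ract p n X (cochain_add p f g) = kos_ract p n X f +[kos_grp (n + int p)] kos_ract p n X g"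
proof (cases "int p \<le> - n")
 case True
 then obtain r where r: "n = - int (p + r)" "n + int p = - int r" by (rule degree_split)
 note fg = cochain_add_closed[OF f g]
 show ?thesis unfolding r(2)
  by (rule kos_eq0I[OF kos_ract_tens(1)[OF fg r(1)] am_add_pointwise[OF ab_kos kos_ract_tens(1)[OF f r(1)] kos_ract_tens(1)[OF g r(1)]] X r(1)])
   (simp only: kos_ract_tens(2)[OF fg r(1)] kos_ract_tens(2)[OF f r(1)] kos_ract_tens(2)[OF g r(1)] TR_coadd[OF f g] KG.signed_add TR_closed[OF f] TR_closed[OF g])
qed (simp add: kos_ract_zero)

lemma kos_lact_scale:
 assumes f: "f : cochains p" and X: "X : car (kos_grp n)"
 shows "kos_lact p n (cochain_scale p k f) X = scal k *[kos_grp (n + int p)] kos_lact p n f X"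
proof (cases "int p \<le> - n")
 case True
 then obtain r where r: "n = - int (r + p)" "n + int p = - int r" by (rule degree_split)
 note kf = cochain_scale_closed[OF f]
 show ?thesis unfolding r(2)
  by (rule kos_eq0I[OF kos_lact_tens(1)[OF kf r(1)] am_comp[OF kos_lact_tens(1)[OF f r(1)] kos_smult(1)[OF scal_cl]] X r(1)])
   (simp only: kos_lact_tens(2)[OF kf r(1)] kos_lact_tens(2)[OF f r(1)] TL_scale[OF f] bim_signed[OF kos_bimodule scal_cl TL_closed[OF f]])
qed (simp add: kos_lact_zero bim_zero[OF kos_bimodule])

lemma kos_ract_scale:
 assumes f: "f : cochains p" and X: "X : car (kos_grp n)"
 shows "kos_ract p n X (cochain_scale p k f) = scal k *[kos_grp (n + int p)] kos_ract p n X f"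
proof (cases "int p \<le> - n")
 case True
 then obtain r where r: "n = - int (p + r)" "n + int p = - int r" by (rule degree_split)
 note kf = cochain_scale_closed[OF f]
 show ?thesis unfolding r(2)
  by (rule kos_eq0I[OF kos_ract_tens(1)[OF kf r(1)] am_comp[OF kos_ract_tens(1)[OF f r(1)] kos_smult(1)[OF scal_cl]] X r(1)])
   (simp only: kos_ract_tens(2)[OF kf r(1)] kos_ract_tens(2)[OF f r(1)] TR_scale[OF f] bim_signed[OF kos_bimodule scal_cl TR_closed[OF f]])
qed (simp add: kos_ract_zero bim_zero[OF kos_bimodule])

lemma TL_one:
 assumes "a : car alg" "x : W r" "b : car alg"
 shows "TL 0 r cochain_one a x b = ktens (- int r) a x b"
proof -
 have t: "tconst 1 : W 0" by (simp add: W_0 tconst_tpower)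
 have "TL 0 r cochain_one a (tmult Q x (tconst 1)) b = ktens (- int r) a x (cochain_one (tconst 1) ** b)"
  unfolding TL_def by (rule tsum_tmult(1)[OF ab_kos balanced_lact[OF cochain_one_closed assms(1,3)] assms(2) t])
 then show ?thesis using assms t by (simp add: tone_mult W_carrier[OF assms(2)] cochain_one_def)
qed

lemma TR_one:
 assumes "a : car alg" "x : W r" "b : car alg"
 shows "TR 0 r cochain_one a x b = ktens (- int r) a x b"
proof -
 have t: "tconst 1 : W 0" by (simp add: W_0 tconst_tpower)
 have "TR 0 r cochain_one a (tmult Q (tconst 1) x) b = ktens (- int r) (a ** cochain_one (tconst 1)) x b"
  unfolding TR_def by (rule tsum_tmult(1)[OF ab_kos balanced_ract[OF cochain_one_closed assms(1,3)] t assms(2)])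
 then show ?thesis using assms t by (simp add: tconst_mult_left W_carrier[OF assms(2)] cochain_one_def)
qed

lemma kos_one:
 assumes X: "X : car (kos_grp n)"
 shows "kos_lact 0 n cochain_one X = X" "kos_ract 0 n X cochain_one = X"
proof -
 have "kos_lact 0 n cochain_one X = X & kos_ract 0 n X cochain_one = X"
 proof (cases "n > 0")
  case True
  \<comment> \<open>In positive degrees the actions are zero by definition, and so is
    \<open>X\<close>.\<close>
  then show ?thesis using kos_pos[OF True X] kos_lact_zero[of 0 n n] kos_ract_zero[of 0 n n] by simp
 next
  case False
  then obtain r where r: "n = - int (r + 0)" "n = - int (0 + r)" "n = - int r" by (metis add.right_neutral add_0 int_nat_eq minus_minus neg_0_le_iff_le not_less of_nat_0_le_iff zero_le_imp_eq_int)
  have id: "addmap (kos_grp n) (kos_grp (- int r)) (%X. X)" by (simp add: addmap_def r(3))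
  note c = cochain_one_closed
  have "kos_lact 0 n cochain_one X = X"
   by (rule kos_eq0I[OF kos_lact_tens(1)[OF c r(1)] id X r(1)])
    (simp add: kos_lact_tens(2)[OF c r(1)] TL_one KG.signed_even, simp add: r(3))
  moreover have "kos_ract 0 n X cochain_one = X"
   by (rule kos_eq0I[OF kos_ract_tens(1)[OF c r(2)] id X r(2)])
    (simp add: kos_ract_tens(2)[OF c r(2)] TR_one KG.signed_even, simp add: r(3))
  ultimately show ?thesis by simp
 qed
 then show "kos_lact 0 n cochain_one X = X" "kos_ract 0 n X cochain_one = X" by auto
qed

lemma cup_R':
 assumes "f : cochains p" "g : cochains q" "x : W (p + q)"
 shows "cup p q f g x = signed alg (int (p * q)) (finsum alg (%d. f (Rt p d x) ** g (rho q d)) (paths q))"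
 using cup_R[OF assms] by (simp add: tsumR_def)

lemma cup_L':
 assumes "f : cochains p" "g : cochains q" "x : W (p + q)"
 shows "cup p q f g x = signed alg (int (p * q)) (finsum alg (%c. f (rho p c) ** g (Lt q c x)) (paths p))"
 using cup_L[OF assms] by (simp add: tsumL_def)

text \<open>Both sides become one double sum of terms \<open>F c d\<close>, where \<open>c\<close>
  runs over the paths of the first r arrows and \<open>d\<close> over those of the last q. The
  projections stand in the outer factors and the coefficient of \<open>x\<close> in the middle. The
  signs agree because r (p + q) + p q = (r + p) q + r p.\<close>

lemma kos_lact_cup_tens:
 assumes f: "f : cochains p" and g: "g : cochains q"
  and abx: "a : car alg" "x : W (r + (p + q))" "b : car alg" and n: "n = - int (r + (p + q))"
 shows "kos_lact (p + q) n (cup p q f g) (ktens n a x b) = kos_lact p (n + int q) f (kos_lact q n g (ktens n a x b))"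
proof -
 let ?M = "kos_grp (- int r)"
 define F where "F c d = ktens (- int r) a (rho r c) (f (Rt p d (Lt (p + q) c x)) ** g (rho q d) ** b)" for c d
 note fg = cup_cl[OF f g]
 have x2: "x : W ((r + p) + q)" using abx(2) by (simp only: add.assoc)
 have Lx: "Lt (p + q) c x : W (p + q)" if "c : paths r" for c using W_Lt[OF abx(2) that] .
 have Rx: "Rt (r + p) d x : W (r + p)" if "d : paths q" for d using W_Rt[OF x2 that] .
 have fRL: "f (Rt p d (Lt (p + q) c x)) : car alg" if "c : paths r" "d : paths q" for c d
  using that f W_Rt[OF Lx] by (simp add: cochain_cl)
 have Fc: "F c d : car ?M" if "c : paths r" "d : paths q" for c d
  unfolding F_def using that g abx rho_W fRL by (simp add: cochain_cl)
 have n2: "n + int q = - int (r + p)" "n = - int ((r + p) + q)" using n by simp_all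
 have "kos_lact (p + q) n (cup p q f g) (ktens n a x b) = signed ?M (int (r * (p + q))) (TL (p + q) r (cup p q f g) a x b)"
  by (rule kos_lact_tens(2)[OF fg n abx])
 also have "TL (p + q) r (cup p q f g) a x b = finsum ?M (%c. signed ?M (int (p * q)) (finsum ?M (F c) (paths q))) (paths r)"
  unfolding TLL[OF fg abx]
 proof (rule KG.finsum_cong'[OF refl])
  fix c assume c: "c : paths r"
  have "ktens (- int r) a (rho r c) (cup p q f g (Lt (p + q) c x) ** b) =
   (%e. ktens (- int r) a (rho r c) (e ** b)) (signed alg (int (p * q)) (finsum alg (%d. f (Rt p d (Lt (p + q) c x)) ** g (rho q d)) (paths q)))"
   unfolding cup_R'[OF f g Lx[OF c]] ..
  also have "... = signed ?M (int (p * q)) (finsum ?M (F c) (paths q))"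
   unfolding F_def
   by (rule addmap_sfinsum[OF ab_alg ab_kos am_comp[OF alg_addmap_right ktens_add3]])
    (use abx c rho_W fRL g in "simp_all add: cochain_cl")
  finally show "ktens (- int r) a (rho r c) (cup p q f g (Lt (p + q) c x) ** b) = signed ?M (int (p * q)) (finsum ?M (F c) (paths q))" .
 qed (use Fc in "auto intro!: KG.signed_cl KG.finsum_closed")
 also have "signed ?M (int (r * (p + q))) ... = signed ?M (int (r * (p + q)) + int (p * q)) (finsum ?M (%c. finsum ?M (F c) (paths q)) (paths r))"
  by (rule KG.signed_dsum[OF fin_paths fin_paths Fc])
 finally have 1: "kos_lact (p + q) n (cup p q f g) (ktens n a x b) = signed ?M (int (r * (p + q)) + int (p * q)) (finsum ?M (%c. finsum ?M (F c) (paths q)) (paths r))" .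
 have "kos_lact p (n + int q) f (kos_lact q n g (ktens n a x b)) =
  kos_lact p (- int (r + p)) f (signed (kos_grp (- int (r + p))) (int ((r + p) * q)) (TL q (r + p) g a x b))"
  unfolding kos_lact_tens(2)[OF g n2(2) abx(1) x2 abx(3)] unfolding n2(1) ..
 also have "... = signed ?M (int ((r + p) * q)) (finsum ?M (%d. kos_lact p (- int (r + p)) f (ktens (- int (r + p)) a (Rt (r + p) d x) (g (rho q d) ** b))) (paths q))"
  unfolding TLR by (rule addmap_sfinsum[OF ab_kos ab_kos kos_lact_tens(1)[OF f refl]])
   (use abx g Rx rho_W in "simp_all add: cochain_cl del: of_nat_add")
 also have "finsum ?M (%d. kos_lact p (- int (r + p)) f (ktens (- int (r + p)) a (Rt (r + p) d x) (g (rho q d) ** b))) (paths q)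
  = finsum ?M (%d. signed ?M (int (r * p)) (finsum ?M (%c. F c d) (paths r))) (paths q)"
 proof (rule KG.finsum_cong'[OF refl])
  fix d assume d: "d : paths q"
  have gb: "g (rho q d) ** b : car alg" using abx g rho_W d by (simp add: cochain_cl)
  have "TL p r f a (Rt (r + p) d x) (g (rho q d) ** b) = finsum ?M (%c. F c d) (paths r)"
   unfolding TLL[OF f abx(1) Rx[OF d] gb]
   by (rule KG.finsum_cong'[OF refl])
    (use Fc d abx g rho_W fRL in "simp_all add: Pi_iff Lt_Rt[OF _ d] F_def A.m_assoc cochain_cl")
  then show "kos_lact p (- int (r + p)) f (ktens (- int (r + p)) a (Rt (r + p) d x) (g (rho q d) ** b)) = signed ?M (int (r * p)) (finsum ?M (%c. F c d) (paths r))"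
   using kos_lact_tens(2)[OF f refl abx(1) Rx[OF d] gb] by simp
 qed (use Fc in "auto intro!: KG.signed_cl KG.finsum_closed")
 also have "signed ?M (int ((r + p) * q)) ... = signed ?M (int ((r + p) * q) + int (r * p)) (finsum ?M (%d. finsum ?M (%c. F c d) (paths r)) (paths q))"
  by (rule KG.signed_dsum[OF fin_paths fin_paths]) (rule Fc)
 also have "finsum ?M (%d. finsum ?M (%c. F c d) (paths r)) (paths q) = finsum ?M (%c. finsum ?M (F c) (paths q)) (paths r)"
  by (rule KG.finsum_swap[OF fin_paths fin_paths]) (rule Fc)
 finally show ?thesis unfolding 1 by (simp add: algebra_simps)
qed

lemma kos_ract_cup_tens:
 assumes f: "f : cochains p" and g: "g : cochains q"
  and abx: "a : car alg" "x : W (p + q + r)" "b : car alg" and n: "n = - int (p + q + r)"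
 shows "kos_ract (p + q) n (ktens n a x b) (cup p q f g) = kos_ract q (n + int p) (kos_ract p n (ktens n a x b) f) g"
proof -
 let ?M = "kos_grp (- int r)"
 define F where "F c d = ktens (- int r) (a ** f (rho p c) ** g (Rt q d (Lt (q + r) c x))) (rho r d) b" for c d
 note fg = cup_cl[OF f g]
 have x2: "x : W (p + (q + r))" using abx(2) by (simp only: add.assoc)
 have Lx: "Lt (q + r) c x : W (q + r)" if "c : paths p" for c using W_Lt[OF x2 that] .
 have Rx: "Rt (p + q) d x : W (p + q)" if "d : paths r" for d using W_Rt[OF abx(2) that] .
 have gRL: "g (Rt q d (Lt (q + r) c x)) : car alg" if "c : paths p" "d : paths r" for c d
  using that g W_Rt[OF Lx] by (simp add: cochain_cl)
 have Fc: "F c d : car ?M" if "c : paths p" "d : paths r" for c d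
  unfolding F_def using that f abx rho_W gRL by (simp add: cochain_cl)
 have n2: "n + int p = - int (q + r)" "n = - int (p + (q + r))" using n by simp_all
 have "kos_ract (p + q) n (ktens n a x b) (cup p q f g) = signed ?M (int ((p + q) * (p + q + r))) (TR (p + q) r (cup p q f g) a x b)"
  by (rule kos_ract_tens(2)[OF fg n abx])
 also have "TR (p + q) r (cup p q f g) a x b = finsum ?M (%d. signed ?M (int (p * q)) (finsum ?M (%c. F c d) (paths p))) (paths r)"
  unfolding TRR
 proof (rule KG.finsum_cong'[OF refl])
  fix d assume d: "d : paths r"
  have "ktens (- int r) (a ** cup p q f g (Rt (p + q) d x)) (rho r d) b =
   (%e. ktens (- int r) (a ** e) (rho r d) b) (signed alg (int (p * q)) (finsum alg (%c. f (rho p c) ** g (Lt q c (Rt (p + q) d x))) (paths p)))"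
   unfolding cup_L'[OF f g Rx[OF d]] ..
  also have "... = signed ?M (int (p * q)) (finsum ?M (%c. (%e. ktens (- int r) (a ** e) (rho r d) b) (f (rho p c) ** g (Lt q c (Rt (p + q) d x)))) (paths p))"
   by (rule addmap_sfinsum[OF ab_alg ab_kos am_comp[OF alg_addmap_left ktens_add1]])
    (use abx d rho_W gRL f in "simp_all add: cochain_cl Lt_Rt[OF _ d]")
  also have "(finsum ?M (%c. (%e. ktens (- int r) (a ** e) (rho r d) b) (f (rho p c) ** g (Lt q c (Rt (p + q) d x)))) (paths p)) = finsum ?M (%c. F c d) (paths p)"
   by (rule KG.finsum_cong'[OF refl])
    (use Fc d abx f rho_W gRL in "simp_all add: Pi_iff Lt_Rt[OF _ d] F_def A.m_assoc cochain_cl")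
  finally show "ktens (- int r) (a ** cup p q f g (Rt (p + q) d x)) (rho r d) b = signed ?M (int (p * q)) (finsum ?M (%c. F c d) (paths p))" .
 qed (use Fc in "auto intro!: KG.signed_cl KG.finsum_closed")
 also have "signed ?M (int ((p + q) * (p + q + r))) ... = signed ?M (int ((p + q) * (p + q + r)) + int (p * q)) (finsum ?M (%d. finsum ?M (%c. F c d) (paths p)) (paths r))"
  by (rule KG.signed_dsum[OF fin_paths fin_paths]) (rule Fc)
 also have "finsum ?M (%d. finsum ?M (%c. F c d) (paths p)) (paths r) = finsum ?M (%c. finsum ?M (F c) (paths r)) (paths p)"
  by (rule KG.finsum_swap[OF fin_paths fin_paths]) (rule Fc)
 finally have 1: "kos_ract (p + q) n (ktens n a x b) (cup p q f g) = signed ?M (int ((p + q) * (p + q + r)) + int (p * q)) (finsum ?M (%c. finsum ?M (F c) (paths r)) (paths p))" .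
 have "kos_ract q (n + int p) (kos_ract p n (ktens n a x b) f) g =
  kos_ract q (- int (q + r)) (signed (kos_grp (- int (q + r))) (int (p * (p + (q + r)))) (TR p (q + r) f a x b)) g"
  unfolding kos_ract_tens(2)[OF f n2(2) abx(1) x2 abx(3)] unfolding n2(1) ..
 also have "... = signed ?M (int (p * (p + (q + r)))) (finsum ?M (%c. kos_ract q (- int (q + r)) (ktens (- int (q + r)) (a ** f (rho p c)) (Lt (q + r) c x) b) g) (paths p))"
  unfolding TRL[OF f abx(1) x2 abx(3)] by (rule addmap_sfinsum[OF ab_kos ab_kos kos_ract_tens(1)[OF g refl]])
   (use abx f Lx rho_W in "simp_all add: cochain_cl del: of_nat_add")
 also have "finsum ?M (%c. kos_ract q (- int (q + r)) (ktens (- int (q + r)) (a ** f (rho p c)) (Lt (q + r) c x) b) g) (paths p)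
  = finsum ?M (%c. signed ?M (int (q * (q + r))) (finsum ?M (F c) (paths r))) (paths p)"
 proof (rule KG.finsum_cong'[OF refl])
  fix c assume c: "c : paths p"
  have af: "a ** f (rho p c) : car alg" using abx f rho_W c by (simp add: cochain_cl)
  have "TR q r g (a ** f (rho p c)) (Lt (q + r) c x) b = finsum ?M (F c) (paths r)"
   unfolding TRR F_def ..
  then show "kos_ract q (- int (q + r)) (ktens (- int (q + r)) (a ** f (rho p c)) (Lt (q + r) c x) b) g = signed ?M (int (q * (q + r))) (finsum ?M (F c) (paths r))"
   using kos_ract_tens(2)[OF g refl af Lx[OF c] abx(3)] by simp
 qed (use Fc in "auto intro!: KG.signed_cl KG.finsum_closed")
 also have "signed ?M (int (p * (p + (q + r)))) ... = signed ?M (int (p * (p + (q + r))) + int (q * (q + r))) (finsum ?M (%c. finsum ?M (F c) (paths r)) (paths p))"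
  by (rule KG.signed_dsum[OF fin_paths fin_paths Fc])
 \<comment> \<open>The two exponents differ by 2 p q.\<close>
 also have "... = signed ?M (int ((p + q) * (p + q + r)) + int (p * q)) (finsum ?M (%c. finsum ?M (F c) (paths r)) (paths p))"
  by (rule KG.signed_cong) (simp add: algebra_simps)
 finally show ?thesis unfolding 1 ..
qed

text \<open>The two actions consume opposite ends of the word: in \<open>F c d\<close> the first q
  arrows go to \<open>g\<close>, the last p arrows to \<open>f\<close>, and the middle remains. Both
  exponents are p q + p r + q q + q r.\<close>

lemma kos_lract_tens:
 assumes f: "f : cochains p" and g: "g : cochains q"
  and abx: "a : car alg" "x : W (q + r + p)" "b : car alg" and n: "n = - int (q + r + p)"
 shows "kos_ract q (n + int p) (kos_lact p n f (ktens n a x b)) g = kos_lact p (n + int q) f (kos_ract q n (ktens n a x b) g)"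
proof -
 let ?M = "kos_grp (- int r)"
 define F where "F c d = ktens (- int r) (a ** g (rho q c)) (Rt r d (Lt (r + p) c x)) (f (rho p d) ** b)" for c d
 have x2: "x : W (q + (r + p))" using abx(2) by (simp only: add.assoc)
 have Lx: "Lt (r + p) c x : W (r + p)" if "c : paths q" for c using W_Lt[OF x2 that] .
 have Rx: "Rt (q + r) d x : W (q + r)" if "d : paths p" for d using W_Rt[OF abx(2) that] .
 have ag: "a ** g (rho q c) : car alg" if "c : paths q" for c using abx g rho_W that by (simp add: cochain_cl)
 have fb: "f (rho p d) ** b : car alg" if "d : paths p" for d using abx f rho_W that by (simp add: cochain_cl)
 have Fc: "F c d : car ?M" if "c : paths q" "d : paths p" for c d
  unfolding F_def using that ag fb W_Rt[OF Lx] by simp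
 have n2: "n + int p = - int (q + r)" "n + int q = - int (r + p)" "n = - int (q + (r + p))" using n by simp_all
 have "kos_ract q (n + int p) (kos_lact p n f (ktens n a x b)) g =
  kos_ract q (- int (q + r)) (signed (kos_grp (- int (q + r))) (int ((q + r) * p)) (TL p (q + r) f a x b)) g"
  unfolding kos_lact_tens(2)[OF f n abx] unfolding n2(1) ..
 also have "... = signed ?M (int ((q + r) * p)) (finsum ?M (%d. kos_ract q (- int (q + r)) (ktens (- int (q + r)) a (Rt (q + r) d x) (f (rho p d) ** b)) g) (paths p))"
  unfolding TLR by (rule addmap_sfinsum[OF ab_kos ab_kos kos_ract_tens(1)[OF g refl]])
   (use abx fb Rx in "simp_all del: of_nat_add")
 also have "finsum ?M (%d. kos_ract q (- int (q + r)) (ktens (- int (q + r)) a (Rt (q + r) d x) (f (rho p d) ** b)) g) (paths p)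
  = finsum ?M (%d. signed ?M (int (q * (q + r))) (finsum ?M (%c. F c d) (paths q))) (paths p)"
 proof (rule KG.finsum_cong'[OF refl])
  fix d assume d: "d : paths p"
  have "TR q r g a (Rt (q + r) d x) (f (rho p d) ** b) = finsum ?M (%c. F c d) (paths q)"
   unfolding TRL[OF g abx(1) Rx[OF d] fb[OF d]]
   by (rule KG.finsum_cong'[OF refl]) (use Fc d in "simp_all add: Pi_iff Lt_Rt[OF _ d] F_def")
  then show "kos_ract q (- int (q + r)) (ktens (- int (q + r)) a (Rt (q + r) d x) (f (rho p d) ** b)) g = signed ?M (int (q * (q + r))) (finsum ?M (%c. F c d) (paths q))"
   using kos_ract_tens(2)[OF g refl abx(1) Rx[OF d] fb[OF d]] by simp
 qed (use Fc in "auto intro!: KG.signed_cl KG.finsum_closed")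
 also have "signed ?M (int ((q + r) * p)) ... = signed ?M (int ((q + r) * p) + int (q * (q + r))) (finsum ?M (%d. finsum ?M (%c. F c d) (paths q)) (paths p))"
  by (rule KG.signed_dsum[OF fin_paths fin_paths]) (rule Fc)
 also have "finsum ?M (%d. finsum ?M (%c. F c d) (paths q)) (paths p) = finsum ?M (%c. finsum ?M (F c) (paths p)) (paths q)"
  by (rule KG.finsum_swap[OF fin_paths fin_paths]) (rule Fc)
 finally have 1: "kos_ract q (n + int p) (kos_lact p n f (ktens n a x b)) g = signed ?M (int ((q + r) * p) + int (q * (q + r))) (finsum ?M (%c. finsum ?M (F c) (paths p)) (paths q))" .
 have "kos_lact p (n + int q) f (kos_ract q n (ktens n a x b) g) =
  kos_lact p (- int (r + p)) f (signed (kos_grp (- int (r + p))) (int (q * (q + (r + p)))) (TR q (r + p) g a x b))"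
  unfolding kos_ract_tens(2)[OF g n2(3) abx(1) x2 abx(3)] unfolding n2(2) ..
 also have "... = signed ?M (int (q * (q + (r + p)))) (finsum ?M (%c. kos_lact p (- int (r + p)) f (ktens (- int (r + p)) (a ** g (rho q c)) (Lt (r + p) c x) b)) (paths q))"
  unfolding TRL[OF g abx(1) x2 abx(3)] by (rule addmap_sfinsum[OF ab_kos ab_kos kos_lact_tens(1)[OF f refl]])
   (use abx ag Lx in "simp_all del: of_nat_add")
 also have "finsum ?M (%c. kos_lact p (- int (r + p)) f (ktens (- int (r + p)) (a ** g (rho q c)) (Lt (r + p) c x) b)) (paths q)
  = finsum ?M (%c. signed ?M (int (r * p)) (finsum ?M (F c) (paths p))) (paths q)"
 proof (rule KG.finsum_cong'[OF refl])
  fix c assume c: "c : paths q"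
  have "TL p r f (a ** g (rho q c)) (Lt (r + p) c x) b = finsum ?M (F c) (paths p)"
   unfolding TLR F_def ..
  then show "kos_lact p (- int (r + p)) f (ktens (- int (r + p)) (a ** g (rho q c)) (Lt (r + p) c x) b) = signed ?M (int (r * p)) (finsum ?M (F c) (paths p))"
   using kos_lact_tens(2)[OF f refl ag[OF c] Lx[OF c] abx(3)] by simp
 qed (use Fc in "auto intro!: KG.signed_cl KG.finsum_closed")
 also have "signed ?M (int (q * (q + (r + p)))) ... = signed ?M (int (q * (q + (r + p))) + int (r * p)) (finsum ?M (%c. finsum ?M (F c) (paths p)) (paths q))"
  by (rule KG.signed_dsum[OF fin_paths fin_paths Fc])
 finally show ?thesis unfolding 1 by (simp add: algebra_simps)
qed

lemma koszul_simps: "grp koszul_complex = kos_grp" "diff koszul_complex = kos_diff" "lact koszul_complex = kos_lact" "ract koszul_complex = kos_ract"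
 by (simp_all add: koszul_complex_def)

text \<open>In degree n = -(r + 1) the sign (-1)^(r+1) of the right action cancels against (-1)^n,
  and the sign (-1)^r of the left action combines with the minus to (-1)^(r+1). For n \<ge> 0 all
  three terms are zero.\<close>

lemma kos_diff_inner:
 assumes X: "X : car (kos_grp n)"
 shows "kos_diff n X = signed (kos_grp (n + 1)) n (kos_ract 1 n X eps) -[kos_grp (n + 1)] kos_lact 1 n eps X"
proof (cases "int 1 \<le> - n")
 case True
 then obtain r where r: "n = - int (r + 1)" "n = - int (1 + r)" "n + int 1 = - int r" by (rule degree_split)
 then have r3: "n + 1 = - int r" by simp
 let ?M = "kos_grp (- int r)"
 note d = kos_diff_tens[OF r(1)] and R = kos_ract_tens[OF eps_cl r(2)] and L = kos_lact_tens[OF eps_cl r(1)]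
 show ?thesis unfolding r3
 proof (rule kos_eq0I[OF d(1) addmap_minus_pointwise[OF ab_kos am_signed_pointwise[OF ab_kos R(1)] L(1)] X r(1)])
  fix a x b assume c: "a : car alg" "x : W (r + 1)" "b : car alg"
  then have x': "x : W (1 + r)" by (simp add: add.commute)
  show "kos_diff n (ktens n a x b) = signed ?M n (kos_ract 1 n (ktens n a x b) eps) -[?M] kos_lact 1 n eps (ktens n a x b)"
   unfolding d(2)[OF c] R(2)[OF c(1) x' c(3)] L(2)[OF c]
   using KG.ag_eq[of "[TR 1 r eps a x b, TL 1 r eps a x b]" "- int r" "Pl (V 0) (Sg (int (r + 1)) (V 1))"
    "Mi (Sg n (Sg (int (1 * (1 + r))) (V 0))) (Sg (int (r * 1)) (V 1))"]
    TR_closed[OF eps_cl c(1) x' c(3)] TL_closed[OF eps_cl c]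
   by (simp add: less_Suc_eq isign_add r(1) isign_diff)
 qed
next
 case False
 have e: "kos_ract 1 n X eps = 0[kos_grp (n + 1)]" "kos_lact 1 n eps X = 0[kos_grp (n + 1)]"
  by (rule kos_ract_zero[OF False], simp) (rule kos_lact_zero[OF False], simp)
 have "kos_diff n X = 0[kos_grp (n + 1)]" using False by (simp add: kos_diff_def)
 then show ?thesis unfolding e using KG.ag_eq[of "[]" "n + 1" Zr "Mi (Sg n Zr) Zr"] by simp
qed

text \<open>Only the axioms of the actions are checked on pure tensors; as the differential is
  inner, d d = 0 and the Leibniz rules come from \<open>inner_dg_object\<close>.\<close>

theorem dg_object_koszul: "dg_object koszul_complex"
proof -
 have "graded_bimodule koszul_complex"
 proof (rule graded_bimoduleI; unfold koszul_simps)
  fix p q n f g X assume f: "f : cochains p" and g: "g : cochains q" and X: "X : car (kos_grp n)"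
  note fg = cup_cl[OF f g]
  show "kos_lact (p + q) n (cup p q f g) X = kos_lact p (n + int q) f (kos_lact q n g X)"
  proof (cases "int (p + q) \<le> - n")
   case True
   then obtain r where r: "n = - int (r + (p + q))" by (rule degree_split)
   show ?thesis
    by (rule kos_eq0I[OF kos_lact_addmap[OF fg refl] am_comp[OF kos_lact_addmap[OF g refl] kos_lact_addmap[OF f]] X r])
    (simp, rule kos_lact_cup_tens[OF f g _ _ _ r])
  next
   case False
   \<comment> \<open>If the cochains are longer than the word, the action applied last is zero by
     definition, whatever the first one gives.\<close>
   then have "\<not> int p \<le> - (n + int q)" by simp
   then show ?thesis using kos_lact_zero[OF False, of "n + int q + int p"] kos_lact_zero[of p "n + int q"] by simp
  qed
  show "kos_ract (p + q) n X (cup p q f g) = kos_ract q (n + int p) (kos_ract p n X f) g"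
  proof (cases "int (p + q) \<le> - n")
   case True
   then obtain r where r: "n = - int (p + q + r)" by (rule degree_split)
   show ?thesis
    by (rule kos_eq0I[OF kos_ract_addmap[OF fg refl] am_comp[OF kos_ract_addmap[OF f refl] kos_ract_addmap[OF g]] X r])
    (simp, rule kos_ract_cup_tens[OF f g _ _ _ r])
  next
   case False
   then have "\<not> int q \<le> - (n + int p)" by simp
   then show ?thesis using kos_ract_zero[OF False, of "deg n p q"] kos_ract_zero[of q "n + int p"] by simp
  qed
  show "kos_ract q (n + int p) (kos_lact p n f X) g = kos_lact p (n + int q) f (kos_ract q n X g)"
  proof (cases "int (p + q) \<le> - n")
   case True
   then obtain r where "n = - int (r + (p + q))" by (rule degree_split)
   then have r: "n = - int (q + r + p)" by simp
   show ?thesis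
    by (rule kos_eq0I[OF am_comp[OF kos_lact_addmap[OF f refl] kos_ract_addmap[OF g refl]] am_comp[OF kos_ract_addmap[OF g refl] kos_lact_addmap[OF f]] X r])
    (simp, rule kos_lract_tens[OF f g _ _ _ r])
  next
   case False
   then have "\<not> int q \<le> - (n + int p)" "\<not> int p \<le> - (n + int q)" by simp_all
   then show ?thesis using kos_ract_zero[of q "n + int p" "deg n p q"] kos_lact_zero[of p "n + int q" "deg n p q"] by simp
  qed
 qed (simp_all add: kos_bimodule kos_lact_hom kos_ract_hom kos_lact_coadd kos_ract_coadd kos_lact_scale kos_ract_scale kos_one)
 then interpret gbo Q R koszul_complex by unfold_locales
 show ?thesis by (rule inner_dg_object) (simp add: koszul_simps kos_diff_inner)
qed

end

section \<open>Transport of structure\<close>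

definition tgrp :: "('x => 'y) => ('a, 'x) bimod => ('a, 'y) bimod" where
 "tgrp \<iota> M = \<lparr>carrier = \<iota> ` car M,
    monoid.mult = (%_ _. undefined), one = undefined,
    ring.zero = \<iota> 0[M],
    add = (%x y. \<iota> (inv_into UNIV \<iota> x +[M] inv_into UNIV \<iota> y)),
    smult = (%a x. \<iota> (a *[M] inv_into UNIV \<iota> x)),
    rsmult = (%x a. \<iota> (rsmult M (inv_into UNIV \<iota> x) a))\<rparr>"

lemma tgrp_simps:
 "car (tgrp \<iota> M) = \<iota> ` car M" "0[tgrp \<iota> M] = \<iota> 0[M]"
 "inj \<iota> ==> \<iota> x +[tgrp \<iota> M] \<iota> y = \<iota> (x +[M] y)"
 "inj \<iota> ==> a *[tgrp \<iota> M] \<iota> x = \<iota> (a *[M] x)"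
 "inj \<iota> ==> rsmult (tgrp \<iota> M) (\<iota> x) a = \<iota> (rsmult M x a)"
 by (simp_all add: tgrp_def)

lemma tr_simps:
 "grp (transport \<iota> C) n = tgrp \<iota> (grp C n)"
 "inj \<iota> ==> diff (transport \<iota> C) n (\<iota> x) = \<iota> (diff C n x)"
 "inj \<iota> ==> lact (transport \<iota> C) p n f (\<iota> x) = \<iota> (lact C p n f x)"
 "inj \<iota> ==> ract (transport \<iota> C) p n (\<iota> x) f = \<iota> (ract C p n x f)"
 by (simp_all add: transport_def tgrp_def)

lemma tgrp_addmap: "inj \<iota> ==> addmap M (tgrp \<iota> M) \<iota>"
 by (simp add: addmap_def tgrp_simps)

lemma tgrp_abelian:
 assumes "inj \<iota>" "abelian_group M" shows "abelian_group (tgrp \<iota> M)"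
proof -
 interpret M: abelian_group M by fact
 show ?thesis
 proof (rule abelian_groupI)
  fix x assume "x : car (tgrp \<iota> M)"
  then obtain y where y: "y : car M" "x = \<iota> y" by (auto simp: tgrp_simps)
  then show "EX y:car (tgrp \<iota> M). y +[tgrp \<iota> M] x = 0[tgrp \<iota> M]"
   by (intro bexI[of _ "\<iota> (-[M] y)"]) (simp_all add: tgrp_simps assms(1) M.l_neg)
 qed (auto simp: tgrp_simps assms(1) M.a_ac)
qed

lemma tgrp_signed:
 assumes "inj \<iota>" "abelian_group M" "x : car M" shows "signed (tgrp \<iota> M) n (\<iota> x) = \<iota> (signed M n x)"
 using am_signed[OF assms(2) tgrp_abelian[OF assms(1,2)] tgrp_addmap[OF assms(1)] assms(3)] by simp

context quadratic_algebra
begin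

lemma tgrp_bimodule:
 assumes i: "inj \<iota>" and M: "bimodule M" shows "bimodule (tgrp \<iota> M)"
proof -
 interpret M: abelian_group M by (rule bim_ab[OF M])
 show ?thesis
  using tgrp_abelian[OF i bim_ab[OF M]]
  by (simp add: bimodule_def tgrp_simps i ball_simps bim_l[OF M] bim_r[OF M] bim_l_add[OF M] bim_r_add[OF M] bim_add_l[OF M]
   bim_add_r[OF M] bim_mult_l[OF M] bim_mult_r[OF M] bim_lr[OF M] bim_one[OF M] bim_scal[OF M])
qed

lemma tgrp_hom:
 assumes i: "inj \<iota>" and h: "bimod_hom M N h" and k: "!!x. x : car M ==> k (\<iota> x) = \<iota> (h x)" and M: "bimodule M"
 shows "bimod_hom (tgrp \<iota> M) (tgrp \<iota> N) k"
proof -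
 interpret M: abelian_group M by (rule bim_ab[OF M])
 show ?thesis
  by (simp add: bimod_hom_def tgrp_simps i ball_simps k bhomD[OF h] bim_l[OF M] bim_r[OF M])
qed

lemma tgrp_iota_hom: "inj \<iota> ==> bimod_hom M (tgrp \<iota> M) \<iota>"
 "inj \<iota> ==> bimod_hom (tgrp \<iota> M) M (inv_into UNIV \<iota>)"
 by (simp_all add: bimod_hom_def tgrp_simps)

theorem dg_object_transport:
 assumes i: "inj \<iota>" and C: "dg_object C" shows "dg_object (transport \<iota> C)"
proof -
 let ?T = "transport \<iota> C"
 interpret dgo Q R C by unfold_locales (rule C)
 note s = tr_simps(1) tr_simps(2-)[OF i] tgrp_simps(1,2) tgrp_simps(3-)[OF i] tgrp_signed[OF i G.ab_ax]
 show ?thesis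
 proof (rule dg_objectI)
  fix p n f assume f: "f : cochains p"
  show "bimod_hom (grp ?T n) (grp ?T (n + int p)) (lact ?T p n f)"
   "bimod_hom (grp ?T n) (grp ?T (n + int p)) (%x. ract ?T p n x f)"
   unfolding tr_simps(1) by (rule tgrp_hom[OF i lact_bim[OF f refl] _ bim] tgrp_hom[OF i ract_bim[OF f refl] _ bim]; simp add: s)+
 next
  fix n show "bimod_hom (grp ?T n) (grp ?T (n + 1)) (diff ?T n)"
   unfolding tr_simps(1) by (rule tgrp_hom[OF i diff_bim[OF refl] _ bim]; simp add: s)
  show "bimodule (grp ?T n)" unfolding tr_simps(1) by (rule tgrp_bimodule[OF i bim])
 next
  fix p n f x assume f: "f : cochains p" "x : elts ?T n"
  then obtain y where y: "x = \<iota> y" "y : elts C n" by (auto simp: s)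
  show "diff ?T (n + int p) (lact ?T p n f x) = lact ?T (p + 1) n (bK p f) x +[grp ?T (n + int p + 1)]
    signed (grp ?T (n + int p + 1)) (int p) (lact ?T p (n + 1) f (diff ?T n x))"
   "diff ?T (n + int p) (ract ?T p n x f) = ract ?T p (n + 1) (diff ?T n x) f +[grp ?T (n + int p + 1)]
    signed (grp ?T (n + int p + 1)) n (ract ?T (p + 1) n x (bK p f))"
   using diff_lact[OF f(1) y(2) refl refl refl refl] diff_ract[OF f(1) y(2) refl refl refl refl]
    lact_cl[OF f(1) diff_cl[OF y(2) refl], of "n + int p + 1"] ract_cl[OF bK_closed[OF f(1)] y(2), of "n + int p + 1"]
   by (simp_all add: s y(1))
  fix c show "lact ?T p n (cochain_scale p c f) x = scal c *[grp ?T (n + int p)] lact ?T p n f x"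
   "ract ?T p n x (cochain_scale p c f) = scal c *[grp ?T (n + int p)] ract ?T p n x f"
   using lact_scale[OF f(1) y(2) refl] ract_scale[OF f(1) y(2) refl] by (simp_all add: s y(1))
  fix g assume g: "g : cochains p"
  show "lact ?T p n (cochain_add p f g) x = lact ?T p n f x +[grp ?T (n + int p)] lact ?T p n g x"
   "ract ?T p n x (cochain_add p f g) = ract ?T p n x f +[grp ?T (n + int p)] ract ?T p n x g"
   using am_add[OF lact_coadd[OF y(2) refl], of f p g] am_add[OF ract_coadd[OF y(2) refl], of f p g] f g
   by (simp_all add: s y(1))
 next
  fix p q n f g x assume f: "f : cochains p" "g : cochains q" "x : elts ?T n"
  then obtain y where y: "x = \<iota> y" "y : elts C n" by (auto simp: s)
  show "lact ?T (p + q) n (cup p q f g) x = lact ?T p (n + int q) f (lact ?T q n g x)"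
   "ract ?T (p + q) n x (cup p q f g) = ract ?T q (n + int p) (ract ?T p n x f) g"
   "ract ?T q (n + int p) (lact ?T p n f x) g = lact ?T p (n + int q) f (ract ?T q n x g)"
   unfolding y(1) s(2-4) lact_cup[OF f(1,2) y(2) refl refl] ract_cup[OF f(1,2) y(2) refl refl] ract_lact[OF f(1,2) y(2) refl refl] by (rule refl)+
 next
  fix n x assume "x : elts ?T n"
  then obtain y where y: "x = \<iota> y" "y : elts C n" by (auto simp: s)
  show "lact ?T 0 n cochain_one x = x" "ract ?T 0 n x cochain_one = x"
   "diff ?T (n + 1) (diff ?T n x) = 0[grp ?T (n + 2)]"
   using lact_one[OF y(2)] ract_one[OF y(2)] diff_diff[OF y(2) refl refl] by (simp_all add: s y(1))
 qed
qed

lemma acyclic_objI: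
 assumes C: "dg_object C" and a: "!!n x. x : elts C n ==> diff C n x = 0[grp C (n + 1)] ==> EX y:elts C (n - 1). diff C (n - 1) y = x"
 shows "acyclic_obj C"
proof -
 interpret dgo Q R C by unfold_locales (rule C)
 show ?thesis unfolding acyclic_obj_def cocycles_def coboundaries_def
 proof (intro allI equalityI subsetI)
  fix n x assume "x : diff C (n - 1) ` elts C (n - 1)"
  then obtain y where y: "y : elts C (n - 1)" "x = diff C (n - 1) y" by blast
  then show "x : {x : elts C n. diff C n x = 0[grp C (n + 1)]}"
   using diff_cl[OF y(1), of n] diff_diff[OF y(1), of n "n + 1"] by simp
 qed (use a in blast)
qed

lemma acyclic_transport:
 assumes i: "inj \<iota>" and C: "dg_object C" and a: "acyclic_obj C" shows "acyclic_obj (transport \<iota> C)"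
proof (rule acyclic_objI[OF dg_object_transport[OF i C]])
 fix n x assume "x : elts (transport \<iota> C) n" and d: "diff (transport \<iota> C) n x = 0[grp (transport \<iota> C) (n + 1)]"
 then obtain y where y: "x = \<iota> y" "y : elts C n" by (auto simp: tgrp_simps tr_simps)
 then have "y : cocycles C n" using d by (simp add: cocycles_def tr_simps tgrp_simps i inj_eq)
 then have "y : coboundaries C n" using a by (simp add: acyclic_obj_def)
 then obtain z where "z : elts C (n - 1)" "y = diff C (n - 1) z" by (auto simp: coboundaries_def)
 then show "EX y:elts (transport \<iota> C) (n - 1). diff (transport \<iota> C) (n - 1) y = x"
  by (intro bexI[of _ "\<iota> z"]) (simp_all add: y tr_simps tgrp_simps i)
qed

text \<open>One function used in all degrees and compatible with every operation. An injection into
  a universe and its inverse on the image are both of this kind.\<close>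

definition strict_map :: "('v, 'e, 'f, 'x) qobj => ('v, 'e, 'f, 'y) qobj => ('x => 'y) => bool" where
 "strict_map C D e \<longleftrightarrow> (\<forall>n. bimod_hom (grp C n) (grp D n) e) &
  (\<forall>n. ALL x:elts C n. e (diff C n x) = diff D n (e x)) &
  (\<forall>p n f. ALL x:elts C n. e (lact C p n f x) = lact D p n f (e x) & e (ract C p n x f) = ract D p n (e x) f)"

lemma strict_transport:
 assumes "inj \<iota>"
 shows "strict_map C (transport \<iota> C) \<iota>" "strict_map (transport \<iota> C) C (inv_into UNIV \<iota>)"
 using tgrp_iota_hom[OF assms] by (auto simp: strict_map_def tr_simps tgrp_simps assms)

section \<open>Morphisms and K-projectivity under change of universe\<close>

lemma Mor_closed: "u : Mor P C r ==> bimod_hom (grp P n) (grp C (n + r)) (u n)"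
 and Mor_ext: "u : Mor P C r ==> u n : extensional (elts P n)"
 and Mor_lact: "u : Mor P C r ==> f : cochains p ==> x : elts P n ==>
   u (n + int p) (lact P p n f x) = signed (grp C (n + r + int p)) (r * int p) (lact C p (n + r) f (u n x))"
 and Mor_ract: "u : Mor P C r ==> f : cochains p ==> x : elts P n ==>
   u (n + int p) (ract P p n x f) = ract C p (n + r) (u n x) f"
 by (simp_all add: Mor_def)

lemma strict_Mor:
 assumes P: "dg_object P" and C: "dg_object C" and D: "dg_object D" and e: "strict_map C D e" and u: "u : Mor P C r"
 shows "(%n. \<lambda>x\<in>elts P n. e (u n x)) : Mor P D r"
  "dMor P D r (%n. \<lambda>x\<in>elts P n. e (u n x)) = (%n. \<lambda>x\<in>elts P n. e (dMor P C r u n x))"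
proof -
 interpret P: dgo Q R P by unfold_locales (rule P)
 interpret C: dgo Q R C by unfold_locales (rule C)
 interpret D: dgo Q R D by unfold_locales (rule D)
 have e1: "bimod_hom (grp C n) (grp D n) e" for n using e by (simp add: strict_map_def)
 have ed: "e (diff C n x) = diff D n (e x)" "e (lact C p n f x) = lact D p n f (e x)" "e (ract C p n x f) = ract D p n (e x) f"
  if "x : elts C n" for p n x f using e that by (simp_all add: strict_map_def)
 note es = am_signed[OF C.G.ab_ax D.G.ab_ax bhomD(1)[OF e1]]
 note em = am_diff[OF C.G.ab_ax D.G.ab_ax bhomD(1)[OF e1]]
 have uc: "u n x : elts C m" if "x : elts P n" "m = n + r" for n m x
  using bhomD(2)[OF Mor_closed[OF u] that(1)] that(2) by simp
 show "(%n. \<lambda>x\<in>elts P n. e (u n x)) : Mor P D r"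
  unfolding Mor_def
 proof (intro CollectI conjI allI ballI)
  fix n show "bimod_hom (grp P n) (grp D (n + r)) (\<lambda>x\<in>elts P n. e (u n x))"
   by (rule bimod_hom_cong[OF P.bim bimod_hom_comp[OF Mor_closed[OF u] e1]]) simp
 next
  fix p n f x assume f: "f : cochains p" and x: "x : elts P n"
  show "(\<lambda>x\<in>elts P (n + int p). e (u (n + int p) x)) (lact P p n f x)
   = signed (grp D (n + r + int p)) (r * int p) (lact D p (n + r) f ((\<lambda>x\<in>elts P n. e (u n x)) x))"
   using P.lact_cl[OF f x refl] C.lact_cl[OF f uc[OF x refl] refl] uc[OF x refl] x
   by (simp add: Mor_lact[OF u f x] es ed)
  show "(\<lambda>x\<in>elts P (n + int p). e (u (n + int p) x)) (ract P p n x f)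
   = ract D p (n + r) ((\<lambda>x\<in>elts P n. e (u n x)) x) f"
   using P.ract_cl[OF f x refl] C.ract_cl[OF f uc[OF x refl] refl] uc[OF x refl] x
   by (simp add: Mor_ract[OF u f x] ed)
 qed simp
 show "dMor P D r (%n. \<lambda>x\<in>elts P n. e (u n x)) = (%n. \<lambda>x\<in>elts P n. e (dMor P C r u n x))"
  unfolding dMor_def
 proof (rule ext, rule rext)
  fix n x assume x: "x : elts P n"
  have c: "diff P n x : elts P (n + 1)" by (rule P.diff_cl[OF x refl])
  have c2: "u (n + 1) (diff P n x) : elts C (n + r + 1)" by (rule uc[OF c]) simp
  have c3: "diff C (n + r) (u n x) : elts C (n + r + 1)" by (rule C.diff_cl[OF uc[OF x refl] refl])
  show "diff D (n + r) ((\<lambda>x\<in>elts P n. e (u n x)) x) -[grp D (n + r + 1)]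
    signed (grp D (n + r + 1)) r ((\<lambda>x\<in>elts P (n + 1). e (u (n + 1) x)) (diff P n x))
   = e ((\<lambda>x\<in>elts P n. diff C (n + r) (u n x) -[grp C (n + r + 1)] signed (grp C (n + r + 1)) r (u (n + 1) (diff P n x))) x)"
   using x c c2 c3 by (simp add: em es ed(1)[OF uc[OF x refl], symmetric])
 qed
qed

text \<open>The definition of \<open>K_projective\<close> quantifies over test objects with carriers
  in \<open>'u\<close>. An object over another type is tested after transport along an injection
  into \<open>'u\<close>, and the bounding morphism is carried back by the inverse.\<close>

lemma K_projective_large:
 fixes P :: "('v, 'e, 'f, 'u) qobj" and C :: "('v, 'e, 'f, 'y) qobj" and E :: "'y => 'u"
 assumes P: "dg_object P" "K_projective P" and C: "dg_object C" "acyclic_obj C" and E: "inj E" and u: "u : closed_mor P C r"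
 shows "EX v:Mor P C (r - 1). u = dMor P C (r - 1) v"
proof -
 let ?T = "transport E C" and ?j = "inv_into UNIV E"
 let ?u = "%n. \<lambda>x\<in>elts P n. E (u n x)"
 have T: "dg_object ?T" by (rule dg_object_transport[OF E C(1)])
 interpret C: dgo Q R C by unfold_locales (rule C)
 have u1: "u : Mor P C r" and u2: "dMor P C r u = zero_mor P C (r + 1)" using u by (simp_all add: closed_mor_def)
 note e = strict_transport[OF E, of C]
 note s = strict_Mor[OF P(1) C(1) T e(1) u1]
 have "dMor P ?T r ?u = zero_mor P ?T (r + 1)"
  unfolding s(2) u2 zero_mor_def by (rule ext, rule rext) (simp add: tr_simps tgrp_simps)
 then have "?u : closed_mor P ?T r" using s(1) by (simp add: closed_mor_def)
 moreover have "acyclic_Mor P ?T" using P(2) T acyclic_transport[OF E C] by (simp add: K_projective_def)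
 ultimately obtain v where v: "v : Mor P ?T (r - 1)" "?u = dMor P ?T (r - 1) v" by (auto simp: acyclic_Mor_def)
 note s' = strict_Mor[OF P(1) T C(1) e(2) v(1)]
 have "dMor P C (r - 1) (%n. \<lambda>x\<in>elts P n. ?j (v n x)) = u"
  unfolding s'(2) v(2)[symmetric]
  by (rule ext, rule extensionalityI[OF restrict_extensional Mor_ext[OF u1]]) (simp add: E)
 with s'(1) show ?thesis by (intro bexI[OF _ s'(1)]) simp
qed

end

section \<open>Contractions of acyclic complexes\<close>

context quadratic_algebra
begin

text \<open>Subspaces over the ground field, which acts on a bimodule through
  \<open>scal\<close>.\<close>

definition fsub :: "(('v, 'e, 'f) qalg, 'x) bimod => 'x set => bool" where
 "fsub M S \<longleftrightarrow> S <= car M & 0[M] : S & (ALL x:S. ALL y:S. x +[M] y : S) & (\<forall>c. ALL x:S. scal c *[M] x : S)"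

lemma bim_scal_zero: "bimodule M ==> x : car M ==> scal 0 *[M] x = 0[M]"
proof -
 assume M: "bimodule M" and x: "x : car M"
 interpret M: abelian_group M by (rule bim_ab[OF M])
 have "scal (0 + 0) *[M] x = scal 0 *[M] x +[M] scal 0 *[M] x" unfolding scal_add by (rule bim_add_l[OF M scal_cl scal_cl x])
 then show ?thesis using bim_l[OF M scal_cl x, of 0] M.add.l_cancel_one by simp
qed

lemma bim_scal_neg: "bimodule M ==> x : car M ==> scal (- 1) *[M] x = -[M] x"
proof -
 assume M: "bimodule M" and x: "x : car M"
 interpret M: abelian_group M by (rule bim_ab[OF M])
 have "scal (- 1 + 1) *[M] x = scal (- 1) *[M] x +[M] scal 1 *[M] x" unfolding scal_add by (rule bim_add_l[OF M scal_cl scal_cl x])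
 then have "scal (- 1) *[M] x +[M] x = 0[M]" using bim_scal_zero[OF M x] x by (simp add: bim_one[OF M])
 then show ?thesis using M.minus_equality[of "scal (- 1) *[M] x" x] bim_l[OF M scal_cl x, of "- 1"] x by simp
qed

lemma fsub_diff: "bimodule M ==> fsub M S ==> x : S ==> y : S ==> x -[M] y : S"
proof -
 assume M: "bimodule M" and S: "fsub M S" "x : S" "y : S"
 then have "y : car M" "scal (- 1) *[M] y : S" by (auto simp: fsub_def)
 then have "-[M] y : S" using bim_scal_neg[OF M, of y] by simp
 then show ?thesis using S by (simp add: fsub_def a_minus_def)
qed

lemma scal_scal: "bimodule M ==> x : car M ==> scal c *[M] (scal d *[M] x) = scal (c * d) *[M] x"
 by (simp add: bim_mult_l[symmetric] scal_mult)

text \<open>By Zorn's lemma there is a maximal subspace meeting \<open>Z\<close> in zero; maximality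
  forces it to span the bimodule together with \<open>Z\<close>.\<close>

lemma complement:
 assumes M: "bimodule M" and Z: "fsub M Z"
 obtains H where "fsub M H" "H \<inter> Z <= {0[M]}" "!!x. x : car M ==> EX z:Z. EX h:H. x = z +[M] h"
proof -
 interpret M: abelian_group M by (rule bim_ab[OF M])
 let ?A = "{H. fsub M H & H \<inter> Z <= {0[M]}}"
 have "EX H:?A. ALL X:?A. H <= X --> X = H"
 proof (rule subset_Zorn_nonempty)
  have "scal c *[M] 0[M] = 0[M]" for c by (rule bim_zero[OF M]) simp
  then have "{0[M]} : ?A" by (simp add: fsub_def)
  then show "?A \<noteq> {}" by blast
 next
  fix \<C> assume ne: "\<C> \<noteq> {}" and ch: "subset.chain ?A \<C>"
  then have sub: "!!H. H : \<C> ==> fsub M H & H \<inter> Z <= {0[M]}" and tot: "!!H K. H : \<C> ==> K : \<C> ==> H <= K \<or> K <= H"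
   using ch unfolding subset.chain_def by blast+
  have "fsub M (\<Union>\<C>)"
   unfolding fsub_def
  proof (intro conjI ballI allI)
   show "\<Union>\<C> <= car M" "0[M] : \<Union>\<C>" using sub ne unfolding fsub_def by blast+
   show "scal c *[M] x : \<Union>\<C>" if "x : \<Union>\<C>" for c x using sub that unfolding fsub_def by blast
   fix x y assume "x : \<Union>\<C>" "y : \<Union>\<C>"
   then obtain H K where HK: "x : H" "H : \<C>" "y : K" "K : \<C>" by blast
   show "x +[M] y : \<Union>\<C>"
   proof (cases "H <= K")
    case True then show ?thesis using sub[OF HK(4)] HK unfolding fsub_def by blast
   next
    case False then have "K <= H" using tot[OF HK(2,4)] by blast
    then show ?thesis using sub[OF HK(2)] HK unfolding fsub_def by blast
   qed
  qed
  then show "\<Union>\<C> : ?A" using sub by blast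
 qed
 then obtain H where HA: "H : ?A" and mxA: "ALL X:?A. H <= X --> X = H" by (rule bexE)
 have H: "fsub M H" "H \<inter> Z <= {0[M]}" and mx: "!!X. fsub M X ==> X \<inter> Z <= {0[M]} ==> H <= X ==> X = H"
  using HA mxA by simp_all
 have Hc: "h : H ==> h : car M" and H0: "0[M] : H" and Ha: "h : H ==> h' : H ==> h +[M] h' : H"
  and Hs: "h : H ==> scal c *[M] h : H" for h h' c
  using H(1) unfolding fsub_def by blast+
 have Zc: "z : Z ==> z : car M" and Z0: "0[M] : Z" and Zs: "z : Z ==> scal c *[M] z : Z" for z c
  using Z unfolding fsub_def by blast+
 note l = bim_l[OF M scal_cl]
 show ?thesis
 proof (rule that[OF H], rule ccontr)
  fix x assume x: "x : car M" and no: "\<not> (EX z:Z. EX h:H. x = z +[M] h)"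
  \<comment> \<open>The span of \<open>H\<close> and \<open>x\<close>. An element of it in
    \<open>Z\<close> with c \<noteq> 0 would put \<open>x\<close> into Z + H, so this larger
    subspace still meets \<open>Z\<close> in zero and contradicts maximality.\<close>
  let ?X = "{scal c *[M] x +[M] h | c h. h : H}"
  have cl: "scal c *[M] x : car M" for c by (rule l[OF x])
  have "fsub M ?X"
   unfolding fsub_def
  proof (intro conjI ballI allI)
   show "?X <= car M" using cl Hc by auto
   have "0[M] = scal 0 *[M] x +[M] 0[M]" using bim_scal_zero[OF M x] by simp
   then show "0[M] : ?X" using H0 by blast
  next
   fix y z assume "y : ?X" "z : ?X"
   then obtain c h c' h' where y: "y = scal c *[M] x +[M] h" "h : H" "z = scal c' *[M] x +[M] h'" "h' : H" by blast
   have "y +[M] z = scal (c + c') *[M] x +[M] (h +[M] h')"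
    using bim_add_l[OF M scal_cl scal_cl x, of c c'] cl Hc y by (simp add: scal_add M.a_ac)
   then show "y +[M] z : ?X" using Ha[OF y(2,4)] by blast
  next
   fix d y assume "y : ?X"
   then obtain c h where y: "y = scal c *[M] x +[M] h" "h : H" by blast
   then have "scal d *[M] y = scal (d * c) *[M] x +[M] scal d *[M] h"
    using cl Hc by (simp add: bim_l_add[OF M scal_cl] scal_scal[OF M x])
   then show "scal d *[M] y : ?X" using Hs[OF y(2)] by blast
  qed
  moreover have "?X \<inter> Z <= {0[M]}"
  proof
   fix z assume "z : ?X \<inter> Z"
   then obtain c h where z: "z = scal c *[M] x +[M] h" "h : H" "z : Z" by blast
   show "z : {0[M]}"
   proof (cases "c = 0")
    case True
    then have "z = h" using z Hc bim_scal_zero[OF M x] by simp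
    then show ?thesis using z H(2) by blast
   next
    case False
    have "scal (inverse c) *[M] z = x +[M] scal (inverse c) *[M] h"
    using False cl Hc[OF z(2)] x by (simp add: z(1) bim_l_add[OF M scal_cl] scal_scal[OF M x] bim_one[OF M])
    then have "x = scal (inverse c) *[M] z +[M] scal (- 1) *[M] (scal (inverse c) *[M] h)"
    using bim_scal_neg[OF M Hc[OF Hs[OF z(2)]]] Hc[OF Hs[OF z(2)], of "inverse c"] x by (simp add: M.a_assoc M.r_neg)
    then show ?thesis using no Zs[OF z(3)] Hs[OF Hs[OF z(2)]] by blast
   qed
  qed
  moreover have "H <= ?X"
  proof
   fix h assume h: "h : H"
   then have "h = scal 0 *[M] x +[M] h" using Hc bim_scal_zero[OF M x] by simp
   then show "h : ?X" using h by blast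
  qed
  ultimately have "?X = H" by (rule mx)
  moreover have "x = scal 1 *[M] x +[M] 0[M]" using x by (simp add: bim_one[OF M])
  ultimately have "x : H" using H0 by blast
  moreover have "x = 0[M] +[M] x" using x by simp
  ultimately show False using no Z0 by blast
 qed
qed

text \<open>Additive \<open>\<bbbF>\<close>-linear maps; for maps of bimodules this is weaker than \<open>bimod_hom\<close>.\<close>

definition flin :: "(('v, 'e, 'f) qalg, 'x) bimod => (('v, 'e, 'f) qalg, 'y) bimod => ('x => 'y) => bool" where
 "flin M N h \<longleftrightarrow> addmap M N h & (\<forall>c. ALL x:car M. h (scal c *[M] x) = scal c *[N] h x)"

lemma bimod_hom_flin: "bimod_hom M N h ==> flin M N h"
 by (simp add: flin_def bhomD(1,4))

lemma flin_left:
 assumes M: "bimodule M" and a: "a : car alg"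
 shows "flin M M (%x. a *[M] x)" "flin M M (%x. rsmult M x a)" "flin M M (%x. signed M n x)"
 by (simp_all add: flin_def bim_addmap[OF M a] bim_mult_l[OF M, symmetric] a scal_comm bim_lr[OF M]
   bim_signed(1)[OF M] am_signed_pointwise[OF bim_ab[OF M]] addmap_def[of M M "%x. x"])

end

text \<open>Complexes of A-bimodules without an action of the cochain algebra: the objects from
  which coinduction starts.\<close>

locale bcx = quadratic_algebra Q R for Q :: "('v, 'e) pre_digraph" and R :: "('v, 'e, 'f::field) tens set" +
 fixes M :: "int => (('v, 'e, 'f) qalg, 'x) bimod" and dM :: "int => 'x => 'x"
 assumes Mbim: "bimodule (M n)" and Mhom: "bimod_hom (M n) (M (n + 1)) (dM n)"
  and Mdd: "x : car (M n) ==> dM (n + 1) (dM n x) = 0[M (n + 2)]"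
begin

sublocale MG: abelian_group "M n" for n by (rule bim_ab[OF Mbim])

lemma Md_hom: "m = n + 1 ==> bimod_hom (M n) (M m) (dM n)"
 by (simp add: Mhom)

lemma Md_cl: "x : car (M n) ==> m = n + 1 ==> dM n x : car (M m)"
 by (rule bhomD(2)[OF Md_hom])

lemma Md_d: "x : car (M n) ==> m = n + 1 ==> k = n + 2 ==> dM m (dM n x) = 0[M k]"
 using Mdd by simp

definition exact :: bool where
 "exact \<longleftrightarrow> (\<forall>n. ALL x:car (M n). dM n x = 0[M (n + 1)] --> (EX y:car (M (n - 1)). dM (n - 1) y = x))"

text \<open>In each degree a complement \<open>H n\<close> of the cocycles is chosen. By exactness
  the differential maps \<open>H (n - 1)\<close> bijectively onto the cocycles of degree n, and
  \<open>s n x\<close> is the element of \<open>H (n - 1)\<close> whose differential is the cocycle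
  part of \<open>x\<close>. As complements of bimodules need not exist, \<open>s\<close> is only
  linear over the field.\<close>

lemma contraction:
 assumes ex: exact
 obtains s where "!!n m. m = n - 1 ==> flin (M n) (M m) (s n)"
  "!!n m k x. x : car (M n) ==> m = n - 1 ==> k = n + 1 ==> dM m (s n x) +[M n] s k (dM n x) = x"
proof -
 let ?Z = "%n. {x : car (M n). dM n x = 0[M (n + 1)]}"
 note dh = bhomD[OF Mhom]
 note dm = am_diff[OF MG.ab_ax MG.ab_ax dh(1)]
 have "fsub (M n) (?Z n)" for n
  unfolding fsub_def using am_zero[OF MG.ab_ax MG.ab_ax dh(1), of n] bim_zero(1)[OF Mbim scal_cl]
  by (simp add: dh(3,4) bim_l[OF Mbim])
 then have "\<exists>H. fsub (M n) H & H \<inter> ?Z n <= {0[M n]} & (ALL x:car (M n). EX z:?Z n. EX h:H. x = z +[M n] h)" for n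
  by (rule complement[OF Mbim, of n "?Z n"]) (intro exI conjI ballI)
 then have "\<exists>H. \<forall>n. fsub (M n) (H n) & H n \<inter> ?Z n <= {0[M n]} & (ALL x:car (M n). EX z:?Z n. EX h:H n. x = z +[M n] h)"
  by (intro choice allI)
 then obtain H where H': "!!n. fsub (M n) (H n) & H n \<inter> ?Z n <= {0[M n]} & (ALL x:car (M n). EX z:?Z n. EX h:H n. x = z +[M n] h)"
  by blast
 have H: "!!n. fsub (M n) (H n)" "!!n. H n \<inter> ?Z n <= {0[M n]}"
  "!!n x. x : car (M n) ==> EX z:?Z n. EX h:H n. x = z +[M n] h"
  using H' by simp_all
 have Hc: "h : H n ==> h : car (M n)" and H0: "0[M n] : H n" and Ha: "h : H n ==> h' : H n ==> h +[M n] h' : H n"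
  and Hs: "h : H n ==> scal c *[M n] h : H n" for h h' c n
  using H(1)[of n] unfolding fsub_def by blast+
 note Hd = fsub_diff[OF Mbim H(1)]
 define P where "P n x y \<longleftrightarrow> y : H (n - 1) & x -[M n] dM (n - 1) y : H n" for n x y
 have dc: "dM (n - 1) y : car (M n)" if "y : car (M (n - 1))" for n y by (rule Md_cl[OF that]) simp
 have dP: "dM (n - 1) (x +[M (n - 1)] y) = dM (n - 1) x +[M n] dM (n - 1) y" "dM (n - 1) (x -[M (n - 1)] y) = dM (n - 1) x -[M n] dM (n - 1) y"
   if "x : car (M (n - 1))" "y : car (M (n - 1))" for n x y using dh(3)[of x "n - 1" y] dm[of x "n - 1" y] that by simp_all
 \<comment> \<open>The cocycle part of \<open>x\<close> is the differential of some
   \<open>y\<close>, and removing from \<open>y\<close> its own cocycle part moves it into the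
   complement.\<close>
 have exP: "\<exists>y. P n x y" if x: "x : car (M n)" for n x
 proof -
  obtain z h where z: "z : ?Z n" "h : H n" "x = z +[M n] h" using H(3)[OF x] by blast
  then obtain y where y: "y : car (M (n - 1))" "dM (n - 1) y = z" using ex unfolding exact_def by blast
  obtain z' h' where z': "z' : ?Z (n - 1)" "h' : H (n - 1)" "y = z' +[M (n - 1)] h'" using H(3)[OF y(1)] by blast
  then have "dM (n - 1) h' = z" using y dc[OF Hc[OF z'(2)]] Hc[OF z'(2)] by (simp add: dP)
  moreover have "x -[M n] z = h" using MG.ag_eq[of "[z, h]" n "Mi (Pl (V 0) (V 1)) (V 0)" "V 1"] z Hc by (simp add: less_Suc_eq)
  ultimately show ?thesis using z z' by (auto simp: P_def)
 qed
 \<comment> \<open>The differential of y - y' lies in \<open>H n\<close> and is a cocycle, hence is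
   zero; then y - y' is itself a cocycle in \<open>H (n - 1)\<close>.\<close>
 have uq: "y = y'" if x: "x : car (M n)" and P: "P n x y" "P n x y'" for n x y y'
 proof -
  have c: "y : car (M (n - 1))" "y' : car (M (n - 1))" using P Hc by (simp_all add: P_def)
  have "(x -[M n] dM (n - 1) y') -[M n] (x -[M n] dM (n - 1) y) = dM (n - 1) y -[M n] dM (n - 1) y'"
   using MG.ag_eq[of "[x, dM (n - 1) y, dM (n - 1) y']" n "Mi (Mi (V 0) (V 2)) (Mi (V 0) (V 1))" "Mi (V 1) (V 2)"] x dc[OF c(1)] dc[OF c(2)]
   by (simp add: less_Suc_eq)
  then have "dM (n - 1) (y -[M (n - 1)] y') : H n" using Hd[of "x -[M n] dM (n - 1) y'" n "x -[M n] dM (n - 1) y"] P by (simp add: P_def dP c)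
  moreover have "dM (n - 1) (y -[M (n - 1)] y') : ?Z n"
   using dc[OF MG.minus_closed[OF c]] Md_d[OF MG.minus_closed[OF c], of n "n + 1"] by simp
  ultimately have "dM (n - 1) (y -[M (n - 1)] y') = 0[M n]" using H(2)[of n] by blast
  then have "y -[M (n - 1)] y' : ?Z (n - 1)" using c by simp
  moreover have "y -[M (n - 1)] y' : H (n - 1)" using Hd P by (simp add: P_def)
  ultimately have "y -[M (n - 1)] y' = 0[M (n - 1)]" using H(2)[of "n - 1"] by blast
  then show ?thesis using MG.ag_eq[of "[y, y']" "n - 1" "Pl (Mi (V 0) (V 1)) (V 1)" "V 0"] c by (simp add: less_Suc_eq)
 qed
 define s where "s n x = (THE y. P n x y)" for n x
 have sP: "P n x (s n x)" if "x : car (M n)" for n x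
  unfolding s_def by (rule theI') (use exP[OF that] uq[OF that] in blast)
 have sI: "s n x = y" if "x : car (M n)" "P n x y" for n x y using uq[OF that(1) sP[OF that(1)] that(2)] .
 have sc: "s n x : car (M (n - 1))" if "x : car (M n)" for n x using sP[OF that] Hc by (simp add: P_def)
 show ?thesis
 proof (rule that[of s])
  fix n m :: int assume m: "m = n - 1"
  show "flin (M n) (M m) (s n)" unfolding m flin_def
  proof (intro conjI addmapI allI ballI)
   fix x assume x: "x : car (M n)"
   show "s n x : car (M (n - 1))" by (rule sc[OF x])
   fix c show "s n (scal c *[M n] x) = scal c *[M (n - 1)] s n x"
   proof (rule sI)
    show "scal c *[M n] x : car (M n)" by (rule bim_l[OF Mbim scal_cl x])
    have "scal c *[M n] x -[M n] dM (n - 1) (scal c *[M (n - 1)] s n x) = scal c *[M n] (x -[M n] dM (n - 1) (s n x))"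
    using dh(4)[OF scal_cl sc[OF x], of c] x dc[OF sc[OF x]]
    by (simp add: am_diff[OF MG.ab_ax MG.ab_ax bim_addmap(1)[OF Mbim scal_cl]])
    then show "P n (scal c *[M n] x) (scal c *[M (n - 1)] s n x)" using sP[OF x] by (simp add: P_def Hs)
   qed
  next
   fix x y assume x: "x : car (M n)" and y: "y : car (M n)"
   show "s n (x +[M n] y) = s n x +[M (n - 1)] s n y"
   proof (rule sI)
    have "(x +[M n] y) -[M n] dM (n - 1) (s n x +[M (n - 1)] s n y) = (x -[M n] dM (n - 1) (s n x)) +[M n] (y -[M n] dM (n - 1) (s n y))"
    using MG.ag_eq[of "[x, y, dM (n - 1) (s n x), dM (n - 1) (s n y)]" n "Mi (Pl (V 0) (V 1)) (Pl (V 2) (V 3))" "Pl (Mi (V 0) (V 2)) (Mi (V 1) (V 3))"]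
    x y dc[OF sc[OF x]] dc[OF sc[OF y]] by (simp add: less_Suc_eq dP sc)
    then show "P n (x +[M n] y) (s n x +[M (n - 1)] s n y)" using sP[OF x] sP[OF y] by (simp add: P_def Ha)
   qed (use x y in simp)
  qed
 next
  fix n m k x assume x: "x : car (M n)" and m: "m = n - 1" and k: "k = n + 1"
  \<comment> \<open>The part of \<open>x\<close> in the complement is the unique preimage of
    \<open>dM n x\<close> there.\<close>
  have "s (n + 1) (dM n x) = x -[M n] dM (n - 1) (s n x)"
  proof (rule sI)
   show "dM n x : car (M (n + 1))" by (rule dh(2)[OF x])
   have "dM n (x -[M n] dM (n - 1) (s n x)) = dM n x"
    using Md_d[OF sc[OF x], of n "n + 1"] dh(2)[OF x] by (simp add: dm x dc sc, simp add: MG.minus_eq)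
   then show "P (n + 1) (dM n x) (x -[M n] dM (n - 1) (s n x))"
    using sP[OF x] dh(2)[OF x] H0 by (simp add: P_def MG.r_neg MG.minus_eq)
  qed
  then show "dM m (s n x) +[M n] s k (dM n x) = x"
   using MG.ag_eq[of "[x, dM (n - 1) (s n x)]" n "Pl (V 1) (Mi (V 0) (V 1))" "V 0"] x dc[OF sc[OF x]] by (simp add: less_Suc_eq m k)
 qed
qed

end

section \<open>Coinduction from complexes of bimodules to dg bimodules\<close>

context quadratic_algebra
begin

definition cM :: "nat => (('v, 'e, 'f) qalg, 'x) bimod => (('v, 'e, 'f) koszul_cochain => 'x) => bool" where
 "cM p M h \<longleftrightarrow> addmap (cgrp p) M h & (\<forall>c. ALL f:cochains p. h (cochain_scale p c f) = scal c *[M] h f)"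

definition clin :: "nat => nat => (('v, 'e, 'f) koszul_cochain => ('v, 'e, 'f) koszul_cochain) => bool" where
 "clin p r h \<longleftrightarrow> addmap (cgrp p) (cgrp r) h & (\<forall>c. ALL f:cochains p. h (cochain_scale p c f) = cochain_scale r c (h f))"

lemma cM_closed: "cM p M h ==> f : cochains p ==> h f : car M"
 using addmap_closed[of "cgrp p" M h f] by (simp add: cM_def)

lemma clin_closed: "clin p r h ==> f : cochains p ==> h f : cochains r"
 using addmap_closed[of "cgrp p" "cgrp r" h f] by (simp add: clin_def)

lemma cM_flin: "cM p M h ==> flin M N k ==> cM p N (%f. k (h f))"
 using am_comp[of "cgrp p" M h N k] cM_closed[of p M h] by (simp add: cM_def[of p N] flin_def, simp add: cM_def)

lemma cM_clin: "clin p r k ==> cM r M h ==> cM p M (%f. h (k f))"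
 using am_comp[of "cgrp p" "cgrp r" k M h] clin_closed by (simp add: cM_def clin_def)

lemma cM_diff: "bimodule M ==> cM p M h ==> cM p M k ==> cM p M (%f. h f -[M] k f)"
 using addmap_minus_pointwise[of M "cgrp p" h k] cM_closed[of p M h] cM_closed[of p M k]
 by (simp add: cM_def[of p M "%f. h f -[M] k f"] bim_ab am_diff[OF bim_ab bim_ab bim_addmap(1)[OF _ scal_cl]])
  (simp add: cM_def)

lemma cM_add: "bimodule M ==> cM p M h ==> cM p M k ==> cM p M (%f. h f +[M] k f)"
 using am_add_pointwise[of M "cgrp p" h k] cM_closed[of p M h] cM_closed[of p M k]
 by (simp add: cM_def[of p M "%f. h f +[M] k f"] bim_ab bim_l_add[OF _ scal_cl])
  (simp add: cM_def)

lemma cM_zero: "bimodule M ==> cM p M (%f. 0[M])"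
 using abelian_group.axioms(1)[OF bim_ab, of M]
 by (simp add: cM_def addmap_def abelian_monoid.zero_closed abelian_monoid.r_zero bim_zero(1)[OF _ scal_cl])

lemma cM_cong: "cM p M h ==> (!!f. f : cochains p ==> k f = h f) ==> cM p M k"
 by (simp add: cM_def addmap_def cochain_add_closed cochain_scale_closed)

lemma clin_cup_left: "g : cochains q ==> clin p (p + q) (%f. cup p q f g)"
 and clin_cup_right: "f : cochains p ==> clin q (p + q) (%g. cup p q f g)"
 and clin_bK: "clin p (p + 1) (bK p)"
 by (simp_all add: clin_def cup_addmap_left cup_addmap_right cup_scale bK_addmap bK_scale)

section \<open>The coinduced dg bimodule\<close>

definition cpairs :: "(nat \<times> nat \<times> ('v, 'e, 'f) koszul_cochain \<times> ('v, 'e, 'f) koszul_cochain) set" where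
 "cpairs = {(p, q, f, g). f : cochains p & g : cochains q}"

text \<open>A family is a function on quadruples, made extensional so that equality can be tested on
  cochains. The degrees belong to the index because one function may be a cochain in several
  degrees.\<close>

definition cfam :: "(nat => nat => ('v, 'e, 'f) koszul_cochain => ('v, 'e, 'f) koszul_cochain => 'x) =>
  nat \<times> nat \<times> ('v, 'e, 'f) koszul_cochain \<times> ('v, 'e, 'f) koszul_cochain => 'x" where
 "cfam t = (\<lambda>(p, q, f, g)\<in>cpairs. t p q f g)"

lemma cfam_eval [simp]: "f : cochains p ==> g : cochains q ==> cfam t (p, q, f, g) = t p q f g"
 by (simp add: cfam_def cpairs_def)

lemma cfam_cong: "(!!p q f g. f : cochains p ==> g : cochains q ==> t p q f g = u p q f g) ==> cfam t = cfam u"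
 unfolding cfam_def by (rule rext) (auto simp: cpairs_def)

lemma cfam_ext: "cfam t : extensional cpairs"
 by (simp add: cfam_def)

lemma cfam_eqI: "ph : extensional cpairs ==> (!!p q f g. f : cochains p ==> g : cochains q ==> t p q f g = ph (p, q, f, g)) ==> cfam t = ph"
 by (rule extensionalityI[OF cfam_ext], assumption) (auto simp: cpairs_def)

end

context bcx
begin

definition multi :: "int => (nat => nat => ('v, 'e, 'f) koszul_cochain => ('v, 'e, 'f) koszul_cochain => 'x) => bool" where
 "multi n t \<longleftrightarrow> (\<forall>p q. (ALL g:cochains q. cM p (M (deg n p q)) (%f. t p q f g)) &
   (ALL f:cochains p. cM q (M (deg n p q)) (%g. t p q f g)))"

lemma multiD:
 assumes "multi n t" "k = deg n p q"
 shows "g : cochains q ==> cM p (M k) (%f. t p q f g)" "f : cochains p ==> cM q (M k) (%g. t p q f g)"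
 using assms by (simp_all add: multi_def)

lemma multi_closed: "multi n t ==> k = deg n p q ==> f : cochains p ==> g : cochains q ==> t p q f g : car (M k)"
 using cM_closed[OF multiD(1)] .

lemma multi_flin:
 assumes "multi n t" "!!p q. flin (M (deg n p q)) (M (m + int p + int q)) (h p q)"
 shows "multi m (%p q f g. h p q (t p q f g))"
 unfolding multi_def using cM_flin[OF multiD(1)[OF assms(1) refl] assms(2)] cM_flin[OF multiD(2)[OF assms(1) refl] assms(2)] by blast

lemma multi_diff: "multi n t ==> multi n u ==> multi n (%p q f g. t p q f g -[M (deg n p q)] u p q f g)"
 by (simp add: multi_def cM_diff[OF Mbim])

lemma multi_add: "multi n t ==> multi n u ==> multi n (%p q f g. t p q f g +[M (deg n p q)] u p q f g)"
 by (simp add: multi_def cM_add[OF Mbim])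

lemma multi_left:
 assumes t: "multi n t" and F: "!!p. clin p (p + r) (F p)"
 shows "multi (n + int r) (%p q f g. t (p + r) q (F p f) g)"
 unfolding multi_def
proof (intro allI conjI ballI)
 fix p q g assume "g : cochains q"
 then show "cM p (M (deg (n + int r) p q)) (%f. t (p + r) q (F p f) g)"
  by (intro cM_clin[OF F multiD(1)[OF t]]) simp_all
next
 fix p q f assume "f : cochains p"
 then show "cM q (M (deg (n + int r) p q)) (%g. t (p + r) q (F p f) g)"
  by (intro multiD(2)[OF t] clin_closed[OF F]) simp_all
qed

lemma multi_right:
 assumes t: "multi n t" and F: "!!q. clin q (q + r) (F q)"
 shows "multi (n + int r) (%p q f g. t p (q + r) f (F q g))"
 unfolding multi_def
proof (intro allI conjI ballI)
 fix p q g assume "g : cochains q"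
 then show "cM p (M (deg (n + int r) p q)) (%f. t p (q + r) f (F q g))"
  by (intro multiD(1)[OF t] clin_closed[OF F]) simp_all
next
 fix p q f assume "f : cochains p"
 then show "cM q (M (deg (n + int r) p q)) (%g. t p (q + r) f (F q g))"
  by (intro cM_clin[OF F multiD(2)[OF t]]) simp_all
qed

lemma multi_cong:
 assumes "multi n t" "!!p q f g. f : cochains p ==> g : cochains q ==> u p q f g = t p q f g" shows "multi n u"
 unfolding multi_def using cM_cong[OF multiD(1)[OF assms(1) refl]] cM_cong[OF multiD(2)[OF assms(1) refl]] assms(2) by simp

text \<open>Degree n of Hom over the field of two copies of the cochain algebra into
  \<open>M\<close>. The value at (f, g) stands for the counit applied to f.ph.g, where the counit is
  evaluation at (1, 1); hence it has degree n + p + q.\<close>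

definition ci_grp :: "int => (('v, 'e, 'f) qalg, nat \<times> nat \<times> ('v, 'e, 'f) koszul_cochain \<times> ('v, 'e, 'f) koszul_cochain => 'x) bimod" where
 "ci_grp n = \<lparr>carrier = {ph : extensional cpairs. multi n (%p q f g. ph (p, q, f, g))},
   monoid.mult = (%_ _. undefined), one = undefined,
   ring.zero = cfam (%p q f g. 0[M (deg n p q)]),
   add = (\<lambda>ph \<psi>. cfam (%p q f g. ph (p, q, f, g) +[M (deg n p q)] \<psi> (p, q, f, g))),
   smult = (\<lambda>a ph. cfam (%p q f g. a *[M (deg n p q)] ph (p, q, f, g))),
   rsmult = (\<lambda>ph a. cfam (%p q f g. rsmult (M (deg n p q)) (ph (p, q, f, g)) a))\<rparr>"

text \<open>The formula is forced by the Leibniz rules: in d(f.ph.g) = b(f).ph.g + (-1)^p f.(d ph).g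
  + (-1)^(p+n) f.ph.b(g), solve for the middle term and apply the counit.\<close>

definition ci_diff where
 "ci_diff n ph = cfam (%p q f g. signed (M (deg (n + 1) p q)) (int p)
   (dM (deg n p q) (ph (p, q, f, g)) -[M (deg (n + 1) p q)] ph (p + 1, q, bK p f, g)
   -[M (deg (n + 1) p q)] signed (M (deg (n + 1) p q)) (int p + n) (ph (p, q + 1, f, bK q g))))"

text \<open>The actions are read off from f.(f'.ph).g = (f f').ph.g and f.(ph.g').g = f.ph.(g' g),
  which hold without signs.\<close>

definition coind where
 "coind = \<lparr>grp = ci_grp, diff = ci_diff,
   lact = (\<lambda>r n f' ph. cfam (%p q f g. ph (p + r, q, cup p r f f', g))),
   ract = (\<lambda>r n ph g'. cfam (%p q f g. ph (p, r + q, f, cup r q g' g)))\<rparr>"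

lemma ci_simps: "grp coind = ci_grp" "diff coind = ci_diff"
 "lact coind r n f' ph = cfam (%p q f g. ph (p + r, q, cup p r f f', g))"
 "ract coind r n ph g' = cfam (%p q f g. ph (p, r + q, f, cup r q g' g))"
 by (simp_all add: coind_def)

lemma ci_ops:
 "ph +[ci_grp n] \<psi> = cfam (%p q f g. ph (p, q, f, g) +[M (deg n p q)] \<psi> (p, q, f, g))"
 "0[ci_grp n] = cfam (%p q f g. 0[M (deg n p q)])"
 "a *[ci_grp n] ph = cfam (%p q f g. a *[M (deg n p q)] ph (p, q, f, g))"
 "rsmult (ci_grp n) ph a = cfam (%p q f g. rsmult (M (deg n p q)) (ph (p, q, f, g)) a)"
 by (simp_all add: ci_grp_def)

lemma ci_carrier: "ph : car (ci_grp n) \<longleftrightarrow> ph : extensional cpairs & multi n (%p q f g. ph (p, q, f, g))"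
 by (simp add: ci_grp_def)

lemma ci_ext: "ph : car (ci_grp n) ==> ph : extensional cpairs"
 and ci_multi: "ph : car (ci_grp n) ==> multi n (%p q f g. ph (p, q, f, g))"
 by (simp_all add: ci_carrier)

lemma cfam_ci: "multi n t ==> cfam t : car (ci_grp n)"
 unfolding ci_carrier using cfam_ext multi_cong[of n t "%p q f g. cfam t (p, q, f, g)"] by simp

lemma ci_cl: "ph : car (ci_grp n) ==> k = deg n p q ==> f : cochains p ==> g : cochains q ==> ph (p, q, f, g) : car (M k)"
 using multi_closed[OF ci_multi] .

lemma ci_abelian: "abelian_group (ci_grp n)"
proof (rule fun_abelian_group[where D = cpairs and H = "%(p, q, f, g). M (deg n p q)"])
 fix ph assume p: "ph : car (ci_grp n)"
 show "ph : extensional cpairs" by (rule ci_ext[OF p])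
 show "x : cpairs ==> ph x : car (case x of (p, q, f, g) => M (deg n p q))" for x
  using ci_cl[OF p refl] by (auto simp: cpairs_def)
 \<comment> \<open>Negation is written as multiplication by the scalar -1, for which linearity of
   the resulting family in both arguments is already available.\<close>
 have "cfam (%p q f g. scal (- 1) *[M (deg n p q)] ph (p, q, f, g)) : car (ci_grp n)"
  by (rule cfam_ci[OF multi_flin[OF ci_multi[OF p] flin_left(1)[OF Mbim scal_cl]]])
 moreover have "cfam (%p q f g. scal (- 1) *[M (deg n p q)] ph (p, q, f, g)) = (\<lambda>x\<in>cpairs. -[case x of (p, q, f, g) => M (deg n p q)] ph x)"
  unfolding cfam_def by (rule rext) (auto simp: cpairs_def bim_scal_neg[OF Mbim] ci_cl[OF p refl])
 ultimately show "(\<lambda>x\<in>cpairs. -[case x of (p, q, f, g) => M (deg n p q)] ph x) : car (ci_grp n)" by simp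
 fix \<psi> assume q: "\<psi> : car (ci_grp n)"
 show "ph +[ci_grp n] \<psi> : car (ci_grp n)" unfolding ci_ops by (rule cfam_ci[OF multi_add[OF ci_multi[OF p] ci_multi[OF q]]])
 show "ph +[ci_grp n] \<psi> = (\<lambda>x\<in>cpairs. ph x +[case x of (p, q, f, g) => M (deg n p q)] \<psi> x)"
  unfolding ci_ops cfam_def by (rule rext) auto
next
 show "0[ci_grp n] = (\<lambda>x\<in>cpairs. 0[case x of (p, q, f, g) => M (deg n p q)])"
  unfolding ci_ops cfam_def by (rule rext) auto
 show "0[ci_grp n] : car (ci_grp n)" unfolding ci_ops by (rule cfam_ci) (simp add: multi_def cM_zero[OF Mbim])
qed (auto simp: MG.ab_ax)

sublocale CG: abelian_group "ci_grp n" for n by (rule ci_abelian)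

lemma ci_eval: "f : cochains p ==> g : cochains q ==> k = deg n p q ==> bimod_hom (ci_grp n) (M k) (\<lambda>ph. ph (p, q, f, g))"
 by (simp add: bimod_hom_def ci_ops ci_cl)

lemma ci_bimodule: "bimodule (ci_grp n)"
 unfolding bimodule_def
proof (intro conjI ballI allI)
 note B = Mbim
 fix a ph assume a: "a : car alg" and p: "ph : car (ci_grp n)"
 note e = ci_ext[OF p] and c = ci_cl[OF p refl]
 show "a *[ci_grp n] ph : car (ci_grp n)" "rsmult (ci_grp n) ph a : car (ci_grp n)"
  unfolding ci_ops by (rule cfam_ci multi_flin[OF ci_multi[OF p] flin_left(1)[OF Mbim a]] multi_flin[OF ci_multi[OF p] flin_left(2)[OF Mbim a]])+
 { fix \<psi> assume q: "\<psi> : car (ci_grp n)"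
  note c' = ci_cl[OF q refl]
  show "a *[ci_grp n] (ph +[ci_grp n] \<psi>) = a *[ci_grp n] ph +[ci_grp n] a *[ci_grp n] \<psi>"
   "rsmult (ci_grp n) (ph +[ci_grp n] \<psi>) a = rsmult (ci_grp n) ph a +[ci_grp n] rsmult (ci_grp n) \<psi> a"
   unfolding ci_ops by (rule cfam_cong, simp add: bim_l_add[OF B a] bim_r_add[OF B a] c c')+ }
 fix b assume b: "b : car alg"
 show "(a +[alg] b) *[ci_grp n] ph = a *[ci_grp n] ph +[ci_grp n] b *[ci_grp n] ph"
  "rsmult (ci_grp n) ph (a +[alg] b) = rsmult (ci_grp n) ph a +[ci_grp n] rsmult (ci_grp n) ph b"
  "(a ** b) *[ci_grp n] ph = a *[ci_grp n] (b *[ci_grp n] ph)"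
  "rsmult (ci_grp n) ph (a ** b) = rsmult (ci_grp n) (rsmult (ci_grp n) ph a) b"
  "rsmult (ci_grp n) (a *[ci_grp n] ph) b = a *[ci_grp n] rsmult (ci_grp n) ph b"
  unfolding ci_ops
  by (rule cfam_cong, simp add: bim_add_l[OF B a b] bim_add_r[OF B a b] bim_mult_l[OF B a b] bim_mult_r[OF B a b] bim_lr[OF B a b] c)+
next
 fix ph assume p: "ph : car (ci_grp n)"
 note e = ci_ext[OF p] and c = ci_cl[OF p refl]
 show "1[alg] *[ci_grp n] ph = ph" "rsmult (ci_grp n) ph 1[alg] = ph"
  unfolding ci_ops by (rule cfam_eqI[OF e], simp add: bim_one[OF Mbim] c)+
 fix r show "scal r *[ci_grp n] ph = rsmult (ci_grp n) ph (scal r)"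
  unfolding ci_ops by (rule cfam_cong) (simp add: bim_scal[OF Mbim] c)
qed (rule ci_abelian)

lemma ci_homI:
 assumes "!!ph. ph : car G ==> multi m (%p q f g. h p q f g ph)"
  "!!p q f g. f : cochains p ==> g : cochains q ==> bimod_hom G (M (m + int p + int q)) (h p q f g)"
 shows "bimod_hom G (ci_grp m) (\<lambda>ph. cfam (%p q f g. h p q f g ph))"
proof (intro bimod_homI addmapI)
 fix ph assume p: "ph : car G"
 show "cfam (%p q f g. h p q f g ph) : car (ci_grp m)" by (rule cfam_ci[OF assms(1)[OF p]])
 show "cfam (%p q f g. h p q f g (ph +[G] \<psi>)) = cfam (%p q f g. h p q f g ph) +[ci_grp m] cfam (%p q f g. h p q f g \<psi>)"
  if "\<psi> : car G" for \<psi>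
  unfolding ci_ops(1)[where n = m] by (rule cfam_cong) (simp add: bhomD(3)[OF assms(2) p that])
 fix a assume a: "a : car alg"
 show "cfam (%p q f g. h p q f g (a *[G] ph)) = a *[ci_grp m] cfam (%p q f g. h p q f g ph)"
  "cfam (%p q f g. h p q f g (rsmult G ph a)) = rsmult (ci_grp m) (cfam (%p q f g. h p q f g ph)) a"
  unfolding ci_ops(3,4)[where n = m] by (rule cfam_cong, simp add: bhomD(4,5)[OF assms(2) a p])+
qed

lemma ci_signed:
 assumes p: "ph : car (ci_grp n)"
 shows "signed (ci_grp n) k ph = cfam (%p q f g. signed (M (deg n p q)) k (ph (p, q, f, g)))"
 by (rule cfam_eqI[OF ci_ext[OF CG.signed_cl[OF p]], symmetric])
  (simp add: am_signed[OF ci_abelian MG.ab_ax bhomD(1)[OF ci_eval] p])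

lemma ci_lact_hom: "f' : cochains r ==> bimod_hom (ci_grp n) (ci_grp (n + int r)) (\<lambda>ph. cfam (%p q f g. ph (p + r, q, cup p r f f', g)))"
 by (rule ci_homI[OF multi_left[OF ci_multi clin_cup_left]], assumption+, rule ci_eval) (simp_all add: cup_cl)

lemma ci_ract_hom: "g' : cochains r ==> bimod_hom (ci_grp n) (ci_grp (n + int r)) (\<lambda>ph. cfam (%p q f g. ph (p, r + q, f, cup r q g' g)))"
 by (rule ci_homI, subst add.commute[of r], rule multi_right[OF ci_multi], assumption, subst add.commute, erule clin_cup_right,
   rule ci_eval) (simp_all add: cup_cl)

lemma ci_diff_multi:
 assumes p: "ph : car (ci_grp n)"
 shows "multi (n + 1) (%p q f g. signed (M (deg (n + 1) p q)) (int p)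
   (dM (deg n p q) (ph (p, q, f, g)) -[M (deg (n + 1) p q)] ph (p + 1, q, bK p f, g)
   -[M (deg (n + 1) p q)] signed (M (deg (n + 1) p q)) (int p + n) (ph (p, q + 1, f, bK q g))))"
 using multi_left[OF ci_multi[OF p] clin_bK] multi_right[OF ci_multi[OF p] clin_bK]
 by (intro multi_flin[OF _ flin_left(3)[OF Mbim A.one_closed]] multi_diff multi_flin[OF ci_multi[OF p] bimod_hom_flin[OF Md_hom]]) simp_all

lemma ci_diff_hom: "bimod_hom (ci_grp n) (ci_grp (n + 1)) (ci_diff n)"
 unfolding ci_diff_def
 by (rule ci_homI[OF ci_diff_multi], assumption, intro bimod_hom_signed bimod_hom_minus Mbim bimod_hom_comp[OF ci_eval Md_hom] ci_eval)
  (simp_all add: clin_closed[OF clin_bK])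

lemma ci_diff_eval:
 assumes "f : cochains p" "g : cochains q" "k = deg (n + 1) p q" "m = deg n p q" "p' = p + 1" "q' = q + 1"
 shows "ci_diff n ph (p, q, f, g) = signed (M k) (int p) (dM m (ph (p, q, f, g)) -[M k] ph (p', q, bK p f, g)
   -[M k] signed (M k) (int p + n) (ph (p, q', f, bK q g)))"
 using assms by (simp add: ci_diff_def)

end

context bcx
begin

lemma ci_add1: "ph : car (ci_grp n) ==> k = deg n p q ==> g : cochains q ==> addmap (cgrp p) (M k) (%f. ph (p, q, f, g))"
 and ci_add2: "ph : car (ci_grp n) ==> k = deg n p q ==> f : cochains p ==> addmap (cgrp q) (M k) (%g. ph (p, q, f, g))"
 and ci_scale1: "ph : car (ci_grp n) ==> k = deg n p q ==> f : cochains p ==> g : cochains q ==>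
   ph (p, q, cochain_scale p c f, g) = scal c *[M k] ph (p, q, f, g)"
 and ci_scale2: "ph : car (ci_grp n) ==> k = deg n p q ==> f : cochains p ==> g : cochains q ==>
   ph (p, q, f, cochain_scale q c g) = scal c *[M k] ph (p, q, f, g)"
 using multiD(1)[OF ci_multi] multiD(2)[OF ci_multi] by (simp_all add: cM_def)

text \<open>The Leibniz rule of the cochain algebra inside the first argument, where
  \<open>ph\<close> is additive.\<close>

lemma ci_bK_cup1:
 assumes p: "ph : car (ci_grp n)" and k: "k = n + 1 + int a + int b + int q" and f: "f : cochains a" "f' : cochains b" and g: "g : cochains q"
 shows "ph (a + b + 1, q, bK (a + b) (cup a b f f'), g) = ph (a + b + 1, q, cup (a + 1) b (bK a f) f', g) +[M k]
   signed (M k) (int a) (ph (a + b + 1, q, cup a (b + 1) f (bK b f'), g))"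
proof -
 have c: "cup (a + 1) b (bK a f) f' : car (cgrp (a + b + 1))" "cup a (b + 1) f (bK b f') : car (cgrp (a + b + 1))"
  using cup_cl[OF bK_closed[OF f(1)] f(2)] cup_cl[OF f(1) bK_closed[OF f(2)]] by (simp_all add: ac_simps)
 have h: "addmap (cgrp (a + b + 1)) (M k) (%f. ph (a + b + 1, q, f, g))" using ci_add1[OF p _ g, of k "a + b + 1"] k by simp
 show ?thesis unfolding bK_cup[OF f]
  using am_add[OF h c(1) C.signed_cl[OF c(2)]] am_signed[OF ab_cgrp MG.ab_ax h c(2)] by simp
qed

lemma ci_bK_cup2:
 assumes p: "ph : car (ci_grp n)" and k: "k = n + 1 + int q + int a + int b" and g: "g : cochains a" "g' : cochains b" and f: "f : cochains q"
 shows "ph (q, a + b + 1, f, bK (a + b) (cup a b g g')) = ph (q, a + b + 1, f, cup (a + 1) b (bK a g) g') +[M k]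
   signed (M k) (int a) (ph (q, a + b + 1, f, cup a (b + 1) g (bK b g')))"
proof -
 have c: "cup (a + 1) b (bK a g) g' : car (cgrp (a + b + 1))" "cup a (b + 1) g (bK b g') : car (cgrp (a + b + 1))"
  using cup_cl[OF bK_closed[OF g(1)] g(2)] cup_cl[OF g(1) bK_closed[OF g(2)]] by (simp_all add: ac_simps)
 have h: "addmap (cgrp (a + b + 1)) (M k) (%g. ph (q, a + b + 1, f, g))" using ci_add2[OF p _ f, of k "a + b + 1"] k by simp
 show ?thesis unfolding bK_cup[OF g]
  using am_add[OF h c(1) C.signed_cl[OF c(2)]] am_signed[OF ab_cgrp MG.ab_ax h c(2)] by simp
qed

text \<open>Both sides are combinations of four values. The Leibniz rule for the product f f' yields
  X1 and X2, and X2 is also the value of the action of \<open>bK r f'\<close>.\<close>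

lemma ci_diff_lact:
 assumes p: "ph : car (ci_grp n)" and f': "f' : cochains r"
 shows "diff coind (n + int r) (lact coind r n f' ph) = lact coind (r + 1) n (bK r f') ph +[ci_grp (n + int r + 1)]
    signed (ci_grp (n + int r + 1)) (int r) (lact coind r (n + 1) f' (diff coind n ph))"
proof -
 have dc: "ci_diff n ph : car (ci_grp (n + 1))" by (rule bhomD(2)[OF ci_diff_hom p])
 have l: "cfam (%p q f g. ci_diff n ph (p + r, q, cup p r f f', g)) : car (ci_grp (n + int r + 1))"
  using bhomD(2)[OF ci_lact_hom[OF f'] dc] by (simp add: ac_simps)
 show ?thesis unfolding ci_simps ci_signed[OF l] ci_ops ci_diff_def[of "n + int r"]
 proof (rule cfam_cong, goal_cases)
  case (1 p q f g) note f = 1(1) and g = 1(2)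
  note ff = cup_cl[OF f f']
  have ff': "cup (p + 1) r (bK p f) f' : cochains (p + r + 1)" "cup p (r + 1) f (bK r f') : cochains (p + r + 1)"
   using cup_cl[OF bK_closed[OF f] f'] cup_cl[OF f bK_closed[OF f']] by (simp_all add: ac_simps)
  define k where "k = n + 1 + int (p + r) + int q"
  have i: "n + int r + 1 + int p + int q = k" "deg (n + int r) p q = n + int (p + r) + int q" "p + 1 + r = p + r + 1" "p + (r + 1) = p + r + 1" by (simp_all add: k_def)
  define X0 X1 X2 X3 where X: "X0 = dM (n + int (p + r) + int q) (ph (p + r, q, cup p r f f', g))"
   "X1 = ph (p + r + 1, q, cup (p + 1) r (bK p f) f', g)" "X2 = ph (p + r + 1, q, cup p (r + 1) f (bK r f'), g)"
   "X3 = ph (p + r, q + 1, cup p r f f', bK q g)"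
  have c: "X0 : car (M k)" "X1 : car (M k)" "X2 : car (M k)" "X3 : car (M k)"
   unfolding X by ((rule Md_cl)?, rule ci_cl[OF p], simp_all add: k_def ff ff' g bK_closed)+
  have e: "ci_diff n ph (p + r, q, cup p r f f', g) = signed (M k) (int (p + r)) (X0 -[M k] (X1 +[M k] signed (M k) (int p) X2)
   -[M k] signed (M k) (int (p + r) + n) X3)"
   unfolding ci_diff_eval[OF ff g k_def refl refl refl] X
   using ci_bK_cup1[OF p _ f f' g, of k] by (simp add: k_def)
  have ag: "agv (M k) [X0, X1, X2, X3] (Sg (int p) (Mi (Mi (V 0) (V 1)) (Sg (int p + (n + int r)) (V 3)))) = agv (M k) [X0, X1, X2, X3] (Pl (V 2) (Sg (int r) (Sg (int (p + r)) (Mi (Mi (V 0) (Pl (V 1) (Sg (int p) (V 2)))) (Sg (int (p + r) + n) (V 3))))))"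
   by (rule MG.ag_eq) (use c in "auto simp: less_Suc_eq isign_def")
  show ?case
   unfolding i cfam_eval[OF f g] cfam_eval[OF bK_closed[OF f] g] cfam_eval[OF f bK_closed[OF g]] e X[symmetric]
   using ag by simp
 qed
qed

lemma ci_diff_ract:
 assumes p: "ph : car (ci_grp n)" and g': "g' : cochains r"
 shows "diff coind (n + int r) (ract coind r n ph g') = ract coind r (n + 1) (diff coind n ph) g' +[ci_grp (n + int r + 1)]
    signed (ci_grp (n + int r + 1)) n (ract coind (r + 1) n ph (bK r g'))"
proof -
 have l: "cfam (%p q f g. ph (p, r + 1 + q, f, cup (r + 1) q (bK r g') g)) : car (ci_grp (n + int r + 1))"
  using bhomD(2)[OF ci_ract_hom[OF bK_closed[OF g']] p] by (simp add: ac_simps)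
 show ?thesis unfolding ci_simps ci_signed[OF l] ci_ops ci_diff_def[of "n + int r"]
 proof (rule cfam_cong, goal_cases)
  case (1 p q f g) note f = 1(1) and g = 1(2)
  note gg = cup_cl[OF g' g]
  have gg': "cup (r + 1) q (bK r g') g : cochains (r + q + 1)" "cup r (q + 1) g' (bK q g) : cochains (r + q + 1)"
   using cup_cl[OF bK_closed[OF g'] g] cup_cl[OF g' bK_closed[OF g]] by (simp_all add: ac_simps)
  define k where "k = n + 1 + int p + int (r + q)"
  have i: "n + int r + 1 + int p + int q = k" "deg (n + int r) p q = n + int p + int (r + q)" "r + 1 + q = r + q + 1" "r + (q + 1) = r + q + 1" by (simp_all add: k_def)
  define X0 X1 X2 X3 where X: "X0 = dM (n + int p + int (r + q)) (ph (p, r + q, f, cup r q g' g))"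
   "X1 = ph (p + 1, r + q, bK p f, cup r q g' g)" "X2 = ph (p, r + q + 1, f, cup (r + 1) q (bK r g') g)"
   "X3 = ph (p, r + q + 1, f, cup r (q + 1) g' (bK q g))"
  have c: "X0 : car (M k)" "X1 : car (M k)" "X2 : car (M k)" "X3 : car (M k)"
   unfolding X by ((rule Md_cl)?, rule ci_cl[OF p], simp_all add: k_def gg gg' f bK_closed)+
  have e: "ci_diff n ph (p, r + q, f, cup r q g' g) = signed (M k) (int p) (X0 -[M k] X1
   -[M k] signed (M k) (int p + n) (X2 +[M k] signed (M k) (int r) X3))"
   unfolding ci_diff_eval[OF f gg k_def refl refl refl] X
   using ci_bK_cup2[OF p _ g' g f, of k] by (simp add: k_def)
  have ag: "agv (M k) [X0, X1, X2, X3] (Sg (int p) (Mi (Mi (V 0) (V 1)) (Sg (int p + (n + int r)) (V 3)))) = agv (M k) [X0, X1, X2, X3] (Pl (Sg (int p) (Mi (Mi (V 0) (V 1)) (Sg (int p + n) (Pl (V 2) (Sg (int r) (V 3)))))) (Sg n (V 2)))"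
   by (rule MG.ag_eq) (use c in "auto simp: less_Suc_eq isign_def")
  show ?case
   unfolding i cfam_eval[OF f g] cfam_eval[OF bK_closed[OF f] g] cfam_eval[OF f bK_closed[OF g]] e X[symmetric]
   using ag by simp
 qed
qed

text \<open>Terms with \<open>dM\<close> twice, or with \<open>bK\<close> twice in the same
  argument, vanish. The terms with one \<open>dM\<close> and one \<open>bK\<close>, and the term X3
  with \<open>bK\<close> in both arguments, each occur twice with opposite signs.\<close>

lemma ci_diff_diff:
 assumes p: "ph : car (ci_grp n)"
 shows "ci_diff (n + 1) (ci_diff n ph) = 0[ci_grp (n + 2)]"
 unfolding ci_ops ci_diff_def[of "n + 1"]
proof (rule cfam_cong, goal_cases)
 case (1 p q f g) note f = 1(1) and g = 1(2)
 note bf = bK_closed[OF f] and bg = bK_closed[OF g]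
 define l k where "l = deg (n + 1) p q" and "k = n + 2 + int p + int q"
 note h = bhomD(1)[OF Md_hom[of k l]]
 note ab = MG.ab_ax
 have i: "n + 1 + 1 + int p + int q = k" "deg (n + 1) p q = l" "n + 2 + int p + int q = k" and kl: "k = l + 1" by (simp_all add: k_def l_def)
 define X0 X1 X2 X3 where X: "X0 = dM (deg n p q) (ph (p, q, f, g))" "X1 = ph (p + 1, q, bK p f, g)"
  "X2 = ph (p, q + 1, f, bK q g)" "X3 = ph (p + 1, q + 1, bK p f, bK q g)"
 have c: "X0 : car (M l)" "X1 : car (M l)" "X2 : car (M l)" "X3 : car (M k)"
  unfolding X by ((rule Md_cl)?, rule ci_cl[OF p], simp_all add: k_def l_def f g bf bg)+
 have d0: "dM l X0 = 0[M k]" unfolding X by (rule Md_d[OF ci_cl[OF p refl f g]]) (simp_all add: k_def l_def)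
 have dc: "dM l X1 : car (M k)" "dM l X2 : car (M k)" using c Md_cl kl by simp_all
 have pq: "p + 1 + 1 = p + 2" "q + 1 + 1 = q + 2" by simp_all
 have z1: "ph (p + 1 + 1, q, bK (p + 1) (bK p f), g) = 0[M k]" unfolding bK_bK[OF f] pq
  using am_zero[OF ab_cgrp ab ci_add1[OF p _ g, of k "p + 2"]] by (simp add: k_def)
 have z2: "ph (p, q + 1 + 1, f, bK (q + 1) (bK q g)) = 0[M k]" unfolding bK_bK[OF g] pq
  using am_zero[OF ab_cgrp ab ci_add2[OF p _ f, of k "q + 2"]] by (simp add: k_def)
 have e0: "ci_diff n ph (p, q, f, g) = signed (M l) (int p) (X0 -[M l] X1 -[M l] signed (M l) (int p + n) X2)"
  using ci_diff_eval[OF f g l_def refl refl refl] by (simp add: X)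
 have e1: "ci_diff n ph (p + 1, q, bK p f, g) = signed (M k) (int (p + 1)) (dM l X1 -[M k] 0[M k] -[M k] signed (M k) (int (p + 1) + n) X3)"
  using ci_diff_eval[OF bf g, of k n l "p + 1 + 1" "q + 1" ph] z1 by (simp add: X l_def k_def)
 have e2: "ci_diff n ph (p, q + 1, f, bK q g) = signed (M k) (int p) (dM l X2 -[M k] X3 -[M k] signed (M k) (int p + n) 0[M k])"
  using ci_diff_eval[OF f bg, of k n l "p + 1" "q + 1 + 1" ph] z2 by (simp add: X l_def k_def)
 have d: "dM l (signed (M l) (int p) (X0 -[M l] X1 -[M l] signed (M l) (int p + n) X2))
   = signed (M k) (int p) (0[M k] -[M k] dM l X1 -[M k] signed (M k) (int p + n) (dM l X2))"
  using c by (simp add: am_signed[OF ab ab h[OF kl]] am_diff[OF ab ab h[OF kl]] d0)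
 have ag: "agv (M k) [dM l X1, dM l X2, X3] (Sg (int p) (Mi (Mi (Sg (int p) (Mi (Mi Zr (V 0)) (Sg (int p + n) (V 1))))
    (Sg (int (p + 1)) (Mi (Mi (V 0) Zr) (Sg (int (p + 1) + n) (V 2))))) (Sg (int p + (n + 1)) (Sg (int p) (Mi (Mi (V 1) (V 2)) (Sg (int p + n) Zr)))))) = agv (M k) [dM l X1, dM l X2, X3] (Zr)"
   by (rule MG.ag_eq) (use dc c(4) in "auto simp: less_Suc_eq isign_def")
  show ?case
  unfolding i e0 e1 e2 d
  using ag by simp
qed

theorem dg_object_coind: "dg_object coind"
proof (rule dg_objectI)
 show "bimodule (grp coind n)" for n by (simp add: ci_simps ci_bimodule)
 show "bimod_hom (grp coind n) (grp coind (n + 1)) (diff coind n)" for n by (simp add: ci_simps ci_diff_hom)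
 show "bimod_hom (grp coind n) (grp coind (n + int p)) (lact coind p n f)" if "f : cochains p" for p n f
  using ci_lact_hom[OF that] by (simp add: coind_def)
 show "bimod_hom (grp coind n) (grp coind (n + int p)) (%x. ract coind p n x f)" if "f : cochains p" for p n f
  using ci_ract_hom[OF that] by (simp add: coind_def)
next
 fix p n f ph assume f: "f : cochains p" and "ph : elts coind n"
 then have p: "ph : car (ci_grp n)" by (simp add: ci_simps)
 show "diff coind (n + int p) (lact coind p n f ph) = lact coind (p + 1) n (bK p f) ph +[grp coind (n + int p + 1)]
    signed (grp coind (n + int p + 1)) (int p) (lact coind p (n + 1) f (diff coind n ph))"
  "diff coind (n + int p) (ract coind p n ph f) = ract coind p (n + 1) (diff coind n ph) f +[grp coind (n + int p + 1)]
    signed (grp coind (n + int p + 1)) n (ract coind (p + 1) n ph (bK p f))"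
  unfolding ci_simps(1) by (rule ci_diff_lact[OF p f] ci_diff_ract[OF p f])+
 fix c
 show "lact coind p n (cochain_scale p c f) ph = scal c *[grp coind (n + int p)] lact coind p n f ph"
  "ract coind p n ph (cochain_scale p c f) = scal c *[grp coind (n + int p)] ract coind p n ph f"
  unfolding ci_simps ci_ops
  by (rule cfam_cong, simp add: cup_scale f ci_scale1[OF p refl] ci_scale2[OF p refl] cup_cl, simp add: ac_simps)+
 fix g assume g: "g : cochains p"
 note cr = am_add[OF cup_addmap_right, simplified] and cl = am_add[OF cup_addmap_left, simplified]
 show "lact coind p n (cochain_add p f g) ph = lact coind p n f ph +[grp coind (n + int p)] lact coind p n g ph"
  unfolding ci_simps ci_ops
 proof (rule cfam_cong, goal_cases)
  case (1 a b u v) note u = 1(1) and v = 1(2)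
  have k: "n + int p + int a + int b = n + int (a + p) + int b" by simp
  show ?case
   unfolding cfam_eval[OF u v] cr[OF u f g] k
   using am_add[OF ci_add1[OF p refl v, of "a + p"], of "cup a p u f" "cup a p u g"] cup_cl[OF u f] cup_cl[OF u g] by simp
 qed
 show "ract coind p n ph (cochain_add p f g) = ract coind p n ph f +[grp coind (n + int p)] ract coind p n ph g"
  unfolding ci_simps ci_ops
 proof (rule cfam_cong, goal_cases)
  case (1 a b u v) note u = 1(1) and v = 1(2)
  have k: "n + int p + int a + int b = n + int a + int (p + b)" by simp
  show ?case
   unfolding cfam_eval[OF u v] cl[OF v f g] k
   using am_add[OF ci_add2[OF p refl u, of "p + b"], of "cup p b f v" "cup p b g v"] cup_cl[OF f v] cup_cl[OF g v] by simp
 qed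
next
 fix p q n f g ph assume f: "f : cochains p" and g: "g : cochains q"
 show "lact coind (p + q) n (cup p q f g) ph = lact coind p (n + int q) f (lact coind q n g ph)"
  "ract coind (p + q) n ph (cup p q f g) = ract coind q (n + int p) (ract coind p n ph f) g"
  "ract coind q (n + int p) (lact coind p n f ph) g = lact coind p (n + int q) f (ract coind q n ph g)"
  unfolding ci_simps by (rule cfam_cong, simp add: cup_cl f g cup_assoc[symmetric] add.assoc[symmetric])+
next
 fix n ph assume "ph : elts coind n"
 then have p: "ph : car (ci_grp n)" by (simp add: ci_simps)
 show "lact coind 0 n cochain_one ph = ph" "ract coind 0 n ph cochain_one = ph"
  unfolding ci_simps by (rule cfam_eqI[OF ci_ext[OF p]], simp add: cup_one_left cup_one_right)+
 show "diff coind (n + 1) (diff coind n ph) = 0[grp coind (n + 2)]"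
  unfolding ci_simps by (rule ci_diff_diff[OF p])
qed

end

section \<open>Acyclicity of coinduction and bounding of cocycles\<close>

context bcx
begin

text \<open>A cocycle is bounded by its composite with an F-linear contraction \<open>s\<close> of
  \<open>M\<close>. The \<open>bK\<close> terms of the differential cause no trouble: applying
  \<open>s\<close> to the cocycle equation at (f, g) expresses s(dM(ph(f, g))) by the values of s ph
  at (b f, g) and (f, b g), and these are the remaining terms in the differential of
  \<open>h\<close>.\<close>

lemma acyclic_coind:
 assumes ex: exact shows "acyclic_obj coind"
proof (rule acyclic_objI[OF dg_object_coind], unfold ci_simps)
 fix n ph assume p: "ph : car (ci_grp n)" and z: "ci_diff n ph = 0[ci_grp (n + 1)]"
 obtain s where s: "!!n m. m = n - 1 ==> flin (M n) (M m) (s n)"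
  "!!n m k x. x : car (M n) ==> m = n - 1 ==> k = n + 1 ==> dM m (s n x) +[M n] s k (dM n x) = x"
  using contraction[OF ex] by metis
 note sa = s(1)[unfolded flin_def, THEN conjunct1] and ab = MG.ab_ax
 \<comment> \<open>The sign (-1)^p undoes the outer sign in \<open>ci_diff\<close>.\<close>
 define h where "h = cfam (%p q f g. signed (M (n - 1 + int p + int q)) (int p) (s (deg n p q) (ph (p, q, f, g))))"
 have "multi (n - 1) (%p q f g. s (deg n p q) (ph (p, q, f, g)))"
  by (rule multi_flin[OF ci_multi[OF p] s(1)]) simp
 then have hc: "h : car (ci_grp (n - 1))"
  unfolding h_def by (intro cfam_ci multi_flin[OF _ flin_left(3)[OF Mbim A.one_closed]])
 have "ci_diff (n - 1) h = ph"
  unfolding ci_diff_def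
 proof (rule cfam_eqI[OF ci_ext[OF p]], goal_cases)
  case (1 p q f g) note f = 1(1) and g = 1(2)
  note bf = bK_closed[OF f] and bg = bK_closed[OF g]
  define k where "k = deg n p q"
  define x0 x1 x2 where x: "x0 = ph (p, q, f, g)" "x1 = ph (p + 1, q, bK p f, g)" "x2 = ph (p, q + 1, f, bK q g)"
  have xc: "x0 : car (M k)" "x1 : car (M (k + 1))" "x2 : car (M (k + 1))" "dM k x0 : car (M (k + 1))"
   unfolding x by ((rule Md_cl)?, rule ci_cl[OF \<open>ph : car (ci_grp n)\<close>], simp_all add: k_def f g bf bg)+
  note S = sa[of k "k + 1", simplified] and S' = sa[of "k - 1" k, simplified]
  define X Y0 Y1 Y2 where X: "X = dM (k - 1) (s k x0)" "Y0 = s (k + 1) (dM k x0)" "Y1 = s (k + 1) x1" "Y2 = s (k + 1) x2"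
  have Xc: "X : car (M k)" "Y0 : car (M k)" "Y1 : car (M k)" "Y2 : car (M k)"
   unfolding X using Md_cl[OF addmap_closed[OF S' xc(1)], of k] addmap_closed[OF S] xc by simp_all
  have XY: "X +[M k] Y0 = x0" unfolding X by (rule s(2)[OF xc(1)]) simp_all
  have ik: "deg (n + 1) p q = k + 1" by (simp add: k_def)
  have "signed (M (k + 1)) (int p) (dM k x0 -[M (k + 1)] x1 -[M (k + 1)] signed (M (k + 1)) (int p + n) x2) = 0[M (k + 1)]"
   (is "?l = _")
  proof -
   have "ci_diff n ph (p, q, f, g) = ?l" unfolding x by (rule ci_diff_eval[OF f g]) (simp_all add: k_def)
   moreover have "ci_diff n ph (p, q, f, g) = 0[M (k + 1)]" unfolding z ci_ops cfam_eval[OF f g] ik by (rule refl)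
   ultimately show ?thesis by simp
  qed
  then have "s (k + 1) (signed (M (k + 1)) (int p) (dM k x0 -[M (k + 1)] x1 -[M (k + 1)] signed (M (k + 1)) (int p + n) x2)) = 0[M k]"
   using am_zero[OF ab ab S] by simp
  then have Z: "signed (M k) (int p) (Y0 -[M k] Y1 -[M k] signed (M k) (int p + n) Y2) = 0[M k]"
   using xc unfolding X by (simp add: am_signed[OF ab ab S] am_diff[OF ab ab S])
  have i: "n - 1 + 1 + int p + int q = k" "n - 1 + int p + int q = k - 1" "deg n p q = k" "n - 1 + int (p + 1) + int q = k"
   "n - 1 + int p + int (q + 1) = k" "n + int (p + 1) + int q = k + 1" "n + int p + int (q + 1) = k + 1" by (simp_all add: k_def)
  have dX: "dM (k - 1) (signed (M (k - 1)) (int p) (s k x0)) = signed (M k) (int p) X"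
   unfolding X by (rule am_signed[OF ab ab bhomD(1)[OF Md_hom] addmap_closed[OF S' xc(1)]]) simp
  have ag: "agv (M k) [X, Y0, Y1, Y2] (Sg (int p) (Mi (Mi (Sg (int p) (V 0)) (Sg (int (p + 1)) (V 2))) (Sg (int p + (n - 1)) (Sg (int p) (V 3)))))
   = agv (M k) [X, Y0, Y1, Y2] (Mi (Pl (V 0) (V 1)) (Sg (int p) (Sg (int p) (Mi (Mi (V 1) (V 2)) (Sg (int p + n) (V 3))))))"
   by (rule MG.ag_eq) (use Xc in "auto simp: less_Suc_eq isign_def")
  show ?case
   unfolding h_def cfam_eval[OF f g] cfam_eval[OF bf g] cfam_eval[OF f bg] i x[symmetric] dX X(2-)[symmetric]
   using ag MG.ag_eq[of "[x0]" k "Mi (V 0) Zr" "V 0"] xc(1) unfolding agv.simps nth_Cons_0 by (simp add: XY Z del: of_nat_add)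
 qed
 then show "\<exists>\<psi>\<in>car (ci_grp (n - 1)). ci_diff (n - 1) \<psi> = ph" using hc by blast
qed

text \<open>The adjunction: a cocycle of bimodule maps into \<open>M\<close> is a closed morphism of dg bimodules into \<^term>\<open>coind\<close>.\<close>

lemma coind_mor:
 fixes P :: "('v, 'e, 'f, 'y) qobj"
 assumes P: "dg_object P" and w: "!!n m. m = n + r ==> bimod_hom (grp P n) (M m) (w n)"
  and wd: "!!n m l x. x : elts P n ==> m = n + r ==> l = n + r + 1 ==> dM m (w n x) = signed (M l) r (w (n + 1) (diff P n x))"
 shows "(%n. \<lambda>x\<in>elts P n. cfam (%p q f g. signed (M (deg (n + r) p q)) (r * int p)
   (w (deg n p q) (ract P q (n + int p) (lact P p n f x) g)))) : closed_mor P coind r" (is "?u : _")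
proof -
 interpret P: dgo Q R P by unfold_locales (rule P)
 \<comment> \<open>The value at (f, g) is \<open>w\<close> on f.x.g. The sign comes from u(f.x) =
   (-1)^(r p) f.u(x) for a morphism \<open>u\<close> of degree r.\<close>
 let ?h = "%n x. cfam (%p q f g. signed (M (deg (n + r) p q)) (r * int p)
   (w (deg n p q) (ract P q (n + int p) (lact P p n f x) g)))"
 note ab = MG.ab_ax
 have mu: "multi (n + r) (%p q f g. signed (M (deg (n + r) p q)) (r * int p)
   (w (deg n p q) (ract P q (n + int p) (lact P p n f x) g)))" if x: "x : elts P n" for n x
  unfolding multi_def
 proof (intro allI conjI ballI)
  fix p q g assume g: "g : cochains q"
  have 1: "cM p (grp P (n + int p)) (%f. lact P p n f x)"
   using P.lact_coadd[OF x refl] P.lact_scale[OF _ x refl] by (simp add: cM_def)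
  note 2 = cM_flin[OF 1 bimod_hom_flin[OF P.ract_bim[OF g refl]]]
  have 3: "cM p (M (deg (n + r) p q)) (%f. w (deg n p q) (ract P q (n + int p) (lact P p n f x) g))"
   by (rule cM_flin[OF 2 bimod_hom_flin[OF w]]) simp
  show "cM p (M (deg (n + r) p q)) (%f. signed (M (deg (n + r) p q)) (r * int p) (w (deg n p q) (ract P q (n + int p) (lact P p n f x) g)))"
   by (rule cM_flin[OF 3 flin_left(3)[OF Mbim A.one_closed]])
 next
  fix p q f assume f: "f : cochains p"
  have y: "lact P p n f x : elts P (n + int p)" by (rule P.lact_cl[OF f x refl])
  have 2: "cM q (grp P (deg n p q)) (%g. ract P q (n + int p) (lact P p n f x) g)"
   using P.ract_coadd[OF y refl] P.ract_scale[OF _ y refl] by (simp add: cM_def)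
  have 3: "cM q (M (deg (n + r) p q)) (%g. w (deg n p q) (ract P q (n + int p) (lact P p n f x) g))"
   by (rule cM_flin[OF 2 bimod_hom_flin[OF w]]) simp
  show "cM q (M (deg (n + r) p q)) (%g. signed (M (deg (n + r) p q)) (r * int p) (w (deg n p q) (ract P q (n + int p) (lact P p n f x) g)))"
   by (rule cM_flin[OF 3 flin_left(3)[OF Mbim A.one_closed]])
 qed
 have hom: "bimod_hom (grp P n) (ci_grp (n + r)) (?h n)" for n
 proof (rule ci_homI[OF mu])
  fix p q f g assume f: "f : cochains p" and g: "g : cochains q"
  show "bimod_hom (grp P n) (M (deg (n + r) p q)) (%x. signed (M (deg (n + r) p q)) (r * int p)
   (w (deg n p q) (ract P q (n + int p) (lact P p n f x) g)))"
   by (rule bimod_hom_signed[OF Mbim bimod_hom_comp[OF bimod_hom_comp[OF P.lact_bim[OF f refl] P.ract_bim[OF g refl]] w]]) simp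
 qed
 note hc = bhomD(2)[OF hom]
 have "?u : Mor P coind r"
  unfolding Mor_def ci_simps(1)
 proof (intro CollectI conjI allI ballI)
  show "bimod_hom (grp P n) (ci_grp (n + r)) (?u n)" for n
   by (rule bimod_hom_cong[OF P.bim hom]) simp
 next
  fix a n f' x assume f': "f' : cochains a" and x: "x : elts P n"
  have l: "cfam (%p q f g. ?h n x (p + a, q, cup p a f f', g)) : car (ci_grp (n + r + int a))"
   by (rule bhomD(2)[OF ci_lact_hom[OF f'] hc[OF x]])
  have u: "?u n x = ?h n x" "?u (n + int a) (lact P a n f' x) = ?h (n + int a) (lact P a n f' x)"
   "?u (n + int a) (ract P a n x f') = ?h (n + int a) (ract P a n x f')"
   using x P.lact_cl[OF f' x refl] P.ract_cl[OF f' x refl] by simp_all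
  show "?u (n + int a) (lact P a n f' x) = signed (ci_grp (n + r + int a)) (r * int a) (lact coind a (n + r) f' (?u n x))"
   unfolding u ci_simps ci_signed[OF l]
  proof (rule cfam_cong, goal_cases)
   case (1 p q f g) note f = 1(1) and g = 1(2)
   have i: "n + int a + r + int p + int q = n + r + int (p + a) + int q" "n + r + int a + int p + int q = n + r + int (p + a) + int q"
    "n + int a + int p = n + int (p + a)" by simp_all
   note y = P.ract_cl[OF g P.lact_cl[OF cup_cl[OF f f'] x refl] refl]
   have c: "w (n + int (p + a) + int q) (ract P q (n + int (p + a)) (lact P (p + a) n (cup p a f f') x) g) : car (M (n + r + int (p + a) + int q))"
    by (rule bhomD(2)[OF w y]) simp
   have e: "lact P p (n + int a) f (lact P a n f' x) = lact P (p + a) n (cup p a f f') x" by (rule P.lact_cup[OF f f' x refl refl, symmetric])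
   show ?case
    unfolding i e cfam_eval[OF f g] cfam_eval[OF cup_cl[OF f f'] g] MG.signed_signed[OF c]
    by (rule MG.signed_cong) (simp add: algebra_simps)
  qed
  show "?u (n + int a) (ract P a n x f') = ract coind a (n + r) (?u n x) f'"
   unfolding u ci_simps
  proof (rule cfam_cong, goal_cases)
   case (1 p q f g) note f = 1(1) and g = 1(2)
   have i: "n + int a + r + int p + int q = n + r + int p + int (a + q)" "deg (n + int a) p q = n + int p + int (a + q)" "n + int p + int a + int q = n + int p + int (a + q)" "n + int a + int p = n + int p + int a" by simp_all
   have e: "ract P q (n + int p + int a) (lact P p (n + int a) f (ract P a n x f')) g = ract P (a + q) (n + int p) (lact P p n f x) (cup a q f' g)"
    unfolding P.ract_lact[OF f f' x refl refl, symmetric] by (rule P.ract_cup[OF f' g P.lact_cl[OF f x refl] refl refl, symmetric])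
   show ?case
    unfolding i e cfam_eval[OF f cup_cl[OF f' g]] by (rule refl)
  qed
 qed simp
 moreover have "dMor P coind r ?u = zero_mor P coind (r + 1)"
  unfolding dMor_def zero_mor_def ci_simps(1)
 proof (rule ext, rule rext)
  fix n x assume x: "x : elts P n"
  note dx = P.diff_cl[OF x refl]
  have hd: "?h (n + 1) (diff P n x) : car (ci_grp (n + r + 1))" using hc[OF dx] by (simp add: ac_simps)
  have u: "?u n x = ?h n x" "?u (n + 1) (diff P n x) = ?h (n + 1) (diff P n x)" using x dx by simp_all
  have "diff coind (n + r) (?h n x) = signed (ci_grp (n + r + 1)) r (?h (n + 1) (diff P n x))"
   unfolding ci_simps ci_signed[OF hd] ci_diff_def
  proof (rule cfam_cong, goal_cases)
   case (1 p q f g) note f = 1(1) and g = 1(2)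
   note bf = bK_closed[OF f] and bg = bK_closed[OF g]
   define k l j where k: "k = n + r + 1 + int p + int q" and l: "l = deg n p q" and j: "j = deg (n + 1) p q"
   have i: "n + r + 1 + int p + int q = k" "deg (n + r) p q = k - 1" "deg n p q = l" "n + r + int (p + 1) + int q = k" "n + r + int p + int (q + 1) = k"
    "n + int (p + 1) + int q = j" "n + int p + int (q + 1) = j" "n + 1 + r + int p + int q = k" "deg (n + 1) p q = j" by (simp_all add: k l j)
   define z z1 z2 z3 where z: "z = ract P q (n + int p) (lact P p n f x) g" "z1 = ract P q (n + int (p + 1)) (lact P (p + 1) n (bK p f) x) g"
    "z2 = ract P (q + 1) (n + int p) (lact P p n f x) (bK q g)" "z3 = ract P q (n + 1 + int p) (lact P p (n + 1) f (diff P n x)) g"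
   have zc: "z : elts P l" "z1 : elts P j" "z2 : elts P j" "z3 : elts P j"
    unfolding z by (rule P.ract_cl[OF _ P.lact_cl[OF _ x refl]] P.ract_cl[OF _ P.lact_cl[OF _ dx refl]]; simp add: f g bf bg l j)+
   note la = P.lact_cl[OF f x refl]
   have m: "n + int (p + 1) = n + int p + 1" "n + 1 + int p = n + int p + 1" by simp_all
   note r = P.ract_bim[OF g, of j "n + int p + 1", THEN bhomD(1)]
   have rj: "j = n + int p + 1 + int q" by (simp add: j)
   \<comment> \<open>The two Leibniz rules of P expand the differential of f.x.g into z1, z2 and
     z3.\<close>
   have "diff P l z = ract P q (n + int p + 1) (diff P (n + int p) (lact P p n f x)) g +[grp P j] signed (grp P j) (n + int p) z2"
    unfolding z by (rule P.diff_ract[OF g la]) (simp_all add: l j)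
   also have "ract P q (n + int p + 1) (diff P (n + int p) (lact P p n f x)) g = z1 +[grp P j] signed (grp P j) (int p) z3"
    unfolding P.diff_lact[OF f x refl refl refl refl] z m
    using P.lact_cl[OF bf x, of "n + int p + 1"] P.lact_cl[OF f dx, of "n + int p + 1"]
    by (simp add: am_add[OF r[OF rj]] am_signed[OF P.G.ab_ax P.G.ab_ax r[OF rj]])
   finally have dz: "diff P l z = z1 +[grp P j] signed (grp P j) (int p) z3 +[grp P j] signed (grp P j) (n + int p) z2" .
   have jk: "k = j + r" by (simp add: k j)
   note W = bhomD(1)[OF w[OF jk]]
   define W1 W2 W3 where W': "W1 = w j z1" "W2 = w j z2" "W3 = w j z3"
   have Wc: "W1 : car (M k)" "W2 : car (M k)" "W3 : car (M k)" unfolding W' by (rule addmap_closed[OF W], rule zc)+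
   have wdz: "w j (diff P l z) = W1 +[M k] signed (M k) (int p) W3 +[M k] signed (M k) (n + int p) W2"
    using zc by (simp add: dz W' am_add[OF W] am_signed[OF P.G.ab_ax ab W])
   have lj: "l + 1 = j" "k - 1 = l + r" "k = l + r + 1" by (simp_all add: l j k)
   have dw: "dM (k - 1) (w l z) = signed (M k) r (w j (diff P l z))"
    unfolding lj(1)[symmetric] by (rule wd[OF zc(1) lj(2,3)])
   have dsw: "dM (k - 1) (signed (M (k - 1)) (r * int p) (w l z)) = signed (M k) (r * int p) (signed (M k) r (w j (diff P l z)))"
    unfolding dw[symmetric] by (rule am_signed[OF ab ab bhomD(1)[OF Md_hom] bhomD(2)[OF w[OF lj(2)] zc(1)]]) simp
   have ag: "agv (M k) [W1, W2, W3] (Sg (int p) (Mi (Mi (Sg (r * int p) (Sg r (Pl (Pl (V 0) (Sg (int p) (V 2))) (Sg (n + int p) (V 1)))))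
    (Sg (r * int (p + 1)) (V 0))) (Sg (int p + (n + r)) (Sg (r * int p) (V 1))))) = agv (M k) [W1, W2, W3] (Sg r (Sg (r * int p) (V 2)))"
    by (rule MG.ag_eq) (use Wc in "auto simp: less_Suc_eq isign_def")
   show ?case
    unfolding cfam_eval[OF f g] cfam_eval[OF bf g] cfam_eval[OF f bg] i z[symmetric] dsw wdz W'[symmetric]
    using ag by simp
  qed
  then show "diff coind (n + r) (?u n x) -[ci_grp (n + r + 1)] signed (ci_grp (n + r + 1)) r (?u (n + 1) (diff P n x)) = 0[ci_grp (n + (r + 1))]"
   unfolding u using CG.r_neg[OF CG.signed_cl[OF hd]] by (simp add: a_minus_def add.assoc)
 qed
 ultimately show ?thesis by (simp add: closed_mor_def)
qed

text \<open>This is K-projectivity of \<open>P\<close> as a complex of bimodules, tested on the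
  exact complex \<open>M\<close>. The cocycle becomes a closed morphism into an acyclic dg bimodule,
  and a morphism bounding it is evaluated at (1, 1).\<close>

theorem K_projective_bounding:
 fixes P :: "('v, 'e, 'f, 'u) qobj"
  and E :: "(nat \<times> nat \<times> ('v, 'e, 'f) koszul_cochain \<times> ('v, 'e, 'f) koszul_cochain => 'x) => 'u"
 assumes P: "dg_object P" "K_projective P" and ex: exact and E: "inj E"
  and w: "!!n m. m = n + r ==> bimod_hom (grp P n) (M m) (w n)"
  and wd: "!!n m l x. x : elts P n ==> m = n + r ==> l = n + r + 1 ==> dM m (w n x) = signed (M l) r (w (n + 1) (diff P n x))"
 obtains v where "!!n m. m = n + r - 1 ==> bimod_hom (grp P n) (M m) (v n)"
  "!!n m l x. x : elts P n ==> m = n + r - 1 ==> l = n + r ==> w n x = dM m (v n x) -[M l] signed (M l) (r - 1) (v (n + 1) (diff P n x))"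
proof -
 interpret P: dgo Q R P by unfold_locales (rule P)
 note ab = MG.ab_ax and o = cochain_one_closed
 let ?h = "%n x. cfam (%p q f g. signed (M (deg (n + r) p q)) (r * int p)
   (w (deg n p q) (ract P q (n + int p) (lact P p n f x) g)))"
 let ?j = "(0, 0, cochain_one, cochain_one)"
 obtain u where u: "u : Mor P coind (r - 1)" and hu: "(%n. \<lambda>x\<in>elts P n. ?h n x) = dMor P coind (r - 1) u"
 proof -
  have "EX u:Mor P coind (r - 1). (%n. \<lambda>x\<in>elts P n. ?h n x) = dMor P coind (r - 1) u"
   by (rule K_projective_large[OF P dg_object_coind acyclic_coind[OF ex] E coind_mor[OF P(1)]]) (rule w wd; assumption)+
  then show thesis using that by (elim bexE)
 qed
 have uh: "bimod_hom (grp P n) (ci_grp (n + (r - 1))) (u n)" for n using Mor_closed[OF u] by (simp add: ci_simps)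
 have e: "bimod_hom (ci_grp n) (M m) (\<lambda>ph. ph ?j)" if "m = n" for n m by (rule ci_eval[OF o o]) (simp add: that)
 show ?thesis
 proof (rule that[of "%n x. u n x ?j"])
  show "bimod_hom (grp P n) (M m) (%x. u n x ?j)" if "m = n + r - 1" for n m
   by (rule bimod_hom_comp[OF uh e]) (simp add: that)
 next
  fix n m l x assume x: "x : elts P n" and m: "m = n + r - 1" and l: "l = n + r"
  note dx = P.diff_cl[OF x refl]
  note ux = bhomD(2)[OF uh x]
  define t where "t = n + (r - 1)"
  have ux': "u n x : car (ci_grp t)" using ux by (simp add: t_def)
  have udx: "u (n + 1) (diff P n x) : car (ci_grp (t + 1))" using bhomD(2)[OF uh dx] by (simp add: t_def ac_simps)
  have tl: "l = t + 1" "m = t" by (simp_all add: l m t_def)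
  have dux: "ci_diff t (u n x) : car (ci_grp (t + 1))" by (rule bhomD(2)[OF ci_diff_hom ux'])
  have "?h n x = ci_diff t (u n x) -[ci_grp (t + 1)] signed (ci_grp (t + 1)) (r - 1) (u (n + 1) (diff P n x))"
   using fun_cong[OF fun_cong[OF hu, of n], of x] x unfolding dMor_def ci_simps(1,2) t_def by simp
  then have "?h n x ?j = (ci_diff t (u n x) -[ci_grp (t + 1)] signed (ci_grp (t + 1)) (r - 1) (u (n + 1) (diff P n x))) ?j" by simp
  also have "... = ci_diff t (u n x) ?j -[M l] signed (M l) (r - 1) (u (n + 1) (diff P n x) ?j)"
   using dux udx by (simp add: am_diff[OF CG.ab_ax ab bhomD(1)[OF e[OF tl(1)]]]
    am_signed[OF CG.ab_ax ab bhomD(1)[OF e[OF tl(1)]]])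
  \<comment> \<open>Evaluation at (1, 1) commutes with the differentials because
    \<open>bK 0 cochain_one\<close> is zero.\<close>
  also have "ci_diff t (u n x) ?j = dM m (u n x ?j)"
  proof -
   have z: "u n x (1, 0, bK 0 cochain_one, cochain_one) = 0[M l]" "u n x (0, 1, cochain_one, bK 0 cochain_one) = 0[M l]"
    unfolding bK_one using am_zero[OF ab_cgrp ab ci_add1[OF ux' _ o, of l 1]] am_zero[OF ab_cgrp ab ci_add2[OF ux' _ o, of l 1]]
    by (simp_all add: tl)
   have d: "dM m (u n x ?j) : car (M l)" using Md_cl[OF bhomD(2)[OF e ux']] tl by simp
   show ?thesis using ci_diff_eval[OF o o, of l t m 1 1 "u n x"] z d MG.ag_eq[of "[dM m (u n x ?j)]" l "Mi (Mi (V 0) Zr) Zr" "V 0"]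
    by (simp add: tl MG.signed_even)
  qed
  also have "?h n x ?j = w n x"
   unfolding cfam_eval[OF o o] using P.lact_one[OF x] P.ract_one[OF x] by (simp add: MG.signed_even)
  finally show "w n x = dM m (u n x ?j) -[M l] signed (M l) (r - 1) (u (n + 1) (diff P n x) ?j)" .
 qed
qed

end

section \<open>Encoding the indices of coinduced families\<close>

lemma single_eqD: "mon a c = mon b d ==> c \<noteq> 0 ==> a = b & c = d"
 by (metis lookup_single_eq lookup_single_not_eq)

text \<open>A set of finitely supported integer functions can store the graphs of \<open>f\<close>
  and \<open>g\<close>, marked by the coefficients 1 and 2, and a code of (p, q, b), marked by a
  coefficient of at least 3, so the three kinds of members cannot be confused. The Boolean serves to
  select a component of a pair.\<close>

lemma cochain_code:
 "\<exists>F :: (nat \<times> nat \<times> ('v, 'e, 'f::field) koszul_cochain \<times> ('v, 'e, 'f) koszul_cochain) \<times> bool => ('v, 'e, 'f) koszul_chain. inj F"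
proof -
 define F :: "(nat \<times> nat \<times> ('v, 'e, 'f) koszul_cochain \<times> ('v, 'e, 'f) koszul_cochain) \<times> bool => ('v, 'e, 'f) koszul_chain"
  where "F = (%((p, q, f, g), b). range (%t. mon ({}, t, f t) 1) \<union> range (%t. mon ({}, t, g t) 2) \<union>
    {mon ({}, 0, {}) (3 + int (to_nat (p, q, b)))})"
 have 1: "mon ({}, t, y) 1 : F ((p, q, f, g), b) \<longleftrightarrow> y = f t" for p q f g b t y
  unfolding F_def by (auto dest!: single_eqD)
 have 2: "mon ({}, t, y) 2 : F ((p, q, f, g), b) \<longleftrightarrow> y = g t" for p q f g b t y
  unfolding F_def by (auto dest!: single_eqD)
 have 3: "mon ({}, 0, {}) (3 + int m) : F ((p, q, f, g), b) \<longleftrightarrow> m = to_nat (p, q, b)" for p q f g b m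
  unfolding F_def by (auto dest!: single_eqD)
 have "inj F"
 proof (rule injI)
  fix k k' assume e: "F k = F k'"
  obtain p q f g b where k: "k = ((p, q, f, g), b)" by (metis surj_pair)
  obtain p' q' f' g' b' where k': "k' = ((p', q', f', g'), b')" by (metis surj_pair)
  have "f t = f' t" for t using 1[of t "f t" p q f g b] 1[of t "f t" p' q' f' g' b'] e[unfolded k k'] by simp
  then have "f = f'" by (rule ext)
  moreover have "g t = g' t" for t using 2[of t "g t" p q f g b] 2[of t "g t" p' q' f' g' b'] e[unfolded k k'] by simp
  then have "g = g'" by (rule ext)
  moreover have "to_nat (p, q, b) = to_nat (p', q', b')"
   using 3[of "to_nat (p, q, b)" p q f g b] 3[of "to_nat (p, q, b)" p' q' f' g' b'] e[unfolded k k'] by simp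
  ultimately show "k = k'" by (simp add: k k')
 qed
 then show ?thesis by blast
qed

text \<open>The universe \<open>'u\<close> contains the coinduced objects of complexes with entries in \<open>'u \<times> 'u\<close>.\<close>

lemma universe_code:
 fixes fam :: "(('v, 'e, 'f::field) koszul_chain => 'u) => 'u"
 assumes fam: "inj fam"
 shows "\<exists>E :: (nat \<times> nat \<times> ('v, 'e, 'f) koszul_cochain \<times> ('v, 'e, 'f) koszul_cochain => 'u \<times> 'u) => 'u. inj E"
proof -
 obtain F :: "(nat \<times> nat \<times> ('v, 'e, 'f) koszul_cochain \<times> ('v, 'e, 'f) koszul_cochain) \<times> bool => ('v, 'e, 'f) koszul_chain"
  where F: "inj F" using cochain_code by blast
 \<comment> \<open>At the code of (k, b) the recorded function has the first or the second component
   of the value at \<open>k\<close>, according to \<open>b\<close>.\<close>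
 have "inj (\<lambda>ph. fam (%S. case inv_into UNIV F S of (k, b) => if b then fst (ph k :: 'u \<times> 'u) else snd (ph k)))"
 proof (rule injI, rule ext)
  fix ph \<psi> :: "nat \<times> nat \<times> ('v, 'e, 'f) koszul_cochain \<times> ('v, 'e, 'f) koszul_cochain => 'u \<times> 'u" and k
  assume "fam (%S. case inv_into UNIV F S of (k, b) => if b then fst (ph k) else snd (ph k)) = fam (%S. case inv_into UNIV F S of (k, b) => if b then fst (\<psi> k) else snd (\<psi> k))"
  then have "(%S. case inv_into UNIV F S of (k, b) => if b then fst (ph k) else snd (ph k)) = (%S. case inv_into UNIV F S of (k, b) => if b then fst (\<psi> k) else snd (\<psi> k))"
   by (rule injD[OF fam])
  from fun_cong[OF this, of "F (k, True)"] fun_cong[OF this, of "F (k, False)"] show "ph k = \<psi> k"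
   by (simp add: F prod_eq_iff)
 qed
 then show ?thesis by blast
qed

section \<open>Null-homotopies on the Koszul complex\<close>

context quadratic_algebra
begin

lemma tmult_vsingle_right: "c : tpower Q 0 ==> v : verts Q ==> tmult Q c (vsingle v l) = vsingle v (coef c (v, []) * l)"
 by (rule poly_mapping_eqI) (auto simp: lookup_tmult_l0 lookup_single when_def)

lemma tmult_vsingle_left: "c : tpower Q 0 ==> v : verts Q ==> tmult Q (vsingle v l) c = vsingle v (coef c (v, []) * l)"
 by (rule poly_mapping_eqI) (auto simp: lookup_tmult_r0[OF tp_vsingle] lookup_single when_def)

lemma kos_lift_hom:
 assumes M: "bimodule M" and t: "kbal n M t"
  and l: "!!a a' x b. a' : car alg ==> a : car alg ==> x : Wc n ==> b : car alg ==> t (a' ** a) x b = a' *[M] t a x b"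
  and r: "!!a x b b'. b' : car alg ==> a : car alg ==> x : Wc n ==> b : car alg ==> t a x (b ** b') = rsmult M (t a x b) b'"
 obtains ph where "bimod_hom (kos_grp n) M ph" "!!a x b. a : car alg ==> x : Wc n ==> b : car alg ==> ph (ktens n a x b) = t a x b"
proof -
 show thesis
 proof (rule kos_lift[OF bim_ab[OF M] t])
 fix ph assume p: "addmap (kos_grp n) M ph" "!!a x b. a : car alg ==> x : Wc n ==> b : car alg ==> ph (ktens n a x b) = t a x b"
 show thesis
 proof (rule that[OF bimod_homI[OF p(1)] p(2)])
  fix a' X assume a': "a' : car alg" and X: "X : car (kos_grp n)"
  show "ph (a' *[kos_grp n] X) = a' *[M] ph X"
   by (rule kos_am_eqI[OF bim_ab[OF M] am_comp[OF kos_smult(1)[OF a'] p(1)] am_comp[OF p(1) bim_addmap(1)[OF M a']] _ X])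
    (simp add: kos_smult(2) a' p(2) l)
  show "ph (rsmult (kos_grp n) X a') = rsmult M (ph X) a'"
   by (rule kos_am_eqI[OF bim_ab[OF M] am_comp[OF kos_rsmult(1)[OF a'] p(1)] am_comp[OF p(1) bim_addmap(2)[OF M a']] _ X])
    (simp add: kos_rsmult(2) a' p(2) r)
 qed
 qed
qed

lemma kos_diff_hom: "m = n + 1 ==> bimod_hom (kos_grp n) (kos_grp m) (kos_diff n)"
 and kos_diff_diff: "x : car (kos_grp n) ==> kos_diff (n + 1) (kos_diff n x) = 0[kos_grp (n + 2)]"
 using dg_object_koszul unfolding dg_object_def koszul_simps by blast+

lemma bim_act_addmap:
 assumes M: "bimodule M" and m: "m : car M"
 shows "b : car alg ==> addmap alg M (%a. rsmult M (a *[M] m) b)" "a : car alg ==> addmap alg M (%b. rsmult M (a *[M] m) b)"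
 using m by (simp_all add: addmap_def bim_l[OF M] bim_r[OF M] bim_add_l[OF M] bim_add_r[OF M] bim_r_add[OF M])

text \<open>The value of the lift on \<open>a \<otimes> x \<otimes> b\<close>, given its values \<open>m\<^sub>p\<close> on the tensors \<open>1 \<otimes> \<rho>\<^sub>p \<otimes> 1\<close>,
 for \<open>x = \<Sum> x\<^sub>p \<rho>\<^sub>p\<close>.\<close>

definition kext where
 "kext M q m a x b = finsum M (%p. rsmult M ((a ** proj (vsingle (fst p) (coef x p))) *[M] m p)
   (proj (vsingle (psrc Q p) 1) ** b)) (paths q)"

context
 fixes M :: "(('v, 'e, 'f) qalg, 'x) bimod" and q m
 assumes M: "bimodule M" and m: "!!p. p : paths q ==> m p : car M"
begin

interpretation M: abelian_group M by (rule bim_ab[OF M])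

lemma pv [simp]: "p : paths q ==> proj (vsingle (fst p) c) : car alg" "p : paths q ==> proj (vsingle (psrc Q p) c) : car alg"
 by (simp_all add: tp_vsingle[OF paths_fst] tp_vsingle[OF paths_src] proj_tpower[of _ 0])

lemma kext_term: "p : paths q ==> a : car alg ==> b : car alg ==>
  rsmult M ((a ** proj (vsingle (fst p) c)) *[M] m p) (proj (vsingle (psrc Q p) 1) ** b) : car M"
 by (simp add: bim_l[OF M] bim_r[OF M] m)

text \<open>The idempotents at both ends of each path are built into the formula, which makes it
  balanced for any choice of the elements \<open>m p\<close>.\<close>

lemma kext_kbal: "kbal (- int q) M (kext M q m)"
proof (rule kbalI)
 fix x b assume b: "b : car alg"
 show "addmap alg M (%a. kext M q m a x b)"
  unfolding kext_def
 proof (rule am_finsum_pointwise[OF A.ab_ax M.ab_ax fin_paths], goal_cases)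
  case (1 p) note p = 1
  have "addmap alg alg (%a. a ** proj (vsingle (fst p) (coef x p)))" using p by (simp add: addmap_def A.l_distr)
  from am_comp[OF this bim_act_addmap(1)[OF M m[OF p], of "proj (vsingle (psrc Q p) 1) ** b"]]
  show ?case
   using p b by simp
 qed
next
 fix a x assume a: "a : car alg"
 show "addmap alg M (%b. kext M q m a x b)"
  unfolding kext_def
 proof (rule am_finsum_pointwise[OF A.ab_ax M.ab_ax fin_paths], goal_cases)
  case (1 p) note p = 1
  have "addmap alg alg (%b. proj (vsingle (psrc Q p) 1) ** b)" using p by (simp add: addmap_def A.r_distr)
  from am_comp[OF this bim_act_addmap(2)[OF M m[OF p], of "a ** proj (vsingle (fst p) (coef x p))"]]
  show ?case
   using p a by simp
 qed
next
 fix a x y b assume a: "a : car alg" and b: "b : car alg"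
 have e: "rsmult M ((a ** proj (vsingle (fst p) (coef (x + y) p))) *[M] m p) (proj (vsingle (psrc Q p) 1) ** b)
  = rsmult M ((a ** proj (vsingle (fst p) (coef x p))) *[M] m p) (proj (vsingle (psrc Q p) 1) ** b) +[M]
   rsmult M ((a ** proj (vsingle (fst p) (coef y p))) *[M] m p) (proj (vsingle (psrc Q p) 1) ** b)" if p: "p : paths q" for p
 proof -
  have v: "vsingle (fst p) c : car T" for c by (rule tpower_carrier[OF tp_vsingle[OF paths_fst[OF p]]])
  have "proj (vsingle (fst p) (coef (x + y) p)) = proj (vsingle (fst p) (coef x p)) +[alg] proj (vsingle (fst p) (coef y p))"
   unfolding lookup_add single_add by (rule proj_add[OF v v])
  then show ?thesis using am_add[OF bim_act_addmap(1)[OF M m[OF p], of "proj (vsingle (psrc Q p) 1) ** b"]] a b p by (simp add: A.r_distr)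
 qed
 show "kext M q m a (x + y) b = kext M q m a x b +[M] kext M q m a y b"
  unfolding kext_def
  by (rule trans[OF M.finsum_cong'[OF refl] M.finsum_addf]; (intro Pi_I M.a_closed kext_term a b; assumption)?; erule e)
next
 fix a x b and c :: "('v, 'e, 'f) tens" assume a: "a : car alg" and b: "b : car alg" and c: "c : tpower Q 0" and x: "x : Wc (- int q)"
 show "kext M q m (a ** proj c) x b = kext M q m a (tmult Q c x) b"
  unfolding kext_def
 proof (intro M.finsum_cong' refl Pi_I)
  fix p assume p: "p : paths q"
  show "rsmult M ((a ** proj (vsingle (fst p) (coef (tmult Q c x) p))) *[M] m p) (proj (vsingle (psrc Q p) 1) ** b) : car M"
   by (rule kext_term[OF p a b])
  have "proj c ** proj (vsingle (fst p) (coef x p)) = proj (vsingle (fst p) (coef (tmult Q c x) p))"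
   using tmult_vsingle_right[OF c paths_fst[OF p]]
   by (simp add: proj_mult[symmetric] tpower_carrier[OF c] tpower_carrier[OF tp_vsingle[OF paths_fst[OF p]]] lookup_tmult_l0[OF c])
  then show "rsmult M ((a ** proj c ** proj (vsingle (fst p) (coef x p))) *[M] m p) (proj (vsingle (psrc Q p) 1) ** b)
   = rsmult M ((a ** proj (vsingle (fst p) (coef (tmult Q c x) p))) *[M] m p) (proj (vsingle (psrc Q p) 1) ** b)"
   using p a c by (simp add: A.m_assoc)
 qed
 show "kext M q m a (tmult Q x c) b = kext M q m a x (proj c ** b)"
  unfolding kext_def
 proof (intro M.finsum_cong' refl Pi_I)
  fix p assume p: "p : paths q"
  show "rsmult M ((a ** proj (vsingle (fst p) (coef x p))) *[M] m p) (proj (vsingle (psrc Q p) 1) ** (proj c ** b)) : car M"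
   using p a b c by (intro kext_term) simp_all
  \<comment> \<open>On the right of rho_p an element of k acts by its value at the source of
    \<open>p\<close>. This value is a scalar and is carried across \<open>m p\<close> to the
    idempotent on the right.\<close>
  let ?g = "coef c (psrc Q p, [])" and ?v = "vsingle (fst p) (coef x p)" and ?e = "vsingle (psrc Q p) 1"
  have v: "vsingle (fst p) d : car T" "vsingle (psrc Q p) d : car T" for d
   by (rule tpower_carrier[OF tp_vsingle[OF paths_fst[OF p]]] tpower_carrier[OF tp_vsingle[OF paths_src[OF p]]])+
  have t: "vsingle w (d * d') = tsc d (vsingle w d')" for w d d' by (rule poly_mapping_eqI) (simp add: lookup_single when_def)
  have "x : tpower Q q" using x by (simp add: W_tpower)
  then have "coef (tmult Q x c) p = ?g * coef x p" using c by (simp add: lookup_tmult_r0 ac_simps)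
  then have 1: "proj (vsingle (fst p) (coef (tmult Q x c) p)) = proj ?v ** scal ?g"
   by (simp add: t proj_scal[OF v(1)])
  have te: "(vsingle (psrc Q p) ?g :: ('v, 'e, 'f) tens) = tsc ?g ?e" by (rule poly_mapping_eqI) (simp add: lookup_single when_def)
  have 2: "proj ?e ** proj c = scal ?g ** proj ?e"
   using tmult_vsingle_left[OF c paths_src[OF p], of 1] te by (simp add: proj_mult[symmetric] v tpower_carrier[OF c] scal_proj)
  have c': "proj c : car alg" using c by simp
  have "proj ?e ** (proj c ** b) = scal ?g ** (proj ?e ** b)"
   using 2 p b c' by (simp add: A.m_assoc[symmetric])
  moreover have "(a ** (proj ?v ** scal ?g)) *[M] m p = rsmult M ((a ** proj ?v) *[M] m p) (scal ?g)"
   using p a m[OF p] by (simp add: A.m_assoc[symmetric] bim_mult_l[OF M, of "a ** proj ?v"] bim_scal[OF M] bim_lr[OF M])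
  ultimately show "rsmult M ((a ** proj (vsingle (fst p) (coef (tmult Q x c) p))) *[M] m p) (proj ?e ** b)
   = rsmult M ((a ** proj ?v) *[M] m p) (proj ?e ** (proj c ** b))"
   using p a b m[OF p] by (simp add: 1 bim_mult_r[OF M] bim_l[OF M])
 qed
qed

lemma kext_left: "a' : car alg ==> a : car alg ==> b : car alg ==> kext M q m (a' ** a) x b = a' *[M] kext M q m a x b"
 unfolding kext_def
 by (rule trans[OF M.finsum_cong'[OF refl] am_finsum[OF M.ab_ax M.ab_ax bim_addmap(1)[OF M] fin_paths, symmetric]])
  (simp_all add: kext_term m A.m_assoc bim_mult_l[OF M] bim_lr[OF M] bim_l[OF M] bim_r[OF M])

lemma kext_right: "b' : car alg ==> a : car alg ==> b : car alg ==> kext M q m a x (b ** b') = rsmult M (kext M q m a x b) b'"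
 unfolding kext_def
 by (rule trans[OF M.finsum_cong'[OF refl] am_finsum[OF M.ab_ax M.ab_ax bim_addmap(2)[OF M] fin_paths, symmetric]])
  (simp_all add: kext_term m A.m_assoc[symmetric] bim_mult_r[OF M] bim_l[OF M] bim_r[OF M])

end

text \<open>A bimodule map is determined by its values on the tensors 1 \<otimes> rho_p \<otimes> 1,
  because every \<open>x\<close> is the sum of the rho_p with its own coefficients.\<close>

lemma kext_value:
 assumes M: "bimodule M" and g: "bimod_hom (kos_grp (- int q)) M g" and a: "a : car alg" and x: "x : W q" and b: "b : car alg"
 shows "kext M q (%p. g (ktens (- int q) 1[alg] (rho q p) 1[alg])) a x b = g (ktens (- int q) a x b)"
proof -
 let ?K = "kos_grp (- int q)" and ?k = "ktens (- int q)"
 have pv: "proj (vsingle (fst p) c) : car alg" "proj (vsingle (psrc Q p) c) : car alg" if "p : paths q" for p c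
  using that by (simp_all add: tp_vsingle[OF paths_fst] tp_vsingle[OF paths_src] proj_tpower[of _ 0])
 have r: "rho q p : Wc (- int q)" if "p : paths q" for p using rho_W[OF that] by simp
 have xc: "x : Wc (- int q)" using x by simp
 have "g (?k a x b) = g (finsum ?K (%p. ?k a (tmult Q (vsingle (fst p) (coef x p)) (rho q p)) b) (paths q))"
 proof -
  have "Wadd q ?K (%x. ?k a x b)" by (rule kbal_addmap_x[OF kbal_ktens a b])
  from Wadd_sum[OF ab_kos this fin_paths, of q "%p. tmult Q (vsingle (fst p) (coef x p)) (rho q p)"]
  show ?thesis using rho_sum_left[OF x] by (simp add: W_left tp_vsingle paths_fst rho_W)
 qed
 also have "... = finsum M (%p. g (?k a (tmult Q (vsingle (fst p) (coef x p)) (rho q p)) b)) (paths q)"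
  by (rule am_finsum[OF ab_kos bim_ab[OF M] bhomD(1)[OF g] fin_paths])
   (intro ktens_closed a b, simp add: W_left tp_vsingle paths_fst rho_W)
 also have "... = kext M q (%p. g (?k 1[alg] (rho q p) 1[alg])) a x b"
  unfolding kext_def
 proof (intro abelian_monoid.finsum_cong'[OF abelian_group.axioms(1)[OF bim_ab[OF M]]] refl Pi_I)
  fix p assume p: "p : paths q"
  let ?v = "vsingle (fst p) (coef x p)" and ?e = "vsingle (psrc Q p) 1"
  have gc: "g (?k 1[alg] (rho q p) 1[alg]) : car M" by (rule bhomD(2)[OF g]) (simp add: rho_W p)
  then show "rsmult M ((a ** proj ?v) *[M] g (?k 1[alg] (rho q p) 1[alg])) (proj ?e ** b) : car M"
   using p a b by (simp add: bim_l[OF M] bim_r[OF M] pv)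
  have "?k a (tmult Q ?v (rho q p)) b = ?k (a ** proj ?v) (rho q p) b"
   by (rule ktens_bal1[symmetric, OF a r[OF p] b tp_vsingle[OF paths_fst[OF p]]])
  also have "... = ?k (a ** proj ?v) (tmult Q (rho q p) ?e) b" by (simp add: rho_right[OF p])
  also have "... = ?k (a ** proj ?v) (rho q p) (proj ?e ** b)"
   by (rule ktens_bal2[OF _ r[OF p] b tp_vsingle[OF paths_src[OF p]]]) (simp add: a pv p)
  also have "... = rsmult ?K ((a ** proj ?v) *[?K] ?k 1[alg] (rho q p) 1[alg]) (proj ?e ** b)"
   using p a b rho_W[OF p] by (simp add: kos_smult(2) kos_rsmult(2) pv)
  finally show "g (?k a (tmult Q ?v (rho q p)) b) = rsmult M ((a ** proj ?v) *[M] g (?k 1[alg] (rho q p) 1[alg])) (proj ?e ** b)"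
   using p a b rho_W[OF p] by (simp add: bhomD(4,5)[OF g] pv bim_l[OF kos_bimodule])
 qed
 finally show ?thesis by simp
qed

end

context bcx
begin

text \<open>Projectivity of A \<otimes> W_q \<otimes> A: exactness gives preimages of the values of
  \<open>g\<close> on the tensors 1 \<otimes> rho_p \<otimes> 1, and \<open>kext\<close> extends
  them to a bimodule map. Its composite with the differential is \<open>kext\<close> of the values
  of \<open>g\<close>, which is \<open>g\<close>.\<close>

lemma kos_factor:
 assumes ex: exact and n: "n = - int q" and g: "bimod_hom (kos_grp n) (M n) g" and dg: "!!x. x : car (kos_grp n) ==> dM n (g x) = 0[M (n + 1)]"
 shows "\<exists>h. bimod_hom (kos_grp n) (M (n - 1)) h & (ALL x:car (kos_grp n). dM (n - 1) (h x) = g x)"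
proof -
 let ?k = "ktens n 1[alg]"
 have dh: "bimod_hom (M (n - 1)) (M n) (dM (n - 1))" by (rule Md_hom) simp
 have kc: "?k (rho q p) 1[alg] : car (kos_grp n)" if "p : paths q" for p using rho_W[OF that] by (simp add: n)
 have "EX y:car (M (n - 1)). dM (n - 1) y = g (?k (rho q p) 1[alg])" if p: "p : paths q" for p
  using ex dg[OF kc[OF p]] bhomD(2)[OF g kc[OF p]] unfolding exact_def by blast
 then have "\<exists>m. ALL p:paths q. m p : car (M (n - 1)) & dM (n - 1) (m p) = g (?k (rho q p) 1[alg])" by (intro bchoice) blast
 then obtain m where m: "!!p. p : paths q ==> m p : car (M (n - 1))" "!!p. p : paths q ==> dM (n - 1) (m p) = g (?k (rho q p) 1[alg])" by blast
 have kb: "kbal n (M (n - 1)) (kext (M (n - 1)) q m)" using kext_kbal[of "M (n - 1)" q m, OF Mbim m(1)] n by simp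
 note kx = kext_kbal[OF Mbim m(1)] kext_left[OF Mbim m(1)] kext_right[OF Mbim m(1)] kext_term[OF Mbim m(1)] pv[OF Mbim m(1)]
 obtain h where h: "bimod_hom (kos_grp n) (M (n - 1)) h" "!!a x b. a : car alg ==> x : Wc n ==> b : car alg ==> h (ktens n a x b) = kext (M (n - 1)) q m a x b"
 proof (rule kos_lift_hom[OF Mbim kb kx(2,3)])
 qed (assumption+, rule that)
 have "dM (n - 1) (h x) = g x" if x: "x : car (kos_grp n)" for x
 proof (rule kos_am_eqI[OF MG.ab_ax am_comp[OF bhomD(1)[OF h(1)] bhomD(1)[OF dh]] bhomD(1)[OF g] _ x])
  fix a x b assume a: "a : car alg" and x: "x : Wc n" and b: "b : car alg"
  have "dM (n - 1) (h (ktens n a x b)) = kext (M n) q (%p. g (?k (rho q p) 1[alg])) a x b"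
   unfolding h(2)[OF a x b] kext_def
   by (rule trans[OF am_finsum[OF MG.ab_ax MG.ab_ax bhomD(1)[OF dh] fin_paths kx(4)] MG.finsum_cong'[OF refl]])
    (simp_all add: bhomD(4,5)[OF dh] m bim_l[OF Mbim] bim_r[OF Mbim] kx(5,6) a b bhomD(2)[OF g] kc)
  also have "... = g (ktens n a x b)" using kext_value[OF Mbim g[unfolded n] a _ b, of x] x by (simp add: n)
  finally show "dM (n - 1) (h (ktens n a x b)) = g (ktens n a x b)" .
 qed
 with h(1) show ?thesis by blast
qed

text \<open>The homotopy is built by dependent choice downwards from degree 1, where the Koszul
  complex is zero. Given the component on degree n + 1, the map u - h d on degree n takes values in
  cocycles and therefore factors through the differential of \<open>M\<close>.\<close>

lemma kos_null:
 assumes ex: exact and u: "!!n. bimod_hom (kos_grp n) (M n) (u n)" and ud: "!!n x. x : car (kos_grp n) ==> dM n (u n x) = u (n + 1) (kos_diff n x)"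
 obtains h where "!!n m. m = n - 1 ==> bimod_hom (kos_grp n) (M m) (h n)"
  "!!n m k x. x : car (kos_grp n) ==> m = n - 1 ==> k = n + 1 ==> dM m (h n x) +[M n] h k (kos_diff n x) = u n x"
proof -
 note ab = MG.ab_ax and kab = ab_kos
 note kd = kos_diff_hom[OF refl]
 \<comment> \<open>The j-th choice is the component on degree 1 - j, with values in degree -j. The
   second condition is what makes u - h d land in the cocycles at the next step.\<close>
 define P where "P j h \<longleftrightarrow> bimod_hom (kos_grp (1 - int j)) (M (- int j)) h &
   (ALL x:car (kos_grp (- int j)). dM (- int j) (h (kos_diff (- int j) x)) = u (1 - int j) (kos_diff (- int j) x))" for j h
 define S where "S j h h' \<longleftrightarrow> (ALL x:car (kos_grp (- int j)). dM (- int j - 1) (h' x) +[M (- int j)] h (kos_diff (- int j) x) = u (- int j) x)" for j h h'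
 have zh: "bimod_hom (kos_grp n) (M m) (%_. 0[M m])" for n m by (simp add: bimod_hom_def bim_zero[OF Mbim])
 have z0: "h 0[kos_grp n] = 0[M m]" if "bimod_hom (kos_grp n) (M m) h" for n m h by (rule am_zero[OF kab ab bhomD(1)[OF that]])
 have dz: "dM n 0[M n] = 0[M m]" if "m = n + 1" for n m by (rule am_zero[OF ab ab bhomD(1)[OF Md_hom[OF that]]])
 have "\<exists>f. \<forall>j. P j (f j) & S j (f j) (f (Suc j))"
 proof (rule dependent_nat_choice)
  have "u 1 (kos_diff 0 x) = 0[M 1]" if "x : car (kos_grp 0)" for x
   using kos_pos[of 1 "kos_diff 0 x"] bhomD(2)[OF kd that] z0[OF u] by simp
  then have "P 0 (%_. 0[M 0])" using zh[of 1 0] dz[of 1 0] by (simp add: P_def)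
  then show "\<exists>h. P 0 h" by blast
 next
  fix h j assume P: "P j h"
  let ?n = "- int j"
  have hh: "bimod_hom (kos_grp (1 - int j)) (M ?n) h" and hd: "!!x. x : car (kos_grp ?n) ==> dM ?n (h (kos_diff ?n x)) = u (1 - int j) (kos_diff ?n x)"
   using P by (simp_all add: P_def)
  have kd': "bimod_hom (kos_grp ?n) (kos_grp (1 - int j)) (kos_diff ?n)" by (rule kos_diff_hom) simp
  note hk = bimod_hom_comp[OF kd' hh]
  let ?g = "%x. u ?n x -[M ?n] h (kos_diff ?n x)"
  have g: "bimod_hom (kos_grp ?n) (M ?n) ?g" by (rule bimod_hom_minus[OF Mbim u hk])
  have dg: "dM ?n (?g x) = 0[M (?n + 1)]" if x: "x : car (kos_grp ?n)" for x
  proof -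
   have ux: "u ?n x : car (M ?n)" "h (kos_diff ?n x) : car (M ?n)" using bhomD(2)[OF u x] bhomD(2)[OF hk x] by simp_all
   have "dM ?n (?g x) = dM ?n (u ?n x) -[M (?n + 1)] dM ?n (h (kos_diff ?n x))"
    by (rule am_diff[OF ab ab bhomD(1)[OF Md_hom[OF refl]] ux])
   also have "... = dM ?n (u ?n x) -[M (?n + 1)] dM ?n (u ?n x)" using ud[OF x] hd[OF x] by (simp add: add.commute)
   finally show ?thesis using MG.r_neg[OF Md_cl[OF ux(1) refl]] by (simp add: a_minus_def)
  qed
  obtain h' where h': "bimod_hom (kos_grp ?n) (M (?n - 1)) h'" "!!x. x : car (kos_grp ?n) ==> dM (?n - 1) (h' x) = ?g x"
   using kos_factor[OF ex refl g dg] by blast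
  have s: "dM (?n - 1) (h' x) +[M ?n] h (kos_diff ?n x) = u ?n x" if x: "x : car (kos_grp ?n)" for x
   using h'(2)[OF x] MG.ag_eq[of "[u ?n x, h (kos_diff ?n x)]" ?n "Pl (Mi (V 0) (V 1)) (V 1)" "V 0"] bhomD(2)[OF u x] bhomD(2)[OF hk x] by (simp add: less_Suc_eq)
  have i: "1 - int (Suc j) = ?n" "- int (Suc j) = ?n - 1" by simp_all
  have "dM (?n - 1) (h' (kos_diff (?n - 1) x)) = u ?n (kos_diff (?n - 1) x)" if x: "x : car (kos_grp (?n - 1))" for x
  proof -
   have c: "kos_diff (?n - 1) x : car (kos_grp ?n)" using bhomD(2)[OF kos_diff_hom x, of ?n] by simp
   have k0: "kos_diff ?n (kos_diff (?n - 1) x) = 0[kos_grp (1 - int j)]" using kos_diff_diff[OF x] by simp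
   have "h (kos_diff ?n (kos_diff (?n - 1) x)) = 0[M ?n]" unfolding k0 by (rule z0[OF hh])
   then show ?thesis using s[OF c] Md_cl[OF bhomD(2)[OF h'(1) c], of ?n] by simp
  qed
  then have "P (Suc j) h'" unfolding P_def i using h'(1) by blast
  moreover have "S j h h'" unfolding S_def using s by blast
  ultimately show "\<exists>h'. P (Suc j) h' & S j h h'" by blast
 qed
 then obtain f where f: "!!j. P j (f j)" "!!j. S j (f j) (f (Suc j))" by blast
 \<comment> \<open>Above degree 1 the Koszul complex vanishes, so the zero map serves there.\<close>
 define h where "h n = (if n \<le> 1 then f (nat (1 - n)) else (%_. 0[M (n - 1)]))" for n
 have hh: "bimod_hom (kos_grp n) (M (n - 1)) (h n)" for n
 proof (cases "n \<le> 1")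
  case True
  then show ?thesis using f(1)[of "nat (1 - n)"] by (simp add: h_def P_def)
 qed (simp add: h_def zh)
 show ?thesis
 proof (rule that[of h])
  show "bimod_hom (kos_grp n) (M m) (h n)" if "m = n - 1" for n m using hh that by simp
  fix n m k x assume x: "x : car (kos_grp n)" and m: "m = n - 1" and k: "k = n + 1"
  show "dM m (h n x) +[M n] h k (kos_diff n x) = u n x"
  proof (cases "n \<le> 0")
   case True
   then have "nat (1 - n) = Suc (nat (- n))" "nat (- n) = nat (- n)" "- int (nat (- n)) = n" "nat (1 - (n + 1)) = nat (- n)" by simp_all
   then show ?thesis using f(2)[of "nat (- n)"] x True by (simp add: h_def S_def m k)
  next
   case False
   have hh': "bimod_hom (kos_grp k) (M n) (h k)" using hh[of k] by (simp add: k)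
   have x0: "x = 0[kos_grp n]" using kos_pos[OF _ x] False by simp
   show ?thesis unfolding x0 z0[OF hh[of n, folded m]] z0[OF u] am_zero[OF kab kab bhomD(1)[OF kos_diff_hom[OF k]]] z0[OF hh']
    using dz[of n m] by (simp add: m)
  qed
 qed
qed

end

section \<open>Quasi-isomorphisms and the localization\<close>

lemma (in abelian_group) coset_eq_iff:
 assumes B: "B <= car G" "\<zero> : B" "!!x y. x : B ==> y : B ==> x \<oplus> y : B" "!!x. x : B ==> \<ominus> x : B"
  and a: "a : car G" and b: "b : car G"
 shows "B +> a = B +> b \<longleftrightarrow> a \<ominus> b : B"
proof -
 have m: "x : B +> y \<longleftrightarrow> (EX h:B. x = h \<oplus> y)" for x y by (auto simp: a_r_coset_def')
 have c: "h : B ==> h : car G" for h using B(1) by blast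
 show ?thesis
 proof
  assume e: "B +> a = B +> b"
  have "a : B +> a" unfolding m using B(2) a by (intro bexI[of _ \<zero>]) simp_all
  then obtain h where h: "h : B" "a = h \<oplus> b" unfolding e m by blast
  then show "a \<ominus> b : B" using ag_eq[of "[h, b]" "Mi (Pl (V 0) (V 1)) (V 1)" "V 0"] c b by (simp add: less_Suc_eq)
 next
  assume ab: "a \<ominus> b : B"
  have 1: "h \<oplus> a = (h \<oplus> (a \<ominus> b)) \<oplus> b" if "h : B" for h
   using ag_eq[of "[h, a, b]" "Pl (V 0) (V 1)" "Pl (Pl (V 0) (Mi (V 1) (V 2))) (V 2)"] c[OF that] a b by (simp add: less_Suc_eq)
  have 2: "h \<oplus> b = (h \<oplus> (\<ominus> (a \<ominus> b))) \<oplus> a" if "h : B" for h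
   using ag_eq[of "[h, a, b]" "Pl (V 0) (V 2)" "Pl (Pl (V 0) (Ng (Mi (V 1) (V 2)))) (V 1)"] c[OF that] a b by (simp add: less_Suc_eq)
  show "B +> a = B +> b"
  proof (rule Set.set_eqI)
   fix x show "x : B +> a \<longleftrightarrow> x : B +> b" unfolding m using 1 2 B(3)[OF _ ab] B(3)[OF _ B(4)[OF ab]] by metis
  qed
 qed
qed

context quadratic_algebra
begin

lemma closed_mor_Mor: "u : closed_mor X Y r ==> u : Mor X Y r"
 by (simp add: closed_mor_def)

lemma closed0_hom: "u : closed_mor X Y 0 ==> bimod_hom (grp X n) (grp Y n) (u n)"
 using Mor_closed[OF closed_mor_Mor, of u X Y 0 n] by simp

lemma minus_zero_eq: "abelian_group G ==> a : car G ==> b : car G ==> a -[G] b = 0[G] ==> a = b"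
proof -
 assume G: "abelian_group G" and ab: "a : car G" "b : car G" "a -[G] b = 0[G]"
 interpret G: abelian_group G by (rule G)
 show "a = b" using G.ag_eq[of "[a, b]" "Pl (Mi (V 0) (V 1)) (V 1)" "V 0"] ab by (simp add: less_Suc_eq)
qed

lemma closed0_diff:
 assumes X: "dg_object X" and Y: "dg_object Y" and u: "u : closed_mor X Y 0" and x: "x : elts X n"
 shows "diff Y n (u n x) = u (n + 1) (diff X n x)"
proof -
 interpret X: dgo Q R X by unfold_locales (rule X)
 interpret Y: dgo Q R Y by unfold_locales (rule Y)
 have "dMor X Y 0 u n x = zero_mor X Y 1 n x" using u by (simp add: closed_mor_def)
 then have "diff Y n (u n x) -[grp Y (n + 1)] u (n + 1) (diff X n x) = 0[grp Y (n + 1)]"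
  using x by (simp add: dMor_def zero_mor_def Y.G.signed_even)
 then show ?thesis
  by (rule minus_zero_eq[OF Y.G.ab_ax Y.diff_cl[OF bhomD(2)[OF closed0_hom[OF u] x] refl]
   bhomD(2)[OF closed0_hom[OF u] X.diff_cl[OF x refl]]])
qed

lemma closed0I:
 assumes X: "dg_object X" and Y: "dg_object Y" and u: "u : Mor X Y 0" and d: "!!n x. x : elts X n ==> diff Y n (u n x) = u (n + 1) (diff X n x)"
 shows "u : closed_mor X Y 0"
proof -
 interpret X: dgo Q R X by unfold_locales (rule X)
 interpret Y: dgo Q R Y by unfold_locales (rule Y)
 have "dMor X Y 0 u = zero_mor X Y (0 + 1)"
  unfolding dMor_def zero_mor_def
 proof (rule ext, rule rext)
  fix n x assume x: "x : elts X n"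
  have "u (n + 1) (diff X n x) : elts Y (n + 1)" using bhomD(2)[OF Mor_closed[OF u] X.diff_cl[OF x refl]] by simp
  then show "diff Y (n + 0) (u n x) -[grp Y (n + 0 + 1)] signed (grp Y (n + 0 + 1)) 0 (u (n + 1) (diff X n x)) = 0[grp Y (n + (0 + 1))]"
   using d[OF x] Y.G.r_neg by (simp add: Y.G.signed_even a_minus_def)
 qed
 then show ?thesis using u by (simp add: closed_mor_def)
qed

text \<open>Bijectivity on cohomology is defined through maps of cosets. Elementwise, the first
  clause is injectivity and the second surjectivity.\<close>

lemma quasi_iso_iff:
 assumes X: "dg_object X" and Y: "dg_object Y" and u: "u : closed_mor X Y 0"
 shows "quasi_iso X Y u \<longleftrightarrow> (\<forall>n. (ALL x:cocycles X n. u n x : coboundaries Y n --> x : coboundaries X n) &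
  (ALL y:cocycles Y n. EX x:cocycles X n. y -[grp Y n] u n x : coboundaries Y n))"
proof -
 interpret X: dgo Q R X by unfold_locales (rule X)
 interpret Y: dgo Q R Y by unfold_locales (rule Y)
 have cob: "coboundaries C n <= elts C n" "0[grp C n] : coboundaries C n"
  "a : coboundaries C n ==> b : coboundaries C n ==> a +[grp C n] b : coboundaries C n"
  "a : coboundaries C n ==> -[grp C n] a : coboundaries C n" if "dg_object C" for C :: "('v, 'e, 'f, 'z) qobj" and n a b
 proof -
  interpret C: dgo Q R C by unfold_locales (rule that)
  have h: "bimod_hom (grp C (n - 1)) (grp C n) (diff C (n - 1))" by (rule C.diff_bim) simp
  note ab = C.G.ab_ax
  show "coboundaries C n <= elts C n" unfolding coboundaries_def using bhomD(2)[OF h] by blast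
  show "0[grp C n] : coboundaries C n" unfolding coboundaries_def
   by (rule image_eqI[of _ _ "0[grp C (n - 1)]"]) (simp_all add: am_zero[OF ab ab bhomD(1)[OF h]])
  show "a +[grp C n] b : coboundaries C n" if ab: "a : coboundaries C n" "b : coboundaries C n"
  proof -
   obtain a' b' where "a' : elts C (n - 1)" "a = diff C (n - 1) a'" "b' : elts C (n - 1)" "b = diff C (n - 1) b'"
    using ab by (auto simp: coboundaries_def)
   then show ?thesis unfolding coboundaries_def by (intro image_eqI[of _ _ "a' +[grp C (n - 1)] b'"]) (simp_all add: bhomD(3)[OF h])
  qed
  show "-[grp C n] a : coboundaries C n" if a: "a : coboundaries C n"
  proof -
   obtain a' where "a' : elts C (n - 1)" "a = diff C (n - 1) a'" using a by (auto simp: coboundaries_def)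
   then show ?thesis unfolding coboundaries_def
    by (intro image_eqI[of _ _ "-[grp C (n - 1)] a'"]) (simp_all add: addmap_neg[OF ab ab bhomD(1)[OF h]])
  qed
 qed
 have one: "bij_betw (%S. \<Union>x \<in> S. coboundaries Y n +>\<^bsub>grp Y n\<^esub> u n x) (cohomology X n) (cohomology Y n) \<longleftrightarrow>
   (ALL x:cocycles X n. u n x : coboundaries Y n --> x : coboundaries X n) &
   (ALL y:cocycles Y n. EX x:cocycles X n. y -[grp Y n] u n x : coboundaries Y n)" for n
 proof -
  let ?BX = "coboundaries X n" and ?BY = "coboundaries Y n" and ?X = "grp X n" and ?Y = "grp Y n" and ?u = "u n"
  let ?F = "%S. \<Union>x \<in> S. ?BY +>\<^bsub>?Y\<^esub> ?u x"
  have h: "bimod_hom ?X ?Y ?u" by (rule closed0_hom[OF u])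
  note hm = am_diff[OF X.G.ab_ax Y.G.ab_ax bhomD(1)[OF h]]
  have ZX: "x : car ?X" if "x : cocycles X n" for x using that by (simp add: cocycles_def)
  have ZY: "x : car ?Y" if "x : cocycles Y n" for x using that by (simp add: cocycles_def)
  have uc: "?u x : car ?Y" if "x : cocycles X n" for x by (rule bhomD(2)[OF h ZX[OF that]])
  have uZ: "?u x : cocycles Y n" if x: "x : cocycles X n" for x
   using closed0_diff[OF X Y u ZX[OF x]] uc[OF x] x am_zero[OF X.G.ab_ax Y.G.ab_ax bhomD(1)[OF closed0_hom[OF u, of "n + 1"]]]
   by (simp add: cocycles_def)
  have ZXd: "x -[?X] y : cocycles X n" if "x : cocycles X n" "y : cocycles X n" for x y
   using that am_diff[OF X.G.ab_ax X.G.ab_ax bhomD(1)[OF X.diff_bim[OF refl]], of x n y] X.G.r_neg[of "0[grp X (n + 1)]" "n + 1"]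
   by (simp add: cocycles_def a_minus_def)
  have eqX: "?BX +>\<^bsub>?X\<^esub> x = ?BX +>\<^bsub>?X\<^esub> y \<longleftrightarrow> x -[?X] y : ?BX" if "x : car ?X" "y : car ?X" for x y
   by (rule X.G.coset_eq_iff[OF cob[OF X] that])
  have eqY: "?BY +>\<^bsub>?Y\<^esub> x = ?BY +>\<^bsub>?Y\<^esub> y \<longleftrightarrow> x -[?Y] y : ?BY" if "x : car ?Y" "y : car ?Y" for x y
   by (rule Y.G.coset_eq_iff[OF cob[OF Y] that])
  have uB: "?u b : ?BY" if b: "b : ?BX" for b
  proof -
   obtain b' where b': "b' : elts X (n - 1)" "b = diff X (n - 1) b'" using b by (auto simp: coboundaries_def)
   then have "?u b = diff Y (n - 1) (u (n - 1) b')" using closed0_diff[OF X Y u b'(1)] by simp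
   then show ?thesis using bhomD(2)[OF closed0_hom[OF u] b'(1)] by (simp add: coboundaries_def)
  qed
  \<comment> \<open>The union over the members of a class collapses to the class of
    \<open>u n x\<close>, because coboundaries go to coboundaries.\<close>
  have F: "?F (?BX +>\<^bsub>?X\<^esub> x) = ?BY +>\<^bsub>?Y\<^esub> ?u x" if x: "x : cocycles X n" for x
  proof -
   have m: "y : ?BX +>\<^bsub>?X\<^esub> x \<longleftrightarrow> (EX b:?BX. y = b +[?X] x)" for y by (auto simp: a_r_coset_def')
   have "?BY +>\<^bsub>?Y\<^esub> ?u y = ?BY +>\<^bsub>?Y\<^esub> ?u x" if y: "y : ?BX +>\<^bsub>?X\<^esub> x" for y
   proof -
    obtain b where b: "b : ?BX" "y = b +[?X] x" using y m by blast
    then have bc: "b : car ?X" using cob(1)[OF X] by blast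
    have "?u y -[?Y] ?u x = ?u b" using bhomD(3)[OF h bc ZX[OF x]] bhomD(2)[OF h bc] uc[OF x] b(2)
    Y.G.ag_eq[of "[?u b, ?u x]" n "Mi (Pl (V 0) (V 1)) (V 1)" "V 0"] by (simp add: less_Suc_eq)
    then show ?thesis using eqY[OF bhomD(2)[OF h] uc[OF x], of y] uB[OF b(1)] b(2) bc ZX[OF x] by simp
   qed
   moreover have "x : ?BX +>\<^bsub>?X\<^esub> x" unfolding m using cob(2)[OF X] ZX[OF x] by (intro bexI[of _ "0[?X]"]) simp_all
   ultimately show ?thesis by blast
  qed
  have "bij_betw ?F (cohomology X n) (cohomology Y n) \<longleftrightarrow> inj_on ?F (cohomology X n) & ?F ` cohomology X n = cohomology Y n"
   by (rule bij_betw_def)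
  also have "inj_on ?F (cohomology X n) \<longleftrightarrow> (ALL x:cocycles X n. ?u x : ?BY --> x : ?BX)"
  proof
   assume inj: "inj_on ?F (cohomology X n)"
   show "ALL x:cocycles X n. ?u x : ?BY --> x : ?BX"
   proof (intro ballI impI)
    fix x assume x: "x : cocycles X n" and ux: "?u x : ?BY"
    have z: "0[?X] : cocycles X n"
    using am_zero[OF X.G.ab_ax X.G.ab_ax bhomD(1)[OF X.diff_bim[OF refl]]] by (simp add: cocycles_def)
    have u0: "?u 0[?X] = 0[?Y]" by (rule am_zero[OF X.G.ab_ax Y.G.ab_ax bhomD(1)[OF h]])
    have m0: "a -[?X] 0[?X] = a" if "a : car ?X" for a using X.G.ag_eq[of "[a]" n "Mi (V 0) Zr" "V 0"] that by simp
    have m0': "a -[?Y] 0[?Y] = a" if "a : car ?Y" for a using Y.G.ag_eq[of "[a]" n "Mi (V 0) Zr" "V 0"] that by simp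
    have "?F (?BX +>\<^bsub>?X\<^esub> x) = ?F (?BX +>\<^bsub>?X\<^esub> 0[?X])"
    unfolding F[OF x] F[OF z] u0 using eqY[OF uc[OF x], of "0[?Y]"] m0'[OF uc[OF x]] ux by simp
    then have "?BX +>\<^bsub>?X\<^esub> x = ?BX +>\<^bsub>?X\<^esub> 0[?X]"
    by (rule inj_onD[OF inj]) (use x z in "auto simp: cohomology_def")
    then show "x : ?BX" using eqX[OF ZX[OF x], of "0[?X]"] m0[OF ZX[OF x]] by simp
   qed
  next
   assume i: "ALL x:cocycles X n. ?u x : ?BY --> x : ?BX"
   show "inj_on ?F (cohomology X n)"
   proof (rule inj_onI)
    fix S S' assume "S : cohomology X n" "S' : cohomology X n" and e: "?F S = ?F S'"
    then obtain x y where xy: "x : cocycles X n" "S = ?BX +>\<^bsub>?X\<^esub> x" "y : cocycles X n" "S' = ?BX +>\<^bsub>?X\<^esub> y" by (auto simp: cohomology_def)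
    have "?u x -[?Y] ?u y : ?BY" using e F[OF xy(1)] F[OF xy(3)] eqY[OF uc[OF xy(1)] uc[OF xy(3)]] xy by simp
    then have "?u (x -[?X] y) : ?BY" using hm[OF ZX[OF xy(1)] ZX[OF xy(3)]] by simp
    then have "x -[?X] y : ?BX" using i ZXd[OF xy(1,3)] by blast
    then show "S = S'" using eqX[OF ZX[OF xy(1)] ZX[OF xy(3)]] xy by simp
   qed
  qed
  also have "?F ` cohomology X n = cohomology Y n \<longleftrightarrow> (ALL y:cocycles Y n. EX x:cocycles X n. y -[?Y] ?u x : ?BY)"
  proof -
   have "?F ` cohomology X n = (%x. ?BY +>\<^bsub>?Y\<^esub> ?u x) ` cocycles X n"
    unfolding cohomology_def image_image by (rule image_cong[OF refl F])
   moreover have "... <= cohomology Y n" unfolding cohomology_def using uZ by blast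
   ultimately have "?F ` cohomology X n = cohomology Y n \<longleftrightarrow> cohomology Y n <= (%x. ?BY +>\<^bsub>?Y\<^esub> ?u x) ` cocycles X n" by auto
   also have "... \<longleftrightarrow> (ALL y:cocycles Y n. EX x:cocycles X n. ?BY +>\<^bsub>?Y\<^esub> y = ?BY +>\<^bsub>?Y\<^esub> ?u x)" unfolding cohomology_def by blast
   finally show ?thesis using eqY[OF ZY uc] by simp
  qed
  finally show ?thesis .
 qed
 show ?thesis unfolding quasi_iso_def using u one by blast
qed

section \<open>Calculus of morphisms and homotopies\<close>

lemma Mor_comp:
 assumes X: "dg_object X" and Y: "dg_object Y" and Z: "dg_object Z" and f: "f : Mor X Y r" and g: "g : Mor Y Z s"
  and t: "t = r + s" and w: "!!n x. x : elts X n ==> w n x = g (n + r) (f n x)" and we: "!!n. w n : extensional (elts X n)"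
 shows "w : Mor X Z t"
 unfolding Mor_def
proof (intro CollectI conjI allI ballI we)
 interpret X: dgo Q R X by unfold_locales (rule X)
 interpret Y: dgo Q R Y by unfold_locales (rule Y)
 interpret Z: dgo Q R Z by unfold_locales (rule Z)
 have i: "n + t = n + r + s" for n by (simp add: t)
 fix n
 show "bimod_hom (grp X n) (grp Z (n + t)) (w n)" unfolding i
  by (rule bimod_hom_cong[OF X.bim bimod_hom_comp[OF Mor_closed[OF f] Mor_closed[OF g]] w])
 fix p f' x assume f': "f' : cochains p" and x: "x : elts X n"
 have fx: "f n x : elts Y (n + r)" by (rule bhomD(2)[OF Mor_closed[OF f] x])
 have j: "n + int p + r = n + r + int p" by simp
 have l: "lact Y p (n + r) f' (f n x) : elts Y (n + r + int p)" by (rule Y.lact_cl[OF f' fx refl])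
 have k: "n + r + int p + s = n + r + s + int p" by simp
 have gh: "bimod_hom (grp Y (n + r + int p)) (grp Z (n + r + s + int p)) (g (n + r + int p))" using Mor_closed[OF g, of "n + r + int p"] unfolding k .
 have gc: "lact Z p (n + r + s) f' (g (n + r) (f n x)) : elts Z (n + r + s + int p)"
  by (rule Z.lact_cl[OF f' bhomD(2)[OF Mor_closed[OF g] fx] refl])
 show "w (n + int p) (lact X p n f' x) = signed (grp Z (n + t + int p)) (t * int p) (lact Z p (n + t) f' (w n x))"
  unfolding w[OF x] w[OF X.lact_cl[OF f' x refl]] j Mor_lact[OF f f' x] i
  unfolding am_signed[OF Y.G.ab_ax Z.G.ab_ax bhomD(1)[OF gh] l] Mor_lact[OF g f' fx] Z.G.signed_signed[OF gc]
  by (simp add: t algebra_simps)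
 show "w (n + int p) (ract X p n x f') = ract Z p (n + t) (w n x) f'"
  unfolding w[OF x] w[OF X.ract_cl[OF f' x refl]] j Mor_ract[OF f f' x] i by (rule Mor_ract[OF g f' fx])
qed

text \<open>Together with \<open>zero_mor_Mor\<close> this yields negatives and sums of
  homotopies.\<close>

lemma Mor_minus:
 assumes X: "dg_object X" and Y: "dg_object Y" and f: "f : Mor X Y r" and g: "g : Mor X Y r"
 shows "(%n. \<lambda>x\<in>elts X n. f n x -[grp Y (n + r)] g n x) : Mor X Y r"
  "x : elts X n ==> dMor X Y r (%n. \<lambda>x\<in>elts X n. f n x -[grp Y (n + r)] g n x) n x =
    dMor X Y r f n x -[grp Y (n + r + 1)] dMor X Y r g n x"
proof -
 interpret X: dgo Q R X by unfold_locales (rule X)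
 interpret Y: dgo Q R Y by unfold_locales (rule Y)
 note ab = Y.G.ab_ax
 have c: "u n x : elts Y m" if "u : Mor X Y r" "x : elts X n" "m = n + r" for u n x m
  using bhomD(2)[OF Mor_closed[OF that(1)] that(2)] that(3) by simp
 show "(%n. \<lambda>x\<in>elts X n. f n x -[grp Y (n + r)] g n x) : Mor X Y r" (is "?w : _")
  unfolding Mor_def
 proof (intro CollectI conjI allI ballI)
  fix n
  show "bimod_hom (grp X n) (grp Y (n + r)) (?w n)"
   by (rule bimod_hom_cong[OF X.bim bimod_hom_minus[OF Y.bim Mor_closed[OF f] Mor_closed[OF g]]]) simp
  fix p f' x assume f': "f' : cochains p" and x: "x : elts X n"
  have j: "n + int p + r = n + r + int p" by simp
  note l = am_diff[OF ab ab bhomD(1)[OF Y.lact_bim[OF f' refl]]] and rr = am_diff[OF ab ab bhomD(1)[OF Y.ract_bim[OF f' refl]]]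
  note lc = Y.lact_cl[OF f' c[OF f x refl] refl] Y.lact_cl[OF f' c[OF g x refl] refl]
  have sm: "signed G k a -[G] signed G k b = signed G k (a -[G] b)" if "abelian_group G" "a : car G" "b : car G" for G :: "(('v, 'e, 'f) qalg, 'c) bimod" and k a b
   using abelian_group.ag_eq[OF that(1), of "[a, b]" "Mi (Sg k (V 0)) (Sg k (V 1))" "Sg k (Mi (V 0) (V 1))"] that by (auto simp: less_Suc_eq)
  show "?w (n + int p) (lact X p n f' x) = signed (grp Y (n + r + int p)) (r * int p) (lact Y p (n + r) f' (?w n x))"
   using x X.lact_cl[OF f' x refl] by (simp add: Mor_lact[OF f f' x] Mor_lact[OF g f' x] l c[OF f] c[OF g] j sm[OF ab lc])
  show "?w (n + int p) (ract X p n x f') = ract Y p (n + r) (?w n x) f'"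
   using x X.ract_cl[OF f' x refl] by (simp add: Mor_ract[OF f f' x] Mor_ract[OF g f' x] rr c[OF f] c[OF g] j)
 qed simp
 assume x: "x : elts X n"
 note dx = X.diff_cl[OF x refl]
 have j: "n + 1 + r = n + r + 1" by simp
 have C: "diff Y (n + r) (f n x) : elts Y (n + r + 1)" "diff Y (n + r) (g n x) : elts Y (n + r + 1)"
  "f (n + 1) (diff X n x) : elts Y (n + r + 1)" "g (n + 1) (diff X n x) : elts Y (n + r + 1)"
  using Y.diff_cl[OF c[OF f x refl] refl] Y.diff_cl[OF c[OF g x refl] refl] c[OF f dx, of "n + r + 1"] c[OF g dx, of "n + r + 1"] by simp_all
 let ?L = "[diff Y (n + r) (f n x), diff Y (n + r) (g n x), f (n + 1) (diff X n x), g (n + 1) (diff X n x)]"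
 have ag: "agv (grp Y (n + r + 1)) ?L (Mi (Mi (V 0) (V 1)) (Sg r (Mi (V 2) (V 3)))) = agv (grp Y (n + r + 1)) ?L (Mi (Mi (V 0) (Sg r (V 2))) (Mi (V 1) (Sg r (V 3))))"
  by (rule Y.G.ag_eq) (use C in "auto simp: less_Suc_eq isign_def")
 show "dMor X Y r ?w n x = dMor X Y r f n x -[grp Y (n + r + 1)] dMor X Y r g n x"
  using ag x dx am_diff[OF ab ab bhomD(1)[OF Y.diff_bim[OF refl]] c[OF f x refl] c[OF g x refl]]
  by (simp add: dMor_def j)
qed

lemma zero_mor_Mor:
 assumes X: "dg_object X" and Y: "dg_object Y"
 shows "zero_mor X Y r : Mor X Y r" "x : elts X n ==> dMor X Y r (zero_mor X Y r) n x = 0[grp Y (n + r + 1)]"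
proof -
 interpret X: dgo Q R X by unfold_locales (rule X)
 interpret Y: dgo Q R Y by unfold_locales (rule Y)
 note ab = Y.G.ab_ax
 show "zero_mor X Y r : Mor X Y r"
  unfolding Mor_def zero_mor_def
 proof (intro CollectI conjI allI ballI)
  fix n show "bimod_hom (grp X n) (grp Y (n + r)) (\<lambda>x\<in>elts X n. 0[grp Y (n + r)])"
   by (simp add: bimod_hom_def bim_l[OF X.bim] bim_r[OF X.bim] bim_zero[OF Y.bim])
  fix p f x assume f: "f : cochains p" and x: "x : elts X n"
  have j: "n + int p + r = n + r + int p" by simp
  show "(\<lambda>x\<in>elts X (n + int p). 0[grp Y (n + int p + r)]) (lact X p n f x) =
   signed (grp Y (n + r + int p)) (r * int p) (lact Y p (n + r) f ((\<lambda>x\<in>elts X n. 0[grp Y (n + r)]) x))"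
   using X.lact_cl[OF f x refl] x am_zero[OF ab ab bhomD(1)[OF Y.lact_bim[OF f refl]]] by (simp add: j)
  show "(\<lambda>x\<in>elts X (n + int p). 0[grp Y (n + int p + r)]) (ract X p n x f) =
   ract Y p (n + r) ((\<lambda>x\<in>elts X n. 0[grp Y (n + r)]) x) f"
   using X.ract_cl[OF f x refl] x am_zero[OF ab ab bhomD(1)[OF Y.ract_bim[OF f refl]]] by (simp add: j)
 qed simp
 assume x: "x : elts X n"
 have j: "n + 1 + r = n + r + 1" by simp
 show "dMor X Y r (zero_mor X Y r) n x = 0[grp Y (n + r + 1)]"
  using x X.diff_cl[OF x refl] am_zero[OF ab ab bhomD(1)[OF Y.diff_bim[OF refl]]] Y.G.r_neg[of "0[grp Y (n + r + 1)]" "n + r + 1"]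
  by (simp add: dMor_def zero_mor_def j a_minus_def)
qed

end

context quadratic_algebra
begin

lemma dMor_closed:
 assumes X: "dg_object X" and Y: "dg_object Y" and h: "h : Mor X Y r" and x: "x : elts X n" and m: "m = n + r + 1"
 shows "dMor X Y r h n x : elts Y m"
proof -
 interpret X: dgo Q R X by unfold_locales (rule X)
 interpret Y: dgo Q R Y by unfold_locales (rule Y)
 have "h (n + 1) (diff X n x) : elts Y (n + 1 + r)" by (rule bhomD(2)[OF Mor_closed[OF h] X.diff_cl[OF x refl]])
 then have "h (n + 1) (diff X n x) : elts Y (n + r + 1)" by (simp only: ac_simps)
 then show ?thesis using Y.diff_cl[OF bhomD(2)[OF Mor_closed[OF h] x] refl] x by (simp add: dMor_def m)
qed

text \<open>Differentials of morphisms of degree -1 are closed under sums and negatives, so shifting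
  the representative by one of them leaves its class unchanged.\<close>

lemma homotopy_class_cong:
 assumes X: "dg_object X" and Y: "dg_object Y" and u: "u : closed_mor X Y 0" and h: "h : Mor X Y (- 1)"
  and v: "!!n x. x : elts X n ==> v n x = u n x +[grp Y n] dMor X Y (- 1) h n x"
 shows "homotopy_class X Y v = homotopy_class X Y u"
proof -
 interpret Y: dgo Q R Y by unfold_locales (rule Y)
 have hz: "EX k:Mor X Y (- 1). \<forall>n. ALL x:elts X n. dMor X Y (- 1) k n x = -[grp Y n] dMor X Y (- 1) h n x" if h: "h : Mor X Y (- 1)" for h
  by (intro bexI[OF _ Mor_minus(1)[OF X Y zero_mor_Mor(1)[OF X Y] h]] allI ballI, subst Mor_minus(2)[OF X Y zero_mor_Mor(1)[OF X Y] h], assumption)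
   (use zero_mor_Mor(2)[OF X Y] dMor_closed[OF X Y h] in "simp add: Y.G.minus_eq")
 have add: "EX k:Mor X Y (- 1). \<forall>n. ALL x:elts X n. dMor X Y (- 1) k n x = dMor X Y (- 1) h n x +[grp Y n] dMor X Y (- 1) h' n x"
  if h: "h : Mor X Y (- 1)" "h' : Mor X Y (- 1)" for h h'
 proof -
  obtain k where k: "k : Mor X Y (- 1)" "!!n x. x : elts X n ==> dMor X Y (- 1) k n x = -[grp Y n] dMor X Y (- 1) h' n x" using hz[OF h(2)] by blast
  show ?thesis
   by (intro bexI[OF _ Mor_minus(1)[OF X Y h(1) k(1)]] allI ballI, subst Mor_minus(2)[OF X Y h(1) k(1)], assumption)
    (use k(2) dMor_closed[OF X Y h(2)] in "simp add: Y.G.minus_eq")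
 qed
 have uc: "u n x : elts Y n" if "x : elts X n" for n x by (rule bhomD(2)[OF closed0_hom[OF u] that])
 have dc: "dMor X Y (- 1) h n x : elts Y n" if "h : Mor X Y (- 1)" "x : elts X n" for h n x
  by (rule dMor_closed[OF X Y that]) simp
 have "(EX k:Mor X Y (- 1). \<forall>n. ALL x:elts X n. w n x = v n x +[grp Y n] dMor X Y (- 1) k n x) \<longleftrightarrow>
    (EX k:Mor X Y (- 1). \<forall>n. ALL x:elts X n. w n x = u n x +[grp Y n] dMor X Y (- 1) k n x)" for w
 proof
  assume "EX k:Mor X Y (- 1). \<forall>n. ALL x:elts X n. w n x = v n x +[grp Y n] dMor X Y (- 1) k n x"
  then obtain k where k: "k : Mor X Y (- 1)" "!!n x. x : elts X n ==> w n x = v n x +[grp Y n] dMor X Y (- 1) k n x" by blast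
  obtain l where l: "l : Mor X Y (- 1)" "!!n x. x : elts X n ==> dMor X Y (- 1) l n x = dMor X Y (- 1) h n x +[grp Y n] dMor X Y (- 1) k n x"
   using add[OF h k(1)] by blast
  show "EX k:Mor X Y (- 1). \<forall>n. ALL x:elts X n. w n x = u n x +[grp Y n] dMor X Y (- 1) k n x"
   by (intro bexI[OF _ l(1)] allI ballI) (simp add: k(2) v l(2) Y.G.a_assoc uc dc[OF h] dc[OF k(1)])
 next
  assume "EX k:Mor X Y (- 1). \<forall>n. ALL x:elts X n. w n x = u n x +[grp Y n] dMor X Y (- 1) k n x"
  then obtain k where k: "k : Mor X Y (- 1)" "!!n x. x : elts X n ==> w n x = u n x +[grp Y n] dMor X Y (- 1) k n x" by blast
  obtain h' where h': "h' : Mor X Y (- 1)" "!!n x. x : elts X n ==> dMor X Y (- 1) h' n x = -[grp Y n] dMor X Y (- 1) h n x" using hz[OF h] by blast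
  obtain l where l: "l : Mor X Y (- 1)" "!!n x. x : elts X n ==> dMor X Y (- 1) l n x = dMor X Y (- 1) h' n x +[grp Y n] dMor X Y (- 1) k n x"
   using add[OF h'(1) k(1)] by blast
  have e: "a +[grp Y n] c = a +[grp Y n] b +[grp Y n] (-[grp Y n] b +[grp Y n] c)"
   if "a : elts Y n" "b : elts Y n" "c : elts Y n" for a b c n
   using Y.G.ag_eq[of "[a, b, c]" n "Pl (V 0) (V 2)" "Pl (Pl (V 0) (V 1)) (Pl (Ng (V 1)) (V 2))"] that by (simp add: less_Suc_eq)
  show "EX k:Mor X Y (- 1). \<forall>n. ALL x:elts X n. w n x = v n x +[grp Y n] dMor X Y (- 1) k n x"
   by (intro bexI[OF _ l(1)] allI ballI) (simp add: k(2) v l(2) h'(2) e[symmetric] uc dc[OF h] dc[OF k(1)])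
 qed
 then show ?thesis unfolding homotopy_class_def by simp
qed

lemma homotopy_class_self:
 assumes X: "dg_object X" and Y: "dg_object Y" and u: "u : closed_mor X Y 0"
 shows "u : homotopy_class X Y u"
proof -
 interpret Y: dgo Q R Y by unfold_locales (rule Y)
 show ?thesis unfolding homotopy_class_def
 proof (intro CollectI conjI u bexI[OF _ zero_mor_Mor(1)[OF X Y]] allI ballI)
  fix n x assume x: "x : elts X n"
  then show "u n x = u n x +[grp Y n] dMor X Y (- 1) (zero_mor X Y (- 1)) n x"
   using zero_mor_Mor(2)[OF X Y x, of "- 1"] bhomD(2)[OF closed0_hom[OF u] x] by simp
 qed
qed

lemma closed_comp:
 assumes X: "dg_object X" and Y: "dg_object Y" and Z: "dg_object Z" and f: "f : closed_mor X Y 0" and g: "g : closed_mor Y Z 0"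
 shows "(%n. \<lambda>x\<in>elts X n. g n (f n x)) : closed_mor X Z 0"
proof -
 interpret X: dgo Q R X by unfold_locales (rule X)
 show ?thesis
 proof (rule closed0I[OF X Z])
  show "(%n. \<lambda>x\<in>elts X n. g n (f n x)) : Mor X Z 0"
   by (rule Mor_comp[OF X Y Z closed_mor_Mor[OF f] closed_mor_Mor[OF g]]) simp_all
  fix n x assume x: "x : elts X n"
  then show "diff Z n ((\<lambda>x\<in>elts X n. g n (f n x)) x) = (\<lambda>x\<in>elts X (n + 1). g (n + 1) (f (n + 1) x)) (diff X n x)"
   using X.diff_cl[OF x refl] closed0_diff[OF X Y f x] closed0_diff[OF Y Z g bhomD(2)[OF closed0_hom[OF f] x]] by simp
 qed
qed

text \<open>The factors are changed one at a time: a homotopy of \<open>g\<close> is composed with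
  f' on the right, then a homotopy of \<open>f\<close> with \<open>g\<close> on the left.\<close>

lemma homotopy_comp:
 assumes X: "dg_object X" and Y: "dg_object Y" and Z: "dg_object Z" and f: "f : closed_mor X Y 0" and g: "g : closed_mor Y Z 0"
  and f': "f' : homotopy_class X Y f" and g': "g' : homotopy_class Y Z g"
 shows "homotopy_class X Z (%n. \<lambda>x\<in>elts X n. g' n (f' n x)) = homotopy_class X Z (%n. \<lambda>x\<in>elts X n. g n (f n x))"
proof -
 interpret X: dgo Q R X by unfold_locales (rule X)
 interpret Y: dgo Q R Y by unfold_locales (rule Y)
 interpret Z: dgo Q R Z by unfold_locales (rule Z)
 note ab = Y.G.ab_ax Z.G.ab_ax
 obtain h where fc': "f' : closed_mor X Y 0" and h: "h : Mor X Y (- 1)" "!!n x. x : elts X n ==> f' n x = f n x +[grp Y n] dMor X Y (- 1) h n x"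
  using f' unfolding homotopy_class_def by blast
 obtain k where k: "k : Mor Y Z (- 1)" "!!n x. x : elts Y n ==> g' n x = g n x +[grp Z n] dMor Y Z (- 1) k n x"
  using g' unfolding homotopy_class_def by blast
 have fc: "f n x : elts Y n" "f' n x : elts Y n" if "x : elts X n" for n x
  using bhomD(2)[OF closed0_hom[OF f] that] bhomD(2)[OF closed0_hom[OF fc'] that] by simp_all
 note gh = closed0_hom[OF g]
 let ?k = "%n. \<lambda>x\<in>elts X n. k n (f' n x)" and ?h = "%n. \<lambda>x\<in>elts X n. g (n - 1) (h n x)"
 have kM: "?k : Mor X Z (- 1)" by (rule Mor_comp[OF X Y Z closed_mor_Mor[OF fc'] k(1)]) simp_all
 have hM: "?h : Mor X Z (- 1)" by (rule Mor_comp[OF X Y Z h(1) closed_mor_Mor[OF g]]) simp_all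
 have "homotopy_class X Z (%n. \<lambda>x\<in>elts X n. g' n (f' n x)) = homotopy_class X Z (%n. \<lambda>x\<in>elts X n. g n (f' n x))"
 proof (rule homotopy_class_cong[OF X Z closed_comp[OF X Y Z fc' g] kM])
  fix n x assume x: "x : elts X n"
  have "dMor X Z (- 1) ?k n x = dMor Y Z (- 1) k n (f' n x)"
   using x X.diff_cl[OF x refl] closed0_diff[OF X Y fc' x] fc(2)[OF x] by (simp add: dMor_def)
  then show "(\<lambda>x\<in>elts X n. g' n (f' n x)) x = (\<lambda>x\<in>elts X n. g n (f' n x)) x +[grp Z n] dMor X Z (- 1) ?k n x"
   using x k(2)[OF fc(2)[OF x]] by simp
 qed
 also have "... = homotopy_class X Z (%n. \<lambda>x\<in>elts X n. g n (f n x))"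
 proof (rule homotopy_class_cong[OF X Z closed_comp[OF X Y Z f g] hM])
  fix n x assume x: "x : elts X n"
  note dx = X.diff_cl[OF x refl]
  have hx: "h n x : elts Y (n - 1)" "h (n + 1) (diff X n x) : elts Y n" using bhomD(2)[OF Mor_closed[OF h(1)] x] bhomD(2)[OF Mor_closed[OF h(1)] dx] by simp_all
  have dh: "diff Y (n - 1) (h n x) : elts Y n" by (rule Y.diff_cl[OF hx(1)]) simp
  have "diff Z (n - 1) (g (n - 1) (h n x)) = g n (diff Y (n - 1) (h n x))" using closed0_diff[OF Y Z g hx(1)] by simp
  then have "dMor X Z (- 1) ?h n x = g n (dMor X Y (- 1) h n x)"
   using x dx hx dh by (simp add: dMor_def am_diff[OF ab bhomD(1)[OF gh]] am_signed[OF ab bhomD(1)[OF gh]])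
  then show "(\<lambda>x\<in>elts X n. g n (f' n x)) x = (\<lambda>x\<in>elts X n. g n (f n x)) x +[grp Z n] dMor X Z (- 1) ?h n x"
   using x h(2)[OF x] fc[OF x] dMor_closed[OF X Y h(1) x, of n] by (simp add: bhomD(3)[OF gh])
 qed
 finally show ?thesis .
qed

text \<open>The union in \<open>Kcomp\<close> runs over all pairs of representatives, but each pair
  gives the same class.\<close>

lemma Kcomp_KHom:
 assumes X: "dg_object X" and Y: "dg_object Y" and Z: "dg_object Z" and F: "F : KHom X Y" and G: "G : KHom Y Z"
 shows "Kcomp X Z G F : KHom X Z"
proof -
 obtain f g where f: "f : closed_mor X Y 0" "F = homotopy_class X Y f" and g: "g : closed_mor Y Z 0" "G = homotopy_class Y Z g"
  using F G by (auto simp: KHom_def)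
 have "Kcomp X Z G F = homotopy_class X Z (%n. \<lambda>x\<in>elts X n. g n (f n x))"
  unfolding Kcomp_def f(2) g(2)
  using homotopy_comp[OF X Y Z f(1) g(1)] homotopy_class_self[OF X Y f(1)] homotopy_class_self[OF Y Z g(1)] by blast
 then show ?thesis using closed_comp[OF X Y Z f(1) g(1)] by (simp add: KHom_def)
qed

lemma Kid_KHom:
 assumes X: "dg_object X" shows "Kid X : KHom X X"
proof -
 interpret X: dgo Q R X by unfold_locales (rule X)
 have "(%n. \<lambda>x\<in>elts X n. x) : closed_mor X X 0"
 proof (rule closed0I[OF X X])
  show "(%n. \<lambda>x\<in>elts X n. x) : Mor X X 0"
   unfolding Mor_def by (auto simp: bimod_hom_def bim_l[OF X.bim] bim_r[OF X.bim] X.lact_cl X.ract_cl X.G.signed_even)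
 qed (simp add: X.diff_cl)
 then show ?thesis unfolding Kid_def KHom_def by (rule imageI)
qed

section \<open>Zigzags and isomorphisms in the derived category\<close>

lemma zigzag_dg: "zigzag X Y w ==> dg_object X & dg_object Y"
 by (induction rule: zigzag.induct) auto

lemma zigzag_append: "zigzag X Y w ==> zigzag Y Z w' ==> zigzag X Z (w @ w')"
 by (induction rule: zigzag.induct) (auto intro: zigzag.intros)

text \<open>Only the rules for identities and compositions demand more than the formation of words:
  identities and composites must be homotopy classes of closed morphisms.\<close>

lemma zigzag_eq_zigzag: "zigzag_eq X Y w w' ==> zigzag X Y w & zigzag X Y w'"
proof (induction rule: zigzag_eq.induct)
 case (ze_cong X' X l Y w w' Y' r)
 then show ?case by (blast intro: zigzag_append)
next
 case (ze_comp X Y Z F G)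
 then show ?case using Kcomp_KHom[OF ze_comp] by (auto intro!: zigzag.intros)
qed (auto intro!: zigzag.intros Kid_KHom simp: Kquasi_iso_def)

text \<open>The morphism is the class of one forward letter, and its inverse that of the backward
  letter with the same homotopy class; they cancel by the defining relations of the
  localization.\<close>

lemma D_iso_of_quasi_iso:
 assumes X: "dg_object X" and Y: "dg_object Y" and s: "quasi_iso X Y s"
 shows "\<exists>ph. D_iso X Y ph"
proof -
 let ?S = "homotopy_class X Y s"
 have sc: "s : closed_mor X Y 0" using s by (simp add: quasi_iso_def)
 have S: "Kquasi_iso X Y ?S" "?S : KHom X Y"
  unfolding Kquasi_iso_def KHom_def using sc s homotopy_class_self[OF X Y sc] by blast+
 let ?f = "[Fwd X ?S Y]" and ?b = "[Bwd Y ?S X]"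
 have zf: "zigzag X Y ?f" by (rule zz_fwd[OF X S(2) zz_nil[OF Y]])
 have zb: "zigzag Y X ?b" by (rule zz_bwd[OF Y S(1) zz_nil[OF X]])
 \<comment> \<open>\<open>Dcomp\<close> collects all words equivalent to a concatenation of
   representatives. By congruence each such concatenation is equivalent to \<open>a @ b\<close>,
   here to the empty word.\<close>
 have comp: "Dcomp A A {w. zigzag_eq B A b w} {w. zigzag_eq A B a w} = Did A"
  if a: "zigzag A B a" and b: "zigzag B A b" and e: "zigzag_eq A A (a @ b) []" for A B a b
 proof -
  have c: "zigzag_eq A A (a @ b) (w1 @ w2)" if w: "zigzag_eq A B a w1" "zigzag_eq B A b w2" for w1 w2
  proof -
   have "zigzag_eq A A ([] @ a @ b) ([] @ w1 @ b)" by (rule ze_cong[OF zz_nil w(1) b]) (use zigzag_dg[OF a] in blast)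
   moreover have "zigzag_eq A A (w1 @ b @ []) (w1 @ w2 @ [])"
    by (rule ze_cong[OF _ w(2) zz_nil]) (use zigzag_dg[OF a] zigzag_eq_zigzag[OF w(1)] in blast)+
   ultimately show ?thesis using ze_trans by simp
  qed
  show ?thesis unfolding Dcomp_def Did_def
  proof (intro Collect_cong iffI)
   fix w assume "EX w1:{w. zigzag_eq A B a w}. EX w2:{w. zigzag_eq B A b w}. zigzag_eq A A (w1 @ w2) w"
   then obtain w1 w2 where "zigzag_eq A B a w1" "zigzag_eq B A b w2" "zigzag_eq A A (w1 @ w2) w" by blast
   then show "zigzag_eq A A [] w" using c e ze_trans ze_sym by blast
  next
   fix w assume "zigzag_eq A A [] w"
   then show "EX w1:{w. zigzag_eq A B a w}. EX w2:{w. zigzag_eq B A b w}. zigzag_eq A A (w1 @ w2) w"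
    using ze_refl[OF a] ze_refl[OF b] ze_trans[OF e] by blast
  qed
 qed
 have "{w. zigzag_eq X Y ?f w} : DHom X Y" "{w. zigzag_eq Y X ?b w} : DHom Y X"
  unfolding DHom_def quotient_def using zf zb by auto
 moreover have "Dcomp X X {w. zigzag_eq Y X ?b w} {w. zigzag_eq X Y ?f w} = Did X"
  by (rule comp[OF zf zb]) (use ze_inv1[OF X Y S(1)] in simp)
 moreover have "Dcomp Y Y {w. zigzag_eq X Y ?f w} {w. zigzag_eq Y X ?b w} = Did Y"
  by (rule comp[OF zb zf]) (use ze_inv2[OF X Y S(1)] in simp)
 ultimately show ?thesis unfolding D_iso_def using X Y by blast
qed

end

section \<open>The mapping cone of the resolution\<close>

definition pgrp :: "('a, 'x) bimod => ('a, 'y) bimod => ('a, 'x \<times> 'y) bimod" where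
 "pgrp M N = \<lparr>carrier = car M \<times> car N, monoid.mult = (%_ _. undefined), one = undefined, ring.zero = (0[M], 0[N]),
   add = (%x y. (fst x +[M] fst y, snd x +[N] snd y)), smult = (%a x. (a *[M] fst x, a *[N] snd x)),
   rsmult = (%x a. (rsmult M (fst x) a, rsmult N (snd x) a))\<rparr>"

lemma pgrp_simps: "car (pgrp M N) = car M \<times> car N" "0[pgrp M N] = (0[M], 0[N])"
 "x +[pgrp M N] y = (fst x +[M] fst y, snd x +[N] snd y)" "a *[pgrp M N] x = (a *[M] fst x, a *[N] snd x)"
 "rsmult (pgrp M N) x a = (rsmult M (fst x) a, rsmult N (snd x) a)"
 by (simp_all add: pgrp_def)

lemma pgrp_abelian:
 assumes "abelian_group M" "abelian_group N" shows "abelian_group (pgrp M N)"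
proof -
 interpret M: abelian_group M by fact
 interpret N: abelian_group N by fact
 show ?thesis
 proof (rule abelian_groupI)
  fix x assume "x : car (pgrp M N)"
  then show "EX y:car (pgrp M N). y +[pgrp M N] x = 0[pgrp M N]"
   by (intro bexI[of _ "(-[M] fst x, -[N] snd x)"]) (auto simp: pgrp_simps M.l_neg N.l_neg)
 qed (auto simp: pgrp_simps M.a_ac N.a_ac)
qed

lemma pgrp_neg:
 assumes M: "abelian_group M" and N: "abelian_group N" and x: "x : car (pgrp M N)"
 shows "-[pgrp M N] x = (-[M] fst x, -[N] snd x)"
proof -
 interpret M: abelian_group M by fact
 interpret N: abelian_group N by fact
 interpret P: abelian_group "pgrp M N" by (rule pgrp_abelian[OF M N])
 show ?thesis by (rule P.minus_equality) (use x in "auto simp: pgrp_simps M.l_neg N.l_neg")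
qed

lemma pgrp_diff:
 assumes M: "abelian_group M" and N: "abelian_group N" and y: "y : car (pgrp M N)"
 shows "x -[pgrp M N] y = (fst x -[M] fst y, snd x -[N] snd y)"
 using pgrp_neg[OF assms] by (simp add: a_minus_def pgrp_simps)

context quadratic_algebra
begin

lemma pgrp_bimodule:
 assumes M: "bimodule M" and N: "bimodule N" shows "bimodule (pgrp M N)"
 using pgrp_abelian[OF bim_ab[OF M] bim_ab[OF N]]
 by (simp add: bimodule_def pgrp_simps bim_l[OF M] bim_r[OF M] bim_l_add[OF M] bim_r_add[OF M] bim_add_l[OF M]
   bim_add_r[OF M] bim_mult_l[OF M] bim_mult_r[OF M] bim_lr[OF M] bim_one[OF M] bim_scal[OF M]
   bim_l[OF N] bim_r[OF N] bim_l_add[OF N] bim_r_add[OF N] bim_add_l[OF N]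
   bim_add_r[OF N] bim_mult_l[OF N] bim_mult_r[OF N] bim_lr[OF N] bim_one[OF N] bim_scal[OF N])

lemma pgrp_hom: "bimod_hom L M h ==> bimod_hom L N k ==> bimod_hom L (pgrp M N) (%x. (h x, k x))"
 and pgrp_fst: "bimod_hom (pgrp M N) M fst"
 and pgrp_snd: "bimod_hom (pgrp M N) N snd"
 by (auto simp: bimod_hom_def pgrp_simps)

lemma bimod_hom_neg: "bimodule N ==> bimod_hom M N h ==> bimod_hom M N (%x. -[N] h x)"
 using bimod_hom_signed[of N M h 1] by (simp add: signed_def)

lemma bimod_hom_add:
 assumes N: "bimodule N" and h: "bimod_hom M N h" and k: "bimod_hom M N k" shows "bimod_hom M N (%x. h x +[N] k x)"
 by (rule bimod_homI[OF am_add_pointwise[OF bim_ab[OF N] bhomD(1)[OF h] bhomD(1)[OF k]]])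
  (simp_all add: bhomD[OF h] bhomD[OF k] bim_l_add[OF N] bim_r_add[OF N])

end

locale resolution = K: dgo Q R K + P: dgo Q R P
 for Q :: "('v, 'e) pre_digraph" and R :: "('v, 'e, 'f::field) tens set" and K :: "('v, 'e, 'f, 'u) qobj" and P :: "('v, 'e, 'f, 'u) qobj" +
 fixes pi :: "int => 'u => 'u"
 assumes qi: "K.quasi_iso P K pi"
begin

lemma pi_closed: "pi : K.closed_mor P K 0"
 using qi by (simp add: K.quasi_iso_def)

lemma pi_hom: "K.bimod_hom (grp P n) (grp K n) (pi n)"
 by (rule K.closed0_hom[OF pi_closed])

lemma pi_diff: "x : elts P n ==> m = n + 1 ==> diff K n (pi n x) = pi m (diff P n x)"
 using K.closed0_diff[OF P.dg K.dg pi_closed] by simp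

lemma pi_cl: "x : elts P n ==> pi n x : elts K n"
 by (rule K.bhomD(2)[OF pi_hom])

text \<open>Degree n pairs P in degree n + 1 with K in degree n; because of this shift
  \<open>cone_diff\<close> carries a minus sign on the differential of P.\<close>

definition cone_grp where "cone_grp n = pgrp (grp P (n + 1)) (grp K n)"

definition cone_diff where
 "cone_diff n = (%x. (-[grp P (n + 2)] diff P (n + 1) (fst x), pi (n + 1) (fst x) +[grp K (n + 1)] diff K n (snd x)))"

lemma cone_hom: "K.bimod_hom (cone_grp n) (cone_grp (n + 1)) (cone_diff n)"
 unfolding cone_grp_def cone_diff_def
 by (rule K.pgrp_hom, simp add: add.assoc, intro K.bimod_hom_neg P.bim K.bimod_hom_comp[OF K.pgrp_fst P.diff_bim], simp,
   intro K.bimod_hom_add K.bim K.bimod_hom_comp[OF K.pgrp_fst pi_hom] K.bimod_hom_comp[OF K.pgrp_snd K.diff_bim[OF refl]])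

lemma P_addd: "x : elts P n ==> m = n + 1 ==> diff P n (-[grp P n] x) = -[grp P m] diff P n x"
 by (rule addmap_neg[OF P.G.ab_ax P.G.ab_ax K.bhomD(1)[OF P.diff_bim]])

lemma pi_neg: "x : elts P n ==> pi n (-[grp P n] x) = -[grp K n] pi n x"
 by (rule addmap_neg[OF P.G.ab_ax K.G.ab_ax K.bhomD(1)[OF pi_hom]])

lemma cone_bcx: "bcx Q R cone_grp cone_diff"
proof (unfold_locales)
 show "K.bimodule (cone_grp n)" for n unfolding cone_grp_def by (rule K.pgrp_bimodule[OF P.bim K.bim])
 show "K.bimod_hom (cone_grp n) (cone_grp (n + 1)) (cone_diff n)" for n by (rule cone_hom)
 fix n x assume "x : car (cone_grp n)"
 then obtain p k where x: "x = (p, k)" "p : elts P (n + 1)" "k : elts K n" by (auto simp: cone_grp_def pgrp_simps)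
 have dp: "diff P (n + 1) p : elts P (n + 2)" by (rule P.diff_cl[OF x(2)]) simp
 have z: "diff P (n + 2) (diff P (n + 1) p) = 0[grp P (n + 3)]" by (rule P.diff_diff[OF x(2)]) simp_all
 have 1: "diff P (n + 2) (-[grp P (n + 2)] diff P (n + 1) p) = -[grp P (n + 3)] 0[grp P (n + 3)]" using P_addd[OF dp, of "n + 3"] z by simp
 have 2: "pi (n + 2) (-[grp P (n + 2)] diff P (n + 1) p) = -[grp K (n + 2)] pi (n + 2) (diff P (n + 1) p)" by (rule pi_neg[OF dp])
 have 3: "diff K (n + 1) (pi (n + 1) p +[grp K (n + 1)] diff K n k) = pi (n + 2) (diff P (n + 1) p) +[grp K (n + 2)] 0[grp K (n + 2)]"
  using K.bhomD(3)[OF K.diff_bim pi_cl[OF x(2)] K.diff_cl[OF x(3) refl], of "n + 2"] pi_diff[OF x(2), of "n + 2"] K.diff_diff[OF x(3) refl refl] by simp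
 have nz: "-[grp P m] 0[grp P m] = 0[grp P m]" for m using P.G.ag_eq[of "[]" m "Ng Zr" Zr] by simp
 have i: "n + 1 + 1 = n + 2" "n + 1 + 2 = n + 3" "n + 2 + 1 = n + 3" by simp_all
 show "cone_diff (n + 1) (cone_diff n x) = 0[cone_grp (n + 2)]"
  unfolding cone_diff_def cone_grp_def pgrp_simps x(1) fst_conv snd_conv i 1 2 3 nz
  using pi_cl[OF dp] K.G.l_neg by simp
qed

text \<open>For a cocycle (p, k), the element \<open>p\<close> is a cocycle whose image is a
  coboundary, so p = d p1 by injectivity on cohomology. Then k + pi p1 is a cocycle, hence pi c + d
  k' by surjectivity, and (c - p1, k') is mapped to (p, k).\<close>

lemma cone_exact: "bcx.exact cone_grp cone_diff"
 unfolding bcx.exact_def[OF cone_bcx]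
proof (intro allI ballI impI)
 have Q: "(ALL x:K.cocycles P n. pi n x : K.coboundaries K n --> x : K.coboundaries P n) &
  (ALL y:K.cocycles K n. EX x:K.cocycles P n. y -[grp K n] pi n x : K.coboundaries K n)" for n
  using K.quasi_iso_iff[OF P.dg K.dg pi_closed] qi by blast
 fix n x assume "x : car (cone_grp n)" and d: "cone_diff n x = 0[cone_grp (n + 1)]"
 then obtain p k where x: "x = (p, k)" "p : elts P (n + 1)" "k : elts K n" by (auto simp: cone_grp_def pgrp_simps)
 have dp: "diff P (n + 1) p : elts P (n + 2)" by (rule P.diff_cl[OF x(2)]) simp
 note dk = K.diff_cl[OF x(3) refl] and pip = pi_cl[OF x(2)]
 have "-[grp P (n + 2)] diff P (n + 1) p = 0[grp P (n + 2)]" and s: "pi (n + 1) p +[grp K (n + 1)] diff K n k = 0[grp K (n + 1)]"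
  using d by (simp_all add: cone_diff_def cone_grp_def pgrp_simps x(1) add.assoc)
 then have "diff P (n + 1) p = 0[grp P (n + 2)]"
  using P.G.ag_eq[of "[diff P (n + 1) p]" "n + 2" "Ng (Ng (V 0))" "V 0"] P.G.ag_eq[of "[]" "n + 2" "Ng Zr" Zr] dp by simp
 then have pc: "p : K.cocycles P (n + 1)" using x(2) by (simp add: K.cocycles_def add.assoc)
 have "pi (n + 1) p = diff K n (-[grp K n] k)"
  using addmap_neg[OF K.G.ab_ax K.G.ab_ax K.bhomD(1)[OF K.diff_bim[OF refl]] x(3)] s
   K.G.ag_eq[of "[pi (n + 1) p, diff K n k]" "n + 1" "V 0" "Pl (Pl (V 0) (V 1)) (Ng (V 1))"] pip dk by (simp add: less_Suc_eq)
 then have "pi (n + 1) p : K.coboundaries K (n + 1)" using x(3) by (simp add: K.coboundaries_def)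
 then have "p : K.coboundaries P (n + 1)" using Q pc by blast
 then obtain p1 where p1: "p1 : elts P n" "p = diff P n p1" by (auto simp: K.coboundaries_def)
 note pip1 = pi_cl[OF p1(1)]
 have kc: "k +[grp K n] pi n p1 : K.cocycles K n"
  unfolding K.cocycles_def using x(3) pip1 K.bhomD(3)[OF K.diff_bim[OF refl] x(3) pip1] pi_diff[OF p1(1) refl] s pip dk
  by (simp add: p1(2)[symmetric] K.G.a_comm)
 then obtain c where c: "c : K.cocycles P n" "(k +[grp K n] pi n p1) -[grp K n] pi n c : K.coboundaries K n" using Q by blast
 then obtain k' where k': "k' : elts K (n - 1)" "(k +[grp K n] pi n p1) -[grp K n] pi n c = diff K (n - 1) k'" by (auto simp: K.coboundaries_def)
 have cc: "c : elts P n" "diff P n c = 0[grp P (n + 1)]" using c(1) by (simp_all add: K.cocycles_def)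
 note pic = pi_cl[OF cc(1)]
 let ?q = "c -[grp P n] p1"
 have q: "?q : elts P n" using cc p1 by simp
 have dq: "diff P n ?q = 0[grp P (n + 1)] -[grp P (n + 1)] p"
  using am_diff[OF P.G.ab_ax P.G.ab_ax K.bhomD(1)[OF P.diff_bim[OF refl]] cc(1) p1(1)] cc(2) p1(2) by simp
 have piq: "pi n ?q = pi n c -[grp K n] pi n p1"
  by (rule am_diff[OF P.G.ab_ax K.G.ab_ax K.bhomD(1)[OF pi_hom] cc(1) p1(1)])
 have 1: "-[grp P (n + 1)] diff P n ?q = p" unfolding dq
  using P.G.ag_eq[of "[p]" "n + 1" "Ng (Mi Zr (V 0))" "V 0"] x(2) by simp
 have e1: "-[grp P (1 + n)] diff P n ?q = p" using 1 by (simp add: add.commute)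
 have 2: "pi n ?q +[grp K n] diff K (n - 1) k' = k" unfolding piq k'(2)[symmetric]
  using K.G.ag_eq[of "[pi n c, pi n p1, k]" n "Pl (Mi (V 0) (V 1)) (Mi (Pl (V 2) (V 1)) (V 0))" "V 2"] pic pip1 x(3) by (simp add: less_Suc_eq)
 show "EX y:car (cone_grp (n - 1)). cone_diff (n - 1) y = x"
  by (rule bexI[of _ "(?q, k')"]) (simp_all add: cone_diff_def cone_grp_def pgrp_simps x(1) q k'(1) e1 2)
qed

end

section \<open>Splitting the resolution over bimodules\<close>

context resolution
begin

lemma cone_grp_eq: "a = m + 1 ==> cone_grp m = pgrp (grp P a) (grp K m)"
 by (simp add: cone_grp_def)

lemma cone_diff_eq: "a = m + 1 ==> b = m + 2 ==>
  cone_diff m x = (-[grp P b] diff P a (fst x), pi a (fst x) +[grp K a] diff K m (snd x))"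
 by (simp add: cone_diff_def)

text \<open>A null-homotopy of x \<mapsto> (0, x) into the cone has a component
  \<open>\<sigma>\<close> into P and a component \<open>\<theta>\<close> into K; its equation says
  that \<open>\<sigma>\<close> commutes with the differentials and that pi \<sigma> is homotopic to
  the identity through \<open>\<theta>\<close>. Consequently 1 - \<sigma> pi becomes null-homotopic
  after pi, so with \<open>\<theta>\<close> it lifts to a cocycle of maps from P into the cone. This
  cocycle is bounded, and the first component of the bounding map is \<open>v\<close>.\<close>

lemma splitting:
 fixes \<iota> :: "('v, 'e, 'f) koszul_chain => 'u" and fam :: "(('v, 'e, 'f) koszul_chain => 'u) => 'u"
 assumes i: "inj \<iota>" and fam: "inj fam" and Kt: "K = transport \<iota> K.koszul_complex" and Kp: "K.K_projective P"
 obtains \<sigma> \<theta> v where "!!n. K.bimod_hom (grp K n) (grp P n) (\<sigma> n)"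
  "!!n m x. x : elts K n ==> m = n + 1 ==> diff P n (\<sigma> n x) = \<sigma> m (diff K n x)"
  "!!n m. m = n - 1 ==> K.bimod_hom (grp K n) (grp K m) (\<theta> n)"
  "!!n m k x. x : elts K n ==> m = n - 1 ==> k = n + 1 ==> pi n (\<sigma> n x) +[grp K n] diff K m (\<theta> n x) +[grp K n] \<theta> k (diff K n x) = x"
  "!!n m. m = n - 1 ==> K.bimod_hom (grp P n) (grp P m) (v n)"
  "!!n m k x. x : elts P n ==> m = n - 1 ==> k = n + 1 ==>
    x -[grp P n] \<sigma> n (pi n x) = -[grp P n] diff P m (v n x) -[grp P n] v k (diff P n x)"
proof -
 interpret N: bcx Q R cone_grp cone_diff by (rule cone_bcx)
 let ?j = "inv_into UNIV \<iota>"
 \<comment> \<open>K is a transported copy, so maps on it are obtained from maps on the Koszul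
   complex through \<open>\<iota>\<close> and its inverse.\<close>
 have Kg: "grp K n = tgrp \<iota> (K.kos_grp n)" for n by (simp add: Kt tr_simps K.koszul_simps)
 have Kd: "diff K n (\<iota> x) = \<iota> (K.kos_diff n x)" for n x by (simp add: Kt tr_simps i K.koszul_simps)
 have ih: "K.bimod_hom (K.kos_grp n) (grp K n) \<iota>" and jh: "K.bimod_hom (grp K n) (K.kos_grp n) ?j" for n
  unfolding Kg by (rule K.tgrp_iota_hom[OF i])+
 have Kj: "EX y:car (K.kos_grp n). x = \<iota> y" if "x : elts K n" for n x using that by (auto simp: Kg tgrp_simps)
 have zh: "K.bimod_hom (K.kos_grp n) (grp P m) (%_. 0[grp P m])" for n m by (simp add: K.bimod_hom_def K.bim_zero[OF P.bim])
 have dz: "diff P n 0[grp P n] = 0[grp P m]" if "m = n + 1" for n m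
  by (rule am_zero[OF P.G.ab_ax P.G.ab_ax K.bhomD(1)[OF P.diff_bim[OF that]]])
 have pz: "pi n 0[grp P n] = 0[grp K n]" for n
  by (rule am_zero[OF P.G.ab_ax K.G.ab_ax K.bhomD(1)[OF pi_hom]])
 have nz: "-[grp P m] 0[grp P m] = 0[grp P m]" for m using P.G.ag_eq[of "[]" m "Ng Zr" Zr] by simp
 let ?u = "%n x. (0[grp P (n + 1)], \<iota> x)"
 have uh: "K.bimod_hom (K.kos_grp n) (cone_grp n) (?u n)" for n unfolding cone_grp_def by (rule K.pgrp_hom[OF zh ih])
 have ud: "cone_diff n (?u n x) = ?u (n + 1) (K.kos_diff n x)" if x: "x : car (K.kos_grp n)" for n x
  using K.bhomD(2)[OF ih K.bhomD(2)[OF K.kos_diff_hom[OF refl] x]] dz[of "n + 2" "n + 1"] pz[of "n + 1"] nz[of "n + 2"]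
  by (simp add: cone_diff_def Kd add.assoc)
 obtain h where h: "!!n m. m = n - 1 ==> K.bimod_hom (K.kos_grp n) (cone_grp m) (h n)"
  and hd: "!!n m k x. x : car (K.kos_grp n) ==> m = n - 1 ==> k = n + 1 ==> cone_diff m (h n x) +[cone_grp n] h k (K.kos_diff n x) = ?u n x"
  by (rule N.kos_null[OF cone_exact, of ?u]) (rule uh, rule ud, assumption, rule that)
 define \<sigma> \<theta> where st: "\<sigma> n x = fst (h n (?j x))" "\<theta> n x = snd (h n (?j x))" for n x
 have hh: "K.bimod_hom (grp K n) (pgrp (grp P n) (grp K m)) (%x. h n (?j x))" if "m = n - 1" for n m
  using K.bimod_hom_comp[OF jh h[OF that]] cone_grp_eq[of n m] that by simp
 have sh: "K.bimod_hom (grp K n) (grp P n) (\<sigma> n)" for n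
  using K.bimod_hom_comp[OF hh[OF refl] K.pgrp_fst] by (simp add: st[abs_def])
 have th: "K.bimod_hom (grp K n) (grp K m) (\<theta> n)" if "m = n - 1" for n m
  using K.bimod_hom_comp[OF hh[OF that] K.pgrp_snd] by (simp add: st[abs_def])
 note sc = K.bhomD(2)[OF sh] and tc = K.bhomD(2)[OF th]
 have eq: "-[grp P (n + 1)] diff P n (\<sigma> n x) +[grp P (n + 1)] \<sigma> (n + 1) (diff K n x) = 0[grp P (n + 1)]"
  "pi n (\<sigma> n x) +[grp K n] diff K (n - 1) (\<theta> n x) +[grp K n] \<theta> (n + 1) (diff K n x) = x" if x: "x : elts K n" for n x
 proof -
  obtain y where y: "y : car (K.kos_grp n)" "x = \<iota> y" using Kj[OF x] by blast
  have jx: "?j x = y" "?j (diff K n x) = K.kos_diff n y" using i by (simp_all add: y(2) Kd)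
  have a: "n = n - 1 + 1" "n + 1 = n - 1 + 2" by simp_all
  from hd[OF y(1) refl refl] show "-[grp P (n + 1)] diff P n (\<sigma> n x) +[grp P (n + 1)] \<sigma> (n + 1) (diff K n x) = 0[grp P (n + 1)]"
   "pi n (\<sigma> n x) +[grp K n] diff K (n - 1) (\<theta> n x) +[grp K n] \<theta> (n + 1) (diff K n x) = x"
   unfolding cone_diff_eq[OF a] cone_grp_eq[OF refl] st jx by (simp_all add: pgrp_simps y(2))
 qed
 have sd: "diff P n (\<sigma> n x) = \<sigma> m (diff K n x)" if x: "x : elts K n" and m: "m = n + 1" for n m x
  using eq(1)[OF x] P.G.ag_eq[of "[diff P n (\<sigma> n x), \<sigma> (n + 1) (diff K n x)]" "n + 1" "Pl (V 0) (Pl (Ng (V 0)) (V 1))" "V 1"]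
   P.diff_cl[OF sc[OF x] refl] sc[OF K.diff_cl[OF x refl]] by (simp add: m less_Suc_eq)
 have tpc: "\<theta> n x : elts K m" if "x : elts K n" "m = n - 1" for n m x using tc[OF that(2,1)] .
 have st_eq: "pi n (\<sigma> n x) +[grp K n] diff K m (\<theta> n x) +[grp K n] \<theta> k (diff K n x) = x"
  if "x : elts K n" "m = n - 1" "k = n + 1" for n m k x using eq(2)[OF that(1)] that by simp
 \<comment> \<open>A map of degree -1, since degree n - 1 of the cone contains P in degree n. The
   second component and its sign come from pi (x - \<sigma> pi x) = d \<theta> pi x + \<theta> pi d
   x.\<close>
 let ?w = "%n x. (x -[grp P n] \<sigma> n (pi n x), -[grp K (n - 1)] \<theta> n (pi n x))"
 have idh: "K.bimod_hom (grp P n) (grp P n) (%x. x)" for n by (simp add: K.bimod_hom_def)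
 have w: "K.bimod_hom (grp P n) (cone_grp m) (?w n)" if "m = n + (- 1)" for n m
 proof -
  have a: "n = m + 1" "m = n - 1" using that by simp_all
  have cg: "cone_grp m = pgrp (grp P n) (grp K (n - 1))" using cone_grp_eq[OF a(1)] a(2) by simp
  show ?thesis unfolding cg
   by (intro K.pgrp_hom K.bimod_hom_minus[OF P.bim idh K.bimod_hom_comp[OF pi_hom sh]] K.bimod_hom_neg[OF K.bim K.bimod_hom_comp[OF pi_hom th[OF refl]]])
 qed
 have wd: "cone_diff m (?w n x) = signed (cone_grp l) (- 1) (?w (n + 1) (diff P n x))"
  if x: "x : elts P n" and m: "m = n + (- 1)" and l: "l = n + (- 1) + 1" for n m l x
 proof -
  have ln: "l = n" "m = n - 1" using m l by simp_all
  note dx = P.diff_cl[OF x refl] and px = pi_cl[OF x]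
  have spx: "\<sigma> n (pi n x) : elts P n" by (rule sc[OF px])
  have tpx: "\<theta> n (pi n x) : elts K (n - 1)" by (rule tpc[OF px refl])
  have dtpx: "diff K (n - 1) (\<theta> n (pi n x)) : elts K n" by (rule K.diff_cl[OF tpx]) simp
  have pdx: "diff K n (pi n x) = pi (n + 1) (diff P n x)" by (rule pi_diff[OF x refl])
  have tdx: "\<theta> (n + 1) (pi (n + 1) (diff P n x)) : elts K n" by (rule tpc[OF pi_cl[OF dx]]) simp
  have 1: "diff P n (x -[grp P n] \<sigma> n (pi n x)) = diff P n x -[grp P (n + 1)] \<sigma> (n + 1) (pi (n + 1) (diff P n x))"
   using am_diff[OF P.G.ab_ax P.G.ab_ax K.bhomD(1)[OF P.diff_bim[OF refl]] x spx] sd[OF px refl] pdx by simp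
  have 2: "pi n (x -[grp P n] \<sigma> n (pi n x)) = pi n x -[grp K n] pi n (\<sigma> n (pi n x))"
   by (rule am_diff[OF P.G.ab_ax K.G.ab_ax K.bhomD(1)[OF pi_hom] x spx])
  have 3: "diff K (n - 1) (-[grp K (n - 1)] \<theta> n (pi n x)) = -[grp K n] diff K (n - 1) (\<theta> n (pi n x))"
   by (rule addmap_neg[OF K.G.ab_ax K.G.ab_ax K.bhomD(1)[OF K.diff_bim] tpx]) simp
  have 4: "pi n x -[grp K n] pi n (\<sigma> n (pi n x)) +[grp K n] (-[grp K n] diff K (n - 1) (\<theta> n (pi n x))) = -[grp K n] (-[grp K n] \<theta> (n + 1) (pi (n + 1) (diff P n x)))"
   using st_eq[OF px refl refl] pdx K.G.ag_eq[of "[pi n (\<sigma> n (pi n x)), diff K (n - 1) (\<theta> n (pi n x)), \<theta> (n + 1) (pi (n + 1) (diff P n x))]" n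
    "Pl (Mi (Pl (Pl (V 0) (V 1)) (V 2)) (V 0)) (Ng (V 1))" "Ng (Ng (V 2))"] pi_cl[OF spx] dtpx tdx by (simp add: less_Suc_eq)
  have wc: "?w (n + 1) (diff P n x) : car (pgrp (grp P (n + 1)) (grp K n))"
   using dx sc[OF pi_cl[OF dx]] tdx by (simp add: pgrp_simps)
  have a: "n = n - 1 + 1" "n + 1 = n - 1 + 2" by simp_all
  have s: "signed G (- 1) y = -[G] y" for G :: "(('v, 'e, 'f) qalg, 'u \<times> 'u) bimod" and y by (simp add: signed_def)
  have n1: "n + 1 - 1 = n" by simp
  show ?thesis unfolding ln
   unfolding cone_diff_eq[OF a] s cone_grp_eq[OF refl] pgrp_neg[OF P.G.ab_ax K.G.ab_ax wc[unfolded n1]] fst_conv snd_conv 1 2 3 4 n1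
   by (rule refl)
 qed
 \<comment> \<open>The cone has its entries in \<open>'u \<times> 'u\<close>, so its coinduced
   object consists of families of pairs, which must be encoded before the K-projectivity of P can be
   applied.\<close>
 obtain E :: "(nat \<times> nat \<times> ('v, 'e, 'f) koszul_cochain \<times> ('v, 'e, 'f) koszul_cochain => 'u \<times> 'u) => 'u" where E: "inj E"
  using universe_code[OF fam] by blast
 obtain V where V: "!!n m. m = n + (- 1) - 1 ==> K.bimod_hom (grp P n) (cone_grp m) (V n)"
  and Vd: "!!n m l x. x : elts P n ==> m = n + (- 1) - 1 ==> l = n + (- 1) ==>
   ?w n x = cone_diff m (V n x) -[cone_grp l] signed (cone_grp l) (- 1 - 1) (V (n + 1) (diff P n x))"
  by (rule N.K_projective_bounding[OF P.dg Kp cone_exact E, of "- 1" ?w]) (rule w, assumption, rule wd, assumption+, rule that)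
 have Vh: "K.bimod_hom (grp P n) (pgrp (grp P m) (grp K (n - 2))) (V n)" if "m = n - 1" for n m
  using V[of "n - 2" n] cone_grp_eq[of m "n - 2"] that by simp
 show thesis
 proof (rule that[of \<sigma> \<theta> "%n x. fst (V n x)"])
  show "K.bimod_hom (grp P n) (grp P m) (%x. fst (V n x))" if "m = n - 1" for n m
   by (rule K.bimod_hom_comp[OF Vh[OF that] K.pgrp_fst])
  fix n m k x assume x: "x : elts P n" and m: "m = n - 1" and k: "k = n + 1"
  note dx = P.diff_cl[OF x k]
  have a: "n - 1 = n - 2 + 1" "n = n - 2 + 2" "n = n - 1 + 1" by simp_all
  have Vc: "V k (diff P n x) : car (pgrp (grp P n) (grp K (n - 1)))"
   using K.bhomD(2)[OF Vh[of n k] dx] k by simp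
  have s: "signed G (- 1 - 1) y = y" for G :: "(('v, 'e, 'f) qalg, 'u \<times> 'u) bimod" and y by (simp add: signed_def)
  have e: "?w n x = cone_diff (n - 2) (V n x) -[cone_grp (n - 1)] V k (diff P n x)"
   unfolding k by (rule Vd[OF x, of "n - 2" "n - 1", unfolded s]) simp_all
  have "fst (?w n x) = -[grp P n] diff P (n - 1) (fst (V n x)) -[grp P n] fst (V k (diff P n x))"
   unfolding e cone_grp_eq[OF a(3)] cone_diff_eq[OF a(1,2)] pgrp_diff[OF P.G.ab_ax K.G.ab_ax Vc] fst_conv by (rule refl)
  then show "x -[grp P n] \<sigma> n (pi n x) = -[grp P n] diff P m (fst (V n x)) -[grp P n] fst (V k (diff P n x))"
   by (simp add: m)
 qed (rule sh sd th st_eq; assumption)+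
qed

section \<open>Precomposition with the resolution on the duals\<close>

lemma dual_pull_pi:
 assumes C: "K.dg_object C" and D: "K.dg_object D" and u: "u : car (K.dual_grp C n)" and t: "K.bimod_hom (grp D (- n')) (grp C (- n)) t"
 shows "(\<lambda>x\<in>elts D (- n'). signed K.env k (u (t x))) : car (K.dual_grp D n')"
proof -
 interpret C: dgo Q R C by unfold_locales (rule C)
 interpret D: dgo Q R D by unfold_locales (rule D)
 note tD = K.bhomD[OF t]
 show ?thesis
  by (rule D.dual_memI) (simp_all add: C.dual_cl[OF u] tD am_add[OF C.dual_addmap[OF u]] K.N.signed_add C.dual_equiv[OF u]
    K.signed_env_mult K.bim_l[OF C.bim] K.bim_l[OF D.bim])
qed

definition dual_pi where
 "dual_pi n = (\<lambda>u\<in>car (K.dual_grp K n). \<lambda>x\<in>elts P (- n). u (pi (- n) x))"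

lemma dual_pi_eval: "u : car (K.dual_grp K n) ==> m = - n ==> x : elts P m ==> dual_pi n u x = u (pi m x)"
 by (simp add: dual_pi_def)

lemma dual_pi_in: "u : car (K.dual_grp K n) ==> dual_pi n u : car (K.dual_grp P n)"
 using dual_pull_pi[OF K.dg P.dg _ pi_hom, of u n 0] by (simp add: dual_pi_def K.N.signed_even)

text \<open>As a closed morphism of degree 0, \<open>pi\<close> commutes with the differentials and
  with both actions without signs, and the operations on the duals are precompositions with
  these.\<close>

lemma dual_pi_closed: "dual_pi : K.closed_mor (K.Hom_Ae K) (K.Hom_Ae P) 0"
proof (rule K.closed0I[OF K.dg_object_Hom_Ae P.dg_object_Hom_Ae])
 interpret HK: dgo Q R "K.Hom_Ae K" by unfold_locales (rule K.dg_object_Hom_Ae)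
 interpret HP: dgo Q R "K.Hom_Ae P" by unfold_locales (rule P.dg_object_Hom_Ae)
 show "dual_pi : K.Mor (K.Hom_Ae K) (K.Hom_Ae P) 0"
  unfolding K.Mor_def K.Hom_simps(1) P.Hom_simps(1)
 proof (intro CollectI conjI allI ballI)
  fix n show "dual_pi n : extensional (car (K.dual_grp K n))" by (simp add: dual_pi_def)
  have "K.bimod_hom (K.dual_grp K n) (K.dual_grp P n) (dual_pi n)"
  proof (rule K.bimod_homI[OF addmapI])
   fix u assume u: "u : car (K.dual_grp K n)"
   show "dual_pi n u : car (K.dual_grp P n)" by (rule dual_pi_in[OF u])
   fix v assume v: "v : car (K.dual_grp K n)"
   note uv = K.dual_add_closed[OF u v]
   show "dual_pi n (u +[K.dual_grp K n] v) = dual_pi n u +[K.dual_grp P n] dual_pi n v"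
    unfolding P.dual_ops dual_pi_def restrict_apply'[OF uv]
    by (rule rext) (simp add: K.dual_ops pi_cl u v)
  next
   fix a u assume a: "a : car K.alg" and u: "u : car (K.dual_grp K n)"
   note l = K.bim_l[OF K.dual_bimodule a u] and r = K.bim_r[OF K.dual_bimodule a u]
   show "dual_pi n (a *[K.dual_grp K n] u) = a *[K.dual_grp P n] dual_pi n u"
    unfolding P.dual_ops dual_pi_def restrict_apply'[OF l] by (rule rext) (simp add: K.dual_ops pi_cl u)
   show "dual_pi n (rsmult (K.dual_grp K n) u a) = rsmult (K.dual_grp P n) (dual_pi n u) a"
    unfolding P.dual_ops dual_pi_def restrict_apply'[OF r] by (rule rext) (simp add: K.dual_ops pi_cl u)
  qed
  then show "K.bimod_hom (K.dual_grp K n) (K.dual_grp P (n + 0)) (dual_pi n)" by simp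
  fix p f u assume f: "f : K.cochains p" and u: "u : car (K.dual_grp K n)"
  let ?m = "- (n + int p)"
  have lu: "lact (K.Hom_Ae K) p n f u : car (K.dual_grp K (n + int p))" "ract (K.Hom_Ae K) p n u f : car (K.dual_grp K (n + int p))"
   using HK.lact_cl[OF f _ refl, of u n] HK.ract_cl[OF f _ refl, of u n] u unfolding K.Hom_simps(1) by simp_all
  have pl: "pi (- n) (lact P p ?m f x) = lact K p ?m f (pi ?m x)" "pi (- n) (ract P p ?m x f) = ract K p ?m (pi ?m x) f" if x: "x : elts P ?m" for x
   using K.Mor_lact[OF K.closed_mor_Mor[OF pi_closed] f x] K.Mor_ract[OF K.closed_mor_Mor[OF pi_closed] f x] by (simp_all add: K.G.signed_even)
  have "dual_pi (n + int p) (lact (K.Hom_Ae K) p n f u) = lact (K.Hom_Ae P) p n f (dual_pi n u)"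
   unfolding P.Hom_simps dual_pi_def restrict_apply'[OF lu(1)]
  proof (rule rext)
   fix x assume x: "x : elts P ?m"
   have rx: "ract P p ?m x f : elts P (- n)" by (rule P.ract_cl[OF f x]) simp
   show "lact (K.Hom_Ae K) p n f u (pi ?m x) = signed K.env (int p) ((\<lambda>u\<in>car (K.dual_grp K n). \<lambda>x\<in>elts P (- n). u (pi (- n) x)) u (ract P p ?m x f))"
    using x rx u pi_cl[OF x] by (simp add: K.Hom_simps pl[OF x, simplified])
  qed
  moreover have "lact (K.Hom_Ae P) p n f (dual_pi n u) : car (K.dual_grp P (n + int p))"
   using HP.lact_cl[OF f _ refl, of "dual_pi n u" n] dual_pi_in[OF u] unfolding P.Hom_simps(1) by simp
  ultimately show "dual_pi (n + int p) (lact (K.Hom_Ae K) p n f u) = signed (K.dual_grp P (n + 0 + int p)) (0 * int p) (lact (K.Hom_Ae P) p (n + 0) f (dual_pi n u))"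
   by (simp add: signed_def)
  have "dual_pi (n + int p) (ract (K.Hom_Ae K) p n u f) = ract (K.Hom_Ae P) p n (dual_pi n u) f"
   unfolding P.Hom_simps dual_pi_def restrict_apply'[OF lu(2)]
  proof (rule rext)
   fix x assume x: "x : elts P ?m"
   have rx: "lact P p ?m f x : elts P (- n)" by (rule P.lact_cl[OF f x]) simp
   show "ract (K.Hom_Ae K) p n u f (pi ?m x) = (\<lambda>u\<in>car (K.dual_grp K n). \<lambda>x\<in>elts P (- n). u (pi (- n) x)) u (lact P p ?m f x)"
    using x rx u pi_cl[OF x] by (simp add: K.Hom_simps pl[OF x, simplified])
  qed
  then show "dual_pi (n + int p) (ract (K.Hom_Ae K) p n u f) = ract (K.Hom_Ae P) p (n + 0) (dual_pi n u) f" by simp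
 qed
 fix n u assume "u : elts (K.Hom_Ae K) n"
 then have u: "u : car (K.dual_grp K n)" by (simp add: K.Hom_simps)
 let ?m = "- (n + 1)"
 have du: "diff (K.Hom_Ae K) n u : car (K.dual_grp K (n + 1))"
  using HK.diff_cl[OF _ refl, of u n] u unfolding K.Hom_simps(1) by simp
 show "diff (K.Hom_Ae P) n (dual_pi n u) = dual_pi (n + 1) (diff (K.Hom_Ae K) n u)"
  unfolding P.Hom_diff[OF dual_pi_in[OF u]] unfolding dual_pi_def restrict_apply'[OF du]
 proof (rule rext)
  fix x assume x: "x : elts P ?m"
  have dx: "diff P ?m x : elts P (- n)" by (rule P.diff_cl[OF x]) simp
  show "signed K.env (n + 1) ((\<lambda>u\<in>car (K.dual_grp K n). \<lambda>x\<in>elts P (- n). u (pi (- n) x)) u (diff P ?m x)) = diff (K.Hom_Ae K) n u (pi ?m x)"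
   using x dx u pi_cl[OF x] pi_diff[OF x, of "- n"] by (simp add: K.Hom_diff[OF u])
 qed
qed

text \<open>Injectivity: for a cocycle u one has u d = 0 and hence u = u pi \<sigma> + u \<theta> d,
  where u pi is bounded by some w; thus u is bounded by w \<sigma> and u \<theta>. Surjectivity: a
  cocycle y is cohomologous to y \<sigma> pi, since y - y \<sigma> pi = - y v d.\<close>

lemma quasi_iso_dual_pi:
 fixes \<iota> :: "('v, 'e, 'f) koszul_chain => 'u" and fam :: "(('v, 'e, 'f) koszul_chain => 'u) => 'u"
 assumes i: "inj \<iota>" and fam: "inj fam" and Kt: "K = transport \<iota> K.koszul_complex" and Kp: "K.K_projective P"
 shows "K.quasi_iso (K.Hom_Ae K) (K.Hom_Ae P) dual_pi"
proof (rule splitting[OF i fam Kt Kp])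
 fix \<sigma> \<theta> v assume sh: "!!n. K.bimod_hom (grp K n) (grp P n) (\<sigma> n)"
  and sd: "!!n m x. x : elts K n ==> m = n + 1 ==> diff P n (\<sigma> n x) = \<sigma> m (diff K n x)"
  and th: "!!n m. m = n - 1 ==> K.bimod_hom (grp K n) (grp K m) (\<theta> n)"
  and st: "!!n m k x. x : elts K n ==> m = n - 1 ==> k = n + 1 ==> pi n (\<sigma> n x) +[grp K n] diff K m (\<theta> n x) +[grp K n] \<theta> k (diff K n x) = x"
  and vh: "!!n m. m = n - 1 ==> K.bimod_hom (grp P n) (grp P m) (v n)"
  and vd: "!!n m k x. x : elts P n ==> m = n - 1 ==> k = n + 1 ==>
    x -[grp P n] \<sigma> n (pi n x) = -[grp P n] diff P m (v n x) -[grp P n] v k (diff P n x)"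
 note sc = K.bhomD(2)[OF sh] and tc = K.bhomD(2)[OF th] and vc = K.bhomD(2)[OF vh]
 interpret HP: dgo Q R "K.Hom_Ae P" by unfold_locales (rule P.dg_object_Hom_Ae)
 note abN = K.N.ab_ax
 have s0: "signed K.env k a = 0[K.env] ==> a : car K.env ==> a = 0[K.env]" for k a
  using K.N.signed_signed[of a k k] K.N.signed_even[of "k + k" a] K.N.signed_zero[of k] by simp
 have "(ALL u:K.cocycles (K.Hom_Ae K) n. dual_pi n u : K.coboundaries (K.Hom_Ae P) n --> u : K.coboundaries (K.Hom_Ae K) n) &
  (ALL y:K.cocycles (K.Hom_Ae P) n. EX u:K.cocycles (K.Hom_Ae K) n. y -[grp (K.Hom_Ae P) n] dual_pi n u : K.coboundaries (K.Hom_Ae P) n)" for n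
 proof (intro conjI ballI impI)
  define m where "m = - n"
  have mi: "- (n + 1) = m - 1" "- n = m" "- (n - 1) = m + 1" by (simp_all add: m_def)
  { fix u assume uZ: "u : K.cocycles (K.Hom_Ae K) n" and uB: "dual_pi n u : K.coboundaries (K.Hom_Ae P) n"
   have u: "u : car (K.dual_grp K n)" and du: "diff (K.Hom_Ae K) n u = 0[K.dual_grp K (n + 1)]"
    using uZ by (simp_all add: K.cocycles_def K.Hom_simps(1))
   obtain w where w: "w : car (K.dual_grp P (n - 1))" "dual_pi n u = diff (K.Hom_Ae P) (n - 1) w"
    using uB by (auto simp: K.coboundaries_def P.Hom_simps(1))
   have uc: "u x : car K.env" if "x : elts K m" for x using K.dual_cl[OF u] that by (simp add: mi)
   have wc: "w x : car K.env" if "x : elts P (m + 1)" for x using P.dual_cl[OF w(1)] that unfolding mi by simp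
   have ud: "u (diff K (m - 1) x) = 0[K.env]" if x: "x : elts K (m - 1)" for x
   proof (rule s0)
    show "signed K.env (n + 1) (u (diff K (m - 1) x)) = 0[K.env]"
    using fun_cong[OF du, of x] x unfolding K.Hom_diff[OF u] K.dual_ops mi by simp
    show "u (diff K (m - 1) x) : car K.env" by (rule uc[OF K.diff_cl[OF x]]) simp
   qed
   have upi: "u (pi m p) = signed K.env n (w (diff P m p))" if p: "p : elts P m" for p
    using fun_cong[OF w(2), of p] p unfolding P.Hom_diff[OF w(1)] by (simp add: dual_pi_eval[OF u m_def p] m_def)
   \<comment> \<open>The differential of the dual out of degree n - 1 has the sign (-1)^n. It is the
     sign relating w to u pi, and in the second summand it is cancelled.\<close>
   define w' where "w' = (\<lambda>x\<in>car (grp K (- (n - 1))). signed K.env 0 (w (\<sigma> (m + 1) x))) +[K.dual_grp K (n - 1)]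
    (\<lambda>x\<in>car (grp K (- (n - 1))). signed K.env n (u (\<theta> (m + 1) x)))"
   have w'c: "w' : car (K.dual_grp K (n - 1))" unfolding w'_def
    by (intro K.dual_add_closed dual_pull_pi[OF P.dg K.dg w(1)] dual_pull_pi[OF K.dg K.dg u]; unfold mi) (rule sh, rule th, simp)
   have "diff (K.Hom_Ae K) (n - 1) w' = u"
    unfolding K.Hom_diff[OF w'c]
   proof (rule extensionalityI[OF restrict_extensional])
    show "u : extensional (car (grp K (- (n - 1 + 1))))" using K.dual_ext[OF u] by simp
    fix x assume "x : car (grp K (- (n - 1 + 1)))"
    then have x: "x : elts K m" by (simp add: mi)
    note dx = K.diff_cl[OF x refl]
    have tx: "\<theta> m x : elts K (m - 1)" by (rule tc[OF refl x])
    have tdx: "\<theta> (m + 1) (diff K m x) : elts K m" by (rule tc[OF _ dx]) simp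
    note sx = sc[OF x] and sdx = sc[OF dx]
    have dtx: "diff K (m - 1) (\<theta> m x) : elts K m" by (rule K.diff_cl[OF tx]) simp
    have ua: "u (a +[grp K m] b) = u a +[K.env] u b" if "a : elts K m" "b : elts K m" for a b
    using am_add[OF K.dual_addmap[OF u], of a b] that by (simp add: mi)
    have "u x = u (pi m (\<sigma> m x)) +[K.env] u (diff K (m - 1) (\<theta> m x)) +[K.env] u (\<theta> (m + 1) (diff K m x))"
    using st[OF x refl refl] ua[of "pi m (\<sigma> m x) +[grp K m] diff K (m - 1) (\<theta> m x)" "\<theta> (m + 1) (diff K m x)"] ua[of "pi m (\<sigma> m x)" "diff K (m - 1) (\<theta> m x)"]
    pi_cl[OF sx] dtx tdx by simp
    also have "... = signed K.env n (w (\<sigma> (m + 1) (diff K m x))) +[K.env] u (\<theta> (m + 1) (diff K m x))"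
    unfolding ud[OF tx] upi[OF sx] sd[OF x refl] using wc[OF sdx] by simp
    finally have ux: "u x = signed K.env n (w (\<sigma> (m + 1) (diff K m x))) +[K.env] u (\<theta> (m + 1) (diff K m x))" .
    have wx: "w' (diff K m x) = w (\<sigma> (m + 1) (diff K m x)) +[K.env] signed K.env n (u (\<theta> (m + 1) (diff K m x)))"
    unfolding w'_def K.dual_ops mi using dx by (simp add: K.N.signed_even)
    show "(\<lambda>x\<in>car (grp K (- (n - 1 + 1))). signed K.env (n - 1 + 1) (w' (diff K (- (n - 1 + 1)) x))) x = u x"
    using x wc[OF sdx] uc[OF tdx] by (simp add: mi wx ux K.N.signed_add K.N.signed_signed K.N.signed_even)
   qed
   then show "u : K.coboundaries (K.Hom_Ae K) n" using w'c unfolding K.coboundaries_def K.Hom_simps(1) by blast }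
  { fix y assume yZ: "y : K.cocycles (K.Hom_Ae P) n"
   have y: "y : car (K.dual_grp P n)" and dy: "diff (K.Hom_Ae P) n y = 0[K.dual_grp P (n + 1)]"
    using yZ by (simp_all add: K.cocycles_def P.Hom_simps(1))
   have yc: "y x : car K.env" if "x : elts P m" for x using P.dual_cl[OF y] that by (simp add: mi)
   have yd: "y (diff P (m - 1) x) = 0[K.env]" if x: "x : elts P (m - 1)" for x
   proof (rule s0)
    show "signed K.env (n + 1) (y (diff P (m - 1) x)) = 0[K.env]"
    using fun_cong[OF dy, of x] x unfolding P.Hom_diff[OF y] P.dual_ops mi by simp
    show "y (diff P (m - 1) x) : car K.env" by (rule yc[OF P.diff_cl[OF x]]) simp
   qed
   define u where "u = (\<lambda>x\<in>elts K (- n). signed K.env 0 (y (\<sigma> m x)))"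
   have u: "u : car (K.dual_grp K n)" unfolding u_def by (rule dual_pull_pi[OF P.dg K.dg y]) (unfold mi, rule sh)
   have ue: "u x = y (\<sigma> m x)" if "x : elts K m" for x using that by (simp add: u_def mi K.N.signed_even)
   have "diff (K.Hom_Ae K) n u = 0[K.dual_grp K (n + 1)]"
    unfolding K.Hom_diff[OF u] K.dual_ops
   proof (rule rext, unfold mi)
    fix x assume x: "x : elts K (m - 1)"
    have dx: "diff K (m - 1) x : elts K m" by (rule K.diff_cl[OF x]) simp
    show "signed K.env (n + 1) (u (diff K (m - 1) x)) = 0[K.env]"
    using yd[OF sc[OF x]] sd[OF x, of m] by (simp add: ue[OF dx])
   qed
   then have uZ: "u : K.cocycles (K.Hom_Ae K) n" using u by (simp add: K.cocycles_def K.Hom_simps(1))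
   \<comment> \<open>The exponent n + 1 combines with the sign (-1)^n of the differential to the
     minus in - y v d.\<close>
   define w where "w = (\<lambda>x\<in>car (grp P (- (n - 1))). signed K.env (n + 1) (y (v (m + 1) x)))"
   have w: "w : car (K.dual_grp P (n - 1))" unfolding w_def
    by (rule dual_pull_pi[OF P.dg P.dg y]) (unfold mi, rule vh, simp)
   have du: "y -[K.dual_grp P n] dual_pi n u : car (K.dual_grp P n)"
    using HP.G.minus_closed[of y n "dual_pi n u"] y dual_pi_in[OF u] unfolding P.Hom_simps(1) by simp
   have "diff (K.Hom_Ae P) (n - 1) w = y -[K.dual_grp P n] dual_pi n u"
    unfolding P.Hom_diff[OF w]
   proof (rule extensionalityI[OF restrict_extensional])
    show "y -[K.dual_grp P n] dual_pi n u : extensional (car (grp P (- (n - 1 + 1))))" using P.dual_ext[OF du] by simp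
    fix x assume "x : car (grp P (- (n - 1 + 1)))"
    then have x: "x : elts P m" by (simp add: mi)
    note dx = P.diff_cl[OF x refl] and spx = sc[OF pi_cl[OF x]]
    have vx: "v m x : elts P (m - 1)" by (rule vc[OF refl x])
    have vdx: "v (m + 1) (diff P m x) : elts P m" by (rule vc[OF _ dx]) simp
    have dvx: "diff P (m - 1) (v m x) : elts P m" by (rule P.diff_cl[OF vx]) simp
    have ya: "addmap (grp P m) K.env y" using P.dual_addmap[OF y] by (simp add: mi)
    note yD = am_diff[OF P.G.ab_ax abN ya] and yN = addmap_neg[OF P.G.ab_ax abN ya]
    have "(y -[K.dual_grp P n] dual_pi n u) x = y x -[K.env] dual_pi n u x"
    by (rule am_diff[OF P.dual_abelian abN P.dual_eval y dual_pi_in[OF u]]) (simp add: mi x)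
    also have "... = y x -[K.env] y (\<sigma> m (pi m x))" by (simp add: dual_pi_eval[OF u m_def x] ue[OF pi_cl[OF x]])
    also have "... = y (-[grp P m] diff P (m - 1) (v m x) -[grp P m] v (m + 1) (diff P m x))"
    unfolding yD[OF x spx, symmetric] vd[OF x refl refl] by (rule refl)
    also have "... = -[K.env] 0[K.env] -[K.env] y (v (m + 1) (diff P m x))"
    using dvx vdx by (simp add: yD yN yd[OF vx])
    also have "... = -[K.env] y (v (m + 1) (diff P m x))"
    using K.N.ag_eq[of "[y (v (m + 1) (diff P m x))]" "Mi (Ng Zr) (V 0)" "Ng (V 0)"] yc[OF vdx] by simp
    finally have e: "(y -[K.dual_grp P n] dual_pi n u) x = -[K.env] y (v (m + 1) (diff P m x))" .
    have we: "w (diff P m x) = signed K.env (n + 1) (y (v (m + 1) (diff P m x)))" unfolding w_def mi using dx by simp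
    have "signed K.env n (w (diff P m x)) = -[K.env] y (v (m + 1) (diff P m x))"
    unfolding we K.N.signed_signed[OF yc[OF vdx]] by (simp add: signed_def)
    then show "(\<lambda>x\<in>car (grp P (- (n - 1 + 1))). signed K.env (n - 1 + 1) (w (diff P (- (n - 1 + 1)) x))) x = (y -[K.dual_grp P n] dual_pi n u) x"
    using x e by (simp add: mi)
   qed
   then have "y -[grp (K.Hom_Ae P) n] dual_pi n u : K.coboundaries (K.Hom_Ae P) n"
    using w unfolding K.coboundaries_def P.Hom_simps(1) by (metis image_eqI)
   with uZ show "EX u:K.cocycles (K.Hom_Ae K) n. y -[grp (K.Hom_Ae P) n] dual_pi n u : K.coboundaries (K.Hom_Ae P) n" by blast }
 qed
 then show "K.quasi_iso (K.Hom_Ae K) (K.Hom_Ae P) dual_pi" unfolding K.quasi_iso_iff[OF K.dg_object_Hom_Ae P.dg_object_Hom_Ae dual_pi_closed] by blast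
qed

end

text \<open>Any value of the derived functor is the dual of some K-projective resolution of the
  transported Koszul complex; the isomorphism is represented by precomposition with that
  resolution.\<close>

theorem proposition4p10:
  fixes Q :: "('v, 'e) pre_digraph"
    and R :: "('v, 'e, 'f::field) tens set"
    and \<iota> :: "('v, 'e, 'f) koszul_chain \<Rightarrow> 'u"
    and fam :: "(('v, 'e, 'f) koszul_chain \<Rightarrow> 'u) \<Rightarrow> 'u"
    and RHomK :: "('v, 'e, 'f, 'u \<Rightarrow> ('v, 'e, 'f) env_elem) qobj"
  assumes "quadratic_algebra Q R"
    and "inj \<iota>" and "inj fam"
    and "quadratic_algebra.is_RHom_Ae Q R
           (transport \<iota> (quadratic_algebra.koszul_complex Q R)) RHomK"
  shows "\<exists>\<phi>. quadratic_algebra.D_iso Q R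
           (quadratic_algebra.Hom_Ae Q R (transport \<iota> (quadratic_algebra.koszul_complex Q R)))
           RHomK \<phi>"
proof -
  interpret quadratic_algebra Q R by fact
  let ?K = "transport \<iota> koszul_complex"
  obtain P \<pi> where P: "dg_object P" "K_projective P" "quasi_iso P ?K \<pi>" and RH: "RHomK = Hom_Ae P"
    using assms(4) by (auto simp: is_RHom_Ae_def K_projective_resolution_def)
  interpret resolution Q R ?K P \<pi>
    by unfold_locales (rule dg_object_transport[OF assms(2) dg_object_koszul] P)+
  show ?thesis unfolding RH
    by (rule D_iso_of_quasi_iso[OF K.dg_object_Hom_Ae P.dg_object_Hom_Ae quasi_iso_dual_pi[OF assms(2,3) refl P(2)]])
qed

end
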